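(* Let $G$ be a $C^\infty$-rigid Carnot group, let $U\subset G$ be open, and let $Z$ be a weak contact field on $U$. Then $Z$ can be redefined on a set of measure zero so that it becomes smooth on $U$, and the resulting smooth vector field is a contact field on $U$. If $Z$ is already continuous, then $Z$ itself is smooth.
   Context: A Carnot group $G$ is a connected, simply connected (real) Lie group whose Lie algebra has a stratification $\mathfrak g=\mathfrak g_{-1}\oplus\dots\oplus\mathfrak g_{-s}$ with $[\mathfrak g_{-1},\mathfrak g_{-i}]=\mathfrak g_{-i-1}$ for $i=1,\dots,s$, where $\mathfrak g_{-s-1}=\{0\}$. Put $n=\dim\mathfrak g$, $d_l=\dim\mathfrak g_{-l}$, $\nu=\sum_{l=1}^s l\,d_l$. Fix a basis $\{X_{-l,v}: 1\le l\le s,\ 1\le v\le d_l\}$ of $\mathfrak g$ adapted to the stratification (with $X_{-l,v}\in\mathfrak g_{-l}$), identified with left-invariant vector fields, and let $\{\sigma_{-l,v}\}$ be the dual basis of left-invariant 1-forms. The group $G$ is oriented by the left-invariant volume form $\bigwedge_{(l,v)}\sigma_{-l,v}$; measure zero refers to Haar measure. The horizontal bundle $\mathcal H\subset TG$ is the left-invariant subbundle whose fiber at $x$ is the left translate of $\mathfrak g_{-1}$ to $T_xG$. A 1-form $\eta$ on $U$ is vertical if $\eta_x(X_x)=0$ for a.e. $x\in U$ and every $X_x\in\mathcal H_x$ (i.e. it is a combination with function coefficients of the $\sigma_{-l,v}$ with $l\ge2$). An $(n-1)$-form $\beta$ is said to be of weight $-\nu+1$ if it can be written $\beta=\sum_{i=1}^{d_1}\beta_i\,\hat\sigma_{-1,i}$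 with functions $\beta_i$, where $\hat\sigma_{-1,i}=\bigwedge_{(l,v)\ne(1,i)}\sigma_{-l,v}$. $i_Z$ denotes interior multiplication. Weak contact field: a measurable vector field $Z$ on $U$ whose coefficients in the frame $\{X_{-l,v}\}$ are in $L^1_{\mathrm{loc}}(U)$ is a weak contact field if $$\int_U i_Z(d\eta)\wedge\beta-\int_U i_Z(\eta)\wedge d\beta=0$$ for every smooth vertical 1-form $\eta$ on $U$ and every smooth compactly supported $(n-1)$-form $\beta$ on $U$ of weight $-\nu+1$. Contact field: a $C^1$ vector field $Z$ on an open subset $W$ of $G$ is a contact field if $[Z,X]$ is a section of $\mathcal H$ for every smooth section $X$ of $\mathcal H$ over an open subset of $W$ (equivalently, $[Z,X](x)\in\mathcal H_x$ for all $x \in W$ and all left-invariant $X\in\mathfrak g_{-1}$). For smooth $Z$ this is equivalent to the local flow of $Z$ consisting of contact maps. $C^k$-contact map ($k\in\{1,2,\dots\}\cup\{\infty\}$): a $C^k$ local diffeomorphism $f:U\to G$, $U\subset G$ open, with $d_xf(\mathcal H_x)\subset\mathcal H_{f(x)}$ for every $x\in U$. $C^k$-rigidity (Ottazzi–Warhurst): $G$ is $C^k$-rigid if for every connected open $U\subset G$ the space $\mathrm{Con}^k(U)$ of $C^k$-contact maps $U\to G$ is finite dimensional. Known facts of Ottazzi–Warhurst, which give the precise meaning of this condition used here: $C^\infty$-rigid groups are $C^2$-rigid, and $G$ is $C^2$-rigid if and only if for every $p\in G$ the real vector space of germs at $p$ of contact fields is finite dimensional. *)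

theory Defs
  imports "HOL-Analysis.Analysis"
begin

section \<open>Smooth functions on open subsets of a Euclidean space\<close>

text \<open>For open \<open>S\<close> this is the class \<open>C\<^sup>k\<close>: \<open>f\<close> is differentiable and all its directional
  derivatives are of class \<open>C\<^sup>k\<^sup>-\<^sup>1\<close>.\<close>

primrec Ck_on :: "nat \<Rightarrow> 'a::euclidean_space set \<Rightarrow> ('a \<Rightarrow> 'b::real_normed_vector) \<Rightarrow> bool" where
  "Ck_on 0 S f \<longleftrightarrow> continuous_on S f"
| "Ck_on (Suc k) S f \<longleftrightarrow>
     (\<forall>x\<in>S. f differentiable (at x)) \<and> (\<forall>v. Ck_on k S (\<lambda>x. frechet_derivative f (at x) v))"

definition smooth_on :: "'a::euclidean_space set \<Rightarrow> ('a \<Rightarrow> 'b::real_normed_vector) \<Rightarrow> bool" where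
  "smooth_on S f \<longleftrightarrow> (\<forall>k. Ck_on k S f)"


section \<open>Lie groups\<close>

text \<open>A chart is a pair \<open>(W, \<phi>)\<close>; only the values of \<open>\<phi>\<close> on its domain \<open>W\<close> matter. The group and
  the manifold live on the whole type \<open>'g\<close>, the model space is \<open>'a\<close>, so the dimension of the
  manifold is \<open>DIM('a)\<close>.\<close>

record ('g, 'a) lie_group_data =
  charts :: "('g set \<times> ('g \<Rightarrow> 'a)) set"
  gmul :: "'g \<Rightarrow> 'g \<Rightarrow> 'g"
  gone :: "'g"
  ginv :: "'g \<Rightarrow> 'g"

definition is_chart :: "'g::topological_space set \<times> ('g \<Rightarrow> 'a::euclidean_space) \<Rightarrow> bool" where
  "is_chart c \<longleftrightarrow> (case c of (W, \<phi>) \<Rightarrow>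
     open W \<and> open (\<phi> ` W) \<and> (\<exists>\<psi>. homeomorphism W (\<phi> ` W) \<phi> \<psi>))"

definition smooth_atlas :: "('g::topological_space set \<times> ('g \<Rightarrow> 'a::euclidean_space)) set \<Rightarrow> bool" where
  "smooth_atlas \<A> \<longleftrightarrow>
     (\<forall>c\<in>\<A>. is_chart c) \<and>
     (\<Union>c\<in>\<A>. fst c) = UNIV \<and>
     (\<forall>(W, \<phi>)\<in>\<A>. \<forall>(W', \<phi>')\<in>\<A>. smooth_on (\<phi> ` (W \<inter> W')) (\<phi>' \<circ> inv_into W \<phi>))"

definition lie_group ::
    "('g::{t2_space,second_countable_topology}, 'a::euclidean_space, 'm) lie_group_data_scheme \<Rightarrow> bool" where
  "lie_group G \<longleftrightarrow>
     smooth_atlas (charts G) \<and>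
     group (gmul G) (gone G) (ginv G) \<and>
     continuous_on UNIV (\<lambda>(x, y). gmul G x y) \<and>
     continuous_on UNIV (ginv G) \<and>
     (\<forall>(W1, \<phi>1)\<in>charts G. \<forall>(W2, \<phi>2)\<in>charts G. \<forall>(W3, \<phi>3)\<in>charts G.
        smooth_on {(u, v). u \<in> \<phi>1 ` W1 \<and> v \<in> \<phi>2 ` W2 \<and>
                     gmul G (inv_into W1 \<phi>1 u) (inv_into W2 \<phi>2 v) \<in> W3}
          (\<lambda>(u, v). \<phi>3 (gmul G (inv_into W1 \<phi>1 u) (inv_into W2 \<phi>2 v)))) \<and>
     (\<forall>(W1, \<phi>1)\<in>charts G. \<forall>(W2, \<phi>2)\<in>charts G.
        smooth_on {u \<in> \<phi>1 ` W1. ginv G (inv_into W1 \<phi>1 u) \<in> W2}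
          (\<lambda>u. \<phi>2 (ginv G (inv_into W1 \<phi>1 u))))"

definition Ck_fun_on ::
    "('g, 'a::euclidean_space, 'm) lie_group_data_scheme \<Rightarrow> nat \<Rightarrow> 'g::topological_space set
      \<Rightarrow> ('g \<Rightarrow> 'b::real_normed_vector) \<Rightarrow> bool" where
  "Ck_fun_on G k U f \<longleftrightarrow> (\<forall>(W, \<phi>)\<in>charts G. Ck_on k (\<phi> ` (W \<inter> U)) (f \<circ> inv_into W \<phi>))"

definition smooth_fun_on ::
    "('g, 'a::euclidean_space, 'm) lie_group_data_scheme \<Rightarrow> 'g::topological_space set
      \<Rightarrow> ('g \<Rightarrow> 'b::real_normed_vector) \<Rightarrow> bool" where
  "smooth_fun_on G U f \<longleftrightarrow> (\<forall>k. Ck_fun_on G k U f)"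


section \<open>Lie algebra and left-invariant vector fields\<close>

text \<open>The Lie algebra is the tangent space at the identity, written as \<open>'a\<close> by means of one fixed
  chart around the identity.  Which chart is chosen is immaterial: all data that refer to \<open>'a\<close>
  (stratification, adapted basis, fields, forms) are arbitrary.\<close>

definition id_chart :: "('g, 'a, 'm) lie_group_data_scheme \<Rightarrow> 'g set \<times> ('g \<Rightarrow> 'a)" where
  "id_chart G = (SOME c. c \<in> charts G \<and> gone G \<in> fst c)"

text \<open>\<open>left_deriv G A f x\<close> is \<open>(A f)(x)\<close> for the left-invariant vector field with value \<open>A\<close> at the
  identity: the derivative at the identity of \<open>f \<circ> L\<^sub>x\<close> in direction \<open>A\<close>.\<close>

definition left_deriv ::
    "('g, 'a::euclidean_space, 'm) lie_group_data_scheme \<Rightarrow> 'a \<Rightarrow> ('g \<Rightarrow> 'b::real_normed_vector)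
      \<Rightarrow> 'g \<Rightarrow> 'b" where
  "left_deriv G A f x = (case id_chart G of (W, \<kappa>) \<Rightarrow>
     frechet_derivative (\<lambda>u. f (gmul G x (inv_into W \<kappa> u))) (at (\<kappa> (gone G))) A)"

definition lie_bracket ::
    "('g::topological_space, 'a::euclidean_space, 'm) lie_group_data_scheme \<Rightarrow> 'a \<Rightarrow> 'a \<Rightarrow> 'a" where
  "lie_bracket G A B = (THE C. \<forall>f :: 'g \<Rightarrow> real. smooth_fun_on G UNIV f \<longrightarrow>
     (\<forall>x. left_deriv G C f x =
        left_deriv G A (left_deriv G B f) x - left_deriv G B (left_deriv G A f) x))"


section \<open>Carnot groups\<close>

text \<open>\<open>layer G l\<close> is \<open>\<gg>\<^sub>-\<^sub>l\<close>, and \<open>basis_vec G l v\<close> is \<open>X\<^sub>-\<^sub>l\<^sub>,\<^sub>v\<close>, for \<open>1 \<le> l \<le> nstep G\<close> and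
  \<open>1 \<le> v \<le> layer_dim G l\<close>.\<close>

record ('g, 'a) carnot_data = "('g, 'a) lie_group_data" +
  nstep :: nat
  layer :: "nat \<Rightarrow> 'a set"
  layer_dim :: "nat \<Rightarrow> nat"
  basis_vec :: "nat \<Rightarrow> nat \<Rightarrow> 'a"

definition stratification ::
    "('g::topological_space, 'a::euclidean_space, 'm) carnot_data_scheme \<Rightarrow> bool" where
  "stratification G \<longleftrightarrow>
     (\<forall>l\<in>{1..nstep G}. subspace (layer G l)) \<and>
     (\<forall>A. \<exists>!a. (\<forall>l\<in>{1..nstep G}. a l \<in> layer G l) \<and> (\<forall>l. l \<notin> {1..nstep G} \<longrightarrow> a l = 0) \<and>
            A = (\<Sum>l=1..nstep G. a l)) \<and>
     (\<forall>i\<in>{1..nstep G}.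
        span {lie_bracket G A B | A B. A \<in> layer G 1 \<and> B \<in> layer G i} = layer G (Suc i)) \<and>
     layer G (Suc (nstep G)) = {0}"

definition adapted_basis ::
    "('g::topological_space, 'a::euclidean_space, 'm) carnot_data_scheme \<Rightarrow> bool" where
  "adapted_basis G \<longleftrightarrow> (\<forall>l\<in>{1..nstep G}.
     inj_on (basis_vec G l) {1..layer_dim G l} \<and>
     independent (basis_vec G l ` {1..layer_dim G l}) \<and>
     span (basis_vec G l ` {1..layer_dim G l}) = layer G l)"

definition carnot_group ::
    "('g::{t2_space,second_countable_topology}, 'a::euclidean_space, 'm) carnot_data_scheme \<Rightarrow> bool" where
  "carnot_group G \<longleftrightarrow>
     lie_group G \<and> connected (UNIV :: 'g set) \<and> simply_connected (UNIV :: 'g set) \<and>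
     stratification G \<and> adapted_basis G"

definition basis_indices :: "('g, 'a, 'm) carnot_data_scheme \<Rightarrow> (nat \<times> nat) list" where
  "basis_indices G = [(l, v). l \<leftarrow> [1..<Suc (nstep G)], v \<leftarrow> [1..<Suc (layer_dim G l)]]"

definition frame :: "('g, 'a, 'm) carnot_data_scheme \<Rightarrow> 'a list" where
  "frame G = map (\<lambda>(l, v). basis_vec G l v) (basis_indices G)"

definition coframe ::
    "('g, 'a::euclidean_space, 'm) carnot_data_scheme \<Rightarrow> nat \<times> nat \<Rightarrow> 'a \<Rightarrow> real" where
  "coframe G lv A = representation (set (frame G)) A (basis_vec G (fst lv) (snd lv))"

definition haar_measure ::
    "('g::topological_space, 'a, 'm) lie_group_data_scheme \<Rightarrow> 'g measure \<Rightarrow> bool" where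
  "haar_measure G \<mu> \<longleftrightarrow>
     sets \<mu> = sets borel \<and>
     (\<forall>K. compact K \<longrightarrow> emeasure \<mu> K < \<infinity>) \<and>
     (\<forall>W. open W \<and> W \<noteq> {} \<longrightarrow> emeasure \<mu> W > 0) \<and>
     (\<forall>g. \<forall>A\<in>sets borel. emeasure \<mu> (gmul G g ` A) = emeasure \<mu> A)"


section \<open>Vector fields\<close>

text \<open>Tangent spaces are identified with the Lie algebra by left translation: \<open>Z :: 'g \<Rightarrow> 'a\<close>
  stands for the vector field whose value at \<open>x\<close> is the value at \<open>x\<close> of the left-invariant field
  determined by \<open>Z x\<close>.  The coefficients of \<open>Z\<close> in the frame are \<open>\<lambda>x. coframe G lv (Z x)\<close>, and the
  fibre of the horizontal bundle at any point is \<open>layer G 1\<close>.  Left-invariant fields being smooth,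
  the regularity of a vector field is that of the function \<open>Z\<close>.\<close>

text \<open>The Lie bracket of vector fields, from \<open>[fA, gB] = f (A g) B - g (B f) A + f g [A, B]\<close>.\<close>

definition field_bracket ::
    "('g::topological_space, 'a::euclidean_space, 'm) lie_group_data_scheme
      \<Rightarrow> ('g \<Rightarrow> 'a) \<Rightarrow> ('g \<Rightarrow> 'a) \<Rightarrow> 'g \<Rightarrow> 'a" where
  "field_bracket G Z Y x =
     left_deriv G (Z x) Y x - left_deriv G (Y x) Z x + lie_bracket G (Z x) (Y x)"

definition contact_field ::
    "('g::topological_space, 'a::euclidean_space, 'm) carnot_data_scheme \<Rightarrow> 'g set
      \<Rightarrow> ('g \<Rightarrow> 'a) \<Rightarrow> bool" where
  "contact_field G W Z \<longleftrightarrow>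
     Ck_fun_on G 1 W Z \<and>
     (\<forall>V Y. open V \<and> V \<subseteq> W \<and> smooth_fun_on G V Y \<and> (\<forall>x\<in>V. Y x \<in> layer G 1) \<longrightarrow>
        (\<forall>x\<in>V. field_bracket G Z Y x \<in> layer G 1))"

text \<open>The set of smooth contact maps on an open set is not a linear space.  Its finite dimensionality
  is understood in the sense of Ottazzi and Warhurst: at each point \<open>p\<close> the real vector space of
  germs at \<open>p\<close> of contact fields is finite dimensional, i.e. spanned by finitely many germs.\<close>

definition Cinf_rigid ::
    "('g::topological_space, 'a::euclidean_space, 'm) carnot_data_scheme \<Rightarrow> bool" where
  "Cinf_rigid G \<longleftrightarrow> (\<forall>p. \<exists>(N::nat) Y.
     (\<forall>i<N. \<exists>W. open W \<and> p \<in> W \<and> contact_field G W (Y i)) \<and>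
     (\<forall>W Z. open W \<and> p \<in> W \<and> contact_field G W Z \<longrightarrow>
        (\<exists>V c. open V \<and> p \<in> V \<and> V \<subseteq> W \<and> (\<forall>x\<in>V. Z x = (\<Sum>i<N. c i *\<^sub>R Y i x)))))"


section \<open>Differential forms\<close>

text \<open>With the same trivialisation, a \<open>k\<close>-form is a function \<open>\<omega> :: 'g \<Rightarrow> 'a list \<Rightarrow> real\<close> whose
  value \<open>\<omega> x\<close> is an alternating multilinear function of the lists of length \<open>k\<close>; values on lists of
  other lengths are irrelevant.\<close>

definition alternating_form :: "nat \<Rightarrow> ('a::real_vector list \<Rightarrow> real) \<Rightarrow> bool" where
  "alternating_form k \<alpha> \<longleftrightarrow>
     (\<forall>As i. length As = k \<and> i < k \<longrightarrow> linear (\<lambda>A. \<alpha> (As[i := A]))) \<and>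
     (\<forall>As i j. length As = k \<and> i < j \<and> j < k \<and> As ! i = As ! j \<longrightarrow> \<alpha> As = 0)"

definition smooth_form_on ::
    "('g::topological_space, 'a::euclidean_space, 'm) lie_group_data_scheme \<Rightarrow> nat \<Rightarrow> 'g set
      \<Rightarrow> ('g \<Rightarrow> 'a list \<Rightarrow> real) \<Rightarrow> bool" where
  "smooth_form_on G k U \<omega> \<longleftrightarrow>
     (\<forall>x\<in>U. alternating_form k (\<omega> x)) \<and>
     (\<forall>As. length As = k \<longrightarrow> smooth_fun_on G U (\<lambda>x. \<omega> x As))"

definition wedge ::
    "nat \<Rightarrow> nat \<Rightarrow> ('a list \<Rightarrow> real) \<Rightarrow> ('a list \<Rightarrow> real) \<Rightarrow> 'a list \<Rightarrow> real" where
  "wedge k l \<alpha> \<beta> As =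
     (\<Sum>p | p permutes {..<k + l}. of_int (sign p) *
        \<alpha> (map (\<lambda>i. As ! p i) [0..<k]) * \<beta> (map (\<lambda>i. As ! p i) [k..<k + l]))
     / (fact k * fact l)"

primrec wedge_list :: "('a \<Rightarrow> real) list \<Rightarrow> 'a list \<Rightarrow> real" where
  "wedge_list [] = (\<lambda>As. 1)"
| "wedge_list (\<sigma> # \<sigma>s) = wedge 1 (length \<sigma>s) (\<lambda>As. \<sigma> (As ! 0)) (wedge_list \<sigma>s)"

definition interior_mult :: "('g \<Rightarrow> 'a) \<Rightarrow> ('g \<Rightarrow> 'a list \<Rightarrow> real) \<Rightarrow> 'g \<Rightarrow> 'a list \<Rightarrow> real" where
  "interior_mult Z \<omega> x As = \<omega> x (Z x # As)"

definition omit_nth :: "nat \<Rightarrow> 'a list \<Rightarrow> 'a list" where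
  "omit_nth i xs = take i xs @ drop (Suc i) xs"

text \<open>The invariant formula for the exterior derivative, evaluated on left-invariant vector fields;
  the degree of \<open>\<omega>\<close> is \<open>length As - 1\<close>.\<close>

definition ext_deriv ::
    "('g::topological_space, 'a::euclidean_space, 'm) lie_group_data_scheme
      \<Rightarrow> ('g \<Rightarrow> 'a list \<Rightarrow> real) \<Rightarrow> 'g \<Rightarrow> 'a list \<Rightarrow> real" where
  "ext_deriv G \<omega> x As =
     (\<Sum>i<length As. (-1) ^ i * left_deriv G (As ! i) (\<lambda>y. \<omega> y (omit_nth i As)) x) +
     (\<Sum>j<length As. \<Sum>i<j. (-1) ^ (i + j) *
        \<omega> x (lie_bracket G (As ! i) (As ! j) # omit_nth i (omit_nth j As)))"

text \<open>A top-degree form \<open>\<omega>\<close> is \<open>\<omega>(frame)\<close> times the left-invariant volume form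
  \<open>\<And>\<^sub>(\<^sub>l\<^sub>,\<^sub>v\<^sub>) \<sigma>\<^sub>-\<^sub>l\<^sub>,\<^sub>v\<close>, which orients the group and whose associated measure is a Haar measure.  The
  completion is taken so that measurability is Lebesgue rather than Borel measurability.\<close>

definition form_integral ::
    "('g, 'a, 'm) carnot_data_scheme \<Rightarrow> 'g measure \<Rightarrow> 'g set \<Rightarrow> ('g \<Rightarrow> 'a list \<Rightarrow> real) \<Rightarrow> real" where
  "form_integral G \<mu> U \<omega> = set_lebesgue_integral (completion \<mu>) U (\<lambda>x. \<omega> x (frame G))"

definition vertical ::
    "('g, 'a, 'm) carnot_data_scheme \<Rightarrow> 'g measure \<Rightarrow> 'g set \<Rightarrow> ('g \<Rightarrow> 'a list \<Rightarrow> real) \<Rightarrow> bool" where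
  "vertical G \<mu> U \<eta> \<longleftrightarrow> (AE x in \<mu>. x \<in> U \<longrightarrow> (\<forall>A\<in>layer G 1. \<eta> x [A] = 0))"

definition hat_coframe ::
    "('g, 'a::euclidean_space, 'm) carnot_data_scheme \<Rightarrow> nat \<Rightarrow> 'a list \<Rightarrow> real" where
  "hat_coframe G i = wedge_list (map (coframe G) (filter (\<lambda>lv. lv \<noteq> (1, i)) (basis_indices G)))"

text \<open>\<open>(n-1)\<close>-forms of weight \<open>-\<nu>+1\<close>.\<close>

definition horizontal_weight ::
    "('g, 'a::euclidean_space, 'm) carnot_data_scheme \<Rightarrow> 'g set \<Rightarrow> ('g \<Rightarrow> 'a list \<Rightarrow> real) \<Rightarrow> bool" where
  "horizontal_weight G U \<beta> \<longleftrightarrow> (\<exists>b :: nat \<Rightarrow> 'g \<Rightarrow> real. \<forall>x\<in>U. \<forall>As. length As = DIM('a) - 1 \<longrightarrow>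
     \<beta> x As = (\<Sum>i=1..layer_dim G 1. b i x * hat_coframe G i As))"

definition compactly_supported_form ::
    "nat \<Rightarrow> 'g::topological_space set \<Rightarrow> ('g \<Rightarrow> 'a list \<Rightarrow> real) \<Rightarrow> bool" where
  "compactly_supported_form k U \<omega> \<longleftrightarrow>
     (\<exists>K. compact K \<and> K \<subseteq> U \<and> (\<forall>x\<in>U - K. \<forall>As. length As = k \<longrightarrow> \<omega> x As = 0))"


section \<open>Weak contact fields\<close>

definition L1_loc_field ::
    "('g::topological_space, 'a::euclidean_space, 'm) carnot_data_scheme \<Rightarrow> 'g measure \<Rightarrow> 'g set
      \<Rightarrow> ('g \<Rightarrow> 'a) \<Rightarrow> bool" where
  "L1_loc_field G \<mu> U Z \<longleftrightarrow>
     Z \<in> borel_measurable (restrict_space (completion \<mu>) U) \<and>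
     (\<forall>lv\<in>set (basis_indices G). \<forall>K. compact K \<and> K \<subseteq> U \<longrightarrow>
        set_integrable (completion \<mu>) K (\<lambda>x. coframe G lv (Z x)))"

definition weak_contact_field ::
    "('g::topological_space, 'a::euclidean_space, 'm) carnot_data_scheme \<Rightarrow> 'g measure \<Rightarrow> 'g set
      \<Rightarrow> ('g \<Rightarrow> 'a) \<Rightarrow> bool" where
  "weak_contact_field G \<mu> U Z \<longleftrightarrow>
     L1_loc_field G \<mu> U Z \<and>
     (\<forall>\<eta> \<beta>.
        smooth_form_on G 1 U \<eta> \<and> vertical G \<mu> U \<eta> \<and>
        smooth_form_on G (DIM('a) - 1) U \<beta> \<and> compactly_supported_form (DIM('a) - 1) U \<beta> \<and>
        horizontal_weight G U \<beta> \<longrightarrow>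
        form_integral G \<mu> U
            (\<lambda>x. wedge 1 (DIM('a) - 1) (interior_mult Z (ext_deriv G \<eta>) x) (\<beta> x)) -
        form_integral G \<mu> U
            (\<lambda>x. wedge 0 (DIM('a)) (interior_mult Z \<eta> x) (ext_deriv G \<beta> x)) = 0)"

end

theory Submission
  imports Defs "HOL-Complex_Analysis.Conformal_Mappings"
begin

text \<open>In the frame, the weak contact condition says that \<open>\<integral> \<sigma>\<^sub>j[Z, X\<^sub>i] b + \<integral> \<sigma>\<^sub>j(Z) L\<^sub>i b = 0\<close> for every test
  function \<open>b\<close>, every \<open>\<sigma>\<^sub>j\<close> with weight at least two and every horizontal \<open>X\<^sub>i\<close> with derivative \<open>L\<^sub>i\<close>. In the mollification
  \<open>Z\<^sub>\<phi>(x) = \<integral> \<phi>(x y\<^sup>-\<^sup>1) Z(y) dy\<close> a left-invariant derivative in \<open>x\<close> acts on the kernel as the negative of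
  the same derivative in \<open>y\<close>. Taking \<open>b(y) = \<phi>(x y\<^sup>-\<^sup>1)\<close> therefore shows that \<open>Z\<^sub>\<phi>\<close> is a smooth contact field.

  Rigidity makes the germs of contact fields at a point finite dimensional, and all \<open>Z\<^sub>\<phi>\<close> restrict, on one
  common neighbourhood, to a finite-dimensional space. As \<open>\<phi>\<close> concentrates at the identity, \<open>Z\<^sub>\<phi>\<close> converges weakly to
  \<open>Z\<close>; a finite-dimensional space is closed under weak limits, so \<open>Z\<close> agrees almost everywhere with some \<open>Z\<^sub>\<phi>\<close>.\<close>

section \<open>Calculus of \<open>C\<^sup>k\<close> functions on Euclidean spaces\<close>

text \<open>The kernel has the form \<open>\<phi>(x y\<^sup>-\<^sup>1)\<close> because
  \<open>Z\<^sub>\<phi>\<close> then averages left translates of \<open>Z\<close>, and the contact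
  condition has constant coefficients in the left-invariant frame. The price is paid in the weak
  limit: there the kernel is integrated over \<open>x\<close>, so the left Haar measure must also be
  invariant under right translations. This comes from the grading, by which every map
  \<open>a \<mapsto> [a, C]\<close> has trace 0.

  Rigidity bounds germs only: the neighbourhood on which a contact field becomes a combination of
  given germs may depend on the field, and no unique continuation is assumed. A common neighbourhood
  is forced by pigeonhole on a power series of fields.

  The given germs are merely C^1. They are exchanged for finitely many mollifications that span the
  restrictions of all mollifications; the weak limit is then itself a mollification and inherits
  smoothness and the contact property. Closedness under weak limits is proved with finitely
  supported annihilators, without a topology on a function space.\<close>

lemma Ck_on_cong:
  fixes f g :: "'a::euclidean_space \<Rightarrow> 'b::real_normed_vector"
  assumes "open S" "\<And>x. x \<in> S \<Longrightarrow> f x = g x" "Ck_on k S f"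
  shows "Ck_on k S g"
  using assms(2,3)
proof (induction k arbitrary: f g)
  case 0
  then show ?case using continuous_on_cong[of S S f g] by simp
next
  case (Suc k)
  have d: "f differentiable (at x)" if "x \<in> S" for x using Suc that by simp
  have e: "(g has_derivative frechet_derivative f (at x)) (at x)" if "x \<in> S" for x
    using has_derivative_transform_within_open[OF _ assms(1) that, of f "frechet_derivative f (at x)"
       UNIV g] d[OF that] Suc.prems(1) by (auto simp: frechet_derivative_works)
  have f: "frechet_derivative f (at x) = frechet_derivative g (at x)" if "x \<in> S" for x
    by (rule frechet_derivative_at[OF e[OF that]])
  have "Ck_on k S (\<lambda>x. frechet_derivative g (at x) v)" for v
    by (rule Suc.IH[where f="\<lambda>x. frechet_derivative f (at x) v"]) (use f Suc.prems in auto)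
  then show ?case using e by (auto simp: differentiable_def)
qed

lemma Ck_on_subset: "Ck_on k S f \<Longrightarrow> T \<subseteq> S \<Longrightarrow> Ck_on k T f"
  by (induction k arbitrary: f) (auto intro: continuous_on_subset)

lemma Ck_on_local:
  assumes "\<And>x. x \<in> S \<Longrightarrow> \<exists>T. open T \<and> x \<in> T \<and> Ck_on k T f"
  shows "Ck_on k S f"
  using assms
proof (induction k arbitrary: f)
  case 0
  have "continuous (at x within S) f" if x: "x \<in> S" for x
  proof -
    obtain T where T: "open T" "x \<in> T" "continuous_on T f" using 0[OF x] by auto
    then show ?thesis
      using continuous_on_eq_continuous_at continuous_at_imp_continuous_at_within by blast
  qed
  then show ?case by (simp add: continuous_on_eq_continuous_within)
next
  case (Suc k)
  have "Ck_on k S (\<lambda>x. frechet_derivative f (at x) v)" for v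
  proof (rule Suc.IH)
    fix x assume "x \<in> S"
    then obtain T where "open T" "x \<in> T" "Ck_on (Suc k) T f" using Suc.prems by blast
    then show "\<exists>T. open T \<and> x \<in> T \<and> Ck_on k T (\<lambda>x. frechet_derivative f (at x) v)" by auto
  qed
  moreover have "f differentiable (at x)" if "x \<in> S" for x
    using Suc.prems[OF that] by auto
  ultimately show ?case by simp
qed

lemma Ck_on_SucD: "Ck_on (Suc k) S f \<Longrightarrow> Ck_on k S f"
proof (induction k arbitrary: f)
  case 0
  then show ?case
    by (auto intro!: continuous_at_imp_continuous_on differentiable_imp_continuous_within)
next
  case (Suc k)
  have "Ck_on k S (\<lambda>x. frechet_derivative f (at x) v)" for v
    using Suc.prems[THEN Ck_on.simps(2)[THEN iffD1]] by (blast intro: Suc.IH)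
  then show ?case using Suc.prems by simp
qed

lemma Ck_on_le: "Ck_on n S f \<Longrightarrow> k \<le> n \<Longrightarrow> Ck_on k S f"
proof (induction n)
  case (Suc n)
  then show ?case by (cases "k = Suc n") (auto dest: Ck_on_SucD simp del: Ck_on.simps)
qed simp

lemma Ck_on_imp_continuous_on: "Ck_on k S f \<Longrightarrow> continuous_on S f"
  using Ck_on_le[of k S f 0] by simp

lemma Ck_on_SucI:
  fixes f :: "'a::euclidean_space \<Rightarrow> 'b::real_normed_vector"
  assumes "open S" "\<And>x. x \<in> S \<Longrightarrow> (f has_derivative D x) (at x)" "\<And>v. Ck_on k S (\<lambda>x. D x v)"
  shows "Ck_on (Suc k) S f"
proof -
  have "D x = frechet_derivative f (at x)" if "x \<in> S" for x
    by (rule frechet_derivative_at[OF assms(2)[OF that]])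
  then have "Ck_on k S (\<lambda>x. frechet_derivative f (at x) v)" for v
    using Ck_on_cong[OF assms(1) _ assms(3)[of v]] by simp
  then show ?thesis using assms(2) by (auto simp: differentiable_def)
qed

lemma Ck_on_has_derivative:
  "Ck_on (Suc k) S f \<Longrightarrow> x \<in> S \<Longrightarrow> (f has_derivative frechet_derivative f (at x)) (at x)"
  using frechet_derivative_works by auto

lemma Ck_on_const: "Ck_on k S (\<lambda>x. c)"
  by (induction k arbitrary: c) auto

lemma Ck_on_bounded_linear:
  assumes "bounded_linear f" "open S" shows "Ck_on k S f"
proof (cases k)
  case 0
  then show ?thesis using assms by (simp add: linear_continuous_on)
next
  case (Suc n)
  have "Ck_on (Suc n) S f"
    by (rule Ck_on_SucI[OF assms(2) bounded_linear_imp_has_derivative[OF assms(1)] Ck_on_const])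
  then show ?thesis using Suc by simp
qed

lemma Ck_on_add:
  assumes "open S" "Ck_on k S f" "Ck_on k S g"
  shows "Ck_on k S (\<lambda>x. f x + g x)"
  using assms(2,3)
proof (induction k arbitrary: f g)
  case 0
  then show ?case by (auto intro: continuous_on_add)
next
  case (Suc k)
  show ?case
  proof (rule Ck_on_SucI[OF assms(1)])
    show "((\<lambda>x. f x + g x) has_derivative
       (\<lambda>v. frechet_derivative f (at x) v + frechet_derivative g (at x) v)) (at x)" if "x \<in> S" for x
      by (intro has_derivative_add Ck_on_has_derivative[OF Suc.prems(1) that]
         Ck_on_has_derivative[OF Suc.prems(2) that])
    show "Ck_on k S (\<lambda>x. frechet_derivative f (at x) v + frechet_derivative g (at x) v)" for v
      using Suc.prems by (intro Suc.IH) simp_all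
  qed
qed

lemma Ck_on_bilinear:
  assumes "bounded_bilinear bop" "open S" "Ck_on k S f" "Ck_on k S g"
  shows "Ck_on k S (\<lambda>x. bop (f x) (g x))"
  using assms(3,4)
proof (induction k arbitrary: f g)
  case 0
  then show ?case by (auto intro: bounded_bilinear.continuous_on[OF assms(1)])
next
  case (Suc k)
  show ?case
  proof (rule Ck_on_SucI[OF assms(2)])
    show "((\<lambda>x. bop (f x) (g x)) has_derivative
       (\<lambda>v. bop (f x) (frechet_derivative g (at x) v) + bop (frechet_derivative f (at x) v) (g x)))
       (at x)" if "x \<in> S" for x
      by (intro bounded_bilinear.FDERIV[OF assms(1)] Ck_on_has_derivative[OF Suc.prems(1) that]
         Ck_on_has_derivative[OF Suc.prems(2) that])
    show "Ck_on k S (\<lambda>x. bop (f x) (frechet_derivative g (at x) v)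
              + bop (frechet_derivative f (at x) v) (g x))" for v
      using Suc.prems by (intro Ck_on_add[OF assms(2)] Suc.IH Ck_on_SucD[OF Suc.prems(1)]
          Ck_on_SucD[OF Suc.prems(2)]) auto
  qed
qed

lemmas Ck_on_scaleR = Ck_on_bilinear[OF bounded_bilinear_scaleR]
lemmas Ck_on_mult = Ck_on_bilinear[OF bounded_bilinear_mult]
lemmas Ck_on_inner = Ck_on_bilinear[OF bounded_bilinear_inner]

lemma Ck_on_minus: "open S \<Longrightarrow> Ck_on k S f \<Longrightarrow> Ck_on k S (\<lambda>x. - f x)"
  using Ck_on_scaleR[OF _ Ck_on_const, of S k f "-1"] by simp

lemma Ck_on_diff: "open S \<Longrightarrow> Ck_on k S f \<Longrightarrow> Ck_on k S g \<Longrightarrow> Ck_on k S (\<lambda>x. f x - g x)"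
  using Ck_on_add[OF _ _ Ck_on_minus, of S k f g] by simp

lemma Ck_on_sum:
  "finite I \<Longrightarrow> open S \<Longrightarrow> (\<And>i. i \<in> I \<Longrightarrow> Ck_on k S (f i)) \<Longrightarrow> Ck_on k S (\<lambda>x. \<Sum>i\<in>I. f i x)"
  by (induction I rule: finite_induct) (auto simp: Ck_on_const intro: Ck_on_add)

lemma Ck_on_compose:
  fixes f :: "'b::euclidean_space \<Rightarrow> 'c::real_normed_vector" and g :: "'a::euclidean_space \<Rightarrow> 'b"
  assumes "open S" "open T" "g ` S \<subseteq> T" "Ck_on k T f" "Ck_on k S g"
  shows "Ck_on k S (\<lambda>x. f (g x))"
  using assms(4,5)
proof (induction k arbitrary: f)
  case 0
  then show ?case using continuous_on_compose2 assms(3) by auto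
next
  case (Suc k)
  \<comment> \<open>The chain rule is expanded in the basis: each directional derivative becomes a
    sum of products whose last factor is again a composition with \<open>g\<close>, and the
    induction hypothesis, generalised over \<open>f\<close>, applies to it.\<close>
  let ?D = "\<lambda>x v. \<Sum>b\<in>Basis. (frechet_derivative g (at x) v \<bullet> b) *\<^sub>R frechet_derivative f (at (g x)) b"
  show ?case
  proof (rule Ck_on_SucI[OF assms(1)])
    fix x assume x: "x \<in> S"
    have f: "(f has_derivative frechet_derivative f (at (g x))) (at (g x))"
      using Ck_on_has_derivative[OF Suc.prems(1)] assms(3) x by auto
    have l: "linear (frechet_derivative f (at (g x)))"
      using f has_derivative_linear by blast
    have eq: "frechet_derivative f (at (g x)) w = (\<Sum>b\<in>Basis. (w \<bullet> b) *\<^sub>R frechet_derivative f (at (g x)) b)" for w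
    proof -
      have "frechet_derivative f (at (g x)) (\<Sum>b\<in>Basis. (w \<bullet> b) *\<^sub>R b) =
        (\<Sum>b\<in>Basis. (w \<bullet> b) *\<^sub>R frechet_derivative f (at (g x)) b)"
        by (simp add: linear_sum[OF l] linear_scale[OF l])
      then show ?thesis by (simp add: euclidean_representation)
    qed
    have "?D x = frechet_derivative f (at (g x)) \<circ> frechet_derivative g (at x)"
        by (simp only: o_def eq[symmetric])
    moreover have "(f \<circ> g has_derivative frechet_derivative f (at (g x)) \<circ> frechet_derivative g (at x)) (at x)"
      by (rule diff_chain_at[OF Ck_on_has_derivative[OF Suc.prems(2) x] f])
    ultimately show "((\<lambda>x. f (g x)) has_derivative ?D x) (at x)" by (simp add: o_def)
  next
    fix v
    have 1: "Ck_on k S (\<lambda>x. frechet_derivative g (at x) v)" using Suc.prems(2) by simp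
    show "Ck_on k S (\<lambda>x. ?D x v)"
      using Suc.prems(1) by (intro Ck_on_sum Ck_on_scaleR Ck_on_inner Ck_on_const 1 assms(1) finite_Basis
         Suc.IH Ck_on_SucD[OF Suc.prems(2)]) simp_all
  qed
qed

lemma Ck_on_Pair:
  assumes "open S" "Ck_on k S f" "Ck_on k S g"
  shows "Ck_on k S (\<lambda>x. (f x, g x))"
  using assms(2,3)
proof (induction k arbitrary: f g)
  case 0
  then show ?case by (auto intro: continuous_on_Pair)
next
  case (Suc k)
  show ?case
  proof (rule Ck_on_SucI[OF assms(1)])
    show "((\<lambda>x. (f x, g x)) has_derivative
       (\<lambda>v. (frechet_derivative f (at x) v, frechet_derivative g (at x) v))) (at x)" if "x \<in> S" for x
      by (intro has_derivative_Pair Ck_on_has_derivative[OF Suc.prems(1) that]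
         Ck_on_has_derivative[OF Suc.prems(2) that])
    show "Ck_on k S (\<lambda>x. (frechet_derivative f (at x) v, frechet_derivative g (at x) v))" for v
      using Suc.prems by (intro Suc.IH) simp_all
  qed
qed

lemma Ck_on_fst: "open S \<Longrightarrow> Ck_on k S fst"
  and Ck_on_snd: "open S \<Longrightarrow> Ck_on k S snd"
  by (auto intro: Ck_on_bounded_linear bounded_linear_fst bounded_linear_snd)

lemma Ck_on_id: "open S \<Longrightarrow> Ck_on k S (\<lambda>x. x)"
  by (rule Ck_on_bounded_linear[OF bounded_linear_ident])

lemma Ck_on_frechet: "Ck_on (Suc k) S f \<Longrightarrow> Ck_on k S (\<lambda>x. frechet_derivative f (at x) v)"
  by simp

section \<open>Symmetry of second derivatives\<close>

lemma second_difference_mean_value: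
  fixes f :: "'a::euclidean_space \<Rightarrow> real"
  assumes "Ck_on 2 S f" "0 < h"
    and in_S: "\<And>s t. 0 \<le> s \<Longrightarrow> s \<le> h \<Longrightarrow> 0 \<le> t \<Longrightarrow> t \<le> h \<Longrightarrow> x + s *\<^sub>R v + t *\<^sub>R w \<in> S"
  shows "\<exists>s t. 0 < s \<and> s < h \<and> 0 < t \<and> t < h \<and>
    f (x + h *\<^sub>R v + h *\<^sub>R w) - f (x + h *\<^sub>R v) - f (x + h *\<^sub>R w) + f x =
    h * (h * frechet_derivative (\<lambda>y. frechet_derivative f (at y) v) (at (x + s *\<^sub>R v + t *\<^sub>R w)) w)"
proof -
  define Dv where "Dv = (\<lambda>y. frechet_derivative f (at y) v)"
  have c1: "Ck_on (Suc 0) S Dv" and c2: "Ck_on (Suc (Suc 0)) S f"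
    using assms(1) by (auto simp: numeral_2_eq_2 Dv_def)
  have line: "((\<lambda>r. F (y + r *\<^sub>R z)) has_real_derivative frechet_derivative F (at (y + r *\<^sub>R z)) z) (at r)"
    if "Ck_on (Suc k) S F" "y + r *\<^sub>R z \<in> S" for F :: "'a \<Rightarrow> real" and y z r k
  proof -
    have F: "(F has_derivative frechet_derivative F (at (y + r *\<^sub>R z))) (at (y + r *\<^sub>R z))"
      by (rule Ck_on_has_derivative[OF that])
    have "((\<lambda>r. y + r *\<^sub>R z) has_derivative (\<lambda>d. d *\<^sub>R z)) (at r)"
      by (auto intro!: derivative_eq_intros)
    from diff_chain_at[OF this F]
    have "((\<lambda>r. F (y + r *\<^sub>R z)) has_derivative (\<lambda>d. frechet_derivative F (at (y + r *\<^sub>R z)) (d *\<^sub>R z))) (at r)"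
      by (simp add: o_def)
    moreover have "frechet_derivative F (at (y + r *\<^sub>R z)) (d *\<^sub>R z) = frechet_derivative F (at (y + r *\<^sub>R z)) z * d" for d
      using has_derivative_linear[OF F] by (simp add: linear_scale)
    ultimately show ?thesis by (simp add: has_field_derivative_def)
  qed
  have "\<exists>s. 0 < s \<and> s < h \<and>
     (f ((x + h *\<^sub>R w) + h *\<^sub>R v) - f (x + h *\<^sub>R v)) - (f ((x + h *\<^sub>R w) + 0 *\<^sub>R v) - f (x + 0 *\<^sub>R v))
       = (h - 0) * (Dv ((x + h *\<^sub>R w) + s *\<^sub>R v) - Dv (x + s *\<^sub>R v))"
  proof (rule MVT2[OF assms(2)])
    fix s assume s: "0 \<le> s" "s \<le> h"
    have "(x + h *\<^sub>R w) + s *\<^sub>R v \<in> S" "x + s *\<^sub>R v \<in> S"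
      using in_S[OF s, of h] in_S[OF s, of 0] assms(2) by (simp_all add: add_ac)
    then show "((\<lambda>s. f ((x + h *\<^sub>R w) + s *\<^sub>R v) - f (x + s *\<^sub>R v)) has_real_derivative
        Dv ((x + h *\<^sub>R w) + s *\<^sub>R v) - Dv (x + s *\<^sub>R v)) (at s)"
      unfolding Dv_def by (intro DERIV_diff line[OF c2])
  qed
  then obtain s where s: "0 < s" "s < h" and
    "(f ((x + h *\<^sub>R w) + h *\<^sub>R v) - f (x + h *\<^sub>R v)) - (f ((x + h *\<^sub>R w) + 0 *\<^sub>R v) - f (x + 0 *\<^sub>R v))
       = (h - 0) * (Dv ((x + h *\<^sub>R w) + s *\<^sub>R v) - Dv (x + s *\<^sub>R v))" by blast
  then have s3: "f (x + h *\<^sub>R v + h *\<^sub>R w) - f (x + h *\<^sub>R v) - f (x + h *\<^sub>R w) + f x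
       = h * (Dv ((x + s *\<^sub>R v) + h *\<^sub>R w) - Dv ((x + s *\<^sub>R v) + 0 *\<^sub>R w))"
    by (simp add: add_ac)
  have "\<exists>t. 0 < t \<and> t < h \<and> Dv ((x + s *\<^sub>R v) + h *\<^sub>R w) - Dv ((x + s *\<^sub>R v) + 0 *\<^sub>R w) =
     (h - 0) * frechet_derivative Dv (at ((x + s *\<^sub>R v) + t *\<^sub>R w)) w"
    by (rule MVT2[OF assms(2)]) (rule line[OF c1], rule in_S, use s in auto)
  then obtain t where "0 < t" "t < h" "Dv ((x + s *\<^sub>R v) + h *\<^sub>R w) - Dv ((x + s *\<^sub>R v) + 0 *\<^sub>R w) =
     (h - 0) * frechet_derivative Dv (at ((x + s *\<^sub>R v) + t *\<^sub>R w)) w" by blast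
  with s s3 show ?thesis unfolding Dv_def[symmetric] by (intro exI[of _ s] exI[of _ t]) simp
qed

text \<open>The second difference over a small parallelogram is symmetric in \<open>v\<close> and
  \<open>w\<close>, and two mean value steps turn it into either mixed derivative at a nearby point.
  Continuity of both mixed derivatives brings them together at \<open>x\<close>.\<close>

lemma second_derivative_symmetric_real:
  fixes f :: "'a::euclidean_space \<Rightarrow> real"
  assumes f: "Ck_on 2 S f" and S: "open S" "x \<in> S"
  shows "frechet_derivative (\<lambda>y. frechet_derivative f (at y) v) (at x) w =
         frechet_derivative (\<lambda>y. frechet_derivative f (at y) w) (at x) v" (is "?A x = ?B x")
proof (rule ccontr)
  assume ne: "?A x \<noteq> ?B x"
  \<comment> \<open>Half the gap: the two deviations below add up to less than the whole of
    it.\<close>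
  define e where "e = \<bar>?A x - ?B x\<bar> / 2"
  have e: "e > 0" using ne by (simp add: e_def)
  have cont: "isCont (\<lambda>x. frechet_derivative (\<lambda>y. frechet_derivative f (at y) a) (at x) b) x" for a b
    using f S by (auto simp: numeral_2_eq_2 continuous_on_eq_continuous_at)
  obtain d1 where d1: "d1 > 0" "\<And>y. dist y x < d1 \<Longrightarrow> dist (?A y) (?A x) < e"
    using cont e unfolding continuous_at_eps_delta by metis
  obtain d2 where d2: "d2 > 0" "\<And>y. dist y x < d2 \<Longrightarrow> dist (?B y) (?B x) < e"
    using cont e unfolding continuous_at_eps_delta by metis
  obtain d3 where d3: "d3 > 0" "ball x d3 \<subseteq> S" using S by (meson openE)
  define d where "d = min d1 (min d2 d3)"
  \<comment> \<open>The parallelogram with side factor \<open>h\<close> stays within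
    \<open>d / 2\<close> of \<open>x\<close>; the summand 1 keeps the denominator positive when both
    vectors vanish.\<close>
  define h where "h = d / (2 * (norm v + norm w + 1))"
  have pos: "norm v + norm w + 1 > 0" by (simp add: add_nonneg_pos)
  have d: "d > 0" using d1 d2 d3 by (simp add: d_def)
  have h: "h > 0" using d pos by (simp add: h_def)
  have near: "dist (x + s *\<^sub>R a + t *\<^sub>R b) x < d"
    if "0 \<le> s" "s \<le> h" "0 \<le> t" "t \<le> h" "{a,b} = {v,w}" for s t a b
  proof -
    have "dist (x + s *\<^sub>R a + t *\<^sub>R b) x \<le> norm (s *\<^sub>R a) + norm (t *\<^sub>R b)"
      using norm_triangle_ineq[of "s *\<^sub>R a" "t *\<^sub>R b"] by (simp add: dist_norm add.assoc)
    also have "\<dots> \<le> h * norm a + h * norm b"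
      using that by (intro add_mono) (auto intro: mult_right_mono)
    also have "\<dots> = h * (norm v + norm w)"
      using that(5) by (auto simp: algebra_simps doubleton_eq_iff)
    also have "\<dots> \<le> h * (norm v + norm w + 1)" using h by simp
    also have "\<dots> = d / 2" using pos by (simp add: h_def field_simps)
    also have "\<dots> < d" using d by simp
    finally show ?thesis .
  qed
  have inS: "x + s *\<^sub>R a + t *\<^sub>R b \<in> S"
    if "0 \<le> s" "s \<le> h" "0 \<le> t" "t \<le> h" "{a,b} = {v,w}" for s t a b
    using near[OF that] d3(2) by (auto simp: d_def dist_commute)
  obtain s t where st: "0 < s" "s < h" "0 < t" "t < h"
    "f (x + h *\<^sub>R v + h *\<^sub>R w) - f (x + h *\<^sub>R v) - f (x + h *\<^sub>R w) + f x =
     h * (h * ?A (x + s *\<^sub>R v + t *\<^sub>R w))"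
    using second_difference_mean_value[OF f h, of x v w] inS[of _ _ v w] by blast
  obtain s' t' where st': "0 < s'" "s' < h" "0 < t'" "t' < h"
    "f (x + h *\<^sub>R w + h *\<^sub>R v) - f (x + h *\<^sub>R w) - f (x + h *\<^sub>R v) + f x =
     h * (h * ?B (x + s' *\<^sub>R w + t' *\<^sub>R v))"
    using second_difference_mean_value[OF f h, of x w v] inS[of _ _ w v] insert_commute[of w v "{}"] by metis
  have "h * (h * ?A (x + s *\<^sub>R v + t *\<^sub>R w)) = h * (h * ?B (x + s' *\<^sub>R w + t' *\<^sub>R v))"
    using st(5) st'(5) by (simp add: algebra_simps)
  then have eq: "?A (x + s *\<^sub>R v + t *\<^sub>R w) = ?B (x + s' *\<^sub>R w + t' *\<^sub>R v)"
    using h by simp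
  have "dist (?A (x + s *\<^sub>R v + t *\<^sub>R w)) (?A x) < e"
    using near[of s t v w] st by (intro d1(2)) (auto simp: d_def)
  moreover have "dist (?B (x + s' *\<^sub>R w + t' *\<^sub>R v)) (?B x) < e"
    using near[of s' t' w v] st' by (intro d2(2)) (auto simp: d_def insert_commute)
  ultimately have "\<bar>?A x - ?B x\<bar> < 2 * e" unfolding eq dist_real_def by linarith
  then show False by (simp add: e_def)
qed

lemma has_derivative_inner_left_const:
  "(f has_derivative D) F \<Longrightarrow> ((\<lambda>x. f x \<bullet> b) has_derivative (\<lambda>v. D v \<bullet> b)) F"
  by (rule has_derivative_inner_left)

lemma second_derivative_symmetric:
  fixes f :: "'a::euclidean_space \<Rightarrow> 'b::euclidean_space"
  assumes f: "Ck_on 2 S f" and S: "open S" "x \<in> S"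
  shows "frechet_derivative (\<lambda>y. frechet_derivative f (at y) v) (at x) w =
         frechet_derivative (\<lambda>y. frechet_derivative f (at y) w) (at x) v"
proof (rule euclidean_eqI)
  fix b :: 'b assume b: "b \<in> Basis"
  have f2: "Ck_on (Suc (Suc 0)) S f" and f1: "Ck_on (Suc 0) S (\<lambda>y. frechet_derivative f (at y) a)" for a
    using f by (auto simp: numeral_2_eq_2)
  have 1: "frechet_derivative (\<lambda>y. f y \<bullet> b) (at y) a = frechet_derivative f (at y) a \<bullet> b"
    if "y \<in> S" for y a
    using frechet_derivative_at[OF has_derivative_inner_left_const[OF Ck_on_has_derivative[OF f2 that], of b]]
    by metis
  have 2: "frechet_derivative (\<lambda>y. frechet_derivative (\<lambda>y. f y \<bullet> b) (at y) a) (at x) c =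
      frechet_derivative (\<lambda>y. frechet_derivative f (at y) a) (at x) c \<bullet> b" for a c
  proof -
    have "((\<lambda>y. frechet_derivative f (at y) a \<bullet> b) has_derivative
      (\<lambda>c. frechet_derivative (\<lambda>y. frechet_derivative f (at y) a) (at x) c \<bullet> b)) (at x)"
      by (rule has_derivative_inner_left_const[OF Ck_on_has_derivative[OF f1 S(2)]])
    then have "((\<lambda>y. frechet_derivative (\<lambda>y. f y \<bullet> b) (at y) a) has_derivative
      (\<lambda>c. frechet_derivative (\<lambda>y. frechet_derivative f (at y) a) (at x) c \<bullet> b)) (at x)"
      by (rule has_derivative_transform_within_open[OF _ S]) (simp add: 1)
    from frechet_derivative_at[OF this] show ?thesis by metis
  qed
  have "Ck_on 2 S (\<lambda>y. f y \<bullet> b)"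
    by (intro Ck_on_inner S f Ck_on_const)
  from second_derivative_symmetric_real[OF this S, of v w]
  show "frechet_derivative (\<lambda>y. frechet_derivative f (at y) v) (at x) w \<bullet> b =
        frechet_derivative (\<lambda>y. frechet_derivative f (at y) w) (at x) v \<bullet> b"
    unfolding 2 .
qed

lemma smooth_onD: "smooth_on S f \<Longrightarrow> Ck_on k S f"
  by (simp add: smooth_on_def)

lemma has_derivative_partial_snd:
  assumes "(F has_derivative D) (at (w, u))"
  shows "((\<lambda>u. F (w, u)) has_derivative (\<lambda>v. D (0, v))) (at u)"
proof -
  have "((\<lambda>u. (w, u)) has_derivative (\<lambda>v. (0, v))) (at u)"
    by (auto intro!: derivative_eq_intros)
  from diff_chain_at[OF this assms] show ?thesis by (simp add: o_def)
qed

lemma has_derivative_partial_fst: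
  assumes "(F has_derivative D) (at (w, u))"
  shows "((\<lambda>w. F (w, u)) has_derivative (\<lambda>v. D (v, 0))) (at w)"
proof -
  have "((\<lambda>w. (w, u)) has_derivative (\<lambda>v. (v, 0))) (at w)"
    by (auto intro!: derivative_eq_intros)
  from diff_chain_at[OF this assms] show ?thesis by (simp add: o_def)
qed

section \<open>A smooth bump function\<close>

text \<open>The powers of \<open>t\<close> in the denominator close the family under
  differentiation, so that one induction over all \<open>n\<close> simultaneously gives
  smoothness.\<close>

definition flat_exp :: "nat \<Rightarrow> real \<Rightarrow> real" where
  "flat_exp n t = (if t > 0 then exp (- (1 / t)) / t ^ n else 0)"

lemma flat_exp_tendsto_0: "((\<lambda>t. flat_exp n t) \<longlongrightarrow> 0) (at 0)"
proof -
  have r: "((\<lambda>t. flat_exp n t) \<longlongrightarrow> 0) (at_right 0)"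
  proof -
    have "((\<lambda>s::real. s ^ n / exp s) \<longlongrightarrow> 0) at_top"
      by (rule tendsto_power_div_exp_0)
    then have "((\<lambda>t::real. inverse t ^ n / exp (inverse t)) \<longlongrightarrow> 0) (at_right 0)"
      by (rule filterlim_compose) (rule filterlim_inverse_at_top_right)
    then show ?thesis
      by (rule Lim_transform_eventually)
        (auto simp: eventually_at_filter flat_exp_def field_simps exp_minus)
  qed
  have "((\<lambda>t. flat_exp n t) \<longlongrightarrow> 0) (at_left 0)"
    by (rule tendsto_eventually) (auto simp: eventually_at_filter flat_exp_def)
  with r show ?thesis by (simp add: filterlim_at_split)
qed

lemma flat_exp_derivative:
  "(flat_exp n has_real_derivative flat_exp (n + 2) t - real n * flat_exp (n + 1) t) (at t)"
proof (cases "t = 0")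
  case True
  \<comment> \<open>At 0 the difference quotient of \<open>flat_exp n\<close> is
    \<open>flat_exp (Suc n)\<close>, which tends to 0.\<close>
  have "((\<lambda>h. (flat_exp n (0 + h) - flat_exp n 0) / h) \<longlongrightarrow> 0) (at 0)"
    by (rule Lim_transform_eventually[OF flat_exp_tendsto_0[of "Suc n"]])
      (auto simp: eventually_at_filter flat_exp_def)
  then show ?thesis using True by (simp add: DERIV_def flat_exp_def)
next
  case False
  show ?thesis
  proof (cases "t > 0")
    case True
    have p: "real n * t ^ (n - 1) * t = real n * t ^ n" by (cases n) auto
    have "((\<lambda>t. exp (- (1 / t)) / t ^ n) has_real_derivative
       (exp (- (1 / t)) * (1 / (t * t)) * t ^ n - exp (- (1 / t)) * (real n * t ^ (n - 1))) / (t ^ n * t ^ n)) (at t)"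
      using True by (auto intro!: derivative_eq_intros simp: field_simps)
    also have "(exp (- (1 / t)) * (1 / (t * t)) * t ^ n - exp (- (1 / t)) * (real n * t ^ (n - 1))) / (t ^ n * t ^ n)
      = (exp (- (1 / t)) * (1 / t) * t ^ n - exp (- (1 / t)) * (real n * t ^ (n - 1) * t)) / (t ^ n * t ^ n * t)"
      using True by (simp add: field_simps)
    also have "\<dots> = flat_exp (n + 2) t - real n * flat_exp (n + 1) t"
      unfolding p using True by (simp add: flat_exp_def field_simps power2_eq_square)
    finally have "((\<lambda>t. exp (- (1 / t)) / t ^ n) has_real_derivative
       flat_exp (n + 2) t - real n * flat_exp (n + 1) t) (at t)" .
    then show ?thesis
      by (rule has_field_derivative_transform_within_open[where S="{0<..}"])
         (use True in \<open>auto simp: flat_exp_def\<close>)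
  next
    case f: False
    have "((\<lambda>t. 0) has_real_derivative flat_exp (n + 2) t - real n * flat_exp (n + 1) t) (at t)"
      using False f by (auto simp: flat_exp_def)
    then show ?thesis
      by (rule has_field_derivative_transform_within_open[where S="{..<0}"])
         (use False f in \<open>auto simp: flat_exp_def\<close>)
  qed
qed

lemma Ck_on_flat_exp: "Ck_on k UNIV (flat_exp n)"
proof (induction k arbitrary: n)
  case 0
  then show ?case
    by (auto simp: continuous_on_eq_continuous_at intro: DERIV_isCont[OF flat_exp_derivative])
next
  case (Suc k)
  show ?case
  proof (rule Ck_on_SucI[OF open_UNIV])
    show "(flat_exp n has_derivative (*) (flat_exp (n + 2) t - real n * flat_exp (n + 1) t)) (at t)" for t
      using flat_exp_derivative by (simp add: has_field_derivative_def)
    show "Ck_on k UNIV (\<lambda>t. (flat_exp (n + 2) t - real n * flat_exp (n + 1) t) * v)" for v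
      by (intro Ck_on_mult Ck_on_diff Suc Ck_on_const open_UNIV)
  qed
qed

definition euclid_bump :: "'a::euclidean_space \<Rightarrow> real \<Rightarrow> 'a \<Rightarrow> real" where
  "euclid_bump p r x = flat_exp 0 (r\<^sup>2 - (x - p) \<bullet> (x - p))"

lemma smooth_on_euclid_bump: "smooth_on UNIV (euclid_bump p r)"
proof -
  have "Ck_on k UNIV (\<lambda>x. r\<^sup>2 - (x - p) \<bullet> (x - p))" for k
    by (intro Ck_on_diff Ck_on_inner Ck_on_const Ck_on_id open_UNIV)
  then have "Ck_on k UNIV (\<lambda>x. flat_exp 0 (r\<^sup>2 - (x - p) \<bullet> (x - p)))" for k
    by (rule Ck_on_compose[OF open_UNIV open_UNIV subset_UNIV Ck_on_flat_exp])
  then show ?thesis unfolding smooth_on_def euclid_bump_def by blast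
qed

lemma euclid_bump_nonneg: "euclid_bump p r x \<ge> 0"
  by (simp add: euclid_bump_def flat_exp_def)

lemma euclid_bump_pos: "r > 0 \<Longrightarrow> euclid_bump p r p > 0"
  by (simp add: euclid_bump_def flat_exp_def)

lemma euclid_bump_zero: "r > 0 \<Longrightarrow> x \<notin> ball p r \<Longrightarrow> euclid_bump p r x = 0"
proof -
  assume r: "r > 0" and "x \<notin> ball p r"
  then have "r \<le> norm (x - p)" by (simp add: dist_norm norm_minus_commute)
  then have "r\<^sup>2 \<le> (norm (x - p))\<^sup>2" using r by (intro power_mono) auto
  then show ?thesis by (simp add: euclid_bump_def flat_exp_def power2_norm_eq_inner)
qed

section \<open>Lie groups in charts\<close>

locale lie_grp =
  fixes G :: "('g::{t2_space,second_countable_topology}, 'a::euclidean_space, 'm) lie_group_data_scheme"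
  assumes lie: "lie_group G"
begin

abbreviation gm (infixl "\<cdot>" 70) where "x \<cdot> y \<equiv> gmul G x y"
abbreviation "iv \<equiv> ginv G"
abbreviation "ge \<equiv> gone G"

sublocale grp: group "gmul G" "gone G" "ginv G"
  using lie by (simp add: lie_group_def)

lemma gm_iv_cancel [simp]:
  "iv x \<cdot> (x \<cdot> y) = y" "x \<cdot> (iv x \<cdot> y) = y" "x \<cdot> iv y \<cdot> y = x" "x \<cdot> y \<cdot> iv y = x"
  by (simp_all add: grp.assoc[symmetric]) (simp_all add: grp.assoc)

lemma continuous_on_gm [continuous_intros]:
  "continuous_on S f \<Longrightarrow> continuous_on S g \<Longrightarrow> continuous_on S (\<lambda>x. f x \<cdot> g x)"
  using continuous_on_compose2[of UNIV "\<lambda>(x, y). gmul G x y" S "\<lambda>x. (f x, g x)"] lie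
  by (auto simp: lie_group_def intro: continuous_on_Pair)

lemma continuous_on_iv [continuous_intros]:
  "continuous_on S f \<Longrightarrow> continuous_on S (\<lambda>x. iv (f x))"
  using continuous_on_compose2[of UNIV "ginv G" S f] lie by (auto simp: lie_group_def)

lemma open_left_translate: "open V \<Longrightarrow> open {y. x \<cdot> y \<in> V}"
proof -
  assume "open V"
  then have "open (UNIV \<inter> (\<lambda>y. x \<cdot> y) -` V)"
    by (intro continuous_open_preimage continuous_intros open_UNIV)
  then show ?thesis by (simp add: vimage_def)
qed

lemma
  assumes "(W, \<phi>) \<in> charts G"
  shows chart_open: "open W" and chart_open_image: "open (\<phi> ` W)"
    and chart_continuous: "continuous_on W \<phi>"
    and chart_inv_continuous: "continuous_on (\<phi> ` W) (inv_into W \<phi>)"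
    and chart_inj: "inj_on \<phi> W"
proof -
  have c: "is_chart (W, \<phi>)" using lie assms by (auto simp: lie_group_def smooth_atlas_def)
  then obtain \<psi> where h: "homeomorphism W (\<phi> ` W) \<phi> \<psi>" by (auto simp: is_chart_def)
  show "open W" "open (\<phi> ` W)" using c by (auto simp: is_chart_def)
  show "continuous_on W \<phi>" using h by (simp add: homeomorphism_def)
  show i: "inj_on \<phi> W" using h by (metis homeomorphism_apply1 inj_on_inverseI)
  have "continuous_on (\<phi> ` W) \<psi>" using h by (simp add: homeomorphism_def)
  then show "continuous_on (\<phi> ` W) (inv_into W \<phi>)"
    by (rule continuous_on_eq) (use h i in \<open>auto simp: homeomorphism_def\<close>)
qed

lemma chart_inv [simp]:
  assumes "(W, \<phi>) \<in> charts G"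
  shows "x \<in> W \<Longrightarrow> inv_into W \<phi> (\<phi> x) = x" "u \<in> \<phi> ` W \<Longrightarrow> \<phi> (inv_into W \<phi> u) = u"
    "u \<in> \<phi> ` W \<Longrightarrow> inv_into W \<phi> u \<in> W"
  using chart_inj[OF assms] by (auto simp: f_inv_into_f inv_into_into)

lemma chart_at: obtains W \<phi> where "(W, \<phi>) \<in> charts G" "x \<in> W"
proof -
  have "x \<in> (\<Union>c\<in>charts G. fst c)" using lie by (simp add: lie_group_def smooth_atlas_def)
  then show thesis using that by auto
qed

lemma chart_transition:
  assumes "(W, \<phi>) \<in> charts G" "(W', \<phi>') \<in> charts G"
  shows "Ck_on k (\<phi> ` (W \<inter> W')) (\<lambda>u. \<phi>' (inv_into W \<phi> u))"
proof -
  have "smooth_atlas (charts G)" using lie by (simp add: lie_group_def)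
  then have "\<forall>(W, \<phi>)\<in>charts G. \<forall>(W', \<phi>')\<in>charts G. smooth_on (\<phi> ` (W \<inter> W')) (\<phi>' \<circ> inv_into W \<phi>)"
    unfolding smooth_atlas_def by (elim conjE)
  from this[THEN bspec, OF assms(1), unfolded prod.case, THEN bspec, OF assms(2), unfolded prod.case]
  have "smooth_on (\<phi> ` (W \<inter> W')) (\<phi>' \<circ> inv_into W \<phi>)" .
  then show ?thesis by (simp add: smooth_on_def o_def)
qed

lemma chart_image_open:
  assumes "(W, \<phi>) \<in> charts G" "open V"
  shows "open (\<phi> ` (W \<inter> V))"
proof -
  have "\<phi> ` (W \<inter> V) = \<phi> ` W \<inter> inv_into W \<phi> -` V"
  proof (rule set_eqI, rule iffI)
    fix u assume "u \<in> \<phi> ` W \<inter> inv_into W \<phi> -` V"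
    then show "u \<in> \<phi> ` (W \<inter> V)"
      using chart_inv(2,3)[OF assms(1)] by (intro image_eqI[of _ _ "inv_into W \<phi> u"]) auto
  qed (use chart_inv(1)[OF assms(1)] in auto)
  then show ?thesis
    using continuous_open_preimage[OF chart_inv_continuous chart_open_image assms(2)] assms(1) by simp
qed

text \<open>Continuity is part of the definition: for open \<open>S\<close> it makes the preimage of
  a chart domain open, so that differentiability in that chart makes sense there.\<close>

definition Ck_map :: "nat \<Rightarrow> 'c::euclidean_space set \<Rightarrow> ('c \<Rightarrow> 'g) \<Rightarrow> bool" where
  "Ck_map k S F \<longleftrightarrow> continuous_on S F \<and>
     (\<forall>(W, \<phi>)\<in>charts G. Ck_on k (S \<inter> F -` W) (\<lambda>s. \<phi> (F s)))"

lemma Ck_map_continuous: "Ck_map k S F \<Longrightarrow> continuous_on S F"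
  by (simp add: Ck_map_def)

lemma Ck_map_chart: "Ck_map k S F \<Longrightarrow> (W, \<phi>) \<in> charts G \<Longrightarrow> Ck_on k (S \<inter> F -` W) (\<lambda>s. \<phi> (F s))"
  by (auto simp: Ck_map_def)

text \<open>The definition quantifies over all charts. One chart around each point is enough, since
  any other is reached by a smooth transition map and continuity comes from the inverse
  chart.\<close>

lemma Ck_mapI:
  assumes "\<And>s. s \<in> S \<Longrightarrow> \<exists>W \<phi> T. (W, \<phi>) \<in> charts G \<and> open T \<and> s \<in> T \<and> F ` T \<subseteq> W \<and>
     Ck_on k T (\<lambda>s. \<phi> (F s))"
  shows "Ck_map k S F"
  unfolding Ck_map_def
proof safe
  have c: "\<exists>T. open T \<and> s \<in> T \<and> continuous_on T F" if "s \<in> S" for s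
  proof -
    obtain W \<phi> T where *: "(W, \<phi>) \<in> charts G" "open T" "s \<in> T" "F ` T \<subseteq> W"
       "Ck_on k T (\<lambda>s. \<phi> (F s))" using assms \<open>s \<in> S\<close> by meson
    have "continuous_on T (\<lambda>s. inv_into W \<phi> (\<phi> (F s)))"
      by (rule continuous_on_compose2[OF chart_inv_continuous[OF *(1)] Ck_on_imp_continuous_on[OF *(5)]])
        (use * in auto)
    then have "continuous_on T F"
      by (rule continuous_on_eq) (use * chart_inv[OF *(1)] in auto)
    then show ?thesis using * by blast
  qed
  have "isCont F s" if "s \<in> S" for s
    using c[OF that] continuous_on_eq_continuous_at by blast
  then show "continuous_on S F" by (simp add: continuous_at_imp_continuous_on)
  fix W' \<phi>' assume W': "(W', \<phi>') \<in> charts G"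
  show "Ck_on k (S \<inter> F -` W') (\<lambda>s. \<phi>' (F s))"
  proof (rule Ck_on_local)
    fix s assume s: "s \<in> S \<inter> F -` W'"
    obtain W \<phi> T0 where *: "(W, \<phi>) \<in> charts G" "open T0" "s \<in> T0" "F ` T0 \<subseteq> W"
       "Ck_on k T0 (\<lambda>s. \<phi> (F s))" using assms[of s] s by blast
    obtain T1 where T1: "open T1" "s \<in> T1" "continuous_on T1 F" using c s by blast
    define T where "T = T0 \<inter> (T1 \<inter> F -` W')"
    have T: "open T" "s \<in> T" using * T1 s continuous_open_preimage[OF T1(3,1) chart_open[OF W']]
      by (auto simp: T_def)
    have "Ck_on k T (\<lambda>s. \<phi>' (inv_into W \<phi> (\<phi> (F s))))"
    proof (rule Ck_on_compose[OF T(1) _ _ chart_transition[OF *(1) W']])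
      show "open (\<phi> ` (W \<inter> W'))" using chart_image_open[OF *(1) chart_open[OF W']] .
      show "Ck_on k T (\<lambda>s. \<phi> (F s))" using *(5) by (rule Ck_on_subset) (auto simp: T_def)
    qed (use * in \<open>auto simp: T_def\<close>)
    then have "Ck_on k T (\<lambda>s. \<phi>' (F s))"
      by (rule Ck_on_cong[rotated 2]) (use * T in \<open>auto simp: T_def\<close>)
    then show "\<exists>T. open T \<and> s \<in> T \<and> Ck_on k T (\<lambda>s. \<phi>' (F s))" using T by blast
  qed
qed

lemma Ck_map_inv_chart: "(W, \<phi>) \<in> charts G \<Longrightarrow> Ck_map k (\<phi> ` W) (inv_into W \<phi>)"
proof (rule Ck_mapI)
  fix s assume W: "(W, \<phi>) \<in> charts G" and s: "s \<in> \<phi> ` W"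
  have "Ck_on k (\<phi> ` W) (\<lambda>s. \<phi> (inv_into W \<phi> s))"
    by (rule Ck_on_cong[OF chart_open_image[OF W] _ Ck_on_id[OF chart_open_image[OF W]]]) (use W in auto)
  then show "\<exists>W' \<phi>' T. (W', \<phi>') \<in> charts G \<and> open T \<and> s \<in> T \<and> inv_into W \<phi> ` T \<subseteq> W' \<and>
     Ck_on k T (\<lambda>s. \<phi>' (inv_into W \<phi> s))"
    using W s chart_open_image[OF W]
    by (intro exI[of _ W] exI[of _ \<phi>] exI[of _ "\<phi> ` W"]) auto
qed

lemma Ck_map_const: "Ck_map k S (\<lambda>s. x)"
proof (rule Ck_mapI)
  fix s
  obtain W \<phi> where "(W, \<phi>) \<in> charts G" "x \<in> W" by (rule chart_at)
  then show "\<exists>W \<phi> T. (W, \<phi>) \<in> charts G \<and> open T \<and> s \<in> T \<and> (\<lambda>s. x) ` T \<subseteq> W \<and> Ck_on k T (\<lambda>s. \<phi> x)"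
    by (intro exI[of _ W] exI[of _ \<phi>] exI[of _ UNIV]) (auto intro: Ck_on_const)
qed

lemma Ck_map_subset: "Ck_map k S F \<Longrightarrow> T \<subseteq> S \<Longrightarrow> Ck_map k T F"
  by (auto simp: Ck_map_def intro: continuous_on_subset Ck_on_subset)

lemma Ck_map_mul:
  assumes "open S" "Ck_map k S F" "Ck_map k S H"
  shows "Ck_map k S (\<lambda>s. F s \<cdot> H s)"
proof (rule Ck_mapI)
  fix s assume s: "s \<in> S"
  obtain W1 \<phi>1 where 1: "(W1, \<phi>1) \<in> charts G" "F s \<in> W1" by (rule chart_at)
  obtain W2 \<phi>2 where 2: "(W2, \<phi>2) \<in> charts G" "H s \<in> W2" by (rule chart_at)
  obtain W3 \<phi>3 where 3: "(W3, \<phi>3) \<in> charts G" "F s \<cdot> H s \<in> W3" by (rule chart_at)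
  let ?i1 = "inv_into W1 \<phi>1" and ?i2 = "inv_into W2 \<phi>2"
  define D where "D = {(u, v). u \<in> \<phi>1 ` W1 \<and> v \<in> \<phi>2 ` W2 \<and> ?i1 u \<cdot> ?i2 v \<in> W3}"
  \<comment> \<open>Shrinking to \<open>T\<close> keeps both factors and the product inside chart
    domains, where the smoothness of multiplication is given in coordinates.\<close>
  define T where "T = (S \<inter> F -` W1) \<inter> (S \<inter> H -` W2) \<inter> (S \<inter> (\<lambda>s. F s \<cdot> H s) -` W3)"
  note cF = Ck_map_continuous[OF assms(2)] and cH = Ck_map_continuous[OF assms(3)]
  have T: "open T" "s \<in> T"
    unfolding T_def using s 1 2 3
      continuous_open_preimage[OF cF assms(1) chart_open[OF 1(1)]]
      continuous_open_preimage[OF cH assms(1) chart_open[OF 2(1)]]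
      continuous_open_preimage[OF continuous_on_gm[OF cF cH] assms(1) chart_open[OF 3(1)]]
    by (simp_all add: open_Int)
  have "continuous_on (\<phi>1 ` W1 \<times> \<phi>2 ` W2) (\<lambda>z. ?i1 (fst z) \<cdot> ?i2 (snd z))"
    by (intro continuous_intros continuous_on_compose2[OF chart_inv_continuous[OF 1(1)]]
         continuous_on_compose2[OF chart_inv_continuous[OF 2(1)]]) auto
  from continuous_open_preimage[OF this open_Times[OF chart_open_image[OF 1(1)] chart_open_image[OF 2(1)]]
      chart_open[OF 3(1)]]
  have "open ((\<phi>1 ` W1 \<times> \<phi>2 ` W2) \<inter> (\<lambda>z. ?i1 (fst z) \<cdot> ?i2 (snd z)) -` W3)" .
  also have "(\<phi>1 ` W1 \<times> \<phi>2 ` W2) \<inter> (\<lambda>z. ?i1 (fst z) \<cdot> ?i2 (snd z)) -` W3 = D"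
    unfolding D_def by auto
  finally have "open D" .
  moreover have "smooth_on D (\<lambda>(u, v). \<phi>3 (?i1 u \<cdot> ?i2 v))"
  proof -
    have "\<forall>(W1, \<phi>1)\<in>charts G. \<forall>(W2, \<phi>2)\<in>charts G. \<forall>(W3, \<phi>3)\<in>charts G.
        smooth_on {(u, v). u \<in> \<phi>1 ` W1 \<and> v \<in> \<phi>2 ` W2 \<and>
                     gmul G (inv_into W1 \<phi>1 u) (inv_into W2 \<phi>2 v) \<in> W3}
          (\<lambda>(u, v). \<phi>3 (gmul G (inv_into W1 \<phi>1 u) (inv_into W2 \<phi>2 v)))"
      using lie unfolding lie_group_def by (elim conjE)
    from this[THEN bspec, OF 1(1), unfolded prod.case, THEN bspec, OF 2(1), unfolded prod.case,
        THEN bspec, OF 3(1), unfolded prod.case]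
    show ?thesis unfolding D_def .
  qed
  moreover have "Ck_on k T (\<lambda>s. (\<phi>1 (F s), \<phi>2 (H s)))"
    by (intro Ck_on_Pair T(1) Ck_on_subset[OF Ck_map_chart[OF assms(2) 1(1)]]
        Ck_on_subset[OF Ck_map_chart[OF assms(3) 2(1)]]) (auto simp: T_def)
  moreover have "(\<lambda>s. (\<phi>1 (F s), \<phi>2 (H s))) ` T \<subseteq> D"
    using chart_inv[OF 1(1)] chart_inv[OF 2(1)] by (auto simp: T_def D_def)
  ultimately have "Ck_on k T (\<lambda>s. (\<lambda>(u, v). \<phi>3 (?i1 u \<cdot> ?i2 v)) (\<phi>1 (F s), \<phi>2 (H s)))"
    using Ck_on_compose[OF T(1), where f="\<lambda>(u, v). \<phi>3 (?i1 u \<cdot> ?i2 v)" and T=D and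
       g="\<lambda>s. (\<phi>1 (F s), \<phi>2 (H s))"] smooth_onD by blast
  then have "Ck_on k T (\<lambda>s. \<phi>3 (F s \<cdot> H s))"
    by (rule Ck_on_cong[OF T(1), rotated]) (use 1 2 in \<open>auto simp: T_def\<close>)
  then show "\<exists>W \<phi> T. (W, \<phi>) \<in> charts G \<and> open T \<and> s \<in> T \<and> (\<lambda>s. F s \<cdot> H s) ` T \<subseteq> W \<and>
      Ck_on k T (\<lambda>s. \<phi> (F s \<cdot> H s))"
    using 3 T by (intro exI[of _ W3] exI[of _ \<phi>3] exI[of _ T]) (auto simp: T_def)
qed

lemma Ck_map_iv:
  assumes "open S" "Ck_map k S F"
  shows "Ck_map k S (\<lambda>s. iv (F s))"
proof (rule Ck_mapI)
  fix s assume s: "s \<in> S"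
  obtain W1 \<phi>1 where 1: "(W1, \<phi>1) \<in> charts G" "F s \<in> W1" by (rule chart_at)
  obtain W2 \<phi>2 where 2: "(W2, \<phi>2) \<in> charts G" "iv (F s) \<in> W2" by (rule chart_at)
  let ?i1 = "inv_into W1 \<phi>1"
  define D where "D = {u \<in> \<phi>1 ` W1. iv (?i1 u) \<in> W2}"
  define T where "T = (S \<inter> F -` W1) \<inter> (S \<inter> (\<lambda>s. iv (F s)) -` W2)"
  note cF = Ck_map_continuous[OF assms(2)]
  have T: "open T" "s \<in> T"
    unfolding T_def using s 1 2
      continuous_open_preimage[OF cF assms(1) chart_open[OF 1(1)]]
      continuous_open_preimage[OF continuous_on_iv[OF cF] assms(1) chart_open[OF 2(1)]]
    by (simp_all add: open_Int)
  have "continuous_on (\<phi>1 ` W1) (\<lambda>z. iv (?i1 z))"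
    by (intro continuous_intros chart_inv_continuous[OF 1(1)])
  from continuous_open_preimage[OF this chart_open_image[OF 1(1)] chart_open[OF 2(1)]]
  have "open D" by (auto simp: D_def vimage_def Int_def)
  moreover have "smooth_on D (\<lambda>u. \<phi>2 (iv (?i1 u)))"
  proof -
    have "\<forall>(W1, \<phi>1)\<in>charts G. \<forall>(W2, \<phi>2)\<in>charts G.
        smooth_on {u \<in> \<phi>1 ` W1. ginv G (inv_into W1 \<phi>1 u) \<in> W2}
          (\<lambda>u. \<phi>2 (ginv G (inv_into W1 \<phi>1 u)))"
      using lie unfolding lie_group_def by (elim conjE)
    from this[THEN bspec, OF 1(1), unfolded prod.case, THEN bspec, OF 2(1), unfolded prod.case]
    show ?thesis unfolding D_def .
  qed
  moreover have "Ck_on k T (\<lambda>s. \<phi>1 (F s))"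
    by (intro Ck_on_subset[OF Ck_map_chart[OF assms(2) 1(1)]]) (auto simp: T_def)
  moreover have "(\<lambda>s. \<phi>1 (F s)) ` T \<subseteq> D"
    using chart_inv[OF 1(1)] by (auto simp: T_def D_def)
  ultimately have "Ck_on k T (\<lambda>s. \<phi>2 (iv (?i1 (\<phi>1 (F s)))))"
    using Ck_on_compose[OF T(1), where f="\<lambda>u. \<phi>2 (iv (?i1 u))" and T=D and g="\<lambda>s. \<phi>1 (F s)"]
      smooth_onD by blast
  then have "Ck_on k T (\<lambda>s. \<phi>2 (iv (F s)))"
    by (rule Ck_on_cong[OF T(1), rotated]) (use 1 2 in \<open>auto simp: T_def\<close>)
  then show "\<exists>W \<phi> T. (W, \<phi>) \<in> charts G \<and> open T \<and> s \<in> T \<and> (\<lambda>s. iv (F s)) ` T \<subseteq> W \<and>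
      Ck_on k T (\<lambda>s. \<phi> (iv (F s)))"
    using 2 T by (intro exI[of _ W2] exI[of _ \<phi>2] exI[of _ T]) (auto simp: T_def)
qed

lemma Ck_map_compose:
  assumes "open S" "open T" "Ck_map k T F" "Ck_on k S g" "g ` S \<subseteq> T"
  shows "Ck_map k S (\<lambda>s. F (g s))"
proof -
  have c: "continuous_on S (\<lambda>s. F (g s))"
    by (rule continuous_on_compose2[OF Ck_map_continuous[OF assms(3)] Ck_on_imp_continuous_on[OF assms(4)] assms(5)])
  moreover have "Ck_on k (S \<inter> (\<lambda>s. F (g s)) -` W) (\<lambda>s. \<phi> (F (g s)))" if W: "(W, \<phi>) \<in> charts G" for W \<phi>
  proof (rule Ck_on_compose[where f="\<lambda>s. \<phi> (F s)" and T="T \<inter> F -` W"])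
    show "open (S \<inter> (\<lambda>s. F (g s)) -` W)"
      by (rule continuous_open_preimage[OF c assms(1) chart_open[OF W]])
    show "open (T \<inter> F -` W)"
      by (rule continuous_open_preimage[OF Ck_map_continuous[OF assms(3)] assms(2) chart_open[OF W]])
    show "Ck_on k (T \<inter> F -` W) (\<lambda>s. \<phi> (F s))" by (rule Ck_map_chart[OF assms(3) W])
    show "Ck_on k (S \<inter> (\<lambda>s. F (g s)) -` W) g" by (rule Ck_on_subset[OF assms(4)]) auto
  qed (use assms(5) in auto)
  ultimately show ?thesis by (auto simp: Ck_map_def)
qed

section \<open>Functions of class C^k on the group\<close>

lemma Ck_fun_onD: "Ck_fun_on G k U f \<Longrightarrow> (W, \<phi>) \<in> charts G \<Longrightarrow> Ck_on k (\<phi> ` (W \<inter> U)) (\<lambda>u. f (inv_into W \<phi> u))"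
  by (auto simp: Ck_fun_on_def o_def)

lemma Ck_fun_onI: "(\<And>W \<phi>. (W, \<phi>) \<in> charts G \<Longrightarrow> Ck_on k (\<phi> ` (W \<inter> U)) (\<lambda>u. f (inv_into W \<phi> u))) \<Longrightarrow> Ck_fun_on G k U f"
  by (auto simp: Ck_fun_on_def o_def)

text \<open>The bridge from functions on the group to Euclidean calculus: translations, products and
  inverses are substituted through it.\<close>

lemma Ck_fun_on_gmap:
  assumes "Ck_fun_on G k U f" "open U" "open S" "Ck_map k S F" "F ` S \<subseteq> U"
  shows "Ck_on k S (\<lambda>s. f (F s))"
proof (rule Ck_on_local)
  fix s assume s: "s \<in> S"
  obtain W \<phi> where W: "(W, \<phi>) \<in> charts G" "F s \<in> W" by (rule chart_at)
  define T where "T = S \<inter> F -` W"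
  have T: "open T" "s \<in> T" using s W continuous_open_preimage[OF Ck_map_continuous[OF assms(4)] assms(3) chart_open[OF W(1)]]
    by (auto simp: T_def)
  have "Ck_on k T (\<lambda>s. f (inv_into W \<phi> (\<phi> (F s))))"
    by (rule Ck_on_compose[OF T(1) chart_image_open[OF W(1) assms(2)] _ Ck_fun_onD[OF assms(1) W(1)]])
      (use assms(5) Ck_map_chart[OF assms(4) W(1)] in \<open>auto simp: T_def\<close>)
  then have "Ck_on k T (\<lambda>s. f (F s))"
    by (rule Ck_on_cong[OF T(1), rotated]) (use W in \<open>auto simp: T_def\<close>)
  then show "\<exists>T. open T \<and> s \<in> T \<and> Ck_on k T (\<lambda>s. f (F s))" using T by blast
qed

lemma Ck_fun_onI_local:
  assumes "\<And>x. x \<in> U \<Longrightarrow> \<exists>W \<phi> V. (W, \<phi>) \<in> charts G \<and> open V \<and> x \<in> V \<and> V \<subseteq> W \<and>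
     Ck_on k (\<phi> ` V) (\<lambda>u. f (inv_into W \<phi> u))"
  shows "Ck_fun_on G k U f"
proof (rule Ck_fun_onI, rule Ck_on_local)
  fix W' \<phi>' s assume W': "(W', \<phi>') \<in> charts G" and s: "s \<in> \<phi>' ` (W' \<inter> U)"
  then obtain x where x: "s = \<phi>' x" "x \<in> W'" "x \<in> U" by auto
  obtain W \<phi> V where *: "(W, \<phi>) \<in> charts G" "open V" "x \<in> V" "V \<subseteq> W"
     "Ck_on k (\<phi> ` V) (\<lambda>u. f (inv_into W \<phi> u))" using assms[OF x(3)] by blast
  define T where "T = \<phi>' ` (W' \<inter> V)"
  have T: "open T" "s \<in> T" using chart_image_open[OF W' *(2)] x * by (auto simp: T_def)
  have VW: "W \<inter> V = V" using * by blast
  have "Ck_on k T (\<lambda>u. f (inv_into W \<phi> (\<phi> (inv_into W' \<phi>' u))))"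
  proof (rule Ck_on_compose[OF T(1) _ _ *(5)])
    show "open (\<phi> ` V)" using chart_image_open[OF *(1,2)] VW by simp
    show "Ck_on k T (\<lambda>u. \<phi> (inv_into W' \<phi>' u))"
      by (rule Ck_on_subset[OF chart_transition[OF W' *(1)]]) (use *(4) in \<open>auto simp: T_def\<close>)
    show "(\<lambda>u. \<phi> (inv_into W' \<phi>' u)) ` T \<subseteq> \<phi> ` V" using chart_inv[OF W'] by (auto simp: T_def)
  qed
  then have "Ck_on k T (\<lambda>u. f (inv_into W' \<phi>' u))"
    by (rule Ck_on_cong[OF T(1), rotated]) (use chart_inv[OF W'] chart_inv[OF *(1)] *(4) in \<open>auto simp: T_def\<close>)
  then show "\<exists>T. open T \<and> s \<in> T \<and> Ck_on k T (\<lambda>u. f (inv_into W' \<phi>' u))" using T by blast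
qed

lemma Ck_fun_on_local:
  assumes "\<And>x. x \<in> U \<Longrightarrow> \<exists>V. open V \<and> x \<in> V \<and> Ck_fun_on G k V f"
  shows "Ck_fun_on G k U f"
proof (rule Ck_fun_onI_local)
  fix x assume "x \<in> U"
  then obtain V where V: "open V" "x \<in> V" "Ck_fun_on G k V f" using assms by blast
  obtain W \<phi> where W: "(W, \<phi>) \<in> charts G" "x \<in> W" by (rule chart_at)
  show "\<exists>W \<phi> V. (W, \<phi>) \<in> charts G \<and> open V \<and> x \<in> V \<and> V \<subseteq> W \<and>
     Ck_on k (\<phi> ` V) (\<lambda>u. f (inv_into W \<phi> u))"
    by (rule exI[of _ W], rule exI[of _ \<phi>], rule exI[of _ "W \<inter> V"])
      (use V W chart_open[OF W(1)] Ck_fun_onD[OF V(3) W(1)] in auto)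
qed

lemma Ck_fun_on_subset: "Ck_fun_on G k U f \<Longrightarrow> V \<subseteq> U \<Longrightarrow> Ck_fun_on G k V f"
  by (rule Ck_fun_onI, rule Ck_on_subset, rule Ck_fun_onD) auto

lemma Ck_fun_on_cong:
  "open U \<Longrightarrow> (\<And>x. x \<in> U \<Longrightarrow> f x = g x) \<Longrightarrow> Ck_fun_on G k U f \<Longrightarrow> Ck_fun_on G k U g"
proof (rule Ck_fun_onI)
  fix W \<phi> assume *: "open U" "\<And>x. x \<in> U \<Longrightarrow> f x = g x" "Ck_fun_on G k U f" "(W, \<phi>) \<in> charts G"
  show "Ck_on k (\<phi> ` (W \<inter> U)) (\<lambda>u. g (inv_into W \<phi> u))"
    by (rule Ck_on_cong[OF chart_image_open[OF *(4,1)] _ Ck_fun_onD[OF *(3,4)]]) (use *(2,4) in auto)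
qed

lemma Ck_fun_on_continuous: "Ck_fun_on G k U f \<Longrightarrow> open U \<Longrightarrow> continuous_on U f"
proof -
  assume *: "Ck_fun_on G k U f" "open U"
  have "isCont f x" if x: "x \<in> U" for x
  proof -
    obtain W \<phi> where W: "(W, \<phi>) \<in> charts G" "x \<in> W" by (rule chart_at)
    have "continuous_on (W \<inter> U) (\<lambda>x. f (inv_into W \<phi> (\<phi> x)))"
      by (rule continuous_on_compose2[OF Ck_on_imp_continuous_on[OF Ck_fun_onD[OF *(1) W(1)]]])
        (auto intro: continuous_on_subset[OF chart_continuous[OF W(1)]])
    then have "continuous_on (W \<inter> U) f"
      by (rule continuous_on_eq) (use W in auto)
    moreover have "open (W \<inter> U)" using *(2) chart_open[OF W(1)] by auto
    ultimately show ?thesis using W x continuous_on_eq_continuous_at[of "W \<inter> U" f] by blast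
  qed
  then show ?thesis by (simp add: continuous_at_imp_continuous_on)
qed

lemma Ck_fun_on_const: "Ck_fun_on G k U (\<lambda>x. c)"
  by (rule Ck_fun_onI) (rule Ck_on_const)

lemma Ck_fun_on_bilinear:
  assumes "bounded_bilinear bop" "open U" "Ck_fun_on G k U f" "Ck_fun_on G k U g"
  shows "Ck_fun_on G k U (\<lambda>x. bop (f x) (g x))"
  by (rule Ck_fun_onI, rule Ck_on_bilinear[OF assms(1)])
    (auto intro: chart_image_open assms Ck_fun_onD)

lemmas Ck_fun_on_scaleR = Ck_fun_on_bilinear[OF bounded_bilinear_scaleR]
lemmas Ck_fun_on_mult = Ck_fun_on_bilinear[OF bounded_bilinear_mult]
lemmas Ck_fun_on_inner = Ck_fun_on_bilinear[OF bounded_bilinear_inner]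

lemma Ck_fun_on_sum:
  assumes "finite I" "open U" "\<And>i. i \<in> I \<Longrightarrow> Ck_fun_on G k U (f i)"
  shows "Ck_fun_on G k U (\<lambda>x. \<Sum>i\<in>I. f i x)"
  by (rule Ck_fun_onI, rule Ck_on_sum) (auto intro: chart_image_open assms Ck_fun_onD)

lemma smooth_fun_onD: "smooth_fun_on G U f \<Longrightarrow> Ck_fun_on G k U f"
  by (simp add: smooth_fun_on_def)

lemma smooth_fun_onI: "(\<And>k. Ck_fun_on G k U f) \<Longrightarrow> smooth_fun_on G U f"
  by (simp add: smooth_fun_on_def)

section \<open>Extension by zero and bump functions\<close>

lemma chart_preimage_compact:
  "(W, \<phi>) \<in> charts G \<Longrightarrow> compact K \<Longrightarrow> K \<subseteq> \<phi> ` W \<Longrightarrow> compact (inv_into W \<phi> ` K)"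
  by (rule compact_continuous_image) (auto intro: continuous_on_subset chart_inv_continuous)

text \<open>The compact set \<open>K\<close> pulls back to a compact, hence closed, subset of the
  Hausdorff group. A point outside \<open>W\<close> therefore has a neighbourhood on which the
  extension is 0.\<close>

lemma smooth_chart_extension:
  assumes W: "(W, \<phi>) \<in> charts G" and h: "smooth_on (\<phi> ` W) h" and K: "compact K" "K \<subseteq> \<phi> ` W"
    and 0: "\<And>u. u \<in> \<phi> ` W \<Longrightarrow> u \<notin> K \<Longrightarrow> h u = 0"
  shows "smooth_fun_on G UNIV (\<lambda>x. if x \<in> W then h (\<phi> x) else 0)"
    and "x \<notin> inv_into W \<phi> ` K \<Longrightarrow> (if x \<in> W then h (\<phi> x) else 0) = 0"
proof -
  let ?f = "\<lambda>x. if x \<in> W then h (\<phi> x) else 0"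
  let ?C = "inv_into W \<phi> ` K"
  have C: "closed ?C" using chart_preimage_compact[OF W K] by (rule compact_imp_closed)
  have z: "?f x = 0" if "x \<notin> ?C" for x
  proof (cases "x \<in> W")
    case True
    then have "\<phi> x \<notin> K" using that W by (metis chart_inv(1) image_eqI)
    then show ?thesis using 0 True by simp
  qed simp
  then show "x \<notin> ?C \<Longrightarrow> ?f x = 0" .
  show "smooth_fun_on G UNIV ?f"
  proof (rule smooth_fun_onI, rule Ck_fun_onI_local)
    fix k and x :: 'g
    show "\<exists>W' \<phi>' V. (W', \<phi>') \<in> charts G \<and> open V \<and> x \<in> V \<and> V \<subseteq> W' \<and>
       Ck_on k (\<phi>' ` V) (\<lambda>u. ?f (inv_into W' \<phi>' u))"
    proof (cases "x \<in> W")
      case True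
      have "Ck_on k (\<phi> ` W) (\<lambda>u. ?f (inv_into W \<phi> u))"
        by (rule Ck_on_cong[OF chart_open_image[OF W] _ smooth_onD[OF h]]) (use W in auto)
      then show ?thesis using W True chart_open[OF W]
        by (intro exI[of _ W] exI[of _ \<phi>] exI[of _ W]) simp
    next
      case False
      then have x: "x \<notin> ?C" using K W by auto
      obtain W' \<phi>' where W': "(W', \<phi>') \<in> charts G" "x \<in> W'" by (rule chart_at)
      have o: "open (W' \<inter> - ?C)" using chart_open[OF W'(1)] C by auto
      have "Ck_on k (\<phi>' ` (W' \<inter> - ?C)) (\<lambda>u. ?f (inv_into W' \<phi>' u))"
      proof (rule Ck_on_cong[OF chart_image_open[OF W'(1)] _ Ck_on_const[where c=0]])
        show "open (- ?C)" using C by auto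
        fix u assume "u \<in> \<phi>' ` (W' \<inter> - ?C)"
        then have "inv_into W' \<phi>' u \<notin> ?C" using chart_inv[OF W'(1)] by auto
        from z[OF this] show "0 = ?f (inv_into W' \<phi>' u)" by simp
      qed
      then show ?thesis using W' x o
        by (intro exI[of _ W'] exI[of _ \<phi>'] exI[of _ "W' \<inter> - ?C"]) simp
    qed
  qed
qed

lemma smooth_bump:
  assumes "open U" "p \<in> U"
  obtains f :: "'g \<Rightarrow> real" and K where "smooth_fun_on G UNIV f" "\<And>x. f x \<ge> 0" "f p > 0" "compact K" "K \<subseteq> U"
    "\<And>x. x \<notin> K \<Longrightarrow> f x = 0"
proof -
  obtain W \<phi> where W: "(W, \<phi>) \<in> charts G" "p \<in> W" by (rule chart_at)
  have "open (\<phi> ` (W \<inter> U))" "\<phi> p \<in> \<phi> ` (W \<inter> U)" using chart_image_open[OF W(1) assms(1)] W assms by auto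
  then obtain r where r: "r > 0" "cball (\<phi> p) r \<subseteq> \<phi> ` (W \<inter> U)" by (meson open_contains_cball)
  let ?h = "euclid_bump (\<phi> p) r"
  let ?f = "\<lambda>x. if x \<in> W then ?h (\<phi> x) else 0"
  have h: "smooth_on (\<phi> ` W) ?h" using smooth_on_euclid_bump
    by (metis Ck_on_subset smooth_on_def subset_UNIV)
  have K: "compact (cball (\<phi> p) r)" "cball (\<phi> p) r \<subseteq> \<phi> ` W" using r by auto
  have z: "?h u = 0" if "u \<notin> cball (\<phi> p) r" for u
    using that r by (intro euclid_bump_zero) auto
  show thesis
  proof (rule that[of ?f "inv_into W \<phi> ` cball (\<phi> p) r"])
    show "smooth_fun_on G UNIV ?f" by (rule smooth_chart_extension(1)[OF W(1) h K z])
    show "?f x \<ge> 0" for x by (simp add: euclid_bump_nonneg)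
    show "?f p > 0" using W r by (simp add: euclid_bump_pos)
    show "compact (inv_into W \<phi> ` cball (\<phi> p) r)" by (rule chart_preimage_compact[OF W(1) K])
    show "inv_into W \<phi> ` cball (\<phi> p) r \<subseteq> U"
    proof
      fix x assume "x \<in> inv_into W \<phi> ` cball (\<phi> p) r"
      then obtain y where "y \<in> W" "y \<in> U" "x = inv_into W \<phi> (\<phi> y)" using r(2) by blast
      then show "x \<in> U" using chart_inv(1)[OF W(1)] by simp
    qed
    show "?f x = 0" if "x \<notin> inv_into W \<phi> ` cball (\<phi> p) r" for x
      by (rule smooth_chart_extension(2)[OF W(1) h K z that])
  qed
qed

text \<open>The chart behind \<open>left_deriv\<close>. Its inverse \<open>xi\<close> serves as a
  local parametrisation of the group, and \<open>og\<close> is the coordinate of the identity, which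
  may differ from 0.\<close>

definition "W0 = fst (id_chart G)"
definition "kap = snd (id_chart G)"
definition "xi = inv_into W0 kap"
definition "og = kap ge"
definition "D0 = kap ` W0"

lemma id_chart: "(W0, kap) \<in> charts G" and ge_W0: "ge \<in> W0"
proof -
  obtain W \<phi> where "(W, \<phi>) \<in> charts G" "ge \<in> W" by (rule chart_at)
  then have "\<exists>c. c \<in> charts G \<and> ge \<in> fst c" by (intro exI[of _ "(W, \<phi>)"]) auto
  from someI_ex[OF this] show "(W0, kap) \<in> charts G" "ge \<in> W0"
    by (auto simp: id_chart_def W0_def kap_def)
qed

lemma open_D0: "open D0" and og_D0: "og \<in> D0" and xi_og [simp]: "xi og = ge"
  and xi_kap: "x \<in> W0 \<Longrightarrow> xi (kap x) = x" and kap_xi: "u \<in> D0 \<Longrightarrow> kap (xi u) = u"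
  and xi_W0: "u \<in> D0 \<Longrightarrow> xi u \<in> W0"
  using chart_open_image[OF id_chart] ge_W0 chart_inv[OF id_chart]
  by (auto simp: D0_def og_def xi_def)

lemma Ck_map_xi: "Ck_map k D0 xi"
  unfolding xi_def D0_def by (rule Ck_map_inv_chart[OF id_chart])

lemma continuous_on_xi: "continuous_on D0 xi"
  by (rule Ck_map_continuous[OF Ck_map_xi])

section \<open>Left-invariant derivatives\<close>

lemma left_deriv_eq: "left_deriv G A f x = frechet_derivative (\<lambda>u. f (x \<cdot> xi u)) (at og) A"
  by (simp add: left_deriv_def xi_def og_def W0_def kap_def case_prod_beta)

lemma translate_domain:
  assumes "open U" "a \<cdot> b \<in> U"
  shows "open {u \<in> D0. a \<cdot> xi u \<cdot> b \<in> U}" "og \<in> {u \<in> D0. a \<cdot> xi u \<cdot> b \<in> U}"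
proof -
  have "continuous_on D0 (\<lambda>u. a \<cdot> xi u \<cdot> b)" by (intro continuous_intros continuous_on_xi)
  from continuous_open_preimage[OF this open_D0 assms(1)]
  show "open {u \<in> D0. a \<cdot> xi u \<cdot> b \<in> U}" by (simp add: vimage_def Int_def)
qed (use assms og_D0 in auto)

text \<open>With \<open>b\<close> the identity this gives left derivatives, with \<open>a\<close>
  the identity right ones.\<close>

lemma Ck_on_translate:
  assumes "Ck_fun_on G k U f" "open U"
  shows "Ck_on k {u \<in> D0. a \<cdot> xi u \<cdot> b \<in> U} (\<lambda>u. f (a \<cdot> xi u \<cdot> b))"
proof -
  have "continuous_on D0 (\<lambda>u. a \<cdot> xi u \<cdot> b)" by (intro continuous_intros continuous_on_xi)
  from continuous_open_preimage[OF this open_D0 assms(2)]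
  have o: "open {u \<in> D0. a \<cdot> xi u \<cdot> b \<in> U}" by (simp add: vimage_def Int_def)
  show ?thesis
    by (rule Ck_fun_on_gmap[OF assms o]) (auto intro!: Ck_map_mul o Ck_map_const Ck_map_subset[OF Ck_map_xi])
qed

lemma has_left_deriv:
  assumes "Ck_fun_on G (Suc k) U f" "open U" "x \<in> U"
  shows "((\<lambda>u. f (x \<cdot> xi u)) has_derivative (\<lambda>A. left_deriv G A f x)) (at og)"
  unfolding left_deriv_eq
  using Ck_on_has_derivative[OF Ck_on_translate[OF assms(1,2), of x ge] translate_domain(2)[OF assms(2)]] assms(3)
  by simp

lemma left_deriv_eqI:
  "((\<lambda>u. f (x \<cdot> xi u)) has_derivative D) (at og) \<Longrightarrow> left_deriv G A f x = D A"
  unfolding left_deriv_eq using frechet_derivative_at by metis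

text \<open>In coordinates the left derivative is the partial derivative, at \<open>og\<close> in
  the second slot, of the jointly C^(k+1) function
  \<open>(w, u) \<mapsto> f (w \<cdot> xi u)\<close>; joint regularity makes it C^k in
  \<open>w\<close>.\<close>

lemma Ck_fun_on_left_deriv:
  assumes f: "Ck_fun_on G (Suc k) U f" and U: "open U"
  shows "Ck_fun_on G k U (left_deriv G A f)"
proof (rule Ck_fun_onI)
  fix W \<phi> assume W: "(W, \<phi>) \<in> charts G"
  let ?F = "\<lambda>z. f (inv_into W \<phi> (fst z) \<cdot> xi (snd z))"
  let ?P = "\<phi> ` (W \<inter> U)"
  have P: "open ?P" by (rule chart_image_open[OF W U])
  have PW: "?P \<subseteq> \<phi> ` W" by auto
  have PD: "open (?P \<times> D0)" by (intro open_Times P open_D0)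
  have g: "Ck_map k (?P \<times> D0) (\<lambda>z. inv_into W \<phi> (fst z) \<cdot> xi (snd z))" for k
    by (intro Ck_map_mul PD Ck_map_compose[OF PD chart_open_image[OF W] Ck_map_inv_chart[OF W] Ck_on_fst[OF PD]]
        Ck_map_compose[OF PD open_D0 Ck_map_xi Ck_on_snd[OF PD]]) auto
  define Q where "Q = (?P \<times> D0) \<inter> (\<lambda>z. inv_into W \<phi> (fst z) \<cdot> xi (snd z)) -` U"
  have Q: "open Q" unfolding Q_def by (rule continuous_open_preimage[OF Ck_map_continuous[OF g] PD U])
  have F: "Ck_on (Suc k) Q ?F"
    by (rule Ck_fun_on_gmap[OF f U Q Ck_map_subset[OF g]]) (auto simp: Q_def)
  have inQ: "(w, og) \<in> Q" if "w \<in> ?P" for w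
    using that og_D0 chart_inv[OF W] by (auto simp: Q_def)
  have "Ck_on k ?P (\<lambda>w. frechet_derivative ?F (at (w, og)) (0, A))"
    by (rule Ck_on_compose[OF P Q _ Ck_on_frechet[OF F]])
      (use inQ in \<open>auto intro!: Ck_on_Pair P Ck_on_id Ck_on_const\<close>)
  then show "Ck_on k ?P (\<lambda>w. left_deriv G A f (inv_into W \<phi> w))"
  proof (rule Ck_on_cong[OF P, rotated])
    fix w assume w: "w \<in> ?P"
    have "((\<lambda>u. ?F (w, u)) has_derivative (\<lambda>v. frechet_derivative ?F (at (w, og)) (0, v))) (at og)"
      by (rule has_derivative_partial_snd[OF Ck_on_has_derivative[OF F inQ[OF w]]])
    from left_deriv_eqI[of f "inv_into W \<phi> w", OF this[simplified]]
    show "frechet_derivative ?F (at (w, og)) (0, A) = left_deriv G A f (inv_into W \<phi> w)" by simp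
  qed
qed

lemma smooth_left_deriv: "smooth_fun_on G U f \<Longrightarrow> open U \<Longrightarrow> smooth_fun_on G U (left_deriv G A f)"
  by (simp add: smooth_fun_on_def Ck_fun_on_left_deriv)

end

section \<open>Integrals depending on a parameter\<close>

context lie_grp
begin

text \<open>Joint smoothness in a Euclidean parameter and a group variable. Keeping the parameter
  Euclidean makes the derivative in it an ordinary Frechet derivative.\<close>

definition param_smooth :: "'c::euclidean_space set \<Rightarrow> ('c \<Rightarrow> 'g \<Rightarrow> real) \<Rightarrow> bool" where
  "param_smooth S K \<longleftrightarrow> (\<forall>(W, \<phi>)\<in>charts G. smooth_on (S \<times> \<phi> ` W) (\<lambda>z. K (fst z) (inv_into W \<phi> (snd z))))"

lemma param_smoothD: "param_smooth S K \<Longrightarrow> (W, \<phi>) \<in> charts G \<Longrightarrow> Ck_on k (S \<times> \<phi> ` W) (\<lambda>z. K (fst z) (inv_into W \<phi> (snd z)))"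
  by (auto simp: param_smooth_def smooth_on_def)

lemma param_smoothI: "(\<And>W \<phi> k. (W, \<phi>) \<in> charts G \<Longrightarrow> Ck_on k (S \<times> \<phi> ` W) (\<lambda>z. K (fst z) (inv_into W \<phi> (snd z)))) \<Longrightarrow> param_smooth S K"
  by (auto simp: param_smooth_def smooth_on_def)

lemma param_smooth_smooth_fun:
  assumes f: "smooth_fun_on G UNIV f" and S: "open S"
    and H: "\<And>W \<phi> k. (W, \<phi>) \<in> charts G \<Longrightarrow> Ck_map k (S \<times> \<phi> ` W) (\<lambda>z. H (fst z) (inv_into W \<phi> (snd z)))"
  shows "param_smooth S (\<lambda>u y. f (H u y))"
  by (rule param_smoothI, rule Ck_fun_on_gmap[OF smooth_fun_onD[OF f]])
    (auto intro: H open_Times S chart_open_image)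

lemma param_smooth_has_derivative:
  assumes "param_smooth S K" "open S" "u \<in> S"
  shows "((\<lambda>u. K u y) has_derivative frechet_derivative (\<lambda>u. K u y) (at u)) (at u)"
proof -
  obtain W \<phi> where W: "(W, \<phi>) \<in> charts G" "y \<in> W" by (rule chart_at)
  have "((\<lambda>z. K (fst z) (inv_into W \<phi> (snd z))) has_derivative
     frechet_derivative (\<lambda>z. K (fst z) (inv_into W \<phi> (snd z))) (at (u, \<phi> y))) (at (u, \<phi> y))"
    by (rule Ck_on_has_derivative[OF param_smoothD[OF assms(1) W(1)]]) (use assms W in auto)
  from has_derivative_partial_fst[OF this] W
  have "(\<lambda>u. K u y) differentiable (at u)" by (auto simp: differentiable_def)
  then show ?thesis by (simp add: frechet_derivative_works)
qed

lemma param_smooth_deriv: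
  assumes K: "param_smooth S K" and S: "open S"
  shows "param_smooth S (\<lambda>u y. frechet_derivative (\<lambda>u. K u y) (at u) v)"
proof (rule param_smoothI)
  fix W \<phi> k assume W: "(W, \<phi>) \<in> charts G"
  let ?F = "\<lambda>z. K (fst z) (inv_into W \<phi> (snd z))"
  have "Ck_on k (S \<times> \<phi> ` W) (\<lambda>z. frechet_derivative ?F (at z) (v, 0))"
    by (rule Ck_on_frechet[OF param_smoothD[OF K W]])
  then show "Ck_on k (S \<times> \<phi> ` W) (\<lambda>z. frechet_derivative (\<lambda>u. K u (inv_into W \<phi> (snd z))) (at (fst z)) v)"
  proof (rule Ck_on_cong[rotated 2])
    show "open (S \<times> \<phi> ` W)" by (intro open_Times S chart_open_image[OF W])
    fix z assume z: "z \<in> S \<times> \<phi> ` W"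
    have "(?F has_derivative frechet_derivative ?F (at z)) (at z)"
      by (rule Ck_on_has_derivative[OF param_smoothD[OF K W] z])
    then have "(?F has_derivative frechet_derivative ?F (at z)) (at (fst z, snd z))" by simp
    from frechet_derivative_at[OF has_derivative_partial_fst[OF this]]
    show "frechet_derivative ?F (at z) (v, 0) = frechet_derivative (\<lambda>u. K u (inv_into W \<phi> (snd z))) (at (fst z)) v"
      by (simp add: fun_eq_iff)
  qed
qed

lemma param_smooth_continuous:
  assumes K: "param_smooth S K" and S: "open S"
  shows "continuous_on (S \<times> UNIV) (\<lambda>z. K (fst z) (snd z))"
proof -
  have "isCont (\<lambda>z. K (fst z) (snd z)) (u, y)" if u: "u \<in> S" for u y
  proof -
    obtain W \<phi> where W: "(W, \<phi>) \<in> charts G" "y \<in> W" by (rule chart_at)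
    have "continuous_on (S \<times> W) (\<lambda>z. (fst z, \<phi> (snd z)))"
      by (intro continuous_intros continuous_on_compose2[OF chart_continuous[OF W(1)]]) auto
    then have "continuous_on (S \<times> W) (\<lambda>z. K (fst (fst z, \<phi> (snd z))) (inv_into W \<phi> (snd (fst z, \<phi> (snd z)))))"
      by (rule continuous_on_compose2[OF Ck_on_imp_continuous_on[OF param_smoothD[OF K W(1)]]]) auto
    then have "continuous_on (S \<times> W) (\<lambda>z. K (fst z) (snd z))"
      by (rule continuous_on_eq) (use W in auto)
    moreover have "open (S \<times> W)" by (intro open_Times S chart_open[OF W(1)])
    moreover have "(u, y) \<in> S \<times> W" using u W by simp
    ultimately show ?thesis using continuous_on_eq_continuous_at by blast
  qed
  then show ?thesis by (auto intro!: continuous_at_imp_continuous_on)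
qed

text \<open>The kernel vanishes off the compact set \<open>C\<close>, so compactness of
  \<open>Q \<times> C\<close> bounds it uniformly in the group variable. This bound dominates the
  integrals below.\<close>

lemma param_smooth_bounded:
  assumes K: "param_smooth S K" and S: "open S" and C: "compact C" and Q: "compact Q" "Q \<subseteq> S"
    and 0: "\<And>u y. u \<in> S \<Longrightarrow> y \<notin> C \<Longrightarrow> K u y = 0"
  obtains M where "M \<ge> 0" "\<And>u y. u \<in> Q \<Longrightarrow> \<bar>K u y\<bar> \<le> M"
proof -
  have "compact ((\<lambda>z. K (fst z) (snd z)) ` (Q \<times> C))"
    by (intro compact_continuous_image compact_Times C Q continuous_on_subset[OF param_smooth_continuous[OF K S]])
      (use Q in auto)
  then obtain M where M: "\<And>z. z \<in> Q \<times> C \<Longrightarrow> \<bar>K (fst z) (snd z)\<bar> \<le> M"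
    using compact_imp_bounded bounded_iff by (metis (no_types, lifting) imageI real_norm_def)
  show thesis
  proof (rule that[of "max M 0"])
    fix u y assume u: "u \<in> Q"
    show "\<bar>K u y\<bar> \<le> max M 0"
    proof (cases "y \<in> C")
      case True
      then show ?thesis using M[of "(u, y)"] u by auto
    next
      case False
      then show ?thesis using 0[of u y] u Q by auto
    qed
  qed simp
qed

end

section \<open>Differentiation under the Haar integral\<close>

locale lie_haar = lie_grp G
  for G :: "('g::{t2_space,second_countable_topology}, 'a::euclidean_space, 'm) lie_group_data_scheme" +
  fixes \<mu> :: "'g measure"
  assumes haar: "haar_measure G \<mu>"
begin

lemma sets_mu [measurable_cong]: "sets \<mu> = sets borel"
  using haar by (simp add: haar_measure_def)

lemma space_mu [simp]: "space \<mu> = UNIV"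
  using sets_eq_imp_space_eq[OF sets_mu] by simp

lemma emeasure_compact: "compact K \<Longrightarrow> emeasure \<mu> K < \<infinity>"
  using haar by (simp add: haar_measure_def)

lemma emeasure_open: "open W \<Longrightarrow> W \<noteq> {} \<Longrightarrow> emeasure \<mu> W > 0"
  using haar by (simp add: haar_measure_def)

lemma borel_measurable_mu: "borel_measurable \<mu> = borel_measurable borel"
  by (rule measurable_cong_sets[OF sets_mu refl])

lemma compact_sets: "compact K \<Longrightarrow> K \<in> sets \<mu>"
  by (simp add: sets_mu borel_closed compact_imp_closed)

lemma integrable_indicator_compact:
  assumes "compact K" shows "integrable \<mu> (indicator K :: 'g \<Rightarrow> real)"
  using assms compact_sets emeasure_compact by (intro integrable_real_indicator) auto

lemma param_integral_measurable:
  assumes K: "param_smooth S K" and S: "open S" and u: "u \<in> S"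
  shows "K u \<in> borel_measurable \<mu>"
proof -
  have "continuous_on UNIV (\<lambda>y. (u, y))" by (intro continuous_intros)
  from continuous_on_compose2[OF param_smooth_continuous[OF K S] this] u
  have "continuous_on UNIV (K u)" by auto
  then show ?thesis unfolding borel_measurable_mu by (rule borel_measurable_continuous_onI)
qed

lemma param_integral_integrable:
  fixes w :: "'g \<Rightarrow> 'b::euclidean_space"
  assumes K: "param_smooth S K" and S: "open S" and C: "compact C"
    and 0: "\<And>u y. u \<in> S \<Longrightarrow> y \<notin> C \<Longrightarrow> K u y = 0" and w: "integrable \<mu> w" and u: "u \<in> S"
  shows "integrable \<mu> (\<lambda>y. K u y *\<^sub>R w y)"
proof -
  obtain M where M: "M \<ge> 0" "\<And>v y. v \<in> {u} \<Longrightarrow> \<bar>K v y\<bar> \<le> M"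
    by (rule param_smooth_bounded[OF K S C _ _ 0, of "{u}"]) (use u in auto)
  show ?thesis
  proof (rule Bochner_Integration.integrable_bound)
    show "integrable \<mu> (\<lambda>y. M *\<^sub>R w y)" using w by simp
    show "(\<lambda>y. K u y *\<^sub>R w y) \<in> borel_measurable \<mu>"
      by (intro borel_measurable_scaleR param_integral_measurable[OF K S u] borel_measurable_integrable[OF w])
    show "AE x in \<mu>. norm (K u x *\<^sub>R w x) \<le> norm (M *\<^sub>R w x)"
      using M by (auto intro!: AE_I2 mult_right_mono)
  qed
qed

lemma param_integral_continuous:
  fixes w :: "'g \<Rightarrow> 'b::euclidean_space"
  assumes K: "param_smooth S K" and S: "open S" and C: "compact C"
    and 0: "\<And>u y. u \<in> S \<Longrightarrow> y \<notin> C \<Longrightarrow> K u y = 0" and w: "integrable \<mu> w"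
  shows "continuous_on S (\<lambda>u. \<integral>y. K u y *\<^sub>R w y \<partial>\<mu>)"
proof -
  have "isCont (\<lambda>u. \<integral>y. K u y *\<^sub>R w y \<partial>\<mu>) u0" if u0: "u0 \<in> S" for u0
  proof -
    obtain r where r: "r > 0" "cball u0 r \<subseteq> S" using S u0 open_contains_cball by blast
    obtain M where M: "M \<ge> 0" "\<And>v y. v \<in> cball u0 r \<Longrightarrow> \<bar>K v y\<bar> \<le> M"
      by (rule param_smooth_bounded[OF K S C _ r(2) 0]) auto
    have "continuous_on (ball u0 r) (\<lambda>u. \<integral>y. K u y *\<^sub>R w y \<partial>\<mu>)"
      unfolding continuous_on_sequentially
    proof (intro allI ballI impI)
      fix X a assume a: "a \<in> ball u0 r" and "(\<forall>n. X n \<in> ball u0 r) \<and> X \<longlonglongrightarrow> a"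
      then have X: "\<And>n. X n \<in> ball u0 r" "X \<longlonglongrightarrow> a" by auto
      have inS: "a \<in> S" "\<And>n. X n \<in> S"
        using a X(1) r(2) ball_subset_cball[of u0 r] by blast+
      have "(\<lambda>n. \<integral>y. K (X n) y *\<^sub>R w y \<partial>\<mu>) \<longlonglongrightarrow> (\<integral>y. K a y *\<^sub>R w y \<partial>\<mu>)"
      proof (rule integral_dominated_convergence[where w="\<lambda>y. norm (M *\<^sub>R w y)"])
        show "(\<lambda>y. K a y *\<^sub>R w y) \<in> borel_measurable \<mu>"
          using param_integral_integrable[OF K S C 0 w inS(1)] by (rule borel_measurable_integrable)
        show "(\<lambda>y. K (X n) y *\<^sub>R w y) \<in> borel_measurable \<mu>" for n
          using param_integral_integrable[OF K S C 0 w inS(2)] by (rule borel_measurable_integrable)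
        show "integrable \<mu> (\<lambda>y. norm (M *\<^sub>R w y))"
          by (intro integrable_norm) (use w in simp)
        show "AE x in \<mu>. (\<lambda>n. K (X n) x *\<^sub>R w x) \<longlonglongrightarrow> K a x *\<^sub>R w x"
        proof (intro AE_I2 tendsto_scaleR tendsto_const)
          fix x
          have "isCont (\<lambda>u. K u x) a"
            by (rule has_derivative_continuous[OF param_smooth_has_derivative[OF K S inS(1)]])
          then show "(\<lambda>n. K (X n) x) \<longlonglongrightarrow> K a x"
            using X(2) by (rule isCont_tendsto_compose)
        qed
        show "AE x in \<mu>. norm (K (X n) x *\<^sub>R w x) \<le> norm (M *\<^sub>R w x)" for n
        proof (rule AE_I2)
          fix x
          have "\<bar>K (X n) x\<bar> \<le> M" using X(1)[of n] M(2) by auto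
          then show "norm (K (X n) x *\<^sub>R w x) \<le> norm (M *\<^sub>R w x)"
            using M(1) by (auto intro: mult_right_mono)
        qed
      qed
      then show "((\<lambda>u. \<integral>y. K u y *\<^sub>R w y \<partial>\<mu>) \<circ> X) \<longlonglongrightarrow> (\<integral>y. K a y *\<^sub>R w y \<partial>\<mu>)" by (simp add: o_def)
    qed
    then show ?thesis using r by (auto simp: continuous_on_eq_continuous_at)
  qed
  then show ?thesis by (simp add: continuous_at_imp_continuous_on)
qed

lemma linear_bound_Basis:
  fixes D :: "'c::euclidean_space \<Rightarrow> real"
  assumes "linear D" "\<And>b. b \<in> Basis \<Longrightarrow> \<bar>D b\<bar> \<le> M"
  shows "\<bar>D v\<bar> \<le> (real DIM('c) * M) * norm v"
proof -
  have "D v = (\<Sum>b\<in>Basis. (v \<bullet> b) * D b)"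
    using linear_sum[OF assms(1), of "\<lambda>b. (v \<bullet> b) *\<^sub>R b" Basis]
    by (simp add: linear_scale[OF assms(1)] euclidean_representation)
  also have "\<bar>\<dots>\<bar> \<le> (\<Sum>b\<in>Basis. \<bar>(v \<bullet> b) * D b\<bar>)" by (rule sum_abs)
  also have "\<dots> \<le> (\<Sum>b\<in>(Basis::'c set). norm v * M)"
    using assms(2) by (intro sum_mono) (auto simp: abs_mult Basis_le_norm intro!: mult_mono)
  finally show ?thesis by (simp add: mult_ac)
qed

text \<open>A bound on the parameter derivatives over a closed ball makes the kernel Lipschitz in
  the parameter, uniformly in \<open>y\<close>. The remainder quotients are then dominated by a
  multiple of \<open>w\<close> and tend to 0 pointwise.\<close>

lemma param_integral_has_derivative:
  fixes w :: "'g \<Rightarrow> 'b::euclidean_space" and K :: "'c::euclidean_space \<Rightarrow> 'g \<Rightarrow> real"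
  assumes K: "param_smooth S K" and S: "open S" and C: "compact C"
    and 0: "\<And>u y. u \<in> S \<Longrightarrow> y \<notin> C \<Longrightarrow> K u y = 0" and w: "integrable \<mu> w" and u0: "u0 \<in> S"
  shows "((\<lambda>u. \<integral>y. K u y *\<^sub>R w y \<partial>\<mu>) has_derivative
     (\<lambda>v. \<integral>y. frechet_derivative (\<lambda>u. K u y) (at u0) v *\<^sub>R w y \<partial>\<mu>)) (at u0)"
proof -
  let ?D = "\<lambda>u v y. frechet_derivative (\<lambda>u. K u y) (at u) v"
  let ?I = "\<lambda>u. \<integral>y. K u y *\<^sub>R w y \<partial>\<mu>"
  let ?L = "\<lambda>v. \<integral>y. ?D u0 v y *\<^sub>R w y \<partial>\<mu>"
  have D0: "?D u v y = 0" if "u \<in> S" "y \<notin> C" for u v y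
  proof -
    have "((\<lambda>u. 0) has_derivative (\<lambda>_. 0)) (at u)" by simp
    then have "((\<lambda>u. K u y) has_derivative (\<lambda>_. 0)) (at u)"
      by (rule has_derivative_transform_within_open[OF _ S that(1)]) (use 0 that in auto)
    from frechet_derivative_at[OF this] show ?thesis by metis
  qed
  have lin: "linear (\<lambda>v. ?D u v y)" if "u \<in> S" for u y
    using param_smooth_has_derivative[OF K S that] has_derivative_linear by blast
  have int: "integrable \<mu> (\<lambda>y. ?D u v y *\<^sub>R w y)" if "u \<in> S" for u v
    by (rule param_integral_integrable[OF param_smooth_deriv[OF K S] S C D0 w that])
  obtain r where r: "r > 0" "cball u0 r \<subseteq> S" using S u0 open_contains_cball by blast
  have "\<exists>M. M \<ge> 0 \<and> (\<forall>u\<in>cball u0 r. \<forall>y. \<bar>?D u v y\<bar> \<le> M)" for v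
    by (rule param_smooth_bounded[OF param_smooth_deriv[OF K S] S C _ r(2) D0, of v]) auto
  then obtain M where M: "\<And>v. M v \<ge> 0" "\<And>v u y. u \<in> cball u0 r \<Longrightarrow> \<bar>?D u v y\<bar> \<le> M v" by metis
  \<comment> \<open>Bounds in the basis directions give an operator bound at the cost of a dimension
    factor.\<close>
  define B where "B = real DIM('c) * (\<Sum>b\<in>Basis. M b)"
  have B: "\<bar>?D u v y\<bar> \<le> B * norm v" if "u \<in> cball u0 r" for u v y
    unfolding B_def
  proof (rule linear_bound_Basis[OF lin])
    show "u \<in> S" using that r by auto
    fix b :: 'c assume b: "b \<in> Basis"
    have "\<bar>?D u b y\<bar> \<le> M b" by (rule M(2)[OF that])
    also have "\<dots> \<le> (\<Sum>b\<in>Basis. M b)" using b M(1) by (intro member_le_sum) auto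
    finally show "\<bar>?D u b y\<bar> \<le> (\<Sum>b\<in>Basis. M b)" .
  qed
  have B0: "B \<ge> 0" unfolding B_def using M(1) by (simp add: sum_nonneg)
  have lip: "\<bar>K u y - K u0 y\<bar> \<le> B * norm (u - u0)" if "u \<in> cball u0 r" for u y
  proof -
    have "norm (K u y - K u0 y) \<le> B * norm (u - u0)"
    proof (rule differentiable_bound[OF convex_cball[of u0 r]])
      fix x assume x: "x \<in> cball u0 r"
      show "((\<lambda>u. K u y) has_derivative (\<lambda>v. ?D x v y)) (at x within cball u0 r)"
        using param_smooth_has_derivative[OF K S] r(2) x by (blast intro: has_derivative_at_withinI)
      show "onorm (\<lambda>v. ?D x v y) \<le> B" by (rule onorm_bound[OF B0]) (use B[OF x] in auto)
    qed (use that r in auto)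
    then show ?thesis by simp
  qed
  have bl: "bounded_linear ?L"
  proof (rule linear_conv_bounded_linear[THEN iffD1], rule linearI)
    fix v v'
    have "?D u0 (v + v') y *\<^sub>R w y = ?D u0 v y *\<^sub>R w y + ?D u0 v' y *\<^sub>R w y" for y
      using linear_add[OF lin[OF u0]] by (simp add: scaleR_left_distrib)
    then show "?L (v + v') = ?L v + ?L v'" by (simp add: Bochner_Integration.integral_add int u0)
  next
    fix c v
    have "?D u0 (c *\<^sub>R v) y *\<^sub>R w y = c *\<^sub>R (?D u0 v y *\<^sub>R w y)" for y
      using linear_scale[OF lin[OF u0]] by simp
    then have "?L (c *\<^sub>R v) = (\<integral>y. c *\<^sub>R (?D u0 v y *\<^sub>R w y) \<partial>\<mu>)" by (simp only:)
    also have "\<dots> = c *\<^sub>R ?L v" by (rule integral_scaleR_right)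
    finally show "?L (c *\<^sub>R v) = c *\<^sub>R ?L v" .
  qed
  have lim: "((\<lambda>u. (?I u - ?I u0 - ?L (u - u0)) /\<^sub>R norm (u - u0)) \<longlongrightarrow> 0) (at u0 within ball u0 r)"
    unfolding tendsto_at_iff_sequentially
  proof (intro allI impI)
    fix X assume X: "\<forall>i. X i \<in> ball u0 r - {u0}" "X \<longlonglongrightarrow> u0"
    then have Xb: "X n \<in> cball u0 r" and Xn: "X n \<noteq> u0" and XS: "X n \<in> S" for n
      using r(2) by (auto simp: subset_iff less_imp_le)
    let ?g = "\<lambda>n y. ((K (X n) y - K u0 y - ?D u0 (X n - u0) y) / norm (X n - u0)) *\<^sub>R w y"
    have gint: "integrable \<mu> (?g n)" and
      geq: "(?I (X n) - ?I u0 - ?L (X n - u0)) /\<^sub>R norm (X n - u0) = (\<integral>y. ?g n y \<partial>\<mu>)" for n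
    proof -
      note i1 = param_integral_integrable[OF K S C 0 w XS[of n]] and i2 = param_integral_integrable[OF K S C 0 w u0]
        and i3 = int[OF u0, of "X n - u0"]
      have e: "?g n = (\<lambda>y. (K (X n) y *\<^sub>R w y - K u0 y *\<^sub>R w y - ?D u0 (X n - u0) y *\<^sub>R w y) /\<^sub>R norm (X n - u0))"
        by (simp add: fun_eq_iff scaleR_left_diff_distrib[symmetric] divide_inverse mult.commute)
      show "integrable \<mu> (?g n)" unfolding e
        by (intro integrable_scaleR_right Bochner_Integration.integrable_diff i1 i2 i3)
      show "(?I (X n) - ?I u0 - ?L (X n - u0)) /\<^sub>R norm (X n - u0) = (\<integral>y. ?g n y \<partial>\<mu>)"
        unfolding e using i1 i2 i3
        by (simp add: Bochner_Integration.integral_diff Bochner_Integration.integrable_diff)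
    qed
    have "(\<lambda>n. \<integral>y. ?g n y \<partial>\<mu>) \<longlonglongrightarrow> (\<integral>y. 0 \<partial>\<mu>)"
    \<comment> \<open>One \<open>B\<close> comes from the Lipschitz bound, the other from the linear
      term of the remainder.\<close>
    proof (rule integral_dominated_convergence[where w="\<lambda>y. norm ((2 * B) *\<^sub>R w y)"])
      show "integrable \<mu> (\<lambda>y. norm ((2 * B) *\<^sub>R w y))"
        by (intro integrable_norm) (use w in simp)
      show "?g n \<in> borel_measurable \<mu>" for n using gint by (rule borel_measurable_integrable)
      show "AE y in \<mu>. (\<lambda>n. ?g n y) \<longlonglongrightarrow> 0"
      proof (rule AE_I2)
        fix y
        have "((\<lambda>u. (K u y - K u0 y - ?D u0 (u - u0) y) /\<^sub>R norm (u - u0)) \<longlongrightarrow> 0) (at u0)"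
          using param_smooth_has_derivative[OF K S u0, of y] by (simp add: has_derivative_def)
        then have "(\<lambda>n. (K (X n) y - K u0 y - ?D u0 (X n - u0) y) /\<^sub>R norm (X n - u0)) \<longlonglongrightarrow> 0"
          using X Xn unfolding tendsto_at_iff_sequentially by (auto simp: o_def)
        then have "(\<lambda>n. ((K (X n) y - K u0 y - ?D u0 (X n - u0) y) /\<^sub>R norm (X n - u0)) *\<^sub>R w y) \<longlonglongrightarrow> 0 *\<^sub>R w y"
          by (intro tendsto_intros)
        then show "(\<lambda>n. ?g n y) \<longlonglongrightarrow> 0" by (simp add: divide_inverse mult.commute)
      qed
      show "AE y in \<mu>. norm (?g n y) \<le> norm ((2 * B) *\<^sub>R w y)" for n
      proof (rule AE_I2)
        fix y
        have "\<bar>K (X n) y - K u0 y - ?D u0 (X n - u0) y\<bar> \<le> B * norm (X n - u0) + B * norm (X n - u0)"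
          using lip[OF Xb, of n y] B[of u0 y "X n - u0"] r by (auto intro: order_trans[OF abs_triangle_ineq4] add_mono)
        then have "\<bar>K (X n) y - K u0 y - ?D u0 (X n - u0) y\<bar> / norm (X n - u0) \<le> 2 * B"
          using Xn[of n] by (simp add: divide_le_eq)
        then have "\<bar>K (X n) y - K u0 y - ?D u0 (X n - u0) y\<bar> / norm (X n - u0) * norm (w y) \<le> 2 * B * norm (w y)"
          by (rule mult_right_mono) simp
        then show "norm (?g n y) \<le> norm ((2 * B) *\<^sub>R w y)" using B0 by simp
      qed
    qed simp
    then show "((\<lambda>u. (?I u - ?I u0 - ?L (u - u0)) /\<^sub>R norm (u - u0)) \<circ> X) \<longlonglongrightarrow> 0"
      by (simp add: o_def geq)
  qed
  have "at u0 within ball u0 r = at u0" by (rule at_within_open) (use r in auto)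
  with lim bl show ?thesis unfolding has_derivative_def by simp
qed

text \<open>The derived kernel is again smooth and supported in \<open>C\<close>, so the induction
  runs over all such kernels.\<close>

lemma param_integral_smooth:
  fixes w :: "'g \<Rightarrow> 'b::euclidean_space"
  assumes "param_smooth S K" and S: "open S" and C: "compact C"
    and "\<And>u y. u \<in> S \<Longrightarrow> y \<notin> C \<Longrightarrow> K u y = 0" and w: "integrable \<mu> w"
  shows "Ck_on k S (\<lambda>u. \<integral>y. K u y *\<^sub>R w y \<partial>\<mu>)"
  using assms(1,4)
proof (induction k arbitrary: K)
  case 0
  then show ?case using param_integral_continuous[OF 0(1) S C 0(2) w] by simp
next
  case (Suc k)
  show ?case
  proof (rule Ck_on_SucI[OF S])
    show "((\<lambda>u. \<integral>y. K u y *\<^sub>R w y \<partial>\<mu>) has_derivative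
      (\<lambda>v. \<integral>y. frechet_derivative (\<lambda>u. K u y) (at u) v *\<^sub>R w y \<partial>\<mu>)) (at u)" if "u \<in> S" for u
      by (rule param_integral_has_derivative[OF Suc.prems(1) S C Suc.prems(2) w that])
    have "frechet_derivative (\<lambda>u. K u y) (at u) v = 0" if "u \<in> S" "y \<notin> C" for u v y
    proof -
      have "((\<lambda>u. 0) has_derivative (\<lambda>_. 0)) (at u)" by simp
      then have "((\<lambda>u. K u y) has_derivative (\<lambda>_. 0)) (at u)"
        by (rule has_derivative_transform_within_open[OF _ S that(1)]) (use Suc.prems(2) that in auto)
      from frechet_derivative_at[OF this] show ?thesis by metis
    qed
    then show "Ck_on k S (\<lambda>u. \<integral>y. frechet_derivative (\<lambda>u. K u y) (at u) v *\<^sub>R w y \<partial>\<mu>)" for v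
      by (intro Suc.IH param_smooth_deriv[OF Suc.prems(1) S])
  qed
qed

section \<open>Left invariance of the integral\<close>

lemma distr_left_translate: "distr \<mu> \<mu> (gmul G h) = \<mu>"
proof (rule measure_eqI)
  fix A assume "A \<in> sets (distr \<mu> \<mu> (gmul G h))"
  then have A: "A \<in> sets borel" by (simp add: sets_mu)
  have m: "gmul G h \<in> measurable \<mu> \<mu>"
    unfolding measurable_cong_sets[OF sets_mu sets_mu]
    by (rule borel_measurable_continuous_onI) (intro continuous_intros)
  have "gmul G h -` A = gmul G (iv h) ` A"
  proof (intro set_eqI iffI)
    fix x assume "x \<in> gmul G h -` A"
    then show "x \<in> gmul G (iv h) ` A" by (intro image_eqI[of _ _ "h \<cdot> x"]) auto
  qed auto
  then show "emeasure (distr \<mu> \<mu> (gmul G h)) A = emeasure \<mu> A"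
    using A haar by (simp add: emeasure_distr[OF m] sets_mu haar_measure_def)
qed simp

lemma integral_left_translate:
  fixes f :: "'g \<Rightarrow> 'b::{banach,second_countable_topology}"
  assumes "f \<in> borel_measurable borel"
  shows "(\<integral>x. f (h \<cdot> x) \<partial>\<mu>) = (\<integral>x. f x \<partial>\<mu>)"
proof -
  have m: "gmul G h \<in> measurable \<mu> \<mu>"
    unfolding measurable_cong_sets[OF sets_mu sets_mu]
    by (rule borel_measurable_continuous_onI) (intro continuous_intros)
  have "(\<integral>x. f x \<partial>\<mu>) = (\<integral>x. f x \<partial>distr \<mu> \<mu> (gmul G h))" by (simp only: distr_left_translate)
  also have "\<dots> = (\<integral>x. f (h \<cdot> x) \<partial>\<mu>)"
    by (rule integral_distr[OF m]) (simp add: borel_measurable_mu assms)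
  finally show ?thesis ..
qed

end

section \<open>The Lie bracket and the adjoint representation\<close>

text \<open>A product rule in which both the base point and the direction move. Differentiability is
  available for each fixed direction of \<open>F\<close>, hence the expansion of \<open>E u\<close>
  in the basis.\<close>

lemma has_derivative_frechet_apply:
  fixes F :: "'a::euclidean_space \<Rightarrow> 'b::real_normed_vector" and E :: "'a \<Rightarrow> 'a"
  assumes F: "Ck_on 2 S F" and S: "open S" "p \<in> S" and E: "(E has_derivative E') (at p)"
  shows "((\<lambda>u. frechet_derivative F (at u) (E u)) has_derivative
    (\<lambda>A. frechet_derivative (\<lambda>u. frechet_derivative F (at u) (E p)) (at p) A
       + frechet_derivative F (at p) (E' A))) (at p)"
proof -
  have F2: "Ck_on (Suc (Suc 0)) S F" using F by (simp add: numeral_2_eq_2)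
  have F1: "Ck_on (Suc 0) S (\<lambda>u. frechet_derivative F (at u) b)" for b by (rule Ck_on_frechet[OF F2])
  have lin: "linear (frechet_derivative F (at u))" if "u \<in> S" for u
    using Ck_on_has_derivative[OF F2 that] has_derivative_linear by blast
  have ex: "(\<Sum>b\<in>Basis. (w \<bullet> b) *\<^sub>R frechet_derivative F (at u) b) = frechet_derivative F (at u) w"
    if "u \<in> S" for u w
    using linear_sum[OF lin[OF that], of "\<lambda>b. (w \<bullet> b) *\<^sub>R b" Basis]
    by (simp add: linear_scale[OF lin[OF that]] euclidean_representation)
  let ?Q' = "\<lambda>b. frechet_derivative (\<lambda>u. frechet_derivative F (at u) b) (at p)"
  have Q: "((\<lambda>u. frechet_derivative F (at u) b) has_derivative ?Q' b) (at p)" for b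
    by (rule Ck_on_has_derivative[OF F1 S(2)])
  have E_inner: "((\<lambda>u. E u \<bullet> b) has_derivative (\<lambda>A. E' A \<bullet> b)) (at p)" for b
    by (rule has_derivative_inner_left[OF E])
  have "((\<lambda>u. (E u \<bullet> b) *\<^sub>R frechet_derivative F (at u) b) has_derivative
     (\<lambda>A. (E p \<bullet> b) *\<^sub>R ?Q' b A + (E' A \<bullet> b) *\<^sub>R frechet_derivative F (at p) b)) (at p)" for b
    by (rule has_derivative_scaleR[OF E_inner Q])
  then have "((\<lambda>u. \<Sum>b\<in>Basis. (E u \<bullet> b) *\<^sub>R frechet_derivative F (at u) b) has_derivative
     (\<lambda>A. \<Sum>b\<in>Basis. (E p \<bullet> b) *\<^sub>R ?Q' b A + (E' A \<bullet> b) *\<^sub>R frechet_derivative F (at p) b)) (at p)"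
    by (rule has_derivative_sum)
  then have 1: "((\<lambda>u. frechet_derivative F (at u) (E u)) has_derivative
     (\<lambda>A. \<Sum>b\<in>Basis. (E p \<bullet> b) *\<^sub>R ?Q' b A + (E' A \<bullet> b) *\<^sub>R frechet_derivative F (at p) b)) (at p)"
    by (rule has_derivative_transform_within_open[OF _ S]) (rule ex)
  have "((\<lambda>u. \<Sum>b\<in>Basis. (E p \<bullet> b) *\<^sub>R frechet_derivative F (at u) b) has_derivative
     (\<lambda>A. \<Sum>b\<in>Basis. (E p \<bullet> b) *\<^sub>R ?Q' b A)) (at p)"
    by (intro has_derivative_sum has_derivative_scaleR_right Q)
  then have 3: "((\<lambda>u. frechet_derivative F (at u) (E p)) has_derivative
     (\<lambda>A. \<Sum>b\<in>Basis. (E p \<bullet> b) *\<^sub>R ?Q' b A)) (at p)"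
    by (rule has_derivative_transform_within_open[OF _ S]) (rule ex)
  have 2: "frechet_derivative (\<lambda>u. frechet_derivative F (at u) (E p)) (at p) A = (\<Sum>b\<in>Basis. (E p \<bullet> b) *\<^sub>R ?Q' b A)" for A
    by (rule fun_cong[OF frechet_derivative_at[OF 3], symmetric])
  show ?thesis
    using 1 unfolding 2 sum.distrib ex[OF S(2)] .
qed

context lie_grp
begin

lemma kap_ge [simp]: "kap ge = og"
  by (simp add: og_def)

lemma has_left_deriv_smooth:
  assumes "smooth_fun_on G UNIV f"
  shows "((\<lambda>u. f (x \<cdot> xi u)) has_derivative (\<lambda>A. left_deriv G A f x)) (at og)"
  using has_left_deriv[OF smooth_fun_onD[OF assms] open_UNIV] by simp

lemma left_deriv_linear: "smooth_fun_on G UNIV f \<Longrightarrow> linear (\<lambda>A. left_deriv G A f x)"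
  using has_left_deriv_smooth has_derivative_linear by blast

lemma left_deriv_diff:
  assumes "smooth_fun_on G UNIV f" "smooth_fun_on G UNIV g"
  shows "left_deriv G A (\<lambda>x. f x - g x) x = left_deriv G A f x - left_deriv G A g x"
  by (rule left_deriv_eqI) (intro has_derivative_diff has_left_deriv_smooth assms)

text \<open>The derivative along a right-invariant field. Such fields generate left translations, so
  a left-invariant integral annihilates these derivatives of compactly supported functions.\<close>

definition right_deriv :: "'a \<Rightarrow> ('g \<Rightarrow> 'b::real_normed_vector) \<Rightarrow> 'g \<Rightarrow> 'b" where
  "right_deriv A f x = frechet_derivative (\<lambda>u. f (xi u \<cdot> x)) (at og) A"

lemma has_right_deriv_smooth:
  assumes "smooth_fun_on G UNIV f"
  shows "((\<lambda>u. f (xi u \<cdot> x)) has_derivative (\<lambda>A. right_deriv A f x)) (at og)"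
  unfolding right_deriv_def
  using Ck_on_has_derivative[OF Ck_on_translate[OF smooth_fun_onD[OF assms] open_UNIV, of "Suc 0" ge x]] og_D0
  by simp

lemma right_deriv_eqI:
  "((\<lambda>u. f (xi u \<cdot> x)) has_derivative D) (at og) \<Longrightarrow> right_deriv A f x = D A"
  unfolding right_deriv_def using frechet_derivative_at by metis

text \<open>The multiplication read in the identity chart, with open domain \<open>MM\<close>. Its
  second derivative at \<open>(og, og)\<close> determines the bracket.\<close>

definition "mm z = kap (xi (fst z) \<cdot> xi (snd z))"
definition "MM = (D0 \<times> D0) \<inter> (\<lambda>z. xi (fst z) \<cdot> xi (snd z)) -` W0"

lemma open_D0D0: "open (D0 \<times> D0)" by (intro open_Times open_D0)

lemma Ck_map_xi_fst: "Ck_map k (D0 \<times> D0) (\<lambda>z. xi (fst z))"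
  by (rule Ck_map_compose[OF open_D0D0 open_D0 Ck_map_xi Ck_on_fst[OF open_D0D0]]) auto

lemma Ck_map_xi_snd: "Ck_map k (D0 \<times> D0) (\<lambda>z. xi (snd z))"
  by (rule Ck_map_compose[OF open_D0D0 open_D0 Ck_map_xi Ck_on_snd[OF open_D0D0]]) auto

lemma open_MM: "open MM"
  unfolding MM_def
  by (rule continuous_open_preimage[OF Ck_map_continuous[OF Ck_map_mul[OF open_D0D0 Ck_map_xi_fst Ck_map_xi_snd]]
    open_D0D0 chart_open[OF id_chart]])

lemma Ck_on_mm: "Ck_on k MM mm"
  using Ck_map_chart[OF Ck_map_mul[OF open_D0D0 Ck_map_xi_fst Ck_map_xi_snd] id_chart]
  unfolding MM_def mm_def .

lemma mm_og: "u \<in> D0 \<Longrightarrow> mm (u, og) = u" "u \<in> D0 \<Longrightarrow> mm (og, u) = u"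
  by (simp_all add: mm_def kap_xi)

lemma MM_og: "u \<in> D0 \<Longrightarrow> (u, og) \<in> MM" "u \<in> D0 \<Longrightarrow> (og, u) \<in> MM"
  using og_D0 by (auto simp: MM_def xi_W0)

definition "DM z = frechet_derivative mm (at z)"

lemma has_DM: "z \<in> MM \<Longrightarrow> (mm has_derivative DM z) (at z)"
  unfolding DM_def by (rule Ck_on_has_derivative[OF Ck_on_mm])

lemma DM_og: "DM (og, og) (A, 0) = A" "DM (og, og) (0, A) = A"
proof -
  have i: "((\<lambda>u. u) has_derivative (\<lambda>v. v)) (at og)" by simp
  have "((\<lambda>u. mm (u, og)) has_derivative (\<lambda>v. v)) (at og)"
    by (rule has_derivative_transform_within_open[OF i open_D0 og_D0]) (simp add: mm_og)
  with has_derivative_partial_fst[OF has_DM[OF MM_og(1)[OF og_D0]]]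
  show "DM (og, og) (A, 0) = A" using has_derivative_unique by metis
  have "((\<lambda>u. mm (og, u)) has_derivative (\<lambda>v. v)) (at og)"
    by (rule has_derivative_transform_within_open[OF i open_D0 og_D0]) (simp add: mm_og)
  with has_derivative_partial_snd[OF has_DM[OF MM_og(1)[OF og_D0]]]
  show "DM (og, og) (0, A) = A" using has_derivative_unique by metis
qed

text \<open>The mixed second derivative of the multiplication; the Lie bracket is its
  antisymmetrisation.\<close>

definition "Gam A B = frechet_derivative (\<lambda>z. DM z (0, B)) (at (og, og)) (A, 0)"

lemma has_DM_apply:
  "((\<lambda>z. DM z V) has_derivative frechet_derivative (\<lambda>z. DM z V) (at (og, og))) (at (og, og))"
  unfolding DM_def by (rule Ck_on_has_derivative[OF Ck_on_frechet[OF Ck_on_mm] MM_og(1)[OF og_D0]])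

lemma has_Gam: "((\<lambda>u. DM (u, og) (0, B)) has_derivative (\<lambda>A. Gam A B)) (at og)"
  unfolding Gam_def by (rule has_derivative_partial_fst[OF has_DM_apply])

lemma Gam_linear_left: "linear (\<lambda>A. Gam A B)"
  using has_Gam has_derivative_linear by blast

text \<open>\<open>B\<close> enters \<open>Gam\<close> as a fixed direction and not as the variable
  of differentiation, so linearity in it is obtained by differentiating the linearity of
  \<open>DM\<close>.\<close>

lemma Gam_linear_right: "linear (Gam A)"
proof (rule linearI)
  have lin: "linear (DM (u, og))" if "u \<in> D0" for u
    using has_DM[OF MM_og(1)[OF that]] has_derivative_linear by blast
  fix B B'
  have "((\<lambda>u. DM (u, og) (0, B) + DM (u, og) (0, B')) has_derivative (\<lambda>A. Gam A B + Gam A B')) (at og)"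
    by (intro has_derivative_add has_Gam)
  then have "((\<lambda>u. DM (u, og) (0, B + B')) has_derivative (\<lambda>A. Gam A B + Gam A B')) (at og)"
    by (rule has_derivative_transform_within_open[OF _ open_D0 og_D0]) (use linear_add[OF lin, of _ "(0, B)" "(0, B')"] in simp)
  from fun_cong[OF has_derivative_unique[OF has_Gam this]]
  show "Gam A (B + B') = Gam A B + Gam A B'" .
next
  have lin: "linear (DM (u, og))" if "u \<in> D0" for u
    using has_DM[OF MM_og(1)[OF that]] has_derivative_linear by blast
  fix c B
  have "((\<lambda>u. c *\<^sub>R DM (u, og) (0, B)) has_derivative (\<lambda>A. c *\<^sub>R Gam A B)) (at og)"
    by (intro has_derivative_scaleR_right has_Gam)
  then have "((\<lambda>u. DM (u, og) (0, c *\<^sub>R B)) has_derivative (\<lambda>A. c *\<^sub>R Gam A B)) (at og)"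
    by (rule has_derivative_transform_within_open[OF _ open_D0 og_D0]) (use linear_scale[OF lin, of _ c "(0, B)"] in simp)
  from fun_cong[OF has_derivative_unique[OF has_Gam this]]
  show "Gam A (c *\<^sub>R B) = c *\<^sub>R Gam A B" .
qed

text \<open>In coordinates, \<open>A\<close> applied after \<open>B\<close> gives the Hessian in
  \<open>A\<close> and \<open>B\<close> plus the gradient on \<open>Gam A B\<close>. The Hessian is
  symmetric and drops out of the commutator.\<close>

lemma left_deriv_commutator:
  fixes f :: "'g \<Rightarrow> 'b::euclidean_space"
  assumes f: "smooth_fun_on G UNIV f"
  shows "left_deriv G A (left_deriv G B f) x - left_deriv G B (left_deriv G A f) x
     = left_deriv G (Gam A B - Gam B A) f x"
proof -
  define F where "F = (\<lambda>w. f (x \<cdot> xi w))"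
  have F: "Ck_on k D0 F" for k
    using Ck_on_translate[OF smooth_fun_onD[OF f] open_UNIV, of k x ge] by (simp add: F_def)
  have F1: "left_deriv G C f x = frechet_derivative F (at og) C" for C
    by (simp add: left_deriv_eq F_def)
  \<comment> \<open>By associativity the left-invariant field of \<open>C\<close> has coordinates
    \<open>DM (u, og) (0, C)\<close> at the point with coordinate \<open>u\<close>.\<close>
  have near: "left_deriv G C f (x \<cdot> xi u) = frechet_derivative F (at u) (DM (u, og) (0, C))" if u: "u \<in> D0" for u C
  proof (rule left_deriv_eqI)
    have 1: "((\<lambda>v. mm (u, v)) has_derivative (\<lambda>v. DM (u, og) (0, v))) (at og)"
      by (rule has_derivative_partial_snd[OF has_DM[OF MM_og(1)[OF u]]])
    have "(F has_derivative frechet_derivative F (at (mm (u, og)))) (at (mm (u, og)))"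
      using Ck_on_has_derivative[OF F u] mm_og(1)[OF u] by simp
    from diff_chain_at[OF 1 this]
    have "((\<lambda>v. F (mm (u, v))) has_derivative (\<lambda>v. frechet_derivative F (at u) (DM (u, og) (0, v)))) (at og)"
      by (simp add: o_def mm_og(1)[OF u])
    then show "((\<lambda>v. f (x \<cdot> xi u \<cdot> xi v)) has_derivative (\<lambda>v. frechet_derivative F (at u) (DM (u, og) (0, v)))) (at og)"
    proof (rule has_derivative_transform_within_open[of _ _ _ _ "{v. (u, v) \<in> MM}"])
      have "open (Pair u -` MM)" by (rule open_vimage[OF open_MM]) (intro continuous_intros)
      then show "open {v. (u, v) \<in> MM}" by (simp add: vimage_def)
      show "og \<in> {v. (u, v) \<in> MM}" using MM_og(1)[OF u] by simp
      fix v assume "v \<in> {v. (u, v) \<in> MM}"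
      then have "xi u \<cdot> xi v \<in> W0" by (simp add: MM_def)
      then show "F (mm (u, v)) = f (x \<cdot> xi u \<cdot> xi v)" by (simp add: F_def mm_def xi_kap grp.assoc)
    qed
  qed
  have second: "left_deriv G C (left_deriv G E f) x =
     frechet_derivative (\<lambda>u. frechet_derivative F (at u) E) (at og) C + frechet_derivative F (at og) (Gam C E)" for C E
  proof (rule left_deriv_eqI)
    have "((\<lambda>u. frechet_derivative F (at u) (DM (u, og) (0, E))) has_derivative
      (\<lambda>C. frechet_derivative (\<lambda>u. frechet_derivative F (at u) (DM (og, og) (0, E))) (at og) C
         + frechet_derivative F (at og) (Gam C E))) (at og)"
      by (rule has_derivative_frechet_apply[OF F open_D0 og_D0 has_Gam])
    then show "((\<lambda>u. left_deriv G E f (x \<cdot> xi u)) has_derivative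
      (\<lambda>C. frechet_derivative (\<lambda>u. frechet_derivative F (at u) E) (at og) C
         + frechet_derivative F (at og) (Gam C E))) (at og)"
      unfolding DM_og
      by (rule has_derivative_transform_within_open[OF _ open_D0 og_D0]) (simp add: near)
  qed
  have "linear (frechet_derivative F (at og))"
    using Ck_on_has_derivative[OF F og_D0] has_derivative_linear by blast
  from linear_diff[OF this, of "Gam A B" "Gam B A"]
  show ?thesis unfolding second F1 using second_derivative_symmetric[OF F open_D0 og_D0, of A B] by simp
qed

text \<open>A coordinate function cut off by a bump has, as derivative along a vector, a fixed
  positive multiple of that coordinate of the vector.\<close>

lemma left_deriv_separates:
  assumes "\<And>f :: 'g \<Rightarrow> real. smooth_fun_on G UNIV f \<Longrightarrow> left_deriv G C f ge = left_deriv G C' f ge"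
  shows "C = C'"
proof (rule euclidean_eqI)
  fix b :: 'a assume "b \<in> Basis"
  obtain r where r: "r > 0" "cball og r \<subseteq> D0" using open_D0 og_D0 open_contains_cball by blast
  define h where "h = (\<lambda>u. euclid_bump og r u * ((u - og) \<bullet> b))"
  have h: "Ck_on k UNIV h" for k unfolding h_def
    by (intro Ck_on_mult Ck_on_inner Ck_on_diff Ck_on_id Ck_on_const open_UNIV smooth_onD[OF smooth_on_euclid_bump])
  have hz: "h u = 0" if "u \<notin> cball og r" for u
    using that r euclid_bump_zero[of r u og] by (auto simp: h_def)
  define f where "f = (\<lambda>x. if x \<in> W0 then h (kap x) else 0)"
  have f: "smooth_fun_on G UNIV f" unfolding f_def
  proof (rule smooth_chart_extension(1)[OF id_chart])
    show "smooth_on (kap ` W0) h" unfolding smooth_on_def using h Ck_on_subset by blast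
    show "compact (cball og r)" by simp
    show "cball og r \<subseteq> kap ` W0" using r by (simp add: D0_def)
  qed (rule hz)
  have hd: "(h has_derivative (\<lambda>v. euclid_bump og r og * (v \<bullet> b))) (at og)"
  proof -
    have "(euclid_bump og r has_derivative frechet_derivative (euclid_bump og r) (at og)) (at og)"
      by (rule Ck_on_has_derivative[OF smooth_onD[OF smooth_on_euclid_bump]]) simp
    moreover have "((\<lambda>u. (u - og) \<bullet> b) has_derivative (\<lambda>v. v \<bullet> b)) (at og)"
      by (auto intro!: derivative_eq_intros)
    ultimately show ?thesis unfolding h_def using has_derivative_mult by fastforce
  qed
  have "left_deriv G A f ge = euclid_bump og r og * (A \<bullet> b)" for A
  proof (rule left_deriv_eqI)
    show "((\<lambda>u. f (ge \<cdot> xi u)) has_derivative (\<lambda>v. euclid_bump og r og * (v \<bullet> b))) (at og)"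
      by (rule has_derivative_transform_within_open[OF hd open_D0 og_D0]) (simp add: f_def xi_W0 kap_xi)
  qed
  with assms[OF f] euclid_bump_pos[OF r(1), of og] show "C \<bullet> b = C' \<bullet> b" by simp
qed

text \<open>The commutator formula gives existence, and separation by functions uniqueness, for the
  definite description.\<close>

lemma lie_bracket_eq: "lie_bracket G A B = Gam A B - Gam B A"
  unfolding lie_bracket_def
proof (rule the_equality)
  show "\<forall>f :: 'g \<Rightarrow> real. smooth_fun_on G UNIV f \<longrightarrow> (\<forall>x. left_deriv G (Gam A B - Gam B A) f x =
        left_deriv G A (left_deriv G B f) x - left_deriv G B (left_deriv G A f) x)"
    by (simp add: left_deriv_commutator)
  fix C assume C: "\<forall>f :: 'g \<Rightarrow> real. smooth_fun_on G UNIV f \<longrightarrow> (\<forall>x. left_deriv G C f x =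
        left_deriv G A (left_deriv G B f) x - left_deriv G B (left_deriv G A f) x)"
  show "C = Gam A B - Gam B A"
    by (rule left_deriv_separates) (simp add: C left_deriv_commutator)
qed

lemma lie_bracket_linear_left: "linear (\<lambda>A. lie_bracket G A B)"
  unfolding lie_bracket_eq by (intro linear_compose_sub Gam_linear_left Gam_linear_right)

lemma lie_bracket_linear_right: "linear (lie_bracket G A)"
  using linear_compose_sub[OF Gam_linear_right Gam_linear_left, of A A]
  by (simp add: lie_bracket_eq[abs_def])

lemma lie_bracket_antisym: "lie_bracket G A B = - lie_bracket G B A"
  by (simp add: lie_bracket_eq)

lemma left_deriv_lie_bracket:
  fixes f :: "'g \<Rightarrow> 'b::euclidean_space"
  shows "smooth_fun_on G UNIV f \<Longrightarrow> left_deriv G (lie_bracket G A B) f x =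
     left_deriv G A (left_deriv G B f) x - left_deriv G B (left_deriv G A f) x"
  by (simp add: lie_bracket_eq left_deriv_commutator)

text \<open>For commutators of operators the identity is formal; separation by functions carries it
  back to vectors.\<close>

lemma jacobi:
  "lie_bracket G (lie_bracket G A B) C =
   lie_bracket G A (lie_bracket G B C) - lie_bracket G B (lie_bracket G A C)"
proof (rule left_deriv_separates)
  fix f :: "'g \<Rightarrow> real" assume f: "smooth_fun_on G UNIV f"
  note s = smooth_left_deriv[OF _ open_UNIV]
  let ?L = "\<lambda>A f. left_deriv G A f"
  have br: "?L (lie_bracket G A B) h = (\<lambda>x. ?L A (?L B h) x - ?L B (?L A h) x)" if "smooth_fun_on G UNIV h"
    for A B and h :: "'g \<Rightarrow> real"
    using left_deriv_lie_bracket[OF that] by (simp add: fun_eq_iff)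
  have d: "?L A (\<lambda>x. ?L B (?L C f) x - ?L C (?L B f) x) x =
      ?L A (?L B (?L C f)) x - ?L A (?L C (?L B f)) x" for A B C x
    by (rule left_deriv_diff) (intro s f)+
  have "?L (lie_bracket G A (lie_bracket G B C) - lie_bracket G B (lie_bracket G A C)) f ge =
     ?L (lie_bracket G A (lie_bracket G B C)) f ge - ?L (lie_bracket G B (lie_bracket G A C)) f ge"
    by (rule linear_diff[OF left_deriv_linear[OF f]])
  then show "?L (lie_bracket G (lie_bracket G A B) C) f ge =
    ?L (lie_bracket G A (lie_bracket G B C) - lie_bracket G B (lie_bracket G A C)) f ge"
    by (simp add: br s f d)
qed

section \<open>The adjoint representation\<close>

definition "Ad x B = frechet_derivative (\<lambda>u. kap (x \<cdot> xi u \<cdot> iv x)) (at og) B"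

lemma conj_domain: "open {u \<in> D0. x \<cdot> xi u \<cdot> iv x \<in> W0}" "og \<in> {u \<in> D0. x \<cdot> xi u \<cdot> iv x \<in> W0}"
  using translate_domain[OF chart_open[OF id_chart], of x "iv x"] ge_W0 by simp_all

lemma has_Ad: "((\<lambda>u. kap (x \<cdot> xi u \<cdot> iv x)) has_derivative Ad x) (at og)"
proof -
  have "Ck_map (Suc 0) D0 (\<lambda>u. x \<cdot> xi u \<cdot> iv x)"
    by (intro Ck_map_mul Ck_map_const Ck_map_xi open_D0)
  from Ck_on_has_derivative[OF Ck_map_chart[OF this id_chart], of og]
  show ?thesis unfolding Ad_def using og_D0 ge_W0 by simp
qed

lemma Ad_ge: "Ad ge B = B"
proof -
  have "((\<lambda>u. kap (ge \<cdot> xi u \<cdot> iv ge)) has_derivative (\<lambda>v. v)) (at og)"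
    by (rule has_derivative_transform_within_open[OF has_derivative_ident open_D0 og_D0]) (simp add: kap_xi grp.inverse_neutral)
  then show ?thesis using has_derivative_unique[OF has_Ad] by metis
qed

lemma Ad_mult: "Ad (y \<cdot> x) B = Ad y (Ad x B)"
proof -
  have og: "kap (x \<cdot> xi og \<cdot> iv x) = og" by simp
  have "((\<lambda>v. kap (y \<cdot> xi v \<cdot> iv y)) \<circ> (\<lambda>u. kap (x \<cdot> xi u \<cdot> iv x)) has_derivative Ad y \<circ> Ad x) (at og)"
    by (rule diff_chain_at[OF has_Ad]) (use has_Ad og in simp)
  then have "((\<lambda>u. kap ((y \<cdot> x) \<cdot> xi u \<cdot> iv (y \<cdot> x))) has_derivative Ad y \<circ> Ad x) (at og)"
    by (rule has_derivative_transform_within_open[OF _ conj_domain[of x]])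
      (simp add: xi_kap grp.inverse_distrib_swap grp.assoc)
  then show ?thesis using has_derivative_unique[OF has_Ad] by (metis comp_apply)
qed

text \<open>From \<open>x \<cdot> xi u = (x \<cdot> xi u \<cdot> iv x) \<cdot> x\<close>: moving on
  the right of \<open>x\<close> is moving on its left by the conjugate.\<close>

lemma left_deriv_right_deriv:
  assumes f: "smooth_fun_on G UNIV f"
  shows "left_deriv G B f x = right_deriv (Ad x B) f x"
proof -
  have og: "kap (x \<cdot> xi og \<cdot> iv x) = og" by simp
  have "((\<lambda>v. f (xi v \<cdot> x)) \<circ> (\<lambda>u. kap (x \<cdot> xi u \<cdot> iv x)) has_derivative
     (\<lambda>A. right_deriv A f x) \<circ> Ad x) (at og)"
    by (rule diff_chain_at[OF has_Ad]) (use has_right_deriv_smooth[OF f] og in simp)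
  then have "((\<lambda>u. f (x \<cdot> xi u)) has_derivative (\<lambda>A. right_deriv A f x) \<circ> Ad x) (at og)"
    by (rule has_derivative_transform_within_open[OF _ conj_domain[of x]]) (simp add: xi_kap)
  from left_deriv_eqI[OF this] show ?thesis by simp
qed

lemma Ck_fun_on_Ad: "Ck_fun_on G k UNIV (\<lambda>x. Ad x B)"
proof (rule Ck_fun_onI)
  fix W \<phi> assume W: "(W, \<phi>) \<in> charts G"
  let ?P = "\<phi> ` W"
  let ?H = "\<lambda>z. inv_into W \<phi> (fst z) \<cdot> xi (snd z) \<cdot> iv (inv_into W \<phi> (fst z))"
  let ?F = "\<lambda>z. kap (?H z)"
  have P: "open ?P" by (rule chart_open_image[OF W])
  have PD: "open (?P \<times> D0)" by (intro open_Times P open_D0)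
  have g: "Ck_map k (?P \<times> D0) ?H" for k
    by (intro Ck_map_mul Ck_map_iv PD Ck_map_compose[OF PD P Ck_map_inv_chart[OF W] Ck_on_fst[OF PD]]
        Ck_map_compose[OF PD open_D0 Ck_map_xi Ck_on_snd[OF PD]]) auto
  define Q where "Q = (?P \<times> D0) \<inter> ?H -` W0"
  have Q: "open Q" unfolding Q_def
    by (rule continuous_open_preimage[OF Ck_map_continuous[OF g] PD chart_open[OF id_chart]])
  have F: "Ck_on (Suc k) Q ?F" unfolding Q_def by (rule Ck_map_chart[OF g id_chart])
  have inQ: "(w, og) \<in> Q" if "w \<in> ?P" for w
    using that og_D0 ge_W0 by (auto simp: Q_def)
  have "Ck_on k ?P (\<lambda>w. frechet_derivative ?F (at (w, og)) (0, B))"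
    by (rule Ck_on_compose[OF P Q _ Ck_on_frechet[OF F]])
      (use inQ in \<open>auto intro!: Ck_on_Pair P Ck_on_id Ck_on_const\<close>)
  then have "Ck_on k ?P (\<lambda>w. Ad (inv_into W \<phi> w) B)"
  proof (rule Ck_on_cong[OF P, rotated])
    fix w assume w: "w \<in> ?P"
    have "((\<lambda>u. ?F (w, u)) has_derivative (\<lambda>v. frechet_derivative ?F (at (w, og)) (0, v))) (at og)"
      by (rule has_derivative_partial_snd[OF Ck_on_has_derivative[OF F inQ[OF w]]])
    then have "Ad (inv_into W \<phi> w) = (\<lambda>v. frechet_derivative ?F (at (w, og)) (0, v))"
      using has_derivative_unique[OF has_Ad] by simp
    then show "frechet_derivative ?F (at (w, og)) (0, B) = Ad (inv_into W \<phi> w) B" by simp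
  qed
  then show "Ck_on k (\<phi> ` (W \<inter> UNIV)) (\<lambda>w. Ad (inv_into W \<phi> w) B)" by simp
qed

text \<open>The identity \<open>v u = (v u v\<^sup>-\<^sup>1) v\<close> in coordinates,
  differentiated in \<open>u\<close>. One more derivative, in \<open>v\<close>, yields the
  derivative of \<open>Ad\<close>.\<close>

lemma DM_Ad: assumes v: "v \<in> D0" shows "DM (og, v) (Ad (xi v) B, 0) = DM (v, og) (0, B)"
proof -
  let ?c = "\<lambda>u. kap (xi v \<cdot> xi u \<cdot> iv (xi v))"
  have c0: "?c og = og" by simp
  have "((\<lambda>u. (?c u, v)) has_derivative (\<lambda>B. (Ad (xi v) B, 0))) (at og)"
    by (intro has_derivative_Pair has_Ad has_derivative_const)
  from diff_chain_at[OF this, of mm "DM (og, v)"] has_DM[OF MM_og(2)[OF v]]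
  have 1: "((\<lambda>u. mm (?c u, v)) has_derivative (\<lambda>B. DM (og, v) (Ad (xi v) B, 0))) (at og)"
    by (simp add: o_def c0)
  have "((\<lambda>u. mm (v, u)) has_derivative (\<lambda>B. DM (v, og) (0, B))) (at og)"
    by (rule has_derivative_partial_snd[OF has_DM[OF MM_og(1)[OF v]]])
  then have "((\<lambda>u. mm (?c u, v)) has_derivative (\<lambda>B. DM (v, og) (0, B))) (at og)"
    by (rule has_derivative_transform_within_open[OF _ conj_domain[of "xi v"]])
      (simp add: mm_def xi_kap)
  from has_derivative_unique[OF 1 this] show ?thesis by metis
qed

text \<open>When \<open>DM_Ad\<close> is differentiated at \<open>og\<close>, one side contributes
  \<open>Gam B A\<close> and the derivative of \<open>Ad\<close>, the other \<open>Gam A B\<close>;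
  the difference is the bracket.\<close>

lemma has_derivative_Ad_xi: "((\<lambda>v. Ad (xi v) B) has_derivative (\<lambda>A. lie_bracket G A B)) (at og)"
proof -
  have Adx: "Ck_on (Suc 0) D0 (\<lambda>v. Ad (xi v) B)"
    by (rule Ck_fun_on_gmap[OF Ck_fun_on_Ad open_UNIV open_D0 Ck_map_xi]) simp
  define Ad' where "Ad' = frechet_derivative (\<lambda>v. Ad (xi v) B) (at og)"
  have Ad': "((\<lambda>v. Ad (xi v) B) has_derivative Ad') (at og)"
    unfolding Ad'_def by (rule Ck_on_has_derivative[OF Adx og_D0])
  have "((\<lambda>v. Ad (xi v) B) \<circ> snd has_derivative Ad' \<circ> snd) (at (og, og))"
    by (rule diff_chain_at[OF has_derivative_snd[OF has_derivative_ident]]) (simp add: Ad')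
  then have E: "((\<lambda>z. (Ad (xi (snd z)) B, 0)) has_derivative (\<lambda>V. (Ad' (snd V), 0))) (at (og, og))"
    by (intro has_derivative_Pair has_derivative_const) (simp add: o_def)
  from has_derivative_frechet_apply[OF Ck_on_mm open_MM MM_og(1)[OF og_D0] E, folded DM_def]
  have "((\<lambda>z. DM z (Ad (xi (snd z)) B, 0)) has_derivative
      (\<lambda>V. frechet_derivative (\<lambda>z. DM z (B, 0)) (at (og, og)) V + Ad' (snd V))) (at (og, og))"
    by (simp add: Ad_ge DM_og)
  from has_derivative_partial_snd[OF this]
  have "((\<lambda>v. DM (og, v) (Ad (xi v) B, 0)) has_derivative
      (\<lambda>A. frechet_derivative (\<lambda>z. DM z (B, 0)) (at (og, og)) (0, A) + Ad' A)) (at og)" by simp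
  then have "((\<lambda>v. DM (v, og) (0, B)) has_derivative
      (\<lambda>A. frechet_derivative (\<lambda>z. DM z (B, 0)) (at (og, og)) (0, A) + Ad' A)) (at og)"
    by (rule has_derivative_transform_within_open[OF _ open_D0 og_D0]) (rule DM_Ad)
  from has_derivative_unique[OF this has_Gam]
  have "frechet_derivative (\<lambda>z. DM z (B, 0)) (at (og, og)) (0, A) + Ad' A = Gam A B" for A by metis
  moreover have "frechet_derivative (\<lambda>z. DM z (B, 0)) (at (og, og)) (0, A) = Gam B A" for A
    using second_derivative_symmetric[OF Ck_on_mm open_MM MM_og(1)[OF og_D0], of "(B, 0)" "(0, A)"]
    by (simp add: Gam_def DM_def)
  ultimately have "Ad' A = lie_bracket G A B" for A by (simp add: lie_bracket_eq) (metis add_diff_cancel_left')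
  then have "Ad' = (\<lambda>A. lie_bracket G A B)" by (simp add: fun_eq_iff)
  with Ad' show ?thesis by simp
qed

lemma has_right_deriv_Ad:
  "((\<lambda>u. Ad (xi u \<cdot> x) B) has_derivative (\<lambda>A. lie_bracket G A (Ad x B))) (at og)"
  unfolding Ad_mult by (rule has_derivative_Ad_xi)

text \<open>On a convex coordinate ball around any point the vanishing derivative makes
  \<open>F\<close> constant; connectedness then passes from locally constant to constant.\<close>

lemma constant_of_zero_left_derivative:
  fixes F :: "'g \<Rightarrow> 'b::real_normed_vector"
  assumes F: "\<And>h. ((\<lambda>u. F (h \<cdot> xi u)) has_derivative (\<lambda>_. 0)) (at og)"
    and conn: "connected (UNIV :: 'g set)"
  shows "F x = F y"
proof -
  have loc: "\<exists>V. open V \<and> h \<in> V \<and> (\<forall>y\<in>V. F y = F h)" for h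
  proof -
    obtain r where r: "r > 0" "ball og r \<subseteq> D0" using open_D0 og_D0 openE by blast
    \<comment> \<open>The hypothesis speaks of \<open>og\<close> only. Writing \<open>xi u'\<close>
      as \<open>xi u\<close> times a point near the identity moves it to any
      \<open>u\<close>.\<close>
    have der: "((\<lambda>u. F (h \<cdot> xi u)) has_derivative (\<lambda>_. 0)) (at u)" if u: "u \<in> D0" for u
    proof -
      have g: "Ck_map (Suc 0) D0 (\<lambda>u'. iv (xi u) \<cdot> xi u')"
        by (intro Ck_map_mul Ck_map_const Ck_map_xi open_D0)
      let ?T = "D0 \<inter> (\<lambda>u'. iv (xi u) \<cdot> xi u') -` W0"
      let ?\<tau> = "\<lambda>u'. kap (iv (xi u) \<cdot> xi u')"
      have T: "open ?T" by (rule continuous_open_preimage[OF Ck_map_continuous[OF g] open_D0 chart_open[OF id_chart]])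
      have uT: "u \<in> ?T" using u ge_W0 by simp
      have tu: "?\<tau> u = og" by simp
      have "((\<lambda>v. F (h \<cdot> xi u \<cdot> xi v)) \<circ> ?\<tau> has_derivative (\<lambda>_. 0) \<circ> frechet_derivative ?\<tau> (at u)) (at u)"
        by (rule diff_chain_at[OF Ck_on_has_derivative[OF Ck_map_chart[OF g id_chart] uT]])
          (use F[of "h \<cdot> xi u"] tu in simp)
      then have "((\<lambda>u'. F (h \<cdot> xi u')) has_derivative (\<lambda>_. 0) \<circ> frechet_derivative ?\<tau> (at u)) (at u)"
        by (rule has_derivative_transform_within_open[OF _ T uT]) (simp add: xi_kap grp.assoc)
      then show ?thesis by (simp add: o_def)
    qed
    have const: "F (h \<cdot> xi u) = F h" if u: "u \<in> ball og r" for u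
    proof -
      have "\<exists>c. \<forall>u\<in>ball og r. F (h \<cdot> xi u) = c"
        by (rule has_derivative_zero_constant[OF convex_ball])
          (use der r in \<open>blast intro: has_derivative_at_withinI\<close>)
      then obtain c where c: "\<And>u. u \<in> ball og r \<Longrightarrow> F (h \<cdot> xi u) = c" by blast
      show ?thesis using c[OF u] c[of og] r by simp
    qed
    let ?V = "{y. iv h \<cdot> y \<in> W0 \<inter> kap -` ball og r}"
    have "open ?V"
      by (intro open_left_translate continuous_open_preimage chart_continuous[OF id_chart] chart_open[OF id_chart]) simp
    moreover have "h \<in> ?V" using ge_W0 r by simp
    moreover have "F y = F h" if "y \<in> ?V" for y
      using const[of "kap (iv h \<cdot> y)"] that by (simp add: xi_kap)
    ultimately show ?thesis by blast
  qed
  \<comment> \<open>For a locally constant function every set defined through its values is open, in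
    particular a level set and its complement.\<close>
  have o: "open {z. P (F z)}" for P
  proof (subst open_subopen, intro ballI)
    fix z assume z: "z \<in> {z. P (F z)}"
    obtain V where V: "open V \<and> z \<in> V \<and> (\<forall>y\<in>V. F y = F z)" using loc[of z] by (rule exE)
    have "V \<subseteq> {z. P (F z)}"
    proof
      fix y assume "y \<in> V"
      then have "F y = F z" using V by blast
      then show "y \<in> {z. P (F z)}" using z by simp
    qed
    then show "\<exists>T. open T \<and> z \<in> T \<and> T \<subseteq> {z. P (F z)}" using V by blast
  qed
  have "open {z. F z = F x}" and "open {z. F z \<noteq> F x}" by (rule o)+
  then have "{z. F z = F x} = {} \<or> {z. F z \<noteq> F x} = {}"
    using connectedD[OF conn, of "{z. F z = F x}" "{z. F z \<noteq> F x}"] by auto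
  then have "F y = F x" by auto
  then show ?thesis by (rule sym)
qed

end

section \<open>Unimodularity\<close>

context lie_haar
begin

lemma frechet_zero_outside:
  assumes "open S" "u \<in> S" "\<And>v. v \<in> S \<Longrightarrow> K v = 0"
  shows "frechet_derivative K (at u) = (\<lambda>_. 0)"
proof -
  have "((\<lambda>u. 0) has_derivative (\<lambda>_. 0)) (at u)" by simp
  then have "(K has_derivative (\<lambda>_. 0)) (at u)"
    by (rule has_derivative_transform_within_open[OF _ assms(1,2)]) (use assms(3) in simp)
  from frechet_derivative_at[OF this] show ?thesis by simp
qed

text \<open>Left translations serve the integrals of right derivatives, right translations the proof
  of right invariance. They share one support argument and are therefore two cases of
  \<open>H\<close>.\<close>

lemma translate_integral_derivative:
  fixes f :: "'g \<Rightarrow> real"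
  assumes f: "smooth_fun_on G UNIV f" and K: "compact K" "\<And>x. x \<notin> K \<Longrightarrow> f x = 0"
    and H: "\<And>x. (H = (\<lambda>u x. xi u \<cdot> x)) \<or> (\<exists>h. H = (\<lambda>u x. x \<cdot> h \<cdot> xi u))"
  shows "integrable \<mu> (\<lambda>x. frechet_derivative (\<lambda>u. f (H u x)) (at og) v)"
    and "((\<lambda>u. \<integral>x. f (H u x) \<partial>\<mu>) has_derivative
      (\<lambda>v. \<integral>x. frechet_derivative (\<lambda>u. f (H u x)) (at og) v \<partial>\<mu>)) (at og)"
proof -
  obtain r where r: "r > 0" "cball og r \<subseteq> D0" using open_D0 og_D0 open_contains_cball by blast
  define S where "S = ball og r"
  have S: "open S" "og \<in> S" "S \<subseteq> cball og r" "S \<subseteq> D0" using r by (auto simp: S_def)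
  have c1: "continuous_on (cball og r \<times> K) (\<lambda>z. xi (fst z))"
    by (rule continuous_on_compose2[OF continuous_on_xi]) (use r in \<open>auto intro: continuous_intros\<close>)
  \<comment> \<open>While \<open>u\<close> runs through the ball, the supports of all translates
    stay in one compact set, a continuous image of the closed ball times \<open>K\<close>.\<close>
  have "\<exists>C. compact C \<and> (\<forall>u\<in>S. \<forall>x. x \<notin> C \<longrightarrow> H u x \<notin> K) \<and>
    (\<forall>W \<phi> k. (W, \<phi>) \<in> charts G \<longrightarrow> Ck_map k (S \<times> \<phi> ` W) (\<lambda>z. H (fst z) (inv_into W \<phi> (snd z))))"
    using H
  proof
    assume H: "H = (\<lambda>u x. xi u \<cdot> x)"
    let ?C = "(\<lambda>z. iv (xi (fst z)) \<cdot> snd z) ` (cball og r \<times> K)"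
    have "compact ?C"
      by (intro compact_continuous_image compact_Times compact_cball K continuous_intros c1)
    moreover have "H u x \<notin> K" if "u \<in> S" "x \<notin> ?C" for u x
    proof
      assume "H u x \<in> K"
      then have "x \<in> ?C" using that S(3) H by (intro image_eqI[of _ _ "(u, H u x)"]) auto
      then show False using that by simp
    qed
    moreover have "Ck_map k (S \<times> \<phi> ` W) (\<lambda>z. H (fst z) (inv_into W \<phi> (snd z)))" if W: "(W, \<phi>) \<in> charts G" for W \<phi> k
    proof -
      have o: "open (S \<times> \<phi> ` W)" by (intro open_Times S chart_open_image[OF W])
      show ?thesis unfolding H
        by (intro Ck_map_mul o Ck_map_compose[OF o open_D0 Ck_map_xi Ck_on_fst[OF o]]
           Ck_map_compose[OF o chart_open_image[OF W] Ck_map_inv_chart[OF W] Ck_on_snd[OF o]]) (use S in auto)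
    qed
    ultimately show ?thesis by blast
  next
    assume "\<exists>h. H = (\<lambda>u x. x \<cdot> h \<cdot> xi u)"
    then obtain h where H: "H = (\<lambda>u x. x \<cdot> h \<cdot> xi u)" ..
    let ?C = "(\<lambda>z. snd z \<cdot> iv (h \<cdot> xi (fst z))) ` (cball og r \<times> K)"
    have "compact ?C"
      by (intro compact_continuous_image compact_Times compact_cball K continuous_intros c1)
    moreover have "H u x \<notin> K" if "u \<in> S" "x \<notin> ?C" for u x
    proof
      assume "H u x \<in> K"
      moreover have "x = H u x \<cdot> iv (h \<cdot> xi u)" by (simp add: H grp.assoc)
      ultimately have "x \<in> ?C" using that S(3) by (intro image_eqI[of _ _ "(u, H u x)"]) auto
      then show False using that by simp
    qed
    moreover have "Ck_map k (S \<times> \<phi> ` W) (\<lambda>z. H (fst z) (inv_into W \<phi> (snd z)))" if W: "(W, \<phi>) \<in> charts G" for W \<phi> k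
    proof -
      have o: "open (S \<times> \<phi> ` W)" by (intro open_Times S chart_open_image[OF W])
      show ?thesis unfolding H
        by (intro Ck_map_mul Ck_map_const o Ck_map_compose[OF o open_D0 Ck_map_xi Ck_on_fst[OF o]]
           Ck_map_compose[OF o chart_open_image[OF W] Ck_map_inv_chart[OF W] Ck_on_snd[OF o]]) (use S in auto)
    qed
    ultimately show ?thesis by blast
  qed
  then obtain C where C: "compact C" "\<And>u x. u \<in> S \<Longrightarrow> x \<notin> C \<Longrightarrow> H u x \<notin> K"
    "\<And>W \<phi> k. (W, \<phi>) \<in> charts G \<Longrightarrow> Ck_map k (S \<times> \<phi> ` W) (\<lambda>z. H (fst z) (inv_into W \<phi> (snd z)))" by blast
  let ?P = "\<lambda>u x. f (H u x)"
  \<comment> \<open>All integrands vanish off \<open>C\<close>, so its indicator is an integrable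
    weight that leaves them unchanged.\<close>
  let ?w = "indicator C :: 'g \<Rightarrow> real"
  have P: "param_smooth S ?P" by (rule param_smooth_smooth_fun[OF f S(1) C(3)])
  have 0: "?P u x = 0" if "u \<in> S" "x \<notin> C" for u x using C(2)[OF that] K by simp
  have D0: "frechet_derivative (\<lambda>u. ?P u x) (at u) v = 0" if "u \<in> S" "x \<notin> C" for u x v
    using frechet_zero_outside[OF S(1) that(1), of "\<lambda>u. ?P u x"] 0 that(2) by simp
  have w: "integrable \<mu> ?w" by (rule integrable_indicator_compact[OF C(1)])
  have e1: "?P u x *\<^sub>R ?w x = ?P u x" if "u \<in> S" for u x using 0[OF that] by (auto simp: indicator_def)
  have e2: "frechet_derivative (\<lambda>u. ?P u x) (at og) v *\<^sub>R ?w x = frechet_derivative (\<lambda>u. ?P u x) (at og) v" for x v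
    using D0[OF S(2)] by (auto simp: indicator_def)
  show "integrable \<mu> (\<lambda>x. frechet_derivative (\<lambda>u. ?P u x) (at og) v)"
    using param_integral_integrable[OF param_smooth_deriv[OF P S(1)] S(1) C(1) D0 w S(2), of v] unfolding e2 .
  have "((\<lambda>u. \<integral>x. ?P u x *\<^sub>R ?w x \<partial>\<mu>) has_derivative
      (\<lambda>v. \<integral>x. frechet_derivative (\<lambda>u. ?P u x) (at og) v *\<^sub>R ?w x \<partial>\<mu>)) (at og)"
    by (rule param_integral_has_derivative[OF P S(1) C(1) 0 w S(2)])
  then show "((\<lambda>u. \<integral>x. ?P u x \<partial>\<mu>) has_derivative
      (\<lambda>v. \<integral>x. frechet_derivative (\<lambda>u. ?P u x) (at og) v \<partial>\<mu>)) (at og)"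
    unfolding e2 by (rule has_derivative_transform_within_open[OF _ S(1,2)])
      (rule Bochner_Integration.integral_cong[OF refl e1])
qed

text \<open>By left invariance the integral of \<open>g (xi u \<cdot> x)\<close> over
  \<open>x\<close> is constant in \<open>u\<close>, and its derivative at \<open>og\<close> is the
  integral of \<open>right_deriv\<close>.\<close>

lemma
  fixes g :: "'g \<Rightarrow> real"
  assumes g: "smooth_fun_on G UNIV g" and K: "compact K" "\<And>x. x \<notin> K \<Longrightarrow> g x = 0"
  shows integrable_right_deriv: "integrable \<mu> (right_deriv A g)"
    and integral_right_deriv: "(\<integral>x. right_deriv A g x \<partial>\<mu>) = 0"
proof -
  note T = translate_integral_derivative[OF g K, of "\<lambda>u x. xi u \<cdot> x"]
  show "integrable \<mu> (right_deriv A g)" using T(1) by (simp add: right_deriv_def[abs_def])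
  have "g \<in> borel_measurable borel"
    by (rule borel_measurable_continuous_onI[OF Ck_fun_on_continuous[OF smooth_fun_onD[OF g] open_UNIV]])
  then have c: "(\<integral>x. g (xi u \<cdot> x) \<partial>\<mu>) = (\<integral>x. g x \<partial>\<mu>)" for u by (rule integral_left_translate)
  have "((\<lambda>u. \<integral>x. g x \<partial>\<mu>) has_derivative (\<lambda>v. \<integral>x. right_deriv v g x \<partial>\<mu>)) (at og)"
    using T(2) by (simp add: right_deriv_def[abs_def] c)
  moreover have "((\<lambda>u. \<integral>x. g x \<partial>\<mu>) has_derivative (\<lambda>v. 0)) (at og)" by simp
  ultimately have "(\<lambda>v. \<integral>x. right_deriv v g x \<partial>\<mu>) = (\<lambda>v. 0)" by (rule has_derivative_unique)
  from fun_cong[OF this] show "(\<integral>x. right_deriv A g x \<partial>\<mu>) = 0" .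
qed

text \<open>Write \<open>L\<^sub>B f = \<Sum>\<^sub>a R\<^sub>a (\<alpha>\<^sub>a f) - f \<Sum>\<^sub>a R\<^sub>a \<alpha>\<^sub>a\<close> with \<open>\<alpha>\<close> the coefficients of \<open>Ad x B\<close>: the first sum
  integrates to zero by left invariance, the second is the trace of a bracket with \<open>Ad x B\<close>.\<close>

lemma integral_left_deriv:
  fixes f :: "'g \<Rightarrow> real"
  assumes f: "smooth_fun_on G UNIV f" and K: "compact K" "\<And>x. x \<notin> K \<Longrightarrow> f x = 0"
    and trace: "\<And>C. (\<Sum>a\<in>Basis. lie_bracket G a C \<bullet> a) = 0"
  shows "(\<integral>x. left_deriv G B f x \<partial>\<mu>) = 0"
proof -
  let ?g = "\<lambda>a x. (Ad x B \<bullet> a) * f x"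
  have g: "smooth_fun_on G UNIV (?g a)" for a
    by (intro smooth_fun_onI Ck_fun_on_mult Ck_fun_on_inner Ck_fun_on_Ad Ck_fun_on_const smooth_fun_onD[OF f] open_UNIV)
  have g0: "?g a x = 0" if "x \<notin> K" for a x using K that by simp
  have "right_deriv a (?g a) x = (Ad x B \<bullet> a) * right_deriv a f x + (lie_bracket G a (Ad x B) \<bullet> a) * f x" for a x
  proof -
    have "((\<lambda>u. Ad (xi u \<cdot> x) B \<bullet> a) has_derivative (\<lambda>A. lie_bracket G A (Ad x B) \<bullet> a)) (at og)"
      by (rule has_derivative_inner_left[OF has_right_deriv_Ad])
    from has_derivative_mult[OF this has_right_deriv_smooth[OF f, of x]]
    have "((\<lambda>u. ?g a (xi u \<cdot> x)) has_derivative
      (\<lambda>A. (Ad x B \<bullet> a) * right_deriv A f x + (lie_bracket G A (Ad x B) \<bullet> a) * f x)) (at og)" by simp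
    then show ?thesis by (rule right_deriv_eqI)
  qed
  then have e0: "(\<Sum>a\<in>Basis. right_deriv a (?g a) x) =
     (\<Sum>a\<in>Basis. (Ad x B \<bullet> a) * right_deriv a f x) + (\<Sum>a\<in>Basis. lie_bracket G a (Ad x B) \<bullet> a) * f x" for x
    by (simp add: sum.distrib sum_distrib_right)
  have e: "left_deriv G B f x = (\<Sum>a\<in>Basis. right_deriv a (?g a) x)" for x
  proof -
    have lin: "linear (\<lambda>A. right_deriv A f x)" using has_right_deriv_smooth[OF f] has_derivative_linear by blast
    have "right_deriv (\<Sum>a\<in>Basis. (Ad x B \<bullet> a) *\<^sub>R a) f x = (\<Sum>a\<in>Basis. (Ad x B \<bullet> a) * right_deriv a f x)"
      by (simp add: linear_sum[OF lin] linear_scale[OF lin])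
    then show ?thesis unfolding e0 by (simp add: left_deriv_right_deriv[OF f] euclidean_representation trace)
  qed
  show ?thesis unfolding e
    by (subst Bochner_Integration.integral_sum)
      (auto intro!: integrable_right_deriv[OF g K(1) g0] sum.neutral integral_right_deriv[OF g K(1) g0])
qed

text \<open>The integral has zero left derivative in \<open>h\<close>: conjugation by
  \<open>h\<close> turns this derivative into the integral of a left derivative of the translated
  function. Connectedness makes the integral constant.\<close>

lemma right_translate_integral:
  fixes f :: "'g \<Rightarrow> real"
  assumes f: "smooth_fun_on G UNIV f" and K: "compact K" "\<And>x. x \<notin> K \<Longrightarrow> f x = 0"
    and trace: "\<And>C. (\<Sum>a\<in>Basis. lie_bracket G a C \<bullet> a) = 0" and conn: "connected (UNIV :: 'g set)"
  shows "(\<integral>x. f (x \<cdot> h) \<partial>\<mu>) = (\<integral>x. f x \<partial>\<mu>)"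
proof -
  let ?F = "\<lambda>h. \<integral>x. f (x \<cdot> h) \<partial>\<mu>"
  have "((\<lambda>u. ?F (h \<cdot> xi u)) has_derivative (\<lambda>_. 0)) (at og)" for h
  proof -
    let ?f = "\<lambda>x. f (x \<cdot> h)"
    have sf: "smooth_fun_on G UNIV ?f"
    proof (rule smooth_fun_onI, rule Ck_fun_onI)
      fix k W \<phi> assume W: "(W, \<phi>) \<in> charts G"
      note P = chart_open_image[OF W]
      have "Ck_on k (\<phi> ` W) (\<lambda>u. f (inv_into W \<phi> u \<cdot> h))"
        by (rule Ck_fun_on_gmap[OF smooth_fun_onD[OF f] open_UNIV P])
          (auto intro!: Ck_map_mul Ck_map_inv_chart W P Ck_map_const)
      then show "Ck_on k (\<phi> ` (W \<inter> UNIV)) (\<lambda>u. f (inv_into W \<phi> u \<cdot> h))" by simp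
    qed
    have Kh: "compact ((\<lambda>x. x \<cdot> iv h) ` K)" by (intro compact_continuous_image continuous_intros K)
    have f0: "?f x = 0" if "x \<notin> (\<lambda>x. x \<cdot> iv h) ` K" for x
    proof -
      have "x \<cdot> h \<notin> K"
      proof
        assume "x \<cdot> h \<in> K"
        then have "x \<in> (\<lambda>x. x \<cdot> iv h) ` K" by (intro image_eqI[of _ _ "x \<cdot> h"]) auto
        with that show False by simp
      qed
      then show ?thesis using K by simp
    qed
    have der: "((\<lambda>u. ?F (h \<cdot> xi u)) has_derivative
        (\<lambda>v. \<integral>x. frechet_derivative (\<lambda>u. f (x \<cdot> h \<cdot> xi u)) (at og) v \<partial>\<mu>)) (at og)"
      using translate_integral_derivative(2)[OF f K, of "\<lambda>u x. x \<cdot> h \<cdot> xi u"] by (auto simp: grp.assoc)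
    have "frechet_derivative (\<lambda>u. f (x \<cdot> h \<cdot> xi u)) (at og) v = left_deriv G (Ad h v) ?f x" for x v
    proof -
      have "((\<lambda>u. ?f (x \<cdot> xi u)) \<circ> (\<lambda>u. kap (h \<cdot> xi u \<cdot> iv h)) has_derivative
          (\<lambda>A. left_deriv G A ?f x) \<circ> Ad h) (at og)"
        by (rule diff_chain_at[OF has_Ad]) (use has_left_deriv_smooth[OF sf] in simp)
      then have "((\<lambda>u. f (x \<cdot> h \<cdot> xi u)) has_derivative (\<lambda>A. left_deriv G A ?f x) \<circ> Ad h) (at og)"
        by (rule has_derivative_transform_within_open[OF _ conj_domain[of h]]) (simp add: xi_kap grp.assoc)
      from fun_cong[OF frechet_derivative_at[OF this], symmetric] show ?thesis by simp
    qed
    with der integral_left_deriv[OF sf Kh f0 trace] show ?thesis by simp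
  qed
  from constant_of_zero_left_derivative[OF this conn, of h ge] show ?thesis by simp
qed

end

section \<open>Wedge products of covectors\<close>

text \<open>Antisymmetry comes from reindexing the sum over permutations, whatever
  \<open>\<alpha>\<close> and \<open>\<beta>\<close> are.\<close>

lemma wedge_permute:
  assumes q: "q permutes {..<k + l}"
  shows "wedge k l \<alpha> \<beta> (map (\<lambda>i. As ! q i) [0..<k + l]) = of_int (sign q) * wedge k l \<alpha> \<beta> As"
proof -
  define F where "F = (\<lambda>p. \<alpha> (map (\<lambda>i. As ! p i) [0..<k]) * \<beta> (map (\<lambda>i. As ! p i) [k..<k + l]))"
  let ?P = "{p. p permutes {..<k + l}}"
  have 1: "wedge k l \<alpha> \<beta> Bs = (\<Sum>p\<in>?P. of_int (sign p) * (\<alpha> (map (\<lambda>i. Bs ! p i) [0..<k]) * \<beta> (map (\<lambda>i. Bs ! p i) [k..<k + l])))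
     / (fact k * fact l)" for Bs
    by (simp add: wedge_def mult.assoc)
  have 2: "\<alpha> (map (\<lambda>i. map (\<lambda>i. As ! q i) [0..<k + l] ! p i) [0..<k]) *
           \<beta> (map (\<lambda>i. map (\<lambda>i. As ! q i) [0..<k + l] ! p i) [k..<k + l]) = F (q \<circ> p)" if p: "p permutes {..<k + l}" for p
  proof -
    have lt: "p i < k + l" if "i < k + l" for i using permutes_in_image[OF p, of i] that by simp
    have m: "map (\<lambda>i. map (\<lambda>i. As ! q i) [0..<k + l] ! p i) [0..<k] = map (\<lambda>i. As ! (q \<circ> p) i) [0..<k]"
      "map (\<lambda>i. map (\<lambda>i. As ! q i) [0..<k + l] ! p i) [k..<k + l] = map (\<lambda>i. As ! (q \<circ> p) i) [k..<k + l]"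
      by (auto simp: lt)
    show ?thesis unfolding F_def m ..
  qed
  have 3: "of_int (sign p) * F (q \<circ> p) = of_int (sign q) * (of_int (sign (q \<circ> p)) * F (q \<circ> p))"
    if p: "p permutes {..<k + l}" for p
  proof -
    have "sign (q \<circ> p) = sign q * sign p"
      using p q by (intro sign_compose) (auto simp: permutation_permutes)
    then have "sign q * sign (q \<circ> p) = sign p" by (simp add: mult.assoc[symmetric])
    then have "(of_int (sign q) * of_int (sign (q \<circ> p)) :: real) = of_int (sign p)" by (metis of_int_mult)
    then show ?thesis by (simp add: mult.assoc[symmetric])
  qed
  have "(\<Sum>p\<in>?P. of_int (sign p) * F (q \<circ> p)) = (\<Sum>p\<in>?P. of_int (sign q) * (of_int (sign (q \<circ> p)) * F (q \<circ> p)))"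
    by (rule sum.cong) (use 3 in auto)
  also have "\<dots> = of_int (sign q) * (\<Sum>p\<in>?P. of_int (sign (q \<circ> p)) * F (q \<circ> p))"
    by (simp add: sum_distrib_left)
  also have "(\<Sum>p\<in>?P. of_int (sign (q \<circ> p)) * F (q \<circ> p)) = (\<Sum>p\<in>?P. of_int (sign p) * F p)"
    by (rule setum_permutations_compose_left[OF q, symmetric])
  finally have 4: "(\<Sum>p\<in>?P. of_int (sign p) * F (q \<circ> p)) = of_int (sign q) * (\<Sum>p\<in>?P. of_int (sign p) * F p)" .
  have "wedge k l \<alpha> \<beta> (map (\<lambda>i. As ! q i) [0..<k + l]) = (\<Sum>p\<in>?P. of_int (sign p) * F (q \<circ> p)) / (fact k * fact l)"
    unfolding 1 by (intro arg_cong2[where f="(/)"] sum.cong refl) (simp add: 2)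
  also have "\<dots> = of_int (sign q) * wedge k l \<alpha> \<beta> As"
    unfolding 4 unfolding F_def 1 by simp
  finally show ?thesis .
qed

lemma wedge_one_eq:
  assumes "length As = Suc n"
  shows "wedge 1 n \<alpha> \<beta> As = (\<Sum>p | p permutes {..<Suc n}. of_int (sign p) * \<alpha> [As ! p 0] * \<beta> (map (\<lambda>i. As ! p (Suc i)) [0..<n])) / fact n"
proof -
  have m: "map (\<lambda>i. As ! p i) [1..<1 + n] = map (\<lambda>i. As ! p (Suc i)) [0..<n]" for p
  proof -
    have eq: "[1..<1 + n] = map Suc [0..<n]" by (simp add: map_Suc_upt)
    show ?thesis by (simp only: eq map_map o_def)
  qed
  show ?thesis unfolding wedge_def m by simp
qed

lemma wedge_list_Cons:
  assumes "length As = Suc (length \<sigma>s)"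
  shows "wedge_list (\<sigma> # \<sigma>s) As = (\<Sum>p | p permutes {..<Suc (length \<sigma>s)}. of_int (sign p) * \<sigma> (As ! p 0) *
     wedge_list \<sigma>s (map (\<lambda>i. As ! p (Suc i)) [0..<length \<sigma>s])) / fact (length \<sigma>s)"
  unfolding wedge_list.simps wedge_one_eq[OF assms] by simp

lemma wedge_list_permute:
  assumes "q permutes {..<length \<sigma>s}" "length As = length \<sigma>s"
  shows "wedge_list \<sigma>s (map (\<lambda>i. As ! q i) [0..<length \<sigma>s]) = of_int (sign q) * wedge_list \<sigma>s As"
proof (cases \<sigma>s)
  case Nil
  then show ?thesis using assms by simp
next
  case (Cons \<sigma> \<tau>s)
  then show ?thesis using wedge_permute[of q 1 "length \<tau>s"] assms by simp
qed

text \<open>\<open>wedge_list\<close> is the determinant of the matrix of values of the covectors on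
  the vectors; here a column is zero.\<close>

lemma wedge_list_zero_vector:
  assumes "length As = length \<sigma>s" "A \<in> set As" "\<And>\<sigma>. \<sigma> \<in> set \<sigma>s \<Longrightarrow> \<sigma> A = 0"
  shows "wedge_list \<sigma>s As = 0"
  using assms
proof (induction \<sigma>s arbitrary: As)
  case (Cons \<sigma> \<sigma>s)
  let ?n = "length \<sigma>s"
  obtain j where j: "j < Suc ?n" "As ! j = A" using Cons.prems by (auto simp: in_set_conv_nth)
  have "of_int (sign p) * \<sigma> (As ! p 0) * wedge_list \<sigma>s (map (\<lambda>i. As ! p (Suc i)) [0..<?n]) = 0"
    if p: "p permutes {..<Suc ?n}" for p
  proof -
    obtain i where i: "i < Suc ?n" "p i = j" using permutes_image[OF p] j by (metis imageE lessThan_iff)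
    show ?thesis
    proof (cases i)
      case 0
      then show ?thesis using i j Cons.prems(3)[of \<sigma>] by simp
    next
      case (Suc i')
      then have "A \<in> set (map (\<lambda>i. As ! p (Suc i)) [0..<?n])" using i j by force
      then show ?thesis using Cons.IH[of "map (\<lambda>i. As ! p (Suc i)) [0..<?n]"] Cons.prems(3) by simp
    qed
  qed
  then have "(\<Sum>p | p permutes {..<Suc ?n}. of_int (sign p) * \<sigma> (As ! p 0) *
     wedge_list \<sigma>s (map (\<lambda>i. As ! p (Suc i)) [0..<?n])) = 0" by (intro sum.neutral) blast
  then show ?case using Cons.prems(1) by (simp add: wedge_list_Cons del: wedge_list.simps)
qed simp

text \<open>The same determinant with a zero row.\<close>

lemma wedge_list_zero_covector:
  assumes "length As = length \<sigma>s" "\<sigma>0 \<in> set \<sigma>s" "\<And>A. A \<in> set As \<Longrightarrow> \<sigma>0 A = 0"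
  shows "wedge_list \<sigma>s As = 0"
  using assms
proof (induction \<sigma>s arbitrary: As)
  case (Cons \<sigma> \<sigma>s)
  let ?n = "length \<sigma>s"
  have "of_int (sign p) * \<sigma> (As ! p 0) * wedge_list \<sigma>s (map (\<lambda>i. As ! p (Suc i)) [0..<?n]) = 0"
    if p: "p permutes {..<Suc ?n}" for p
  proof -
    have in_As: "As ! p i \<in> set As" if "i < Suc ?n" for i
      using permutes_in_image[OF p, of i] that Cons.prems(1) by simp
    show ?thesis
    proof (cases "\<sigma>0 = \<sigma>")
      case True
      then show ?thesis using Cons.prems(3)[OF in_As[of 0]] by simp
    next
      case False
      then have "\<sigma>0 \<in> set \<sigma>s" using Cons.prems(2) by simp
      have "wedge_list \<sigma>s (map (\<lambda>i. As ! p (Suc i)) [0..<?n]) = 0"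
      proof (rule Cons.IH)
        fix A assume "A \<in> set (map (\<lambda>i. As ! p (Suc i)) [0..<?n])"
        then obtain i where "i < ?n" "A = As ! p (Suc i)" by auto
        then show "\<sigma>0 A = 0" using Cons.prems(3) in_As[of "Suc i"] by simp
      qed (use \<open>\<sigma>0 \<in> set \<sigma>s\<close> in simp_all)
      then show ?thesis by simp
    qed
  qed
  then have "(\<Sum>p | p permutes {..<Suc ?n}. of_int (sign p) * \<sigma> (As ! p 0) *
     wedge_list \<sigma>s (map (\<lambda>i. As ! p (Suc i)) [0..<?n])) = 0" by (intro sum.neutral) blast
  then show ?case using Cons.prems(1) by (simp add: wedge_list_Cons del: wedge_list.simps)
qed simp

text \<open>The determinant of the identity matrix. Only permutations fixing 0 contribute. Each
  gives 1, its sign meeting the same sign from the remaining covectors, and their number cancels the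
  factorial.\<close>

lemma wedge_list_dual:
  assumes "length As = length \<sigma>s"
    and "\<And>i j. i < length \<sigma>s \<Longrightarrow> j < length \<sigma>s \<Longrightarrow> (\<sigma>s ! i) (As ! j) = (if i = j then 1 else 0)"
  shows "wedge_list \<sigma>s As = 1"
  using assms
proof (induction \<sigma>s arbitrary: As)
  case (Cons \<sigma> \<sigma>s)
  let ?n = "length \<sigma>s"
  obtain A Bs where As: "As = A # Bs" "length Bs = ?n" using Cons.prems(1) by (cases As) auto
  have \<sigma>: "\<sigma> (As ! j) = (if j = 0 then 1 else 0)" if "j < Suc ?n" for j
    using Cons.prems(2)[of 0 j] that by simp
  have IH: "wedge_list \<sigma>s Bs = 1"
  proof (rule Cons.IH)
    fix i j assume "i < ?n" "j < ?n"
    then show "(\<sigma>s ! i) (Bs ! j) = (if i = j then 1 else 0)" using Cons.prems(2)[of "Suc i" "Suc j"] As by simp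
  qed (rule As)
  let ?P = "{p. p permutes {..<Suc ?n}}" and ?Q = "{p. p permutes Suc ` {..<?n}}"
  let ?t = "\<lambda>p. of_int (sign p) * \<sigma> (As ! p 0) * wedge_list \<sigma>s (map (\<lambda>i. As ! p (Suc i)) [0..<?n])"
  have fix0: "p 0 = 0" if "p \<in> ?Q" for p using that by (auto intro: permutes_not_in)
  have sub: "?Q \<subseteq> ?P" by (auto intro: permutes_subset)
  have z: "?t p = 0" if "p \<in> ?P - ?Q" for p
  proof -
    have p: "p permutes {..<Suc ?n}" and "\<not> p permutes Suc ` {..<?n}" using that by auto
    have "p 0 \<noteq> 0"
    proof
      assume 0: "p 0 = 0"
      have "p permutes Suc ` {..<?n}"
        by (rule permutes_superset[OF p]) (use 0 in \<open>auto simp: less_Suc_eq_0_disj\<close>)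
      with \<open>\<not> p permutes Suc ` {..<?n}\<close> show False ..
    qed
    then show ?thesis using \<sigma>[of "p 0"] permutes_in_image[OF p, of 0] by simp
  qed
  have one: "?t p = 1" if "p \<in> ?Q" for p
  proof -
    have p: "p permutes Suc ` {..<?n}" using that by simp
    let ?A = "Suc ` {..<?n}"
    \<comment> \<open>Shifting the indices down by one makes it a permutation of the positions of
      the remaining vectors, with the same sign.\<close>
    define q where "q = map_permutation ?A (\<lambda>i. i - 1) p"
    have inj: "inj_on (\<lambda>i. i - 1) ?A" by (auto simp: inj_on_def)
    have "bij_betw (\<lambda>i. i - 1) ?A {..<?n}" using inj by (simp add: bij_betw_def image_image)
    then have q: "q permutes {..<?n}" unfolding q_def by (rule map_permutation_permutes[OF _ p])
    have sq: "sign q = sign p" unfolding q_def by (rule sign_map_permutation[OF inj p]) simp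
    have qi: "p (Suc i) = Suc (q i)" if "i < ?n" for i
    proof -
      have "q (Suc i - 1) = p (Suc i) - 1" unfolding q_def
        by (rule map_permutation_apply[OF inj]) (use that in auto)
      moreover have "p (Suc i) \<in> ?A" using permutes_in_image[OF p, of "Suc i"] that by simp
      ultimately show ?thesis by auto
    qed
    have m: "map (\<lambda>i. As ! p (Suc i)) [0..<?n] = map (\<lambda>i. Bs ! q i) [0..<?n]" by (simp add: qi As)
    have "wedge_list \<sigma>s (map (\<lambda>i. As ! p (Suc i)) [0..<?n]) = of_int (sign p)"
      unfolding m wedge_list_permute[OF q As(2)] using IH sq by simp
    then show ?thesis using \<sigma>[of 0] fix0[OF that] by (simp flip: of_int_mult)
  qed
  have "sum ?t ?P = sum ?t ?Q" by (rule sum.mono_neutral_right) (use sub z in \<open>auto simp: finite_permutations\<close>)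
  also have "\<dots> = (\<Sum>p\<in>?Q. 1)" by (rule sum.cong) (use one in auto)
  also have "\<dots> = fact ?n" using card_permutations[of "Suc ` {..<?n}" ?n] by (simp add: card_image)
  finally show ?case using Cons.prems(1) by (simp add: wedge_list_Cons del: wedge_list.simps)
qed simp

lemma wedge_list_linear:
  assumes "length As = length \<sigma>s" "i < length \<sigma>s" "\<And>\<sigma>. \<sigma> \<in> set \<sigma>s \<Longrightarrow> linear \<sigma>"
  shows "linear (\<lambda>A. wedge_list \<sigma>s (As[i := A]))"
  using assms
proof (induction \<sigma>s arbitrary: As i)
  case (Cons \<sigma> \<sigma>s)
  let ?n = "length \<sigma>s"
  have lin: "linear (\<lambda>A. of_int (sign p) * \<sigma> (As[i := A] ! p 0) * wedge_list \<sigma>s (map (\<lambda>t. As[i := A] ! p (Suc t)) [0..<?n]))"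
    if p: "p permutes {..<Suc ?n}" for p
  proof -
    have i: "i < length As" using Cons.prems by simp
    obtain j where j: "j < Suc ?n" "p j = i"
      using permutes_image[OF p] Cons.prems(2) by (metis imageE length_Cons lessThan_iff)
    have inj: "p t = i \<longleftrightarrow> t = j" for t using permutes_inj[OF p] j(2) by (metis injD)
    show ?thesis
    proof (cases j)
      case 0
      have ne: "i \<noteq> p (Suc t)" for t using inj[of "Suc t"] 0 by auto
      have m: "map (\<lambda>t. As[i := A] ! p (Suc t)) [0..<?n] = map (\<lambda>t. As ! p (Suc t)) [0..<?n]" for A
        by (simp add: nth_list_update_neq[OF ne])
      have h: "As[i := A] ! p 0 = A" for A using i j 0 by simp
      have "linear (\<lambda>A. (of_int (sign p) * wedge_list \<sigma>s (map (\<lambda>t. As ! p (Suc t)) [0..<?n])) *\<^sub>R \<sigma> A)"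
        using Cons.prems(3)[of \<sigma>] by (intro linear_compose_scale_right) simp
      then show ?thesis unfolding m h by (simp add: mult_ac)
    next
      case (Suc j')
      have m: "map (\<lambda>t. As[i := A] ! p (Suc t)) [0..<?n] = (map (\<lambda>t. As ! p (Suc t)) [0..<?n])[j' := A]" for A
      proof (rule nth_equalityI)
        fix t assume t: "t < length (map (\<lambda>t. As[i := A] ! p (Suc t)) [0..<?n])"
        show "map (\<lambda>t. As[i := A] ! p (Suc t)) [0..<?n] ! t = (map (\<lambda>t. As ! p (Suc t)) [0..<?n])[j' := A] ! t"
          using inj[of "Suc t"] Suc j(1) i t by (cases "t = j'") (simp_all add: nth_list_update_neq)
      qed simp
      have h: "As[i := A] ! p 0 = As ! p 0" for A using inj[of 0] Suc by (simp add: nth_list_update_neq)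
      have "linear (\<lambda>A. wedge_list \<sigma>s ((map (\<lambda>t. As ! p (Suc t)) [0..<?n])[j' := A]))"
        by (rule Cons.IH) (use Cons.prems Suc j in auto)
      then have "linear (\<lambda>A. (of_int (sign p) * \<sigma> (As ! p 0)) *\<^sub>R
          wedge_list \<sigma>s ((map (\<lambda>t. As ! p (Suc t)) [0..<?n])[j' := A]))"
        by (rule linear_compose_scale_right)
      then show ?thesis unfolding m h by simp
    qed
  qed
  have "linear (\<lambda>A. (1 / fact ?n) *\<^sub>R (\<Sum>p | p permutes {..<Suc ?n}. of_int (sign p) * \<sigma> (As[i := A] ! p 0) *
     wedge_list \<sigma>s (map (\<lambda>t. As[i := A] ! p (Suc t)) [0..<?n])))"
    by (intro linear_compose_scale_right linear_compose_sum) (use lin in auto)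
  then show ?case using Cons.prems(1) by (simp add: wedge_list_Cons del: wedge_list.simps)
qed simp

lemma alternating_wedge_list:
  fixes \<sigma>s :: "('a::real_vector \<Rightarrow> real) list"
  assumes "\<And>\<sigma>. \<sigma> \<in> set \<sigma>s \<Longrightarrow> linear \<sigma>"
  shows "alternating_form (length \<sigma>s) (wedge_list \<sigma>s)"
  unfolding alternating_form_def
proof (intro conjI allI impI)
  fix As :: "'a list" and i assume "length As = length \<sigma>s \<and> i < length \<sigma>s"
  then show "linear (\<lambda>A. wedge_list \<sigma>s (As[i := A]))" using wedge_list_linear assms by blast
next
  fix As :: "'a list" and i j assume *: "length As = length \<sigma>s \<and> i < j \<and> j < length \<sigma>s \<and> As ! i = As ! j"
  let ?q = "Transposition.transpose i j"
  have q: "?q permutes {..<length \<sigma>s}" using * by (intro permutes_swap_id) auto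
  have "map (\<lambda>t. As ! ?q t) [0..<length \<sigma>s] = As"
    using * by (intro nth_equalityI) (auto simp: Transposition.transpose_def)
  then have "wedge_list \<sigma>s As = - wedge_list \<sigma>s As"
    using wedge_list_permute[OF q, of As] * by (simp add: sign_swap_id)
  then show "wedge_list \<sigma>s As = 0" by simp
qed

text \<open>The cycle \<open>0 \<mapsto> k \<mapsto> k - 1 \<mapsto> \<dots> \<mapsto> 1 \<mapsto>
  0\<close>. Reading a list through it puts entry \<open>k\<close> first and keeps the order of the
  others.\<close>

definition cyc :: "nat \<Rightarrow> nat \<Rightarrow> nat" where
  "cyc k t = (if t = 0 then k else if t \<le> k then t - 1 else t)"

lemma cyc_permutes_sign: "k < n \<Longrightarrow> cyc k permutes {..<n} \<and> sign (cyc k) = (-1) ^ k"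
proof (induction k)
  case 0
  have "cyc 0 = id" by (auto simp: cyc_def fun_eq_iff)
  then show ?case by (metis permutes_id power_0 sign_id)
next
  case (Suc k)
  let ?t = "Transposition.transpose k (Suc k)"
  have eq: "cyc (Suc k) = ?t \<circ> cyc k"
    by (auto simp: cyc_def fun_eq_iff Transposition.transpose_def)
  have t: "?t permutes {..<n}" using Suc.prems by (intro permutes_swap_id) auto
  have c: "cyc k permutes {..<n}" "sign (cyc k) = (-1) ^ k" using Suc by auto
  have "sign (cyc (Suc k)) = sign ?t * sign (cyc k)" unfolding eq
    using c t by (intro sign_compose) (auto simp: permutation_permutes)
  moreover have "cyc (Suc k) permutes {..<n}" unfolding eq by (rule permutes_compose[OF c(1) t])
  ultimately show ?case using c by (simp add: sign_swap_id)
qed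

lemma length_omit_nth: "i < length xs \<Longrightarrow> length (omit_nth i xs) = length xs - 1"
  by (simp add: omit_nth_def)

lemma omit_nth_nth: "i < length xs \<Longrightarrow> t < length xs - 1 \<Longrightarrow> omit_nth i xs ! t = xs ! (if t < i then t else Suc t)"
  by (auto simp: omit_nth_def nth_append min_def)

text \<open>Laplace expansion, antisymmetrised: moving the \<open>k\<close>-th entry to the front by a cycle of sign
  \<open>(-1)\<^sup>k\<close> makes all \<open>n + 1\<close> summands equal.\<close>

lemma antisymmetrised_laplace:
  assumes "length As = Suc n"
  shows "(\<Sum>p | p permutes {..<Suc n}. of_int (sign p) *
      (\<Sum>k<Suc n. (-1) ^ k * (a (As ! p k) * \<beta> (omit_nth k (map (\<lambda>t. As ! p t) [0..<Suc n])))))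
    = real (Suc n) * (\<Sum>p | p permutes {..<Suc n}. of_int (sign p) * a (As ! p 0) * \<beta> (map (\<lambda>i. As ! p (Suc i)) [0..<n]))"
proof -
  let ?P = "{p. p permutes {..<Suc n}}"
  let ?f = "\<lambda>p. of_int (sign p) * a (As ! p 0) * \<beta> (map (\<lambda>i. As ! p (Suc i)) [0..<n])"
  have k: "(\<Sum>p\<in>?P. of_int (sign p) * ((-1) ^ k * (a (As ! p k) * \<beta> (omit_nth k (map (\<lambda>t. As ! p t) [0..<Suc n]))))) = sum ?f ?P"
    if k: "k < Suc n" for k
  proof -
    have c: "cyc k permutes {..<Suc n}" "sign (cyc k) = (-1) ^ k" using cyc_permutes_sign[OF k] by auto
    have "of_int (sign p) * ((-1) ^ k * (a (As ! p k) * \<beta> (omit_nth k (map (\<lambda>t. As ! p t) [0..<Suc n])))) = ?f (p \<circ> cyc k)"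
      if p: "p \<in> ?P" for p
    proof -
      have s: "sign (p \<circ> cyc k) = sign p * (-1) ^ k"
        using p c by (subst sign_compose) (auto simp: permutation_permutes)
      have "omit_nth k (map (\<lambda>t. As ! p t) [0..<Suc n]) = map (\<lambda>i. As ! (p \<circ> cyc k) (Suc i)) [0..<n]"
        using k by (intro nth_equalityI) (auto simp: length_omit_nth omit_nth_nth cyc_def simp del: upt_Suc)
      then show ?thesis unfolding s by (simp add: cyc_def)
    qed
    then have "(\<Sum>p\<in>?P. of_int (sign p) * ((-1) ^ k * (a (As ! p k) * \<beta> (omit_nth k (map (\<lambda>t. As ! p t) [0..<Suc n])))))
      = (\<Sum>p\<in>?P. ?f (p \<circ> cyc k))" by (intro sum.cong) auto
    also have "\<dots> = sum ?f ?P" by (rule sum_permutations_compose_right[OF c(1), symmetric])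
    finally show ?thesis .
  qed
  have "(\<Sum>p\<in>?P. of_int (sign p) *
      (\<Sum>k<Suc n. (-1) ^ k * (a (As ! p k) * \<beta> (omit_nth k (map (\<lambda>t. As ! p t) [0..<Suc n])))))
    = (\<Sum>k<Suc n. \<Sum>p\<in>?P. of_int (sign p) * ((-1) ^ k * (a (As ! p k) * \<beta> (omit_nth k (map (\<lambda>t. As ! p t) [0..<Suc n])))))"
    unfolding sum_distrib_left by (rule sum.swap)
  also have "\<dots> = (\<Sum>k<Suc n. sum ?f ?P)" by (rule sum.cong) (use k in auto)
  finally show ?thesis by simp
qed

section \<open>The stratified Lie algebra\<close>

locale carnot = lie_haar G \<mu>
  for G :: "('g::{t2_space,second_countable_topology}, 'a::euclidean_space, 'm) carnot_data_scheme" and \<mu> +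
  assumes carnot: "carnot_group G"
begin

lemma connected_UNIV_G: "connected (UNIV :: 'g set)"
  using carnot by (simp add: carnot_group_def)

lemma strat: "stratification G" and adapted: "adapted_basis G"
  using carnot by (simp_all add: carnot_group_def)

abbreviation "ns \<equiv> nstep G"
abbreviation "X \<equiv> \<lambda>lv. basis_vec G (fst lv) (snd lv)"

text \<open>Outside the range of the stratification \<open>layer\<close> is mostly unspecified.
  Replacing it by \<open>{0}\<close> there lets the grading rule hold without a bound on the sum of
  two indices.\<close>

definition lay :: "nat \<Rightarrow> 'a set" where
  "lay m = (if m \<in> {1..ns} then layer G m else {0})"

lemma subspace_lay: "subspace (lay m)"
  using strat by (auto simp: stratification_def lay_def subspace_def)

lemma lay_1: "lay 1 = layer G 1"
proof (cases "ns = 0")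
  case True
  then show ?thesis using strat by (simp add: stratification_def lay_def)
qed (simp add: lay_def)

lemma decomposition:
  obtains a where "\<And>l. a l \<in> lay l" "A = (\<Sum>l=1..ns. a l)"
proof -
  obtain a where "(\<forall>l\<in>{1..ns}. a l \<in> layer G l) \<and> (\<forall>l. l \<notin> {1..ns} \<longrightarrow> a l = 0) \<and> A = (\<Sum>l=1..ns. a l)"
    using strat unfolding stratification_def by blast
  then show thesis by (intro that[of a]) (auto simp: lay_def)
qed

lemma decomposition_zero:
  assumes "\<And>l. a l \<in> lay l" "(\<Sum>l=1..ns. a l) = 0"
  shows "a l = 0"
proof -
  let ?P = "\<lambda>a. (\<forall>l\<in>{1..ns}. a l \<in> layer G l) \<and> (\<forall>l. l \<notin> {1..ns} \<longrightarrow> a l = 0) \<and> (0::'a) = (\<Sum>l=1..ns. a l)"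
  have "\<exists>!a. ?P a" using strat unfolding stratification_def by blast
  then obtain b where b: "\<forall>c. ?P c \<longrightarrow> c = b" unfolding Ex1_def by (elim exE conjE)
  have "?P a" using assms unfolding lay_def by (metis singletonD)
  moreover have "?P (\<lambda>l. 0)" using strat by (auto simp: stratification_def subspace_0)
  ultimately have "a = (\<lambda>l. 0)" using b[rule_format, of a] b[rule_format, of "\<lambda>l. 0"] by simp
  then show ?thesis by simp
qed

lemma bracket_lay_1:
  assumes "A \<in> lay 1" "B \<in> lay l" "l \<ge> 1"
  shows "lie_bracket G A B \<in> lay (Suc l)"
proof (cases "l \<le> ns")
  case True
  have "lie_bracket G A B \<in> span {lie_bracket G A B | A B. A \<in> layer G 1 \<and> B \<in> layer G l}"
    using assms True by (intro span_base) (auto simp: lay_1 lay_def)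
  also have "\<dots> = layer G (Suc l)" using strat True assms(3) by (simp add: stratification_def)
  also have "\<dots> = lay (Suc l)"
  proof (cases "l = ns")
    case True
    then show ?thesis using strat by (simp add: stratification_def lay_def)
  next
    case False
    with \<open>l \<le> ns\<close> show ?thesis by (simp add: lay_def)
  qed
  finally show ?thesis .
next
  case False
  then have "B = 0" using assms by (simp add: lay_def)
  then show ?thesis by (simp add: linear_0[OF lie_bracket_linear_right] subspace_0[OF subspace_lay])
qed

text \<open>Layer \<open>Suc i\<close> is spanned by brackets of the first layer with layer
  \<open>i\<close>, so the Jacobi identity reduces it to layer \<open>i\<close> and the first
  layer.\<close>

lemma bracket_lay:
  assumes "A \<in> lay i" "B \<in> lay l" "i \<ge> 1" "l \<ge> 1"
  shows "lie_bracket G A B \<in> lay (i + l)"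
  using assms(3,1,2,4)
proof (induction i arbitrary: A B l rule: dec_induct)
  case base
  then show ?case using bracket_lay_1 by simp
next
  case (step i)
  show ?case
  proof (cases "Suc i \<le> ns")
    case True
    then have A_span: "A \<in> span {lie_bracket G A B | A B. A \<in> layer G 1 \<and> B \<in> layer G i}"
      using strat step.hyps step.prems(1) by (simp add: stratification_def lay_def)
    note IH = step.IH and prems = step.prems and hyps = step.hyps
    from A_span show ?thesis
    proof (induction rule: span_induct_alt)
      case base
      show ?case by (simp add: linear_0[OF lie_bracket_linear_left] subspace_0[OF subspace_lay])
    next
      case (step c x y)
      then obtain a b where x: "x = lie_bracket G a b" "a \<in> lay 1" "b \<in> lay i"
        using hyps True by (auto simp: lay_1 lay_def)
      have "lie_bracket G a (lie_bracket G b B) \<in> lay (Suc (i + l))"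
        using hyps prems by (intro bracket_lay_1 x IH) auto
      moreover have "lie_bracket G b (lie_bracket G a B) \<in> lay (i + Suc l)"
        using hyps prems by (intro IH x bracket_lay_1) auto
      ultimately have "lie_bracket G x B \<in> lay (Suc i + l)"
        unfolding x(1) jacobi by (auto intro: subspace_diff[OF subspace_lay])
      then show ?case using step(2)
        by (simp add: linear_add[OF lie_bracket_linear_left] linear_scale[OF lie_bracket_linear_left]
          subspace_add[OF subspace_lay] subspace_scale[OF subspace_lay])
    qed
  next
    case False
    then have "A = 0" using step.prems by (simp add: lay_def)
    then show ?thesis by (simp add: linear_0[OF lie_bracket_linear_left] subspace_0[OF subspace_lay])
  qed
qed

section \<open>The adapted frame and its dual coframe\<close>

definition "I = set (basis_indices G)"

lemma I_eq: "I = (SIGMA l:{1..ns}. {1..layer_dim G l})"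
  by (auto simp: I_def basis_indices_def less_Suc_eq_le image_iff simp del: upt_Suc)

lemma finite_I: "finite I" by (simp add: I_def)

lemma X_lay: "i \<in> I \<Longrightarrow> X i \<in> lay (fst i)"
proof -
  assume "i \<in> I"
  then have i: "fst i \<in> {1..ns}" "snd i \<in> {1..layer_dim G (fst i)}" by (auto simp: I_eq)
  then have "X i \<in> span (basis_vec G (fst i) ` {1..layer_dim G (fst i)})" by (intro span_base) simp
  then show ?thesis using adapted i by (simp add: adapted_basis_def lay_def)
qed

lemma frame_lin_indep:
  assumes "(\<Sum>i\<in>I. c i *\<^sub>R X i) = 0" "i \<in> I"
  shows "c i = 0"
proof -
  \<comment> \<open>Grouping the combination by layers reduces independence to directness of the sum
    and to independence within one layer.\<close>
  define a where "a = (\<lambda>l. if l \<in> {1..ns} then \<Sum>v=1..layer_dim G l. c (l, v) *\<^sub>R X (l, v) else 0)"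
  have "a l \<in> lay l" for l
    using X_lay by (auto simp: a_def I_eq intro!: subspace_sum[OF subspace_lay] subspace_scale[OF subspace_lay]
      subspace_0[OF subspace_lay])
  moreover have "(\<Sum>l=1..ns. a l) = 0"
    using assms(1) by (simp add: a_def I_eq sum.Sigma case_prod_unfold)
  ultimately have a0: "a l = 0" for l by (rule decomposition_zero)
  obtain l v where i: "i = (l, v)" "l \<in> {1..ns}" "v \<in> {1..layer_dim G l}" using assms(2) by (auto simp: I_eq)
  have ad: "inj_on (basis_vec G l) {1..layer_dim G l}" "independent (basis_vec G l ` {1..layer_dim G l})"
    using adapted i by (auto simp: adapted_basis_def)
  let ?B = "basis_vec G l ` {1..layer_dim G l}"
  let ?u = "\<lambda>b. c (l, inv_into {1..layer_dim G l} (basis_vec G l) b)"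
  have "(\<Sum>b\<in>?B. ?u b *\<^sub>R b) = (\<Sum>v=1..layer_dim G l. c (l, v) *\<^sub>R basis_vec G l v)"
    by (subst sum.reindex[OF ad(1)], rule sum.cong[OF refl]) (simp only: o_def inv_into_f_f[OF ad(1)])
  also have "\<dots> = 0" using a0[of l] i by (simp add: a_def)
  finally have "?u (basis_vec G l v) = 0" using i by (intro independentD[OF ad(2) _ order_refl]) auto
  then show ?thesis using i ad(1) by simp
qed

lemma inj_X: "inj_on X I"
proof (rule inj_onI, rule ccontr)
  fix i j assume ij: "i \<in> I" "j \<in> I" "X i = X j" "i \<noteq> j"
  let ?c = "\<lambda>k. (if k = i then 1 else 0) - (if k = j then 1 else (0::real))"
  have "(\<Sum>k\<in>I. ?c k *\<^sub>R X k) = (\<Sum>k\<in>I. (if k = i then X k else 0)) - (\<Sum>k\<in>I. (if k = j then X k else 0))"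
    by (auto simp: sum_subtractf[symmetric] intro!: sum.cong)
  also have "\<dots> = 0" using ij finite_I by simp
  finally have "?c i = 0" using ij(1) by (rule frame_lin_indep)
  then show False using ij by simp
qed

lemma frame_set: "set (frame G) = X ` I"
  by (auto simp: frame_def I_def case_prod_unfold image_iff)

lemma indep_frame: "independent (set (frame G))"
proof -
  have "(\<forall>v\<in>X ` I. u v = 0)" if "(\<Sum>v\<in>X ` I. u v *\<^sub>R v) = 0" for u
    using that frame_lin_indep[of "\<lambda>i. u (X i)"] by (simp add: sum.reindex[OF inj_X])
  then show ?thesis unfolding frame_set using dependent_finite[OF finite_imageI[OF finite_I], of X] by auto
qed

lemma span_layer_sub: "l \<in> {1..ns} \<Longrightarrow> lay l \<subseteq> span (set (frame G))"
proof -
  assume l: "l \<in> {1..ns}"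
  have "lay l = span (basis_vec G l ` {1..layer_dim G l})" using adapted l by (simp add: adapted_basis_def lay_def)
  also have "\<dots> \<subseteq> span (set (frame G))"
    by (rule span_mono) (use l in \<open>force simp: frame_set I_eq\<close>)
  finally show ?thesis .
qed

lemma span_frame: "span (set (frame G)) = UNIV"
proof -
  have "A \<in> span (set (frame G))" for A
  proof -
    obtain a where a: "\<And>l. a l \<in> lay l" "A = (\<Sum>l=1..ns. a l)" using decomposition by blast
    show ?thesis unfolding a(2) by (rule span_sum) (use a(1) span_layer_sub in blast)
  qed
  then show ?thesis by auto
qed

lemma coframe_linear: "linear (coframe G i)"
  unfolding coframe_def
  by (rule linearI) (simp_all add: representation_add[OF indep_frame] representation_scale[OF indep_frame] span_frame)

lemma coframe_X: "i \<in> I \<Longrightarrow> j \<in> I \<Longrightarrow> coframe G i (X j) = (if i = j then 1 else 0)"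
  unfolding coframe_def
  using representation_basis[OF indep_frame, of "X j"] inj_X by (auto simp: frame_set inj_on_def)

lemma coframe_expansion: "A = (\<Sum>i\<in>I. coframe G i A *\<^sub>R X i)"
proof -
  have "(\<Sum>b\<in>set (frame G). representation (set (frame G)) A b *\<^sub>R b) = A"
    by (rule sum_representation_eq[OF indep_frame]) (simp_all add: span_frame)
  also have "(\<Sum>b\<in>set (frame G). representation (set (frame G)) A b *\<^sub>R b) = (\<Sum>i\<in>I. coframe G i A *\<^sub>R X i)"
    unfolding coframe_def by (subst (1) frame_set) (simp add: sum.reindex[OF inj_X])
  finally show ?thesis ..
qed

lemma coframe_lay: "i \<in> I \<Longrightarrow> A \<in> lay m \<Longrightarrow> m \<noteq> fst i \<Longrightarrow> coframe G i A = 0"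
proof (cases "m \<in> {1..ns}")
  case True
  assume i: "i \<in> I" and A: "A \<in> lay m" and m: "m \<noteq> fst i"
  have "A \<in> span (basis_vec G m ` {1..layer_dim G m})" using adapted True A by (simp add: adapted_basis_def lay_def)
  then show ?thesis
  proof (rule linear_eq_0_on_span[OF coframe_linear, rotated])
    fix x assume "x \<in> basis_vec G m ` {1..layer_dim G m}"
    then obtain v where "x = X (m, v)" "(m, v) \<in> I" using True by (auto simp: I_eq)
    then show "coframe G i x = 0" using coframe_X[OF i, of "(m, v)"] m by auto
  qed
qed (auto simp: lay_def linear_0[OF coframe_linear])

lemma horizontal_iff: "A \<in> layer G 1 \<longleftrightarrow> (\<forall>i\<in>I. fst i \<noteq> 1 \<longrightarrow> coframe G i A = 0)"
proof
  assume "A \<in> layer G 1"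
  then show "\<forall>i\<in>I. fst i \<noteq> 1 \<longrightarrow> coframe G i A = 0" using coframe_lay[of _ A 1] lay_1 by auto
next
  assume *: "\<forall>i\<in>I. fst i \<noteq> 1 \<longrightarrow> coframe G i A = 0"
  have "(\<Sum>i\<in>I. coframe G i A *\<^sub>R X i) \<in> lay 1"
  proof (rule subspace_sum[OF subspace_lay])
    fix i assume i: "i \<in> I"
    show "coframe G i A *\<^sub>R X i \<in> lay 1"
      using * i X_lay[OF i] by (cases "fst i = 1") (auto intro: subspace_scale[OF subspace_lay] subspace_0[OF subspace_lay])
  qed
  then show "A \<in> layer G 1" using coframe_expansion lay_1 by metis
qed

text \<open>Every layer component of \<open>C\<close> has weight at least 1, so bracketing with it
  moves \<open>X i\<close> out of its own layer. Unimodularity and closedness of the hat forms both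
  rest on this.\<close>

lemma coframe_bracket: "i \<in> I \<Longrightarrow> coframe G i (lie_bracket G (X i) C) = 0"
proof -
  assume i: "i \<in> I"
  obtain c where c: "\<And>l. c l \<in> lay l" "C = (\<Sum>l=1..ns. c l)" using decomposition by blast
  have "lie_bracket G (X i) C = (\<Sum>l=1..ns. lie_bracket G (X i) (c l))"
    unfolding c(2) by (rule linear_sum[OF lie_bracket_linear_right])
  moreover have "coframe G i (lie_bracket G (X i) (c l)) = 0" if "l \<in> {1..ns}" for l
  proof (rule coframe_lay[OF i])
    show "lie_bracket G (X i) (c l) \<in> lay (fst i + l)"
      using i that by (intro bracket_lay X_lay c) (auto simp: I_eq)
  qed (use that in auto)
  ultimately show ?thesis by (simp add: linear_sum[OF coframe_linear])
qed

lemma coframe_bracket': "i \<in> I \<Longrightarrow> coframe G i (lie_bracket G C (X i)) = 0"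
  using coframe_bracket[of i C] lie_bracket_antisym[of C "X i"] by (simp add: linear_neg[OF coframe_linear])

text \<open>Infinitesimal unimodularity: relative to the frame all diagonal entries vanish by
  \<open>coframe_bracket\<close>. The interchange of sums passes from \<open>Basis\<close>, in which
  the trace is written, to the frame.\<close>

lemma trace_ad: "(\<Sum>a\<in>Basis. lie_bracket G a C \<bullet> a) = 0"
proof -
  have 1: "lie_bracket G a C = (\<Sum>i\<in>I. coframe G i a *\<^sub>R lie_bracket G (X i) C)" for a
  proof -
    have "lie_bracket G a C = lie_bracket G (\<Sum>i\<in>I. coframe G i a *\<^sub>R X i) C" using coframe_expansion by metis
    then show ?thesis by (simp add: linear_sum[OF lie_bracket_linear_left] linear_scale[OF lie_bracket_linear_left])
  qed
  have "(\<Sum>a\<in>Basis. lie_bracket G a C \<bullet> a) = (\<Sum>a\<in>Basis. \<Sum>i\<in>I. coframe G i a * (lie_bracket G (X i) C \<bullet> a))"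
    by (subst 1) (simp add: inner_sum_left)
  also have "\<dots> = (\<Sum>i\<in>I. \<Sum>a\<in>Basis. coframe G i a * (lie_bracket G (X i) C \<bullet> a))" by (rule sum.swap)
  also have "\<dots> = (\<Sum>i\<in>I. coframe G i (\<Sum>a\<in>Basis. (lie_bracket G (X i) C \<bullet> a) *\<^sub>R a))"
    by (simp add: linear_sum[OF coframe_linear] linear_scale[OF coframe_linear] mult.commute)
  also have "\<dots> = 0" by (simp add: euclidean_representation coframe_bracket)
  finally show ?thesis .
qed

lemma distinct_indices: "distinct (basis_indices G)"
proof -
  have "distinct (concat (map (\<lambda>l. map (Pair l) [1..<Suc (d l)]) ls))" if "distinct ls" for d :: "nat \<Rightarrow> nat" and ls
    using that by (induction ls) (auto simp: distinct_map inj_on_def simp del: upt_Suc)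
  then show ?thesis by (simp add: basis_indices_def del: upt_Suc)
qed

lemma card_I: "card I = DIM('a)"
  using dim_eq_card_independent[OF indep_frame] span_frame dim_span[of "set (frame G)"]
  by (simp add: frame_set card_image[OF inj_X])

lemma length_indices: "length (basis_indices G) = DIM('a)"
  using distinct_card[OF distinct_indices] card_I by (simp add: I_def)

lemma frame_eq: "frame G = map X (basis_indices G)"
  by (simp add: frame_def case_prod_unfold)

end

section \<open>The weak contact equations in coordinates\<close>

lemma set_omit_nth: "i < length xs \<Longrightarrow> set (omit_nth i xs) = {xs ! t | t. t < length xs \<and> t \<noteq> i}"
proof (intro set_eqI iffI)
  fix x assume i: "i < length xs" and "x \<in> set (omit_nth i xs)"
  then obtain t where "t < length xs - 1" "x = xs ! (if t < i then t else Suc t)"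
    by (auto simp: in_set_conv_nth length_omit_nth omit_nth_nth simp del: if_split)
  then show "x \<in> {xs ! t | t. t < length xs \<and> t \<noteq> i}"
    by (intro CollectI exI[of _ "if t < i then t else Suc t"]) auto
next
  fix x assume i: "i < length xs" and "x \<in> {xs ! t | t. t < length xs \<and> t \<noteq> i}"
  then obtain t where t: "t < length xs" "t \<noteq> i" "x = xs ! t" by auto
  define s where "s = (if t < i then t else t - 1)"
  have "s < length xs - 1" "(if s < i then s else Suc s) = t" using t i by (auto simp: s_def)
  then have "omit_nth i xs ! s = x" "s < length (omit_nth i xs)" using t i by (simp_all add: length_omit_nth omit_nth_nth)
  then show "x \<in> set (omit_nth i xs)" by (metis nth_mem)
qed

lemma set_omit_nth2:
  assumes "a < c" "c < length xs"
  shows "{xs ! t | t. t < length xs \<and> t \<noteq> a \<and> t \<noteq> c} = set (omit_nth a (omit_nth c xs))"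
proof -
  have l: "length (omit_nth c xs) = length xs - 1" using assms by (simp add: length_omit_nth)
  have "set (omit_nth a (omit_nth c xs)) = {omit_nth c xs ! t | t. t < length xs - 1 \<and> t \<noteq> a}"
    using set_omit_nth[of a "omit_nth c xs"] assms l by auto
  also have "\<dots> = {xs ! t | t. t < length xs \<and> t \<noteq> a \<and> t \<noteq> c}"
  proof (intro set_eqI iffI)
    fix x assume "x \<in> {omit_nth c xs ! t | t. t < length xs - 1 \<and> t \<noteq> a}"
    then obtain t where t: "t < length xs - 1" "t \<noteq> a" "x = xs ! (if t < c then t else Suc t)"
      using assms by (auto simp: omit_nth_nth simp del: if_split)
    then show "x \<in> {xs ! t | t. t < length xs \<and> t \<noteq> a \<and> t \<noteq> c}"
      using assms by (intro CollectI exI[of _ "if t < c then t else Suc t"]) auto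
  next
    fix x assume "x \<in> {xs ! t | t. t < length xs \<and> t \<noteq> a \<and> t \<noteq> c}"
    then obtain t where t: "t < length xs" "t \<noteq> a" "t \<noteq> c" "x = xs ! t" by auto
    define s where "s = (if t < c then t else t - 1)"
    have s: "s < length xs - 1" "(if s < c then s else Suc s) = t" "s \<noteq> a" using t assms by (auto simp: s_def)
    then have "omit_nth c xs ! s = x" using t assms by (simp add: omit_nth_nth)
    then show "x \<in> {omit_nth c xs ! t | t. t < length xs - 1 \<and> t \<noteq> a}" using s by auto
  qed
  finally show ?thesis ..
qed

lemma alternating_form_scale:
  assumes "alternating_form k \<alpha>"
  shows "alternating_form k (\<lambda>As. c * \<alpha> As)"
  unfolding alternating_form_def
proof (intro conjI allI impI)
  fix As :: "'a list" and i assume "length As = k \<and> i < k"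
  then have "linear (\<lambda>A. \<alpha> (As[i := A]))" using assms unfolding alternating_form_def by blast
  from linear_compose_scale_right[OF this, of c] show "linear (\<lambda>A. c * \<alpha> (As[i := A]))" by simp
next
  fix As :: "'a list" and i j assume "length As = k \<and> i < j \<and> j < k \<and> As ! i = As ! j"
  then have "\<alpha> As = 0" using assms unfolding alternating_form_def by blast
  then show "c * \<alpha> As = 0" by simp
qed

context carnot
begin

text \<open>A Euclidean space has positive dimension, so the frame is nonempty.\<close>

lemma ns_pos: "ns \<ge> 1"
proof (rule ccontr)
  assume "\<not> ns \<ge> 1"
  then have "I = {}" by (simp add: I_eq)
  then show False using card_I by simp
qed

lemma first_layer_I: "i \<in> {1..layer_dim G 1} \<Longrightarrow> (1, i) \<in> I"
  using ns_pos by (simp add: I_eq)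

definition "others i = filter (\<lambda>lv. lv \<noteq> (1, i)) (basis_indices G)"

lemma set_others: "set (others i) = I - {(1, i)}"
  by (auto simp: others_def I_def)

lemma mset_others: "i \<in> {1..layer_dim G 1} \<Longrightarrow> mset (basis_indices G) = mset ((1, i) # others i)"
proof -
  assume "i \<in> {1..layer_dim G 1}"
  then have "(1, i) \<in> set (basis_indices G)" using first_layer_I by (simp add: I_def)
  moreover have "others i = remove1 (1, i) (basis_indices G)"
    using distinct_remove1_removeAll[OF distinct_indices, of "(1, i)"]
    by (simp add: others_def removeAll_filter_not_eq) (metis (no_types, lifting))
  ultimately show ?thesis by simp
qed

lemma length_others: "i \<in> {1..layer_dim G 1} \<Longrightarrow> Suc (length (others i)) = DIM('a)"
  using mset_others[of i] length_indices by (metis length_Cons size_mset)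

text \<open>The whole coframe with \<open>(1, i)\<close> moved to the front, evaluated on the frame:
  a sign. It is the common factor of both integrals in the weak equation and is cancelled
  there.\<close>

definition "vol i = wedge_list (map (coframe G) ((1, i) # others i)) (frame G)"

lemma hat_coframe_eq: "hat_coframe G i = wedge_list (map (coframe G) (others i))"
  by (simp add: hat_coframe_def others_def)

lemma vol_nonzero:
  assumes i: "i \<in> {1..layer_dim G 1}"
  shows "vol i \<noteq> 0"
proof -
  let ?js = "(1, i) # others i"
  let ?n = "length ?js"
  obtain p where p: "p permutes {..<?n}" "permute_list p ?js = basis_indices G"
    using mset_eq_permutation[OF mset_others[OF i]] by blast
  have dist: "distinct ?js" and sub: "set ?js = I"
    using distinct_indices first_layer_I[OF i] by (auto simp: others_def I_def)
  have "frame G = permute_list p (map X ?js)"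
    using p permute_list_map[OF p(1), of X] by (simp add: frame_eq)
  also have "\<dots> = map (\<lambda>t. map X ?js ! p t) [0..<length (map (coframe G) ?js)]"
    by (simp add: permute_list_def)
  finally have "vol i = of_int (sign p) * wedge_list (map (coframe G) ?js) (map X ?js)"
    unfolding vol_def using wedge_list_permute[of p "map (coframe G) ?js" "map X ?js"] p(1) by simp
  moreover have "wedge_list (map (coframe G) ?js) (map X ?js) = 1"
  proof (rule wedge_list_dual)
    fix s t assume "s < length (map (coframe G) ?js)" "t < length (map (coframe G) ?js)"
    then have st: "s < ?n" "t < ?n" by simp_all
    then have "coframe G (?js ! s) (X (?js ! t)) = (if ?js ! s = ?js ! t then 1 else 0)"
      using sub by (intro coframe_X) (metis nth_mem)+
    moreover have "?js ! s = ?js ! t \<longleftrightarrow> s = t" by (rule nth_eq_iff_index_eq[OF dist st])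
    ultimately show "(map (coframe G) ?js ! s) (map X ?js ! t) = (if s = t then 1 else 0)"
      using st by (simp only: nth_map length_map)
  qed simp
  ultimately show ?thesis by simp
qed

lemma frame_nth: "t < DIM('a) \<Longrightarrow> frame G ! t = X (basis_indices G ! t)"
  "t < DIM('a) \<Longrightarrow> basis_indices G ! t \<in> I"
  using length_indices by (auto simp: frame_eq I_def)

lemma length_frame: "length (frame G) = DIM('a)"
  by (simp add: frame_eq length_indices)

lemma permuted_index:
  assumes "p permutes {..<DIM('a)}" "j \<in> I"
  obtains t where "t < DIM('a)" "basis_indices G ! p t = j"
proof -
  obtain s where "s < DIM('a)" "basis_indices G ! s = j"
    using assms(2) length_indices by (auto simp: I_def in_set_conv_nth)
  moreover from this obtain t where "t \<in> {..<DIM('a)}" "p t = s"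
    using permutes_image[OF assms(1)] by (metis imageE lessThan_iff)
  ultimately show thesis using that by auto
qed

text \<open>The hat form omits exactly the covector that is nonzero on \<open>X (1, i)\<close>, so
  this vector gives a zero column.\<close>

lemma hat_zero_vector:
  assumes i: "i \<in> {1..layer_dim G 1}" and As: "length As = DIM('a) - 1" "X (1, i) \<in> set As"
  shows "hat_coframe G i As = 0"
  unfolding hat_coframe_eq
proof (rule wedge_list_zero_vector[OF _ As(2)])
  show "length As = length (map (coframe G) (others i))" using As length_others[OF i] by simp
  fix \<sigma> assume "\<sigma> \<in> set (map (coframe G) (others i))"
  then obtain k where k: "k \<in> I" "k \<noteq> (1, i)" "\<sigma> = coframe G k" by (auto simp: set_others simp del: split_paired_Ex)
  show "\<sigma> (X (1, i)) = 0" unfolding k(3) coframe_X[OF k(1) first_layer_I[OF i]] using k(2) by simp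
qed

text \<open>Permutations that hand \<open>X (1, i)\<close> to \<open>\<beta>\<close> contribute 0;
  the others evaluate \<open>\<alpha>\<close> on it. So \<open>\<alpha>\<close> may be replaced by a
  multiple of the dual covector, which leaves \<open>vol i\<close>.\<close>

lemma wedge_hat_coframe:
  assumes i: "i \<in> {1..layer_dim G 1}"
    and \<beta>: "\<And>As. length As = DIM('a) - 1 \<Longrightarrow> \<beta> As = c * hat_coframe G i As"
  shows "wedge 1 (DIM('a) - 1) \<alpha> \<beta> (frame G) = c * \<alpha> [X (1, i)] * vol i"
proof -
  define m where "m = length (others i)"
  have m: "DIM('a) = Suc m" using length_others[OF i] by (simp add: m_def)
  let ?P = "{p. p permutes {..<Suc m}}"
  let ?tl = "\<lambda>p. map (\<lambda>t. frame G ! p (Suc t)) [0..<m]"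
  have "of_int (sign p) * \<alpha> [frame G ! p 0] * \<beta> (?tl p)
      = (c * \<alpha> [X (1, i)]) * (of_int (sign p) * coframe G (1, i) (frame G ! p 0) * hat_coframe G i (?tl p))"
    if p: "p permutes {..<Suc m}" for p
  proof -
    have lt: "p t < Suc m" if "t < Suc m" for t using permutes_in_image[OF p, of t] that by simp
    have 0: "frame G ! p 0 = X (basis_indices G ! p 0)" "basis_indices G ! p 0 \<in> I"
      using frame_nth lt[of 0] m by auto
    have b: "\<beta> (?tl p) = c * hat_coframe G i (?tl p)" by (rule \<beta>) (simp add: m)
    show ?thesis
    proof (cases "basis_indices G ! p 0 = (1, i)")
      case True
      then show ?thesis unfolding b using 0 coframe_X[OF first_layer_I[OF i] first_layer_I[OF i]] by simp
    next
      case False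
      obtain t where t: "t < Suc m" "basis_indices G ! p t = (1, i)"
        using permuted_index[OF p[folded m] first_layer_I[OF i]] m by metis
      then obtain t' where t': "t = Suc t'" using False by (cases t) auto
      have "X (1, i) = frame G ! p (Suc t')" using frame_nth(1)[of "p t"] lt[of t] t t' m by simp
      then have "X (1, i) \<in> set (?tl p)" using t t' by auto
      then have "hat_coframe G i (?tl p) = 0" by (intro hat_zero_vector[OF i]) (simp_all add: m)
      then show ?thesis unfolding b by simp
    qed
  qed
  then have "(\<Sum>p\<in>?P. of_int (sign p) * \<alpha> [frame G ! p 0] * \<beta> (?tl p))
      = (c * \<alpha> [X (1, i)]) * (\<Sum>p\<in>?P. of_int (sign p) * coframe G (1, i) (frame G ! p 0) * hat_coframe G i (?tl p))"
    unfolding sum_distrib_left by (intro sum.cong) auto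
  moreover have "vol i = (\<Sum>p\<in>?P. of_int (sign p) * coframe G (1, i) (frame G ! p 0) * hat_coframe G i (?tl p)) / fact m"
    unfolding vol_def using wedge_list_Cons[of "frame G" "map (coframe G) (others i)" "coframe G (1, i)"]
    by (simp add: length_frame m m_def[symmetric] hat_coframe_eq del: wedge_list.simps)
  ultimately show ?thesis
    using wedge_one_eq[of "frame G" m \<alpha> \<beta>] by (simp add: length_frame m)
qed

text \<open>These are the bracket terms in the exterior derivative of the hat form. Either
  \<open>X (1, i)\<close> remains among the arguments, a zero column, or it sits in the bracket, and
  then the covector dual to its partner is a zero row.\<close>

lemma hat_bracket_zero:
  assumes i: "i \<in> {1..layer_dim G 1}" and p: "p permutes {..<DIM('a)}" and ac: "a < c" "c < DIM('a)"
    and As: "As = map (\<lambda>t. frame G ! p t) [0..<DIM('a)]"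
  shows "hat_coframe G i (lie_bracket G (As ! a) (As ! c) # omit_nth a (omit_nth c As)) = 0"
proof -
  let ?n = "DIM('a)"
  let ?\<iota> = "\<lambda>t. basis_indices G ! p t"
  have lt: "p t < ?n" if "t < ?n" for t using permutes_in_image[OF p, of t] that by simp
  have Ast: "As ! t = X (?\<iota> t)" "?\<iota> t \<in> I" if "t < ?n" for t
    using frame_nth[OF lt[OF that]] that by (simp_all add: As)
  have inj: "?\<iota> s = ?\<iota> t \<longleftrightarrow> s = t" if "s < ?n" "t < ?n" for s t
    using nth_eq_iff_index_eq[OF distinct_indices] lt[OF that(1)] lt[OF that(2)] length_indices
      permutes_inj[OF p] by (auto simp: inj_def)
  have lAs: "length As = ?n" by (simp add: As)
  have rest: "set (omit_nth a (omit_nth c As)) = {As ! t | t. t < ?n \<and> t \<noteq> a \<and> t \<noteq> c}"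
    using set_omit_nth2[of a c As] ac lAs by simp
  have len: "length (lie_bracket G (As ! a) (As ! c) # omit_nth a (omit_nth c As)) = ?n - 1"
    using ac lAs by (simp add: length_omit_nth)
  have a: "a < ?n" using ac by simp
  obtain t0 where t0: "t0 < ?n" "?\<iota> t0 = (1, i)" using permuted_index[OF p first_layer_I[OF i]] by blast
  show ?thesis
  proof (cases "t0 = a \<or> t0 = c")
    case False
    then have "As ! t0 \<in> set (omit_nth a (omit_nth c As))" unfolding rest using t0(1) by blast
    then have "X (1, i) \<in> set (omit_nth a (omit_nth c As))" using Ast(1)[OF t0(1)] t0(2) by simp
    then show ?thesis by (intro hat_zero_vector[OF i len]) simp
  next
    case True
    \<comment> \<open>The partner of \<open>X (1, i)\<close> in the bracket. Its covector kills the
      bracket because brackets raise the weight.\<close>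
    define s where "s = (if t0 = a then c else a)"
    have s: "s < ?n" "s \<noteq> t0" "{s, t0} = {a, c}" using True a ac by (auto simp: s_def)
    have sI: "?\<iota> s \<in> I - {(1, i)}" using Ast(2)[OF s(1)] inj[OF s(1) t0(1)] s(2) t0(2) by auto
    show ?thesis unfolding hat_coframe_eq
    proof (rule wedge_list_zero_covector)
      show "length (lie_bracket G (As ! a) (As ! c) # omit_nth a (omit_nth c As)) = length (map (coframe G) (others i))"
        using len length_others[OF i] by simp
      show "coframe G (?\<iota> s) \<in> set (map (coframe G) (others i))" using sI by (simp add: set_others)
      fix A assume "A \<in> set (lie_bracket G (As ! a) (As ! c) # omit_nth a (omit_nth c As))"
      then consider "A = lie_bracket G (As ! a) (As ! c)" | "A \<in> set (omit_nth a (omit_nth c As))" by auto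
      then show "coframe G (?\<iota> s) A = 0"
      proof cases
        case 1
        show ?thesis
        proof (cases "t0 = a")
          case True
          then show ?thesis unfolding 1 using coframe_bracket' sI Ast[OF s(1)] by (simp add: s_def)
        next
          case False
          then show ?thesis unfolding 1 using coframe_bracket sI Ast[OF s(1)] by (simp add: s_def)
        qed
      next
        case 2
        then obtain t where t: "t < ?n" "t \<noteq> a" "t \<noteq> c" "A = As ! t" unfolding rest by blast
        then have "t \<noteq> s" using s(3) by auto
        then show ?thesis using coframe_X[OF Ast(2)[OF s(1)] Ast(2)[OF t(1)]] inj[OF s(1) t(1)] t Ast(1)[OF t(1)] by simp
      qed
    qed
  qed
qed

lemma left_deriv_mult_const:
  fixes b :: "'g \<Rightarrow> real"
  assumes "smooth_fun_on G UNIV b"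
  shows "left_deriv G A (\<lambda>y. b y * c) x = left_deriv G A b x * c"
  by (rule left_deriv_eqI[OF has_derivative_mult_left[OF has_left_deriv_smooth[OF assms]]])

text \<open>Only the derivative of \<open>b\<close> along \<open>X (1, i)\<close> survives. Wedging
  with a 0-form still antisymmetrises over all permutations of the frame;
  \<open>antisymmetrised_laplace\<close> evaluates this sum, and its factor \<open>Suc m\<close> is
  absorbed by the factorial.\<close>

lemma wedge_ext_deriv:
  fixes b :: "'g \<Rightarrow> real"
  assumes i: "i \<in> {1..layer_dim G 1}" and b: "smooth_fun_on G UNIV b"
  shows "wedge 0 DIM('a) \<gamma> (ext_deriv G (\<lambda>x As. b x * hat_coframe G i As) x) (frame G)
     = \<gamma> [] * left_deriv G (X (1, i)) b x * vol i"
proof -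
  define m where "m = length (others i)"
  have m: "DIM('a) = Suc m" using length_others[OF i] by (simp add: m_def)
  let ?n = "DIM('a)"
  let ?D = "left_deriv G (X (1, i)) b x"
  let ?P = "{p. p permutes {..<Suc m}}"
  let ?As = "\<lambda>p. map (\<lambda>t. frame G ! p t) [0..<Suc m]"
  have ext: "ext_deriv G (\<lambda>x As. b x * hat_coframe G i As) x (?As p)
     = (\<Sum>k<Suc m. (-1) ^ k * (coframe G (1, i) (frame G ! p k) * hat_coframe G i (omit_nth k (?As p)))) * ?D"
    if p: "p permutes {..<Suc m}" for p
  proof -
    have lt: "p t < Suc m" if "t < Suc m" for t using permutes_in_image[OF p, of t] that by simp
    have l: "length (?As p) = Suc m" by simp
    have br: "hat_coframe G i (lie_bracket G (?As p ! a) (?As p ! c) # omit_nth a (omit_nth c (?As p))) = 0"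
      if "a < c" "c < Suc m" for a c
      by (rule hat_bracket_zero[OF i p[folded m] that(1)]) (use that m in simp_all)
    have first: "left_deriv G (?As p ! k) (\<lambda>y. b y * hat_coframe G i (omit_nth k (?As p))) x
        = coframe G (1, i) (frame G ! p k) * hat_coframe G i (omit_nth k (?As p)) * ?D" if k: "k < Suc m" for k
    proof -
      have Ask: "?As p ! t = frame G ! p t" if "t < Suc m" for t using that by (simp del: upt_Suc)
      have Fk: "frame G ! p t = X (basis_indices G ! p t)" "basis_indices G ! p t \<in> I" if "t < Suc m" for t
        using frame_nth[of "p t"] lt[OF that] m by auto
      show ?thesis
      proof (cases "basis_indices G ! p k = (1, i)")
        case True
        then show ?thesis unfolding left_deriv_mult_const[OF b] Ask[OF k] Fk(1)[OF k]
          using coframe_X[OF first_layer_I[OF i] first_layer_I[OF i]] by simp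
      next
        case False
        obtain t where t: "t < Suc m" "basis_indices G ! p t = (1, i)"
          using permuted_index[OF p[folded m] first_layer_I[OF i]] m by metis
        then have tk: "t \<noteq> k" using False by auto
        have "?As p ! t \<in> set (omit_nth k (?As p))" using t(1) tk k set_omit_nth[of k "?As p"] l by auto
        then have "X (1, i) \<in> set (omit_nth k (?As p))" unfolding Ask[OF t(1)] Fk(1)[OF t(1)] t(2) .
        then have "hat_coframe G i (omit_nth k (?As p)) = 0"
          using k by (intro hat_zero_vector[OF i]) (simp_all add: m length_omit_nth)
        then show ?thesis unfolding left_deriv_mult_const[OF b] by simp
      qed
    qed
    have "ext_deriv G (\<lambda>x As. b x * hat_coframe G i As) x (?As p) =
       (\<Sum>k<Suc m. (-1) ^ k * left_deriv G (?As p ! k) (\<lambda>y. b y * hat_coframe G i (omit_nth k (?As p))) x) +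
       (\<Sum>c<Suc m. \<Sum>a<c. (-1) ^ (a + c) *
          (b x * hat_coframe G i (lie_bracket G (?As p ! a) (?As p ! c) # omit_nth a (omit_nth c (?As p)))))"
      unfolding ext_deriv_def l ..
    also have "(\<Sum>c<Suc m. \<Sum>a<c. (-1) ^ (a + c) *
          (b x * hat_coframe G i (lie_bracket G (?As p ! a) (?As p ! c) # omit_nth a (omit_nth c (?As p))))) = 0"
      by (intro sum.neutral ballI) (use br in simp)
    also have "(\<Sum>k<Suc m. (-1) ^ k * left_deriv G (?As p ! k) (\<lambda>y. b y * hat_coframe G i (omit_nth k (?As p))) x)
      = (\<Sum>k<Suc m. (-1) ^ k * (coframe G (1, i) (frame G ! p k) * hat_coframe G i (omit_nth k (?As p)))) * ?D"
      unfolding sum_distrib_right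
    proof (rule sum.cong[OF refl])
      fix k assume "k \<in> {..<Suc m}"
      then show "(-1) ^ k * left_deriv G (?As p ! k) (\<lambda>y. b y * hat_coframe G i (omit_nth k (?As p))) x =
        (-1) ^ k * (coframe G (1, i) (frame G ! p k) * hat_coframe G i (omit_nth k (?As p))) * ?D"
        using first[of k] by (simp only: lessThan_iff mult.assoc)
    qed
    finally show ?thesis by simp
  qed
  have vol: "(\<Sum>p\<in>?P. of_int (sign p) * coframe G (1, i) (frame G ! p 0) *
      hat_coframe G i (map (\<lambda>t. frame G ! p (Suc t)) [0..<m])) = vol i * fact m"
    unfolding vol_def using wedge_list_Cons[of "frame G" "map (coframe G) (others i)" "coframe G (1, i)"]
    by (simp add: length_frame m m_def[symmetric] hat_coframe_eq del: wedge_list.simps)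
  have "wedge 0 ?n \<gamma> (ext_deriv G (\<lambda>x As. b x * hat_coframe G i As) x) (frame G) =
     (\<Sum>p\<in>?P. of_int (sign p) * \<gamma> [] * ext_deriv G (\<lambda>x As. b x * hat_coframe G i As) x (?As p)) / fact (Suc m)"
    unfolding wedge_def m by simp
  also have "(\<Sum>p\<in>?P. of_int (sign p) * \<gamma> [] * ext_deriv G (\<lambda>x As. b x * hat_coframe G i As) x (?As p)) =
     (\<Sum>p\<in>?P. of_int (sign p) * (\<Sum>k<Suc m. (-1) ^ k * (coframe G (1, i) (frame G ! p k) *
         hat_coframe G i (omit_nth k (?As p)))) * (?D * \<gamma> []))"
    by (rule sum.cong[OF refl]) (simp only: ext mem_Collect_eq mult_ac)
  also have "\<dots> = real (Suc m) * (vol i * fact m) * (?D * \<gamma> [])"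
    unfolding sum_distrib_right[symmetric]
    using antisymmetrised_laplace[of "frame G" m "coframe G (1, i)" "hat_coframe G i"] vol
    by (simp only: length_frame m)
  finally have "wedge 0 ?n \<gamma> (ext_deriv G (\<lambda>x As. b x * hat_coframe G i As) x) (frame G)
      = real (Suc m) * (vol i * fact m) * (?D * \<gamma> []) / (real (Suc m) * fact m)" by (simp only: fact_Suc of_nat_mult)
  also have "\<dots> = \<gamma> [] * ?D * vol i" by (simp del: of_nat_Suc)
  finally show ?thesis .
qed

text \<open>The weak condition is tested with a left-invariant covector of weight at least two,
  which is vertical, and with \<open>b\<close> times a hat form. All forms then reduce to scalars
  times \<open>vol i\<close>, which is divided out.\<close>

lemma weak_equation:
  fixes b :: "'g \<Rightarrow> real"
  assumes Z: "weak_contact_field G \<mu> U Z" and b: "smooth_fun_on G UNIV b"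
    and K: "compact K" "K \<subseteq> U" "\<And>x. x \<notin> K \<Longrightarrow> b x = 0"
    and i: "i \<in> {1..layer_dim G 1}" and j: "j \<in> I" "fst j \<noteq> 1"
  shows "set_lebesgue_integral (completion \<mu>) U (\<lambda>x. coframe G j (lie_bracket G (Z x) (X (1, i))) * b x) +
     set_lebesgue_integral (completion \<mu>) U (\<lambda>x. coframe G j (Z x) * left_deriv G (X (1, i)) b x) = 0"
proof -
  let ?\<eta> = "\<lambda>x As. coframe G j (As ! 0)"
  let ?\<beta> = "\<lambda>x As. b x * hat_coframe G i As"
  have bs: "Ck_fun_on G k V b" for k V by (rule Ck_fun_on_subset[OF smooth_fun_onD[OF b]]) simp
  have len: "length (others i) = DIM('a) - 1" using length_others[OF i] by simp
  have \<eta>: "smooth_form_on G 1 U ?\<eta>" unfolding smooth_form_on_def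
  proof (intro conjI ballI allI impI)
    show "alternating_form 1 (\<lambda>As. coframe G j (As ! 0))"
      unfolding alternating_form_def using coframe_linear[of j] by auto
    show "smooth_fun_on G U (\<lambda>x. coframe G j (As ! 0))" for As
      by (rule smooth_fun_onI) (rule Ck_fun_on_const)
  qed
  have ver: "vertical G \<mu> U ?\<eta>" unfolding vertical_def
    using horizontal_iff j by auto
  have alt: "alternating_form (DIM('a) - 1) (hat_coframe G i)"
  proof -
    have "alternating_form (length (map (coframe G) (others i))) (wedge_list (map (coframe G) (others i)))"
      by (rule alternating_wedge_list) (auto intro: coframe_linear)
    then show ?thesis by (simp add: len hat_coframe_eq)
  qed
  have \<beta>: "smooth_form_on G (DIM('a) - 1) U ?\<beta>" unfolding smooth_form_on_def
  proof (intro conjI ballI allI impI)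
    show "alternating_form (DIM('a) - 1) (\<lambda>As. b x * hat_coframe G i As)" for x
      by (rule alternating_form_scale[OF alt])
    show "smooth_fun_on G U (\<lambda>x. b x * hat_coframe G i As)" for As
    proof (rule smooth_fun_onI, rule Ck_fun_on_subset)
      show "Ck_fun_on G k UNIV (\<lambda>x. b x * hat_coframe G i As)" for k
        by (intro Ck_fun_on_mult bs Ck_fun_on_const open_UNIV)
    qed simp
  qed
  have cs: "compactly_supported_form (DIM('a) - 1) U ?\<beta>"
    unfolding compactly_supported_form_def using K by (intro exI[of _ K]) auto
  have hw: "horizontal_weight G U ?\<beta>"
    unfolding horizontal_weight_def
  proof (intro exI[of _ "\<lambda>k x. if k = i then b x else 0"] ballI allI impI)
    fix x As
    have "(\<Sum>k = 1..layer_dim G 1. (if k = i then b x else 0) * hat_coframe G k As)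
       = (\<Sum>k = 1..layer_dim G 1. if k = i then b x * hat_coframe G i As else 0)"
      by (intro sum.cong) auto
    also have "\<dots> = b x * hat_coframe G i As" using i by simp
    finally show "b x * hat_coframe G i As = (\<Sum>k = 1..layer_dim G 1. (if k = i then b x else 0) * hat_coframe G k As)" ..
  qed
  have lc: "left_deriv G A (\<lambda>y. r) x = 0" for A x and r :: real by (simp add: left_deriv_eq)
  \<comment> \<open>The coefficients of \<open>?\<eta>\<close> are constant, so only the bracket
    term remains, with sign -1.\<close>
  have d\<eta>: "interior_mult Z (ext_deriv G ?\<eta>) x [X (1, i)] = - coframe G j (lie_bracket G (Z x) (X (1, i)))" for x
    by (simp add: interior_mult_def ext_deriv_def lc lessThan_Suc numeral_2_eq_2)
  have "form_integral G \<mu> U (\<lambda>x. wedge 1 (DIM('a) - 1) (interior_mult Z (ext_deriv G ?\<eta>) x) (?\<beta> x)) -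
     form_integral G \<mu> U (\<lambda>x. wedge 0 (DIM('a)) (interior_mult Z ?\<eta> x) (ext_deriv G ?\<beta> x)) = 0"
    using Z \<eta> ver \<beta> cs hw unfolding weak_contact_field_def by blast
  moreover have e1: "wedge 1 (DIM('a) - 1) (interior_mult Z (ext_deriv G ?\<eta>) x) (?\<beta> x) (frame G)
     = (coframe G j (lie_bracket G (Z x) (X (1, i))) * b x) * (- vol i)" for x
    using wedge_hat_coframe[OF i, of "?\<beta> x" "b x" "interior_mult Z (ext_deriv G ?\<eta>) x"] d\<eta>[of x] by simp
  moreover have e2: "wedge 0 (DIM('a)) (interior_mult Z ?\<eta> x) (ext_deriv G ?\<beta> x) (frame G)
     = (coframe G j (Z x) * left_deriv G (X (1, i)) b x) * vol i" for x
    unfolding wedge_ext_deriv[OF i b] by (simp add: interior_mult_def)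
  ultimately have "set_lebesgue_integral (completion \<mu>) U (\<lambda>x. coframe G j (lie_bracket G (Z x) (X (1, i))) * b x) * (- vol i) -
     set_lebesgue_integral (completion \<mu>) U (\<lambda>x. coframe G j (Z x) * left_deriv G (X (1, i)) b x) * vol i = 0"
    by (simp only: form_integral_def set_integral_mult_left)
  then have "(set_lebesgue_integral (completion \<mu>) U (\<lambda>x. coframe G j (lie_bracket G (Z x) (X (1, i))) * b x) +
     set_lebesgue_integral (completion \<mu>) U (\<lambda>x. coframe G j (Z x) * left_deriv G (X (1, i)) b x)) * vol i = 0"
    by (simp add: algebra_simps)
  then show ?thesis using vol_nonzero[OF i] by simp
qed

end

section \<open>Finite-dimensional spaces of functions\<close>

text \<open>Equality is required on \<open>S\<close> only, and the index type is free: the indices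
  are pairs of a point and a basis vector, later pairs of a test function and a basis
  vector.\<close>

definition fun_span :: "'i set \<Rightarrow> nat \<Rightarrow> (nat \<Rightarrow> 'i \<Rightarrow> real) \<Rightarrow> ('i \<Rightarrow> real) \<Rightarrow> bool" where
  "fun_span S N Y f \<longleftrightarrow> (\<exists>c. \<forall>i\<in>S. f i = (\<Sum>j<N. c j * Y j i))"

text \<open>Finite-dimensional duality by Gaussian elimination on \<open>N\<close>: finitely many
  evaluations detect a function outside the span. Setting \<open>a\<close> to 0 off \<open>F\<close>
  allows supports to be united.\<close>

lemma annihilator_exists:
  assumes "\<not> fun_span S N Y f"
  shows "\<exists>F a. finite F \<and> F \<subseteq> S \<and> (\<forall>i. i \<notin> F \<longrightarrow> a i = 0) \<and>
     (\<forall>j<N. (\<Sum>i\<in>F. a i * Y j i) = 0) \<and> (\<Sum>i\<in>F. a i * f i) \<noteq> (0::real)"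
  using assms
proof (induction N arbitrary: f)
  case 0
  then obtain i where i: "i \<in> S" "f i \<noteq> 0" by (auto simp: fun_span_def)
  then show ?case by (intro exI[of _ "{i}"] exI[of _ "\<lambda>k. if k = i then 1 else 0"]) auto
next
  case (Suc N)
  show ?case
  proof (cases "fun_span S N Y (Y N)")
    case True
    then obtain d where d: "\<And>i. i \<in> S \<Longrightarrow> Y N i = (\<Sum>j<N. d j * Y j i)" by (auto simp: fun_span_def)
    have "\<not> fun_span S N Y f"
    proof
      assume "fun_span S N Y f"
      then obtain c where "\<And>i. i \<in> S \<Longrightarrow> f i = (\<Sum>j<N. c j * Y j i)" by (auto simp: fun_span_def)
      then have "fun_span S (Suc N) Y f" unfolding fun_span_def by (intro exI[of _ "c(N := 0)"]) simp
      with Suc.prems show False by simp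
    qed
    from Suc.IH[OF this] obtain F a where Fa: "finite F" "F \<subseteq> S" "\<forall>i. i \<notin> F \<longrightarrow> a i = 0"
      "\<And>j. j < N \<Longrightarrow> (\<Sum>i\<in>F. a i * Y j i) = 0" "(\<Sum>i\<in>F. a i * f i) \<noteq> 0" by blast
    have "(\<Sum>i\<in>F. a i * Y N i) = (\<Sum>i\<in>F. \<Sum>j<N. d j * (a i * Y j i))"
      using d Fa(2) by (intro sum.cong) (auto simp: sum_distrib_left mult_ac)
    also have "\<dots> = (\<Sum>j<N. d j * (\<Sum>i\<in>F. a i * Y j i))" by (subst sum.swap) (simp add: sum_distrib_left)
    also have "\<dots> = 0" using Fa(4) by simp
    finally have "(\<Sum>i\<in>F. a i * Y N i) = 0" .
    with Fa show ?thesis by (intro exI[of _ F] exI[of _ a]) (auto simp: less_Suc_eq)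
  next
    case False
    from Suc.IH[OF this] obtain F1 a1 where 1: "finite F1" "F1 \<subseteq> S" "\<forall>i. i \<notin> F1 \<longrightarrow> a1 i = 0"
      "\<And>j. j < N \<Longrightarrow> (\<Sum>i\<in>F1. a1 i * Y j i) = 0" "(\<Sum>i\<in>F1. a1 i * Y N i) \<noteq> 0" by blast
    define r where "r = (\<Sum>i\<in>F1. a1 i * f i) / (\<Sum>i\<in>F1. a1 i * Y N i)"
    have "\<not> fun_span S N Y (\<lambda>i. f i - r * Y N i)"
    proof
      assume "fun_span S N Y (\<lambda>i. f i - r * Y N i)"
      then obtain c where c: "\<And>i. i \<in> S \<Longrightarrow> f i - r * Y N i = (\<Sum>j<N. c j * Y j i)" by (auto simp: fun_span_def)
      have "fun_span S (Suc N) Y f" unfolding fun_span_def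
      proof (intro exI[of _ "c(N := r)"] ballI)
        fix i assume "i \<in> S"
        then show "f i = (\<Sum>j<Suc N. (c(N := r)) j * Y j i)" using c[of i] by simp
      qed
      with Suc.prems show False by simp
    qed
    from Suc.IH[OF this] obtain F2 a2 where 2: "finite F2" "F2 \<subseteq> S" "\<forall>i. i \<notin> F2 \<longrightarrow> a2 i = 0"
      "\<And>j. j < N \<Longrightarrow> (\<Sum>i\<in>F2. a2 i * Y j i) = 0" "(\<Sum>i\<in>F2. a2 i * (f i - r * Y N i)) \<noteq> 0" by blast
    \<comment> \<open>Subtracting \<open>q\<close> times the first functional cancels the value on
      \<open>Y N\<close>. By the choice of \<open>r\<close>, the value on \<open>f\<close> becomes
      that of the second functional on \<open>f - r * Y N\<close>, which is nonzero.\<close>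
    define q where "q = (\<Sum>i\<in>F2. a2 i * Y N i) / (\<Sum>i\<in>F1. a1 i * Y N i)"
    let ?F = "F1 \<union> F2" and ?a = "\<lambda>i. a2 i - q * a1 i"
    have comb: "(\<Sum>i\<in>?F. ?a i * g i) = (\<Sum>i\<in>F2. a2 i * g i) - q * (\<Sum>i\<in>F1. a1 i * g i)" for g
    proof -
      have "(\<Sum>i\<in>?F. a1 i * g i) = (\<Sum>i\<in>F1. a1 i * g i)"
        by (rule sum.mono_neutral_right) (use 1 2 in auto)
      moreover have "(\<Sum>i\<in>?F. a2 i * g i) = (\<Sum>i\<in>F2. a2 i * g i)"
        by (rule sum.mono_neutral_right) (use 1 2 in auto)
      ultimately show ?thesis by (simp add: left_diff_distrib sum_subtractf mult.assoc flip: sum_distrib_left)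
    qed
    have "(\<Sum>i\<in>?F. ?a i * Y N i) = 0" unfolding comb unfolding q_def using 1(5) by simp
    moreover have "(\<Sum>i\<in>?F. ?a i * f i) \<noteq> 0"
    proof -
      have "(\<Sum>i\<in>F2. a2 i * (f i - r * Y N i)) = (\<Sum>i\<in>F2. a2 i * f i) - r * (\<Sum>i\<in>F2. a2 i * Y N i)"
        by (simp add: right_diff_distrib sum_subtractf sum_distrib_left mult_ac)
      also have "\<dots> = (\<Sum>i\<in>?F. ?a i * f i)" unfolding comb unfolding q_def r_def by simp
      finally show ?thesis using 2(5) by simp
    qed
    ultimately show ?thesis using 1 2 comb
      by (intro exI[of _ ?F] exI[of _ ?a]) (auto simp: less_Suc_eq)
  qed
qed

text \<open>An annihilator uses finitely many indices, so it passes to a pointwise limit.\<close>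

lemma fun_span_limit:
  assumes "\<And>m. fun_span S N Y (f m)" "\<And>i. i \<in> S \<Longrightarrow> (\<lambda>m. f m i) \<longlonglongrightarrow> g i"
  shows "fun_span S N Y g"
proof (rule ccontr)
  assume "\<not> fun_span S N Y g"
  from annihilator_exists[OF this] obtain F a where Fa: "finite F" "F \<subseteq> S"
     "\<forall>j<N. (\<Sum>i\<in>F. a i * Y j i) = 0" "(\<Sum>i\<in>F. a i * g i) \<noteq> 0" by blast
  have "(\<Sum>i\<in>F. a i * f m i) = 0" for m
  proof -
    obtain c where c: "\<And>i. i \<in> S \<Longrightarrow> f m i = (\<Sum>j<N. c j * Y j i)" using assms(1)[of m] by (auto simp: fun_span_def)
    have "(\<Sum>i\<in>F. a i * f m i) = (\<Sum>i\<in>F. \<Sum>j<N. c j * (a i * Y j i))"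
      using c Fa(2) by (intro sum.cong) (auto simp: sum_distrib_left mult_ac)
    also have "\<dots> = (\<Sum>j<N. c j * (\<Sum>i\<in>F. a i * Y j i))" by (subst sum.swap) (simp add: sum_distrib_left)
    also have "\<dots> = 0" using Fa(3) by simp
    finally show ?thesis .
  qed
  moreover have "(\<lambda>m. \<Sum>i\<in>F. a i * f m i) \<longlonglongrightarrow> (\<Sum>i\<in>F. a i * g i)"
    using Fa(2) by (intro tendsto_intros assms(2)) auto
  ultimately show False using Fa(4) by (simp add: tendsto_const_iff)
qed

text \<open>Spanning functions can be chosen in \<open>H\<close> itself. In the induction step some
  \<open>h0\<close> in \<open>H\<close> involves \<open>Y N\<close>; it becomes a generator, and its
  multiples remove \<open>Y N\<close> from the other members.\<close>

lemma fun_span_generators: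
  assumes "\<And>h. h \<in> H \<Longrightarrow> fun_span S N Y h"
  shows "\<exists>r g. (\<forall>j<r. g j \<in> H) \<and> (\<forall>h\<in>H. fun_span S r g h)"
  using assms
proof (induction N arbitrary: H)
  case 0
  then show ?case by (intro exI[of _ 0]) auto
next
  case (Suc N)
  show ?case
  proof (cases "\<forall>h\<in>H. fun_span S N Y h")
    case True
    then show ?thesis using Suc.IH[of H] by blast
  next
    case False
    then obtain h0 where h0: "h0 \<in> H" "\<not> fun_span S N Y h0" by blast
    obtain c0 where c0: "\<And>i. i \<in> S \<Longrightarrow> h0 i = (\<Sum>j<Suc N. c0 j * Y j i)"
      using Suc.prems[OF h0(1)] by (auto simp: fun_span_def)
    have cN: "c0 N \<noteq> 0"
    proof
      assume "c0 N = 0"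
      then have "fun_span S N Y h0" unfolding fun_span_def using c0 by (intro exI[of _ c0]) simp
      with h0 show False by simp
    qed
    have "\<exists>d. fun_span S N Y (\<lambda>i. h i - d * h0 i)" if h: "h \<in> H" for h
    proof -
      obtain c where c: "\<And>i. i \<in> S \<Longrightarrow> h i = (\<Sum>j<Suc N. c j * Y j i)"
        using Suc.prems[OF h] by (auto simp: fun_span_def)
      have "h i - (c N / c0 N) * h0 i = (\<Sum>j<N. (c j - (c N / c0 N) * c0 j) * Y j i)" if "i \<in> S" for i
      proof -
        have "(\<Sum>j<N. (c j - (c N / c0 N) * c0 j) * Y j i) = (\<Sum>j<N. c j * Y j i) - (c N / c0 N) * (\<Sum>j<N. c0 j * Y j i)"
          by (simp add: left_diff_distrib sum_subtractf sum_distrib_left mult.assoc)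
        moreover have "(c N / c0 N) * (c0 N * Y N i) = c N * Y N i" using cN by simp
        ultimately show ?thesis using c[OF that] c0[OF that] by (simp add: distrib_left)
      qed
      then have "fun_span S N Y (\<lambda>i. h i - (c N / c0 N) * h0 i)"
        unfolding fun_span_def by (intro exI[of _ "\<lambda>j. c j - (c N / c0 N) * c0 j"]) blast
      then show ?thesis ..
    qed
    then obtain d where d: "\<And>h. h \<in> H \<Longrightarrow> fun_span S N Y (\<lambda>i. h i - d h * h0 i)" by metis
    let ?H = "(\<lambda>h i. h i - d h * h0 i) ` H"
    obtain r g where g: "\<forall>j<r. g j \<in> ?H" "\<forall>h\<in>?H. fun_span S r g h" using Suc.IH[of ?H] d by blast
    then have "\<forall>j. \<exists>k. j < r \<longrightarrow> k \<in> H \<and> g j = (\<lambda>i. k i - d k * h0 i)" by blast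
    then obtain k where k: "\<And>j. j < r \<Longrightarrow> k j \<in> H" "\<And>j. j < r \<Longrightarrow> g j = (\<lambda>i. k j i - d (k j) * h0 i)" by metis
    have "fun_span S (Suc r) (k(r := h0)) h" if h: "h \<in> H" for h
    proof -
      obtain c where c: "\<And>i. i \<in> S \<Longrightarrow> h i - d h * h0 i = (\<Sum>j<r. c j * g j i)"
        using g(2) h by (fastforce simp: fun_span_def)
      show ?thesis unfolding fun_span_def
      proof (intro exI[of _ "c(r := d h - (\<Sum>j<r. c j * d (k j)))"] ballI)
        fix i assume i: "i \<in> S"
        have "(\<Sum>j<r. c j * g j i) = (\<Sum>j<r. c j * k j i) - (\<Sum>j<r. c j * d (k j)) * h0 i"
          by (simp add: k(2) right_diff_distrib sum_subtractf sum_distrib_right mult.assoc)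
        then show "h i = (\<Sum>j<Suc r. (c(r := d h - (\<Sum>j<r. c j * d (k j)))) j * (k(r := h0)) j i)"
          using c[OF i] by (simp add: algebra_simps)
      qed
    qed
    moreover have "\<forall>j<Suc r. (k(r := h0)) j \<in> H" using k(1) h0(1) by (simp add: less_Suc_eq)
    ultimately show ?thesis by blast
  qed
qed

text \<open>Bounded coefficients give a holomorphic function on the unit disc. The infinite set
  \<open>T\<close> accumulates at a point of \<open>[0, 1/2]\<close>, inside the disc, and the
  identity theorem applies.\<close>

lemma power_series_zero_coefficients:
  fixes a :: "nat \<Rightarrow> real"
  assumes bound: "\<And>m. \<bar>a m\<bar> \<le> B" and T: "T \<subseteq> {0<..<1/2}" "infinite T"
    and zero: "\<And>t. t \<in> T \<Longrightarrow> (\<lambda>m. a m * t ^ m) sums 0"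
  shows "a k = 0"
proof -
  have sm: "summable (\<lambda>m. complex_of_real (a m) * z ^ m)" if "norm z < 1" for z
  proof (rule summable_comparison_test')
    show "summable (\<lambda>m. B * norm z ^ m)" using that by (intro summable_mult summable_geometric) simp
    show "norm (complex_of_real (a m) * z ^ m) \<le> B * norm z ^ m" for m
      using bound[of m] by (simp add: norm_mult norm_power mult_right_mono)
  qed
  define f where "f = (\<lambda>z. \<Sum>m. complex_of_real (a m) * z ^ m)"
  have f: "(\<lambda>m. complex_of_real (a m) * (z - 0) ^ m) sums f z" if "z \<in> ball 0 1" for z
    using sm[of z] that by (simp add: f_def summable_sums)
  have hol: "f holomorphic_on ball 0 1" by (rule power_series_holomorphic[OF f])
  have "bounded T" using T(1) by (intro bounded_subset[OF bounded_closed_interval[of 0 "1/2"]]) auto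
  then have "compact (closure T)" by simp
  then obtain \<xi> where \<xi>: "\<xi> \<in> closure T" "\<xi> islimpt T"
    using Heine_Borel_imp_Bolzano_Weierstrass[OF _ T(2)] closure_subset by blast
  have "closure T \<subseteq> {0..1/2}" by (rule closure_minimal) (use T(1) in auto)
  then have \<xi>': "complex_of_real \<xi> \<in> ball 0 1" using \<xi>(1) by auto
  have lim: "complex_of_real \<xi> islimpt complex_of_real ` T"
    unfolding islimpt_approachable
  proof (intro allI impI)
    fix e :: real assume "e > 0"
    then obtain x where "x \<in> T" "x \<noteq> \<xi>" "dist x \<xi> < e" using \<xi>(2) unfolding islimpt_approachable by blast
    then show "\<exists>x'\<in>complex_of_real ` T. x' \<noteq> complex_of_real \<xi> \<and> dist x' (complex_of_real \<xi>) < e"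
      by (intro bexI[of _ "complex_of_real x"]) (auto simp: dist_of_real)
  qed
  have fT: "f z = 0" if "z \<in> complex_of_real ` T" for z
  proof -
    obtain t where t: "t \<in> T" "z = complex_of_real t" using \<open>z \<in> _\<close> by blast
    have "(\<lambda>m. complex_of_real (a m * t ^ m)) sums complex_of_real 0" using zero[OF t(1)] by (simp only: sums_of_real)
    then have "(\<lambda>m. complex_of_real (a m) * (z - 0) ^ m) sums 0" by (simp add: t)
    moreover have "z \<in> ball 0 1" using t T(1) by force
    ultimately show ?thesis using sums_unique2[OF f] by blast
  qed
  have f0: "f z = 0" if "z \<in> ball 0 1" for z
    by (rule analytic_continuation[OF hol open_ball connected_ball _ \<xi>' lim fT that]) (use T(1) in force)
  have "complex_of_real (a k) = 0"
  proof (rule ccontr)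
    assume ne: "complex_of_real (a k) \<noteq> 0"
    show False
    proof (cases "k = 0")
      case True
      then show ?thesis using f0[of 0] ne powser_zero[of "\<lambda>m. complex_of_real (a m)"] by (simp add: f_def)
    next
      case False
      obtain s where s: "0 < s" "\<And>z. z \<in> cball 0 s - {0} \<Longrightarrow> f z \<noteq> 0"
        using powser_0_nonzero[of 1 0 "\<lambda>m. complex_of_real (a m)" f k] f f0[of 0] ne False
        by (auto simp: dist_norm)
      have "f (complex_of_real (min s (1/2))) = 0" using s(1) by (intro f0) auto
      moreover have "complex_of_real (min s (1/2)) \<in> cball 0 s - {0}" using s(1) by auto
      ultimately show False using s(2) by blast
    qed
  qed
  then show ?thesis by simp
qed

section \<open>Germs of contact fields on a common neighbourhood\<close>

context lie_grp
begin

text \<open>Sends a Lie algebra vector to the coordinates, in the chart \<open>\<phi>\<close>, of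
  its left translate at \<open>x\<close>.\<close>

definition "left_triv \<phi> x = frechet_derivative (\<lambda>u. \<phi> (x \<cdot> xi u)) (at og)"

text \<open>The direction \<open>left_triv \<phi> x A\<close> does not depend on \<open>F\<close>,
  so convergence of derivatives in a chart gives convergence of left derivatives.\<close>

lemma left_deriv_chart:
  assumes W: "(W, \<phi>) \<in> charts G" and V: "open V" and F: "Ck_fun_on G 1 V F" and x: "x \<in> W \<inter> V"
  shows "left_deriv G A F x = frechet_derivative (\<lambda>u. F (inv_into W \<phi> u)) (at (\<phi> x)) (left_triv \<phi> x A)"
proof (rule left_deriv_eqI)
  let ?S = "D0 \<inter> (\<lambda>u. x \<cdot> xi u) -` W"
  have g: "Ck_map (Suc 0) D0 (\<lambda>u. x \<cdot> xi u)" by (intro Ck_map_mul Ck_map_const Ck_map_xi open_D0)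
  have S: "open ?S" by (rule continuous_open_preimage[OF Ck_map_continuous[OF g] open_D0 chart_open[OF W]])
  have og: "og \<in> ?S" using og_D0 x by simp
  have 1: "((\<lambda>u. \<phi> (x \<cdot> xi u)) has_derivative left_triv \<phi> x) (at og)"
    unfolding left_triv_def by (rule Ck_on_has_derivative[OF Ck_map_chart[OF g W] og])
  have "Ck_on (Suc 0) (\<phi> ` (W \<inter> V)) (\<lambda>u. F (inv_into W \<phi> u))" using Ck_fun_onD[OF F W] by simp
  from Ck_on_has_derivative[OF this, of "\<phi> x"]
  have "((\<lambda>u. F (inv_into W \<phi> u)) \<circ> (\<lambda>u. \<phi> (x \<cdot> xi u)) has_derivative
     frechet_derivative (\<lambda>u. F (inv_into W \<phi> u)) (at (\<phi> x)) \<circ> left_triv \<phi> x) (at og)"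
    using x by (intro diff_chain_at[OF 1]) simp
  then have "((\<lambda>u. F (x \<cdot> xi u)) has_derivative
     frechet_derivative (\<lambda>u. F (inv_into W \<phi> u)) (at (\<phi> x)) \<circ> left_triv \<phi> x) (at og)"
    by (rule has_derivative_transform_within_open[OF _ S og]) (use W in auto)
  then show "((\<lambda>u. F (x \<cdot> xi u)) has_derivative
     (\<lambda>A. frechet_derivative (\<lambda>u. F (inv_into W \<phi> u)) (at (\<phi> x)) (left_triv \<phi> x A))) (at og)" by (simp add: o_def)
qed

lemma left_deriv_const: "left_deriv G A (\<lambda>x. c) x = 0"
  by (simp add: left_deriv_eq)

end

context carnot
begin

lemma coframe_bounded_linear: "bounded_linear (coframe G i)"
  by (simp add: linear_conv_bounded_linear[symmetric] coframe_linear)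

lemma subspace_horizontal: "subspace (layer G 1)"
  using subspace_lay[of 1] lay_1 by simp

text \<open>Left-invariant sections suffice: derivatives of a horizontal \<open>Y\<close> stay in
  the fixed linear space \<open>layer G 1\<close>, so the condition depends on the value
  \<open>Y x\<close> alone.\<close>

lemma contact_iff:
  assumes W: "open W"
  shows "contact_field G W Z \<longleftrightarrow> Ck_fun_on G 1 W Z \<and>
    (\<forall>x\<in>W. \<forall>A\<in>layer G 1. left_deriv G A Z x - lie_bracket G (Z x) A \<in> layer G 1)"
proof (intro iffI conjI ballI)
  assume Z: "contact_field G W Z"
  then show "Ck_fun_on G 1 W Z" by (simp add: contact_field_def)
  fix x A assume x: "x \<in> W" and A: "A \<in> layer G 1"
  have "smooth_fun_on G W (\<lambda>x. A)" by (intro smooth_fun_onI Ck_fun_on_const)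
  then have "field_bracket G Z (\<lambda>x. A) x \<in> layer G 1" using Z W x A unfolding contact_field_def by blast
  then have "- (lie_bracket G (Z x) A - left_deriv G A Z x) \<in> layer G 1"
    by (intro subspace_neg[OF subspace_horizontal]) (simp add: field_bracket_def left_deriv_const)
  then show "left_deriv G A Z x - lie_bracket G (Z x) A \<in> layer G 1" by simp
next
  assume *: "Ck_fun_on G 1 W Z \<and>
    (\<forall>x\<in>W. \<forall>A\<in>layer G 1. left_deriv G A Z x - lie_bracket G (Z x) A \<in> layer G 1)"
  show "contact_field G W Z" unfolding contact_field_def
  proof (intro conjI allI impI ballI)
    show "Ck_fun_on G 1 W Z" using * by simp
    fix V Y x assume Y: "open V \<and> V \<subseteq> W \<and> smooth_fun_on G V Y \<and> (\<forall>x\<in>V. Y x \<in> layer G 1)" and x: "x \<in> V"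
    have D: "((\<lambda>u. Y (x \<cdot> xi u)) has_derivative (\<lambda>A. left_deriv G A Y x)) (at og)"
      using has_left_deriv[of 0 V Y x] Y x smooth_fun_onD[of V Y 1] by simp
    have S: "open {u \<in> D0. x \<cdot> xi u \<in> V}" "og \<in> {u \<in> D0. x \<cdot> xi u \<in> V}"
      using translate_domain[of V x ge] Y x by simp_all
    have "left_deriv G (Z x) Y x \<in> layer G 1" unfolding horizontal_iff
    proof (intro ballI impI)
      fix i assume i: "i \<in> I" "fst i \<noteq> 1"
      have "((\<lambda>u. coframe G i (Y (x \<cdot> xi u))) has_derivative (\<lambda>A. coframe G i (left_deriv G A Y x))) (at og)"
        by (rule bounded_linear.has_derivative[OF coframe_bounded_linear D])
      moreover have "((\<lambda>u. coframe G i (Y (x \<cdot> xi u))) has_derivative (\<lambda>A. 0)) (at og)"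
        by (rule has_derivative_transform_within_open[OF has_derivative_const S]) (use Y i horizontal_iff in auto)
      ultimately have "(\<lambda>A. coframe G i (left_deriv G A Y x)) = (\<lambda>A. 0)" by (rule has_derivative_unique)
      from fun_cong[OF this] show "coframe G i (left_deriv G (Z x) Y x) = 0" .
    qed
    moreover have "left_deriv G (Y x) Z x - lie_bracket G (Z x) (Y x) \<in> layer G 1" using * Y x by blast
    ultimately have "left_deriv G (Z x) Y x - (left_deriv G (Y x) Z x - lie_bracket G (Z x) (Y x)) \<in> layer G 1"
      by (rule subspace_diff[OF subspace_horizontal])
    then show "field_bracket G Z Y x \<in> layer G 1" by (simp add: field_bracket_def algebra_simps)
  qed
qed

lemma contact_subset: "contact_field G W Z \<Longrightarrow> V \<subseteq> W \<Longrightarrow> contact_field G V Z"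
  unfolding contact_field_def by (meson Ck_fun_on_subset order_trans)

text \<open>The summable bounds on values and first chart derivatives make the sum C^1 with termwise
  derivatives. The contact condition is the vanishing of covectors on an expression linear in the
  field, so it passes to the sum.\<close>

lemma contact_series:
  fixes w :: "nat \<Rightarrow> 'g \<Rightarrow> 'a"
  assumes W: "(W, \<phi>) \<in> charts G" and O: "ball q r \<subseteq> \<phi> ` W"
    and V: "V = {x \<in> W. \<phi> x \<in> ball q r}"
    and w: "\<And>k. contact_field G V (w k)"
    and b0: "\<And>k x. x \<in> V \<Longrightarrow> norm (w k x) \<le> M k"
    and b1: "\<And>k u v. u \<in> ball q r \<Longrightarrow>
        norm (frechet_derivative (\<lambda>u. w k (inv_into W \<phi> u)) (at u) v) \<le> M k * norm v"
    and M: "summable M"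
  shows "contact_field G V (\<lambda>x. \<Sum>k. w k x)" and "x \<in> V \<Longrightarrow> (\<lambda>k. w k x) sums (\<Sum>k. w k x)"
proof -
  let ?w = "\<lambda>k u. w k (inv_into W \<phi> u)"
  let ?D = "\<lambda>k u. frechet_derivative (?w k) (at u)"
  let ?O = "ball q r"
  have "V = W \<inter> \<phi> -` ?O" using V by auto
  then have oV: "open V" using continuous_open_preimage[OF chart_continuous[OF W] chart_open[OF W] open_ball] by simp
  have im: "\<phi> ` (W \<inter> V) = ?O" using O V by auto
  have inV: "inv_into W \<phi> u \<in> V" if "u \<in> ?O" for u using that O chart_inv[OF W] V by auto
  have C1: "Ck_on (Suc 0) ?O (?w k)" for k
    using Ck_fun_onD[of 1 V "w k", OF _ W] w[of k] unfolding im by (simp add: contact_field_def)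
  have der: "(?w k has_derivative ?D k u) (at u)" if "u \<in> ?O" for k u
    by (rule Ck_on_has_derivative[OF C1 that])
  have sums0: "(\<lambda>k. w k x) sums (\<Sum>k. w k x)" if x: "x \<in> V" for x
    by (rule summable_sums, rule summable_comparison_test'[OF M]) (use b0[OF x] in simp)
  then show "x \<in> V \<Longrightarrow> (\<lambda>k. w k x) sums (\<Sum>k. w k x)" .
  have sumsD: "(\<lambda>k. ?D k u v) sums (\<Sum>k. ?D k u v)" if u: "u \<in> ?O" for u v
    by (rule summable_sums, rule summable_comparison_test'[OF summable_mult2[OF M, of "norm v"]]) (use b1[OF u] in simp)
  have unif: "\<forall>\<^sub>F n in sequentially. \<forall>u\<in>?O. \<forall>h. norm ((\<Sum>k<n. ?D k u h) - (\<Sum>k. ?D k u h)) \<le> e * norm h" if e: "e > 0" for e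
  proof -
    obtain n0 where n0: "\<And>n. n \<ge> n0 \<Longrightarrow> norm (\<Sum>k. M (k + n)) < e" using suminf_exist_split[OF e M] by blast
    have "norm ((\<Sum>k<n. ?D k u h) - (\<Sum>k. ?D k u h)) \<le> e * norm h" if n: "n \<ge> n0" and u: "u \<in> ?O" for n u h
    proof -
      have "(\<Sum>k. ?D k u h) = (\<Sum>k. ?D (k + n) u h) + (\<Sum>k<n. ?D k u h)"
        by (rule suminf_split_initial_segment[OF sums_summable[OF sumsD[OF u]]])
      then have "norm ((\<Sum>k<n. ?D k u h) - (\<Sum>k. ?D k u h)) = norm (\<Sum>k. ?D (k + n) u h)"
        by (simp add: norm_minus_commute)
      also have "\<dots> \<le> (\<Sum>k. M (k + n) * norm h)"
        by (rule norm_suminf_le) (use b1[OF u] summable_ignore_initial_segment[OF M, of n] in \<open>auto intro: summable_mult2\<close>)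
      also have "\<dots> = (\<Sum>k. M (k + n)) * norm h"
        by (rule suminf_mult2[symmetric]) (rule summable_ignore_initial_segment[OF M])
      also have "\<dots> \<le> e * norm h" using n0[OF n] by (intro mult_right_mono) auto
      finally show ?thesis .
    qed
    then show ?thesis unfolding eventually_sequentially by blast
  qed
  have hd: "((\<lambda>u. \<Sum>k. ?w k u) has_derivative (\<lambda>h. \<Sum>k. ?D k u h)) (at u)" if u: "u \<in> ?O" for u
  proof -
    have "\<exists>g. \<forall>u\<in>?O. (\<lambda>k. ?w k u) sums g u \<and> (g has_derivative (\<lambda>h. \<Sum>k. ?D k u h)) (at u within ?O)"
      by (rule has_derivative_series[OF convex_ball has_derivative_at_withinI[OF der] unif u sums0[OF inV[OF u]]])
    then obtain g where g: "\<And>u. u \<in> ?O \<Longrightarrow> (\<lambda>k. ?w k u) sums g u"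
       "\<And>u. u \<in> ?O \<Longrightarrow> (g has_derivative (\<lambda>h. \<Sum>k. ?D k u h)) (at u within ?O)" by blast
    have "(g has_derivative (\<lambda>h. \<Sum>k. ?D k u h)) (at u)" using g(2)[OF u] unfolding at_within_open[OF u open_ball] .
    then show ?thesis
      by (rule has_derivative_transform_within_open[OF _ open_ball u]) (rule sums_unique[OF g(1)])
  qed
  have cont: "continuous_on ?O (\<lambda>u. \<Sum>k. ?D k u v)" for v
  proof (rule uniform_limit_theorem)
    show "uniform_limit ?O (\<lambda>n u. \<Sum>k<n. ?D k u v) (\<lambda>u. \<Sum>k. ?D k u v) sequentially"
      by (rule Weierstrass_m_test[OF _ summable_mult2[OF M, of "norm v"]]) (rule b1)
    show "\<forall>\<^sub>F n in sequentially. continuous_on ?O (\<lambda>u. \<Sum>k<n. ?D k u v)"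
      using C1 by (intro always_eventually allI continuous_on_sum) auto
  qed simp
  have C1s: "Ck_on (Suc 0) ?O (\<lambda>u. \<Sum>k. ?w k u)"
    by (rule Ck_on_SucI[OF open_ball hd]) (use cont in auto)
  have C: "Ck_fun_on G 1 V (\<lambda>x. \<Sum>k. w k x)"
  proof (rule Ck_fun_onI_local)
    fix x assume x: "x \<in> V"
    have "\<phi> ` V = ?O" using im V by (metis Int_absorb1 mem_Collect_eq subsetI)
    then show "\<exists>W \<phi> V'. (W, \<phi>) \<in> charts G \<and> open V' \<and> x \<in> V' \<and> V' \<subseteq> W \<and>
       Ck_on 1 (\<phi> ` V') (\<lambda>u. \<Sum>k. w k (inv_into W \<phi> u))"
      using W oV x C1s V by (intro exI[of _ W] exI[of _ \<phi>] exI[of _ V]) auto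
  qed
  show "contact_field G V (\<lambda>x. \<Sum>k. w k x)" unfolding contact_iff[OF oV]
  proof (intro conjI C ballI)
    fix x A assume x: "x \<in> V" and A: "A \<in> layer G 1"
    have xW: "x \<in> W \<inter> V" "\<phi> x \<in> ?O" using x V by auto
    have k: "left_deriv G A (w k) x - lie_bracket G (w k x) A \<in> layer G 1" "Ck_fun_on G 1 V (w k)" for k
      using w[of k] x A unfolding contact_iff[OF oV] by auto
    have "left_deriv G A (\<lambda>x. \<Sum>k. w k x) x = (\<Sum>k. ?D k (\<phi> x) (left_triv \<phi> x A))"
      unfolding left_deriv_chart[OF W oV C xW(1)] using fun_cong[OF frechet_derivative_at[OF hd[OF xW(2)]]] by simp
    moreover have "(\<lambda>k. ?D k (\<phi> x) (left_triv \<phi> x A)) = (\<lambda>k. left_deriv G A (w k) x)"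
      using left_deriv_chart[OF W oV k(2) xW(1)] by simp
    ultimately have 1: "(\<lambda>k. left_deriv G A (w k) x) sums left_deriv G A (\<lambda>x. \<Sum>k. w k x) x"
      using sumsD[OF xW(2), of "left_triv \<phi> x A"] by simp
    have bl: "bounded_linear (\<lambda>B. lie_bracket G B A)"
      using lie_bracket_linear_left by (simp add: linear_conv_bounded_linear)
    have 2: "(\<lambda>k. lie_bracket G (w k x) A) sums lie_bracket G (\<Sum>k. w k x) A"
      by (rule bounded_linear.sums[OF bl sums0[OF x]])
    show "left_deriv G A (\<lambda>x. \<Sum>k. w k x) x - lie_bracket G (\<Sum>k. w k x) A \<in> layer G 1"
      unfolding horizontal_iff
    proof (intro ballI impI)
      fix i assume i: "i \<in> I" "fst i \<noteq> 1"
      have "(\<lambda>k. coframe G i (left_deriv G A (w k) x - lie_bracket G (w k x) A)) sums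
         coframe G i (left_deriv G A (\<lambda>x. \<Sum>k. w k x) x - lie_bracket G (\<Sum>k. w k x) A)"
        by (rule bounded_linear.sums[OF coframe_bounded_linear sums_diff[OF 1 2]])
      moreover have "coframe G i (left_deriv G A (w k) x - lie_bracket G (w k x) A) = 0" for k
        using k(1)[of k] i unfolding horizontal_iff by blast
      ultimately show "coframe G i (left_deriv G A (\<lambda>x. \<Sum>k. w k x) x - lie_bracket G (\<Sum>k. w k x) A) = 0"
        using sums_unique2[OF _ sums_zero] by simp
    qed
  qed
qed

end

context carnot
begin

lemma contact_scaleR:
  assumes W: "open W" and Z: "contact_field G W Z"
  shows "contact_field G W (\<lambda>x. c *\<^sub>R Z x)"
  unfolding contact_iff[OF W]
proof (intro conjI ballI)
  have C: "Ck_fun_on G 1 W Z" using Z by (simp add: contact_field_def)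
  show "Ck_fun_on G 1 W (\<lambda>x. c *\<^sub>R Z x)" by (intro Ck_fun_on_scaleR W Ck_fun_on_const C)
  fix x A assume x: "x \<in> W" and A: "A \<in> layer G 1"
  have "left_deriv G A (\<lambda>x. c *\<^sub>R Z x) x = c *\<^sub>R left_deriv G A Z x"
    by (rule left_deriv_eqI[OF has_derivative_scaleR_right[OF has_left_deriv[OF _ W x]]]) (use C in simp)
  moreover have "lie_bracket G (c *\<^sub>R Z x) A = c *\<^sub>R lie_bracket G (Z x) A"
    by (rule linear_scale[OF lie_bracket_linear_left])
  moreover have "left_deriv G A Z x - lie_bracket G (Z x) A \<in> layer G 1" using Z x A unfolding contact_iff[OF W] by blast
  from subspace_scale[OF subspace_horizontal this, of c]
  have "c *\<^sub>R left_deriv G A Z x - c *\<^sub>R lie_bracket G (Z x) A \<in> layer G 1" by (simp add: scaleR_diff_right)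
  ultimately show "left_deriv G A (\<lambda>x. c *\<^sub>R Z x) x - lie_bracket G (c *\<^sub>R Z x) A \<in> layer G 1" by simp
qed

text \<open>The constants by which fields are normalised before they enter a power series.\<close>

lemma contact_bounds:
  assumes W: "(W, \<phi>) \<in> charts G" and Q: "cball q r \<subseteq> \<phi> ` (W \<inter> B)" and Z: "contact_field G B Z"
  obtains M where "M > 0" "\<And>x. x \<in> W \<Longrightarrow> \<phi> x \<in> ball q r \<Longrightarrow> norm (Z x) \<le> M"
    "\<And>u v. u \<in> ball q r \<Longrightarrow> norm (frechet_derivative (\<lambda>u. Z (inv_into W \<phi> u)) (at u) v) \<le> M * norm v"
proof -
  let ?z = "\<lambda>u. Z (inv_into W \<phi> u)"
  have C1: "Ck_on (Suc 0) (\<phi> ` (W \<inter> B)) ?z" using Ck_fun_onD[OF _ W, of 1 B Z] Z by (simp add: contact_field_def)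
  have "compact (?z ` cball q r)"
    by (rule compact_continuous_image[OF continuous_on_subset[OF Ck_on_imp_continuous_on[OF C1] Q] compact_cball])
  then obtain M0 where M0: "\<And>u. u \<in> cball q r \<Longrightarrow> norm (?z u) \<le> M0"
    using compact_imp_bounded bounded_iff by (metis imageI)
  have "\<exists>M. \<forall>u\<in>cball q r. norm (frechet_derivative ?z (at u) b) \<le> M" for b
  proof -
    have "compact ((\<lambda>u. frechet_derivative ?z (at u) b) ` cball q r)"
      by (rule compact_continuous_image[OF continuous_on_subset[OF _ Q] compact_cball]) (use C1 in simp)
    then have "bounded ((\<lambda>u. frechet_derivative ?z (at u) b) ` cball q r)" by (rule compact_imp_bounded)
    then show ?thesis unfolding bounded_iff by simp
  qed
  then obtain M1 where M1: "\<And>b u. u \<in> cball q r \<Longrightarrow> norm (frechet_derivative ?z (at u) b) \<le> M1 b" by metis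
  \<comment> \<open>The summand 1 makes \<open>M\<close> positive, so that it can be divided
    by.\<close>
  define M where "M = 1 + \<bar>M0\<bar> + (\<Sum>b\<in>Basis. \<bar>M1 b\<bar>)"
  have Ms: "(\<Sum>b\<in>Basis. \<bar>M1 b\<bar>) \<ge> 0" by (rule sum_nonneg) simp
  show thesis
  proof (rule that[of M])
    show "M > 0" unfolding M_def using Ms by linarith
    fix x assume x: "x \<in> W" "\<phi> x \<in> ball q r"
    have "norm (?z (\<phi> x)) \<le> M0" using x by (intro M0) auto
    then have "norm (Z x) \<le> M0" using x(1) W by simp
    then show "norm (Z x) \<le> M" unfolding M_def using Ms by linarith
  next
    fix u v assume u: "u \<in> ball q r"
    let ?D = "frechet_derivative ?z (at u)"
    have "u \<in> \<phi> ` (W \<inter> B)" using u Q by (auto simp: subset_iff)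
    then have lin: "linear ?D" using Ck_on_has_derivative[OF C1] has_derivative_linear by blast
    have "?D v = (\<Sum>b\<in>Basis. (v \<bullet> b) *\<^sub>R ?D b)"
      using linear_sum[OF lin, of "\<lambda>b. (v \<bullet> b) *\<^sub>R b" Basis] by (simp add: linear_scale[OF lin] euclidean_representation)
    also have "norm \<dots> \<le> (\<Sum>b\<in>Basis. norm ((v \<bullet> b) *\<^sub>R ?D b))" by (rule norm_sum)
    also have "\<dots> \<le> (\<Sum>b\<in>Basis. norm v * \<bar>M1 b\<bar>)"
    proof (rule sum_mono)
      fix b :: 'a assume b: "b \<in> Basis"
      have "norm (?D b) \<le> M1 b" using u by (intro M1) auto
      then have "norm (?D b) \<le> \<bar>M1 b\<bar>" by simp
      then show "norm ((v \<bullet> b) *\<^sub>R ?D b) \<le> norm v * \<bar>M1 b\<bar>"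
        unfolding norm_scaleR by (rule mult_mono[OF Basis_le_norm[OF b]]) auto
    qed
    also have "\<dots> = (\<Sum>b\<in>Basis. \<bar>M1 b\<bar>) * norm v" by (simp add: sum_distrib_left[symmetric] mult.commute)
    also have "\<dots> \<le> M * norm v" by (rule mult_right_mono) (auto simp: M_def)
    finally show "norm (?D v) \<le> M * norm v" .
  qed
qed

text \<open>The neighbourhood on which a contact field is a combination of the given germs may depend on the
  field. If there were bad fields \<open>w\<^sub>k\<close> for a shrinking sequence of neighbourhoods \<open>V\<^sub>k\<close>, then every
  \<open>\<Sum> t\<^sup>k w\<^sub>k\<close> would be a contact field; by pigeonhole one \<open>V\<^sub>k\<close> serves uncountably many \<open>t\<close>, so that the power
  series of \<open>\<Lambda>(w\<^sub>k)\<close>, for \<open>\<Lambda>\<close> annihilating the germs on \<open>V\<^sub>k\<close>, vanishes identically.\<close>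

lemma contact_fields_uniform_germ:
  assumes rigid: "Cinf_rigid G" and B: "open B" "p \<in> B"
  obtains V N Y where "open V" "p \<in> V" "V \<subseteq> B"
    "\<And>Z. contact_field G B Z \<Longrightarrow>
       fun_span (V \<times> Basis) N (\<lambda>j (x, b). Y j x \<bullet> b) (\<lambda>(x, b). Z x \<bullet> b)"
proof -
  have "\<exists>(N::nat) Y. (\<forall>i<N. \<exists>W. open W \<and> p \<in> W \<and> contact_field G W (Y i)) \<and>
     (\<forall>W Z. open W \<and> p \<in> W \<and> contact_field G W Z \<longrightarrow>
        (\<exists>V c. open V \<and> p \<in> V \<and> V \<subseteq> W \<and> (\<forall>x\<in>V. Z x = (\<Sum>i<N. c i *\<^sub>R Y i x))))"
    using rigid unfolding Cinf_rigid_def by (rule spec)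
  then obtain N :: nat and Y where "\<forall>W Z. open W \<and> p \<in> W \<and> contact_field G W Z \<longrightarrow>
        (\<exists>V c. open V \<and> p \<in> V \<and> V \<subseteq> W \<and> (\<forall>x\<in>V. Z x = (\<Sum>i<N. c i *\<^sub>R Y i x)))" by (elim exE conjE)
  then have NY: "\<And>W Z. open W \<and> p \<in> W \<and> contact_field G W Z \<Longrightarrow>
        \<exists>V c. open V \<and> p \<in> V \<and> V \<subseteq> W \<and> (\<forall>x\<in>V. Z x = (\<Sum>i<N. c i *\<^sub>R Y i x))" by blast
  let ?S = "\<lambda>V. V \<times> (Basis :: 'a set)"
  let ?Y = "\<lambda>j (x, b). Y j x \<bullet> b" and ?f = "\<lambda>Z (x, b). Z x \<bullet> b"
  obtain W \<phi> where W: "(W, \<phi>) \<in> charts G" "p \<in> W" by (rule chart_at)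
  have "open (\<phi> ` (W \<inter> B))" "\<phi> p \<in> \<phi> ` (W \<inter> B)" using chart_image_open[OF W(1) B(1)] W B by auto
  then obtain r where r: "r > 0" "cball (\<phi> p) r \<subseteq> \<phi> ` (W \<inter> B)" by (meson open_contains_cball)
  \<comment> \<open>Shrinking coordinate balls, a neighbourhood base at \<open>p\<close>;
    \<open>real k + 1\<close> gives radius \<open>r\<close> for \<open>k = 0\<close>.\<close>
  define V where "V = (\<lambda>k::nat. {x \<in> W. \<phi> x \<in> ball (\<phi> p) (r / (real k + 1))})"
  have oV: "open (V k)" for k
  proof -
    have "V k = W \<inter> \<phi> -` ball (\<phi> p) (r / (real k + 1))" by (auto simp: V_def)
    then show ?thesis using continuous_open_preimage[OF chart_continuous[OF W(1)] chart_open[OF W(1)] open_ball] by simp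
  qed
  have pV: "p \<in> V k" for k using W r by (simp add: V_def)
  have V0: "V k \<subseteq> V 0" for k
  proof -
    have "r / (real k + 1) \<le> r" using r by (simp add: field_simps)
    then show ?thesis by (auto simp: V_def)
  qed
  have VB: "V 0 \<subseteq> B"
  proof
    fix x assume x: "x \<in> V 0"
    then have "\<phi> x \<in> \<phi> ` (W \<inter> B)" "x \<in> W" using r(2) by (auto simp: V_def subset_iff)
    then obtain y where "y \<in> W" "y \<in> B" "\<phi> x = \<phi> y" by auto
    then show "x \<in> B" using \<open>x \<in> W\<close> chart_inj[OF W(1)] by (auto dest: inj_onD)
  qed
  have "\<exists>k. \<forall>Z. contact_field G B Z \<longrightarrow> fun_span (?S (V k)) N ?Y (?f Z)"
  proof (rule ccontr)
    assume "\<not> ?thesis"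
    then obtain w0 where w0: "\<And>k. contact_field G B (w0 k)" "\<And>k. \<not> fun_span (?S (V k)) N ?Y (?f (w0 k))" by metis
    have "\<exists>M>0. (\<forall>x. x \<in> W \<longrightarrow> \<phi> x \<in> ball (\<phi> p) r \<longrightarrow> norm (w0 k x) \<le> M) \<and>
      (\<forall>u v. u \<in> ball (\<phi> p) r \<longrightarrow> norm (frechet_derivative (\<lambda>u. w0 k (inv_into W \<phi> u)) (at u) v) \<le> M * norm v)" for k
      by (rule contact_bounds[OF W(1) r(2) w0(1)[of k]]) blast
    then obtain M where M: "\<And>k. M k > 0" "\<And>k x. x \<in> W \<Longrightarrow> \<phi> x \<in> ball (\<phi> p) r \<Longrightarrow> norm (w0 k x) \<le> M k"
      "\<And>k u v. u \<in> ball (\<phi> p) r \<Longrightarrow> norm (frechet_derivative (\<lambda>u. w0 k (inv_into W \<phi> u)) (at u) v) \<le> M k * norm v" by metis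
    \<comment> \<open>After division by \<open>M k\<close> the fields and their chart derivatives
      are bounded by 1, so the terms are dominated by a geometric series.\<close>
    define z where "z = (\<lambda>t x. \<Sum>k. (t ^ k / M k) *\<^sub>R w0 k x)"
    have series: "contact_field G (V 0) (z t) \<and> (\<forall>x\<in>V 0. (\<lambda>k. (t ^ k / M k) *\<^sub>R w0 k x) sums z t x)"
      if t: "t \<in> {0<..<1/2}" for t
    proof -
      have V0_eq: "V 0 = {x \<in> W. \<phi> x \<in> ball (\<phi> p) r}" by (simp add: V_def)
      have O: "ball (\<phi> p) r \<subseteq> \<phi> ` W" using r(2) ball_subset_cball[of "\<phi> p" r] by blast
      have c: "contact_field G (V 0) (\<lambda>x. (t ^ k / M k) *\<^sub>R w0 k x)" for k
        by (rule contact_scaleR[OF oV contact_subset[OF w0(1) VB]])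
      have n: "norm ((t ^ k / M k) *\<^sub>R w) \<le> t ^ k * a" if "norm w \<le> M k * a" for k w a
      proof -
        have "norm ((t ^ k / M k) *\<^sub>R w) = t ^ k * (norm w / M k)" using t M(1)[of k] by simp
        also have "\<dots> \<le> t ^ k * a" using t that M(1)[of k] by (intro mult_left_mono) (simp_all add: field_simps)
        finally show ?thesis .
      qed
      have n0: "norm ((t ^ k / M k) *\<^sub>R w0 k x) \<le> t ^ k" if "x \<in> V 0" for k x
        using n[of "w0 k x" k 1] M(2)[of x k] that by (simp add: V0_eq)
      have n1: "norm (frechet_derivative (\<lambda>u. (t ^ k / M k) *\<^sub>R w0 k (inv_into W \<phi> u)) (at u) v) \<le> t ^ k * norm v"
        if u: "u \<in> ball (\<phi> p) r" for k u v
      proof -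
        have "Ck_on (Suc 0) (\<phi> ` (W \<inter> B)) (\<lambda>u. w0 k (inv_into W \<phi> u))"
          using Ck_fun_onD[OF _ W(1), of 1 B "w0 k"] w0(1)[of k] by (simp add: contact_field_def)
        moreover have "u \<in> \<phi> ` (W \<inter> B)" using u r(2) by (auto simp: subset_iff)
        ultimately have "((\<lambda>u. w0 k (inv_into W \<phi> u)) has_derivative frechet_derivative (\<lambda>u. w0 k (inv_into W \<phi> u)) (at u)) (at u)"
          by (rule Ck_on_has_derivative)
        from fun_cong[OF frechet_derivative_at[OF has_derivative_scaleR_right[OF this, of "t ^ k / M k"]], of v]
        show ?thesis using n[OF M(3)[OF u, of k v]] by simp
      qed
      have S: "summable (\<lambda>k. t ^ k)" using t by (intro summable_geometric) simp
      let ?wt = "\<lambda>k x. (t ^ k / M k) *\<^sub>R w0 k x"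
      have "contact_field G (V 0) (z t)" unfolding z_def
        by (rule contact_series(1)[where w="?wt" and M="\<lambda>k. t ^ k", OF W(1) O V0_eq c n0 n1 S])
      moreover have "(\<lambda>k. ?wt k x) sums z t x" if "x \<in> V 0" for x unfolding z_def
        by (rule contact_series(2)[where w="?wt" and M="\<lambda>k. t ^ k", OF W(1) O V0_eq c n0 n1 S that])
      ultimately show ?thesis by blast
    qed
    have "\<exists>k. fun_span (?S (V k)) N ?Y (?f (z t))" if t: "t \<in> {0<..<1/2}" for t
    proof -
      obtain V' c where V': "open V'" "p \<in> V'" "V' \<subseteq> V 0" "\<And>x. x \<in> V' \<Longrightarrow> z t x = (\<Sum>i<N. c i *\<^sub>R Y i x)"
        using NY[OF conjI[OF oV conjI[OF pV series[OF t, THEN conjunct1]]]] by (elim exE conjE) blast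
      have "open (\<phi> ` (W \<inter> V'))" "\<phi> p \<in> \<phi> ` (W \<inter> V')" using chart_image_open[OF W(1) V'(1)] W V' by auto
      then obtain s where s: "s > 0" "ball (\<phi> p) s \<subseteq> \<phi> ` (W \<inter> V')" by (meson openE)
      \<comment> \<open>For this \<open>k\<close> the radius \<open>r / (real k + 1)\<close> is at
        most \<open>s\<close>.\<close>
      obtain k :: nat where k: "r / s < k" using reals_Archimedean2 by blast
      have "V k \<subseteq> V'"
      proof
        fix x assume x: "x \<in> V k"
        have "r / (real k + 1) \<le> s" using k s(1) r(1) by (simp add: field_simps)
        then have "\<phi> x \<in> \<phi> ` (W \<inter> V')" "x \<in> W" using x s(2) by (auto simp: V_def subset_iff)
        then obtain y where "y \<in> W" "y \<in> V'" "\<phi> x = \<phi> y" by auto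
        then show "x \<in> V'" using \<open>x \<in> W\<close> chart_inj[OF W(1)] by (auto dest: inj_onD)
      qed
      then have "fun_span (?S (V k)) N ?Y (?f (z t))"
        unfolding fun_span_def by (intro exI[of _ c]) (auto simp: V'(4) inner_sum_left subset_iff)
      then show ?thesis ..
    qed
    note good = this
    define T0 where "T0 = (\<lambda>k. {t \<in> {0<..<1/2::real}. fun_span (?S (V k)) N ?Y (?f (z t))})"
    have sub: "{0<..<1/2} \<subseteq> (\<Union>k. T0 k)" using good by (auto simp: T0_def)
    have "\<exists>k. uncountable (T0 k)"
    proof (rule ccontr)
      assume "\<not> ?thesis"
      then have "countable (\<Union>k. T0 k)" by (intro countable_UN) auto
      then have "countable {0<..<1/2::real}" by (rule countable_subset[OF sub])
      then show False using uncountable_open_interval[of 0 "1/2::real"] by simp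
    qed
    then obtain k where k: "uncountable (T0 k)" by blast
    define T where "T = T0 k"
    have T: "infinite T" "T \<subseteq> {0<..<1/2}"
      using k countable_finite[of "T0 k"] by (auto simp: T_def T0_def)
    \<comment> \<open>Taken on the neighbourhood that serves uncountably many \<open>t\<close>: the
      functional kills every \<open>z t\<close> with \<open>t\<close> in \<open>T\<close>, but not
      the field \<open>w0 k\<close> at index \<open>k\<close> of the series.\<close>
    obtain F a where Fa: "finite F" "F \<subseteq> ?S (V k)" "\<And>j. j < N \<Longrightarrow> (\<Sum>i\<in>F. a i * ?Y j i) = 0"
      "(\<Sum>i\<in>F. a i * ?f (w0 k) i) \<noteq> 0"
      using annihilator_exists[OF w0(2)[of k]] by blast
    define L where "L = (\<lambda>Z. \<Sum>i\<in>F. a i * ?f Z i)"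
    have F0: "fst i \<in> V 0" "snd i \<in> Basis" if "i \<in> F" for i using subsetD[OF Fa(2) that] V0[of k] by (auto simp: mem_Times_iff)
    have "L (w0 k) / M k = 0"
    \<comment> \<open>On \<open>V 0\<close> the field \<open>w0 m\<close> is at most
      \<open>M m\<close>, so the normalised coefficients are bounded by the total weight of the
      functional.\<close>
    proof (rule power_series_zero_coefficients[OF _ T(2,1), where B="\<Sum>i\<in>F. \<bar>a i\<bar>"])
      fix m
      have "\<bar>L (w0 m)\<bar> \<le> (\<Sum>i\<in>F. \<bar>a i * ?f (w0 m) i\<bar>)" unfolding L_def by (rule sum_abs)
      also have "\<dots> \<le> (\<Sum>i\<in>F. \<bar>a i\<bar> * M m)"
      proof (rule sum_mono)
        fix i assume i: "i \<in> F"
        obtain x b where xb: "i = (x, b)" by force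
        have "\<bar>w0 m x \<bullet> b\<bar> \<le> norm (w0 m x)" using F0(2)[OF i] xb by (simp add: Basis_le_norm)
        also have "\<dots> \<le> M m" using F0(1)[OF i] xb by (intro M(2)) (auto simp: V_def)
        finally show "\<bar>a i * ?f (w0 m) i\<bar> \<le> \<bar>a i\<bar> * M m" by (simp add: xb abs_mult mult_left_mono)
      qed
      also have "\<dots> = (\<Sum>i\<in>F. \<bar>a i\<bar>) * M m" by (simp add: sum_distrib_right)
      finally show "\<bar>L (w0 m) / M m\<bar> \<le> (\<Sum>i\<in>F. \<bar>a i\<bar>)" using M(1)[of m] by (simp add: field_simps)
    next
      fix t assume t: "t \<in> T"
      then have tt: "t \<in> {0<..<1/2}" and sp: "fun_span (?S (V k)) N ?Y (?f (z t))" by (auto simp: T_def T0_def)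
      obtain c where c: "\<And>i. i \<in> ?S (V k) \<Longrightarrow> ?f (z t) i = (\<Sum>j<N. c j * ?Y j i)" using sp unfolding fun_span_def by blast
      have "L (z t) = (\<Sum>i\<in>F. \<Sum>j<N. c j * (a i * ?Y j i))" unfolding L_def
      proof (rule sum.cong[OF refl])
        fix i assume i: "i \<in> F"
        have "?f (z t) i = (\<Sum>j<N. c j * ?Y j i)" using i Fa(2) by (intro c) auto
        then show "a i * ?f (z t) i = (\<Sum>j<N. c j * (a i * ?Y j i))" by (simp add: sum_distrib_left mult_ac)
      qed
      also have "\<dots> = (\<Sum>j<N. c j * (\<Sum>i\<in>F. a i * ?Y j i))" by (subst sum.swap) (simp add: sum_distrib_left)
      also have "\<dots> = 0" using Fa(3) by simp
      finally have Lz: "L (z t) = 0" .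
      have "(\<lambda>m. \<Sum>i\<in>F. a i * ?f (\<lambda>x. (t ^ m / M m) *\<^sub>R w0 m x) i) sums (\<Sum>i\<in>F. a i * ?f (z t) i)"
      proof (intro sums_sum sums_mult)
        fix i assume i: "i \<in> F"
        obtain x b where xb: "i = (x, b)" by force
        have "(\<lambda>m. (t ^ m / M m) *\<^sub>R w0 m x) sums z t x" using series[OF tt] F0(1)[OF i] xb by simp
        from bounded_linear.sums[OF bounded_linear_inner_left this, of b]
        show "(\<lambda>m. ?f (\<lambda>x. (t ^ m / M m) *\<^sub>R w0 m x) i) sums ?f (z t) i" by (simp add: xb)
      qed
      moreover have "(\<Sum>i\<in>F. a i * ?f (\<lambda>x. (t ^ m / M m) *\<^sub>R w0 m x) i) = L (w0 m) / M m * t ^ m" for m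
      proof -
        have "(\<Sum>i\<in>F. a i * ?f (\<lambda>x. (t ^ m / M m) *\<^sub>R w0 m x) i) = (\<Sum>i\<in>F. (t ^ m / M m) * (a i * ?f (w0 m) i))"
          by (rule sum.cong) (auto simp: case_prod_unfold)
        also have "\<dots> = (t ^ m / M m) * L (w0 m)" unfolding L_def by (rule sum_distrib_left[symmetric])
        finally show ?thesis by simp
      qed
      ultimately show "(\<lambda>m. L (w0 m) / M m * t ^ m) sums 0" using Lz by (simp add: L_def)
    qed
    then have "L (w0 k) = 0" using M(1)[of k] by simp
    then show False using Fa(4) by (simp add: L_def)
  qed
  then obtain k where "\<And>Z. contact_field G B Z \<Longrightarrow> fun_span (?S (V k)) N ?Y (?f Z)" by blast
  then show thesis using that[OF oV pV, of k] V0[of k] VB by (meson order_trans)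
qed

end

section \<open>Locally integrable functions\<close>

context lie_haar
begin

lemma compact_neighbourhood:
  assumes "open U" "p \<in> U"
  obtains W \<phi> r K where "(W, \<phi>) \<in> charts G" "p \<in> W" "r > 0" "cball (\<phi> p) r \<subseteq> \<phi> ` (W \<inter> U)"
    "K = inv_into W \<phi> ` cball (\<phi> p) r" "compact K" "K \<subseteq> W \<inter> U"
    "open {x \<in> W. \<phi> x \<in> ball (\<phi> p) r}" "p \<in> {x \<in> W. \<phi> x \<in> ball (\<phi> p) r}" "{x \<in> W. \<phi> x \<in> ball (\<phi> p) r} \<subseteq> K"
proof -
  obtain W \<phi> where W: "(W, \<phi>) \<in> charts G" "p \<in> W" by (rule chart_at)
  have "open (\<phi> ` (W \<inter> U))" "\<phi> p \<in> \<phi> ` (W \<inter> U)" using chart_image_open[OF W(1) assms(1)] W assms by auto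
  then obtain r where r: "r > 0" "cball (\<phi> p) r \<subseteq> \<phi> ` (W \<inter> U)" by (meson open_contains_cball)
  let ?K = "inv_into W \<phi> ` cball (\<phi> p) r"
  let ?V = "{x \<in> W. \<phi> x \<in> ball (\<phi> p) r}"
  have "?V = W \<inter> \<phi> -` ball (\<phi> p) r" by auto
  then have o: "open ?V" using continuous_open_preimage[OF chart_continuous[OF W(1)] chart_open[OF W(1)] open_ball] by simp
  have K: "?K \<subseteq> W \<inter> U"
  proof
    fix x assume "x \<in> ?K"
    then obtain y where "y \<in> W" "y \<in> U" "x = inv_into W \<phi> (\<phi> y)" using r(2) by blast
    then show "x \<in> W \<inter> U" using chart_inv(1)[OF W(1)] by simp
  qed
  have "cball (\<phi> p) r \<subseteq> \<phi> ` W" using r(2) by blast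
  then have c: "compact ?K" by (intro chart_preimage_compact[OF W(1)]) simp
  have "?V \<subseteq> ?K"
  proof
    fix x assume "x \<in> ?V"
    then show "x \<in> ?K" by (intro image_eqI[of _ _ "\<phi> x"]) (auto simp: W(1))
  qed
  then show thesis using that[OF W r refl c K o] W r by simp
qed

text \<open>By Lindelof's theorem countably many open sets of finite measure cover the group.
  Fubini's theorem asks for this.\<close>

lemma sigma_finite_mu: "sigma_finite_measure \<mu>"
proof
  have ex: "\<exists>S. open S \<and> x \<in> S \<and> emeasure \<mu> S \<noteq> \<infinity>" for x :: 'g
  proof (rule compact_neighbourhood[OF open_UNIV UNIV_I, of x])
    fix W \<phi> r K
    let ?S = "{y \<in> W. \<phi> y \<in> ball (\<phi> x) r}"
    assume K: "compact K" and S: "open ?S" "x \<in> ?S" "?S \<subseteq> K"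
    have "emeasure \<mu> ?S \<le> emeasure \<mu> K" using S(3) K by (intro emeasure_mono compact_sets)
    also have "\<dots> < \<infinity>" by (rule emeasure_compact[OF K])
    finally show "\<exists>S. open S \<and> x \<in> S \<and> emeasure \<mu> S \<noteq> \<infinity>" using S by (intro exI[of _ ?S]) auto
  qed
  let ?F = "{S. open S \<and> emeasure \<mu> S \<noteq> \<infinity>}"
  obtain F where F: "F \<subseteq> ?F" "countable F" "\<Union>F = \<Union>?F" by (rule Lindelof[of ?F]) auto
  have "\<Union>?F = UNIV" using ex by auto
  then show "\<exists>A. countable A \<and> A \<subseteq> sets \<mu> \<and> \<Union>A = space \<mu> \<and> (\<forall>a\<in>A. emeasure \<mu> a \<noteq> \<infinity>)"
    using F by (intro exI[of _ F]) (auto simp: sets_mu)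
qed

text \<open>Lindelof's theorem makes the cover countable, so that the exceptional null sets can be
  united.\<close>

lemma AE_local:
  assumes "\<And>x. x \<in> U \<Longrightarrow> \<exists>V. open V \<and> x \<in> V \<and> (AE y in \<mu>. y \<in> V \<longrightarrow> P y)"
  shows "AE y in \<mu>. y \<in> U \<longrightarrow> P y"
proof -
  obtain V where V: "\<And>x. x \<in> U \<Longrightarrow> open (V x)" "\<And>x. x \<in> U \<Longrightarrow> x \<in> V x"
    "\<And>x. x \<in> U \<Longrightarrow> AE y in \<mu>. y \<in> V x \<longrightarrow> P y" using assms by metis
  obtain F where F: "F \<subseteq> V ` U" "countable F" "\<Union>F = \<Union>(V ` U)"
    by (rule Lindelof[of "V ` U"]) (use V(1) in auto)
  have "AE y in \<mu>. \<forall>S\<in>F. y \<in> S \<longrightarrow> P y"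
    by (subst AE_ball_countable[OF F(2)]) (use F(1) V(3) in blast)
  then show ?thesis
  proof (rule AE_mp, intro AE_I2 impI)
    fix y assume y: "\<forall>S\<in>F. y \<in> S \<longrightarrow> P y" "y \<in> U"
    then have "y \<in> \<Union>(V ` U)" using V(2) by blast
    then have "y \<in> \<Union>F" unfolding F(3) .
    then show "P y" using y by auto
  qed
qed

text \<open>The set where two continuous functions differ is open, and nonempty open sets have
  positive measure.\<close>

lemma continuous_AE_eq:
  fixes f g :: "'g \<Rightarrow> 'b::real_normed_vector"
  assumes U: "open U" and f: "continuous_on U f" and g: "continuous_on U g"
    and ae: "AE x in \<mu>. x \<in> U \<longrightarrow> f x = g x" and x: "x \<in> U"
  shows "f x = g x"
proof (rule ccontr)
  assume ne: "f x \<noteq> g x"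
  let ?W = "U \<inter> (\<lambda>x. f x - g x) -` (- {0})"
  have o: "open ?W" by (rule continuous_open_preimage[OF continuous_on_diff[OF f g] U]) auto
  have "emeasure \<mu> ?W > 0" by (rule emeasure_open[OF o]) (use ne x in auto)
  moreover have "AE x in \<mu>. x \<notin> ?W" by (rule AE_mp[OF ae]) auto
  then have "?W \<in> null_sets \<mu>" using o by (intro AE_iff_null_sets[THEN iffD2]) (auto simp: sets_mu)
  ultimately show False by (simp add: null_setsD1)
qed

text \<open>Open sets are an intersection-stable generator, so the integral vanishes over all Borel
  sets, in particular where \<open>f\<close> is positive and where it is negative.\<close>

lemma AE_zero_of_set_integrals:
  fixes f :: "'g \<Rightarrow> real"
  assumes f: "integrable \<mu> f" and zero: "\<And>Q. open Q \<Longrightarrow> (\<integral>x. indicator Q x * f x \<partial>\<mu>) = 0"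
  shows "AE x in \<mu>. f x = 0"
proof -
  have int: "integrable \<mu> (\<lambda>x. indicator A x * f x)" if "A \<in> sets borel" for A
    using integrable_mult_indicator[of A \<mu> f] f that by (simp add: sets_mu)
  have all: "(\<integral>x. indicator A x * f x \<partial>\<mu>) = 0" if "A \<in> sets borel" for A
  proof -
    have "Int_stable {S. open S}" "{S. open S} \<subseteq> Pow (UNIV :: 'g set)" by (auto simp: Int_stable_def)
    moreover have "A \<in> sigma_sets UNIV {S. open S}" using that by (simp add: borel_def)
    ultimately show ?thesis
    proof (induction rule: sigma_sets_induct_disjoint)
      case (basic A)
      then show ?case using zero by simp
    next
      case (compl A)
      then have A: "A \<in> sets borel" by (simp add: borel_def)
      have "(\<integral>x. indicator (UNIV - A) x * f x \<partial>\<mu>) = (\<integral>x. indicator UNIV x * f x - indicator A x * f x \<partial>\<mu>)"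
        by (intro Bochner_Integration.integral_cong) (auto simp: indicator_def)
      also have "\<dots> = 0" using zero[of UNIV] compl by (simp add: Bochner_Integration.integral_diff int[OF A] f)
      finally show ?case .
    next
      case (union A)
      have A: "A i \<in> sets \<mu>" for i using union(2) by (auto simp: borel_def sets_mu)
      have "(LINT x:(\<Union>i. A i)|\<mu>. f x) = (\<Sum>i. (LINT x:(A i)|\<mu>. f x))"
      proof (rule lebesgue_integral_countable_add[OF A])
        show "A i \<inter> A j = {}" if "i \<noteq> j" for i j using union(1) that by (auto simp: disjoint_family_on_def)
        show "set_integrable \<mu> (\<Union>i. A i) f"
          unfolding set_integrable_def using int[of "\<Union>i. A i"] A by (simp add: sets_mu)
      qed
      then show ?case using union(3) by (simp add: set_lebesgue_integral_def)
    qed simp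
  qed
  have m: "f \<in> borel_measurable borel" using borel_measurable_integrable[OF f] by (simp add: borel_measurable_mu)
  have nz: "AE x in \<mu>. indicator A x * f x = 0"
    if A: "A \<in> sets borel" and s: "\<And>x. indicator A x * f x * s \<ge> 0" and s0: "s \<noteq> 0" for A and s :: real
  proof -
    have "(\<integral>x. indicator A x * f x * s \<partial>\<mu>) = 0" using all[OF A] by simp
    moreover have "integrable \<mu> (\<lambda>x. indicator A x * f x * s)" using int[OF A] by simp
    ultimately have "AE x in \<mu>. indicator A x * f x * s = 0" using s by (subst (asm) integral_nonneg_eq_0_iff_AE) auto
    then show ?thesis using s0 by auto
  qed
  have "AE x in \<mu>. indicator {x. f x > 0} x * f x = 0"
    by (rule nz[of _ 1]) (use m in \<open>auto simp: indicator_def\<close>)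
  moreover have "AE x in \<mu>. indicator {x. f x < 0} x * f x = 0"
    by (rule nz[of _ "-1"]) (use m in \<open>auto simp: indicator_def\<close>)
  ultimately show ?thesis by eventually_elim (auto simp: indicator_def split: if_splits)
qed

text \<open>In a chart, truncated multiples of the distance to the complement are continuous test
  functions converging to the indicator of an open set. Dominated convergence gives vanishing
  integrals over open sets.\<close>

lemma du_bois_reymond:
  fixes f :: "'g \<Rightarrow> real"
  assumes V: "open V" "p \<in> V" and f: "\<And>K. compact K \<Longrightarrow> K \<subseteq> V \<Longrightarrow> integrable \<mu> (\<lambda>x. indicator K x * f x)"
    and zero: "\<And>\<psi> K. continuous_on UNIV \<psi> \<Longrightarrow> compact K \<Longrightarrow> K \<subseteq> V \<Longrightarrow> (\<And>x. x \<notin> K \<Longrightarrow> \<psi> x = 0) \<Longrightarrow>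
      (\<integral>x. \<psi> x * f x \<partial>\<mu>) = 0"
  shows "\<exists>V'. open V' \<and> p \<in> V' \<and> V' \<subseteq> V \<and> (AE x in \<mu>. x \<in> V' \<longrightarrow> f x = 0)"
proof (rule compact_neighbourhood[OF V])
  fix W \<phi> r K
  assume W: "(W, \<phi>) \<in> charts G" "p \<in> W" and r: "r > 0" "cball (\<phi> p) r \<subseteq> \<phi> ` (W \<inter> V)"
    and K: "K = inv_into W \<phi> ` cball (\<phi> p) r" "compact K" "K \<subseteq> W \<inter> V"
    and V': "open {x \<in> W. \<phi> x \<in> ball (\<phi> p) r}" "p \<in> {x \<in> W. \<phi> x \<in> ball (\<phi> p) r}" "{x \<in> W. \<phi> x \<in> ball (\<phi> p) r} \<subseteq> K"
  let ?V = "{x \<in> W. \<phi> x \<in> ball (\<phi> p) r}"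
  have fK: "integrable \<mu> (\<lambda>x. indicator K x * f x)" using f[OF K(2)] K(3) by blast
  have VK: "indicator ?V x * (indicator K x * f x) = indicator ?V x * f x" for x
    using V'(3) by (auto simp: indicator_def)
  have fV: "integrable \<mu> (\<lambda>x. indicator ?V x * f x)"
    using integrable_mult_indicator[OF _ fK, of ?V] V'(1) unfolding real_scaleR_def VK by (simp add: sets_mu)
  have "(\<integral>x. indicator Q x * (indicator ?V x * f x) \<partial>\<mu>) = 0" if Q: "open Q" for Q
  proof -
    define P where "P = \<phi> ` (W \<inter> (Q \<inter> ?V))"
    have P: "open P" unfolding P_def by (rule chart_image_open[OF W(1) open_Int[OF Q V'(1)]])
    have Pb: "P \<subseteq> ball (\<phi> p) r" by (auto simp: P_def)
    \<comment> \<open>The complement must be nonempty, since \<open>infdist\<close> to the empty set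
      is 0 by convention; it is, because \<open>P\<close> is bounded.\<close>
    have ne: "- P \<noteq> {}"
    proof
      assume "- P = {}"
      then have "ball (\<phi> p) r = UNIV" using Pb by auto
      then show False using not_bounded_UNIV bounded_ball by metis
    qed
    have inP: "\<phi> x \<in> P \<longleftrightarrow> x \<in> Q \<inter> ?V" if "x \<in> W" for x
      using that chart_inj[OF W(1)] by (auto simp: P_def dest: inj_onD)
    define \<psi> where "\<psi> = (\<lambda>n::nat. \<lambda>x. if x \<in> W then min 1 (real n * infdist (\<phi> x) (- P)) else 0)"
    have d0: "infdist u (- P) = 0" if "u \<notin> P" for u using that by simp
    have d1: "infdist u (- P) > 0" if "u \<in> P" for u
    proof -
      have "closed (- P)" using P by (simp add: closed_def)
      then have "infdist u (- P) \<noteq> 0" using that in_closed_iff_infdist_zero[OF _ ne, of u] by simp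
      then show ?thesis using infdist_nonneg[of u "- P"] by simp
    qed
    have \<psi>0: "\<psi> n x = 0" if "x \<notin> K" for n x
    proof (cases "x \<in> W")
      case True
      then have "\<phi> x \<notin> P" using inP that V'(3) by blast
      then show ?thesis by (simp add: \<psi>_def d0)
    qed (simp add: \<psi>_def)
    have "isCont (\<psi> n) x" for n x
    proof (cases "x \<in> W")
      case True
      have "continuous_on W (\<lambda>x. min 1 (real n * infdist (\<phi> x) (- P)))"
        by (intro continuous_intros chart_continuous[OF W(1)])
      then have "continuous_on W (\<psi> n)" by (rule continuous_on_eq) (simp add: \<psi>_def)
      then show ?thesis using True chart_open[OF W(1)] by (simp add: continuous_on_eq_continuous_at)
    next
      case False
      then have "x \<in> - K" using K(3) by auto
      moreover have "open (- K)" using compact_imp_closed[OF K(2)] by auto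
      moreover have "continuous_on (- K) (\<psi> n)"
        by (rule continuous_on_eq[of _ "\<lambda>_. 0"]) (use \<psi>0 in auto)
      ultimately show ?thesis using continuous_on_eq_continuous_at by blast
    qed
    then have c: "continuous_on UNIV (\<psi> n)" for n by (simp add: continuous_at_imp_continuous_on)
    have bd: "\<bar>\<psi> n x\<bar> \<le> 1" for n x by (auto simp: \<psi>_def infdist_nonneg)
    have lim: "(\<lambda>n. \<psi> n x) \<longlonglongrightarrow> indicator (Q \<inter> ?V) x" for x
    proof (cases "x \<in> Q \<inter> ?V")
      case True
      then have x: "x \<in> W" "\<phi> x \<in> P" using inP by auto
      obtain n0 :: nat where n0: "1 / infdist (\<phi> x) (- P) < n0" using reals_Archimedean2 by blast
      have "\<psi> n x = 1" if "n \<ge> n0" for n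
      proof -
        have "1 \<le> real n * infdist (\<phi> x) (- P)" using n0 that d1[OF x(2)] by (simp add: field_simps) (smt (verit) mult_right_mono of_nat_le_iff)
        then show ?thesis using x by (simp add: \<psi>_def)
      qed
      then have "(\<lambda>n. \<psi> n x) \<longlonglongrightarrow> 1" by (intro tendsto_eventually) (auto simp: eventually_sequentially)
      then show ?thesis using True by simp
    next
      case False
      then have "\<psi> n x = 0" for n using inP d0 by (auto simp: \<psi>_def)
      then show ?thesis using False by simp
    qed
    have "(\<lambda>n. \<integral>x. \<psi> n x * (indicator K x * f x) \<partial>\<mu>) \<longlonglongrightarrow> (\<integral>x. indicator (Q \<inter> ?V) x * (indicator K x * f x) \<partial>\<mu>)"
    proof (rule integral_dominated_convergence[where w="\<lambda>x. norm (indicator K x * f x)"])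
      have fm: "(\<lambda>x. indicator K x * f x) \<in> borel_measurable \<mu>" using fK by (rule borel_measurable_integrable)
      show "(\<lambda>x. indicator (Q \<inter> ?V) x * (indicator K x * f x)) \<in> borel_measurable \<mu>"
        using Q V'(1) by (intro borel_measurable_times fm borel_measurable_indicator) (simp add: sets_mu open_Int)
      show "(\<lambda>x. \<psi> n x * (indicator K x * f x)) \<in> borel_measurable \<mu>" for n
        by (intro borel_measurable_times fm) (simp add: borel_measurable_mu borel_measurable_continuous_onI[OF c])
      show "integrable \<mu> (\<lambda>x. norm (indicator K x * f x))" using fK by (rule integrable_norm)
      show "AE x in \<mu>. (\<lambda>n. \<psi> n x * (indicator K x * f x)) \<longlonglongrightarrow> indicator (Q \<inter> ?V) x * (indicator K x * f x)"
        by (intro AE_I2 tendsto_mult lim tendsto_const)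
      show "AE x in \<mu>. norm (\<psi> n x * (indicator K x * f x)) \<le> norm (indicator K x * f x)" for n
      proof (rule AE_I2)
        fix x
        have "norm (\<psi> n x * (indicator K x * f x)) = \<bar>\<psi> n x\<bar> * norm (indicator K x * f x)"
          by (simp only: abs_mult real_norm_def)
        also have "\<dots> \<le> 1 * norm (indicator K x * f x)" by (rule mult_right_mono[OF bd norm_ge_zero])
        finally show "norm (\<psi> n x * (indicator K x * f x)) \<le> norm (indicator K x * f x)" by simp
      qed
    qed
    moreover have "(\<integral>x. \<psi> n x * (indicator K x * f x) \<partial>\<mu>) = 0" for n
    proof -
      have e: "\<psi> n x * (indicator K x * f x) = \<psi> n x * f x" for x using \<psi>0[of x n] by (auto simp: indicator_def)
      have "K \<subseteq> V" using K(3) by blast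
      then show ?thesis unfolding e by (rule zero[OF c K(2) _ \<psi>0])
    qed
    ultimately have "(\<integral>x. indicator (Q \<inter> ?V) x * (indicator K x * f x) \<partial>\<mu>) = 0"
      by (simp only: LIMSEQ_const_iff)
    moreover have "indicator (Q \<inter> ?V) x * (indicator K x * f x) = indicator Q x * (indicator ?V x * f x)" for x
      using VK[of x] by (auto simp: indicator_def)
    ultimately show ?thesis by (simp only:)
  qed
  from AE_zero_of_set_integrals[OF fV this]
  have "AE x in \<mu>. indicator ?V x * f x = 0" by simp
  then have "AE x in \<mu>. x \<in> ?V \<longrightarrow> f x = 0" by eventually_elim (auto simp: indicator_def)
  moreover have "?V \<subseteq> V" using V'(3) K(3) by blast
  ultimately show ?thesis using V'(1,2) by blast
qed

end

context carnot
begin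

text \<open>\<open>Z\<close> is measurable for the completed measure only. A Borel function equal to
  it almost everywhere on \<open>U\<close> allows Fubini's theorem, and it satisfies the same weak
  equations.\<close>

lemma borel_version:
  assumes U: "open U" and Z: "weak_contact_field G \<mu> U Z"
  obtains Z0 where "Z0 \<in> borel_measurable borel" "AE x in \<mu>. x \<in> U \<longrightarrow> Z0 x = Z x"
    "\<And>K. compact K \<Longrightarrow> K \<subseteq> U \<Longrightarrow> integrable \<mu> (\<lambda>x. indicator K x *\<^sub>R Z0 x)"
    "\<And>b K i j. smooth_fun_on G UNIV b \<Longrightarrow> compact K \<Longrightarrow> K \<subseteq> U \<Longrightarrow> (\<And>x. x \<notin> K \<Longrightarrow> b x = 0) \<Longrightarrow>
       i \<in> {1..layer_dim G 1} \<Longrightarrow> j \<in> I \<Longrightarrow> fst j \<noteq> 1 \<Longrightarrow>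
       (\<integral>x. coframe G j (lie_bracket G (Z0 x) (X (1, i))) * b x \<partial>\<mu>) +
       (\<integral>x. coframe G j (Z0 x) * left_deriv G (X (1, i)) b x \<partial>\<mu>) = 0"
proof -
  let ?c = "completion \<mu>"
  \<comment> \<open>Extension by 0 turns measurability on \<open>U\<close> into measurability on the
    whole group.\<close>
  let ?Zt = "\<lambda>x. indicator U x *\<^sub>R Z x"
  have L1: "L1_loc_field G \<mu> U Z" using Z by (simp add: weak_contact_field_def)
  have Us: "U \<in> sets \<mu>" using U by (simp add: sets_mu)
  have Zt: "?Zt \<in> borel_measurable ?c"
    using L1 Us by (subst borel_measurable_restrict_space_iff[symmetric]) (auto simp: L1_loc_field_def)
  have "\<exists>g\<in>borel_measurable \<mu>. AE x in \<mu>. ?Zt x \<bullet> b = g x" for b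
    by (rule completion_ex_borel_measurable_real) (intro borel_measurable_inner Zt borel_measurable_const)
  then obtain g where g: "\<And>b. g b \<in> borel_measurable \<mu>" "\<And>b. AE x in \<mu>. ?Zt x \<bullet> b = g b x" by metis
  define Z0 where "Z0 = (\<lambda>x. \<Sum>b\<in>Basis. g b x *\<^sub>R b)"
  have Z0m: "Z0 \<in> borel_measurable \<mu>" unfolding Z0_def
    by (intro borel_measurable_sum borel_measurable_scaleR g borel_measurable_const)
  have "AE x in \<mu>. \<forall>b\<in>Basis. ?Zt x \<bullet> b = g b x"
    by (subst AE_ball_countable) (use g(2) in \<open>auto intro: countable_finite\<close>)
  then have ae: "AE x in \<mu>. Z0 x = ?Zt x"
  proof eventually_elim
    case (elim x)
    then have "Z0 x = (\<Sum>b\<in>Basis. (?Zt x \<bullet> b) *\<^sub>R b)" unfolding Z0_def by (intro sum.cong) auto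
    then show ?case unfolding euclidean_representation .
  qed
  then have aec: "AE x in ?c. Z0 x = ?Zt x" by (rule AE_completion)
  have transfer: "(\<integral>x. F x (?Zt x) \<partial>?c) = (\<integral>x. F x (Z0 x) \<partial>\<mu>)"
    if "(\<lambda>x. F x (?Zt x)) \<in> borel_measurable ?c" "(\<lambda>x. F x (Z0 x)) \<in> borel_measurable \<mu>" for F :: "'g \<Rightarrow> 'a \<Rightarrow> real"
  proof -
    have "(\<integral>x. F x (?Zt x) \<partial>?c) = (\<integral>x. F x (Z0 x) \<partial>?c)"
    proof (rule integral_cong_AE)
      show "(\<lambda>x. F x (?Zt x)) \<in> borel_measurable ?c" by (rule that(1))
      show "(\<lambda>x. F x (Z0 x)) \<in> borel_measurable ?c" by (rule measurable_completion) (rule that(2))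
      from aec show "AE x in ?c. F x (?Zt x) = F x (Z0 x)" by eventually_elim simp
    qed
    also have "\<dots> = (\<integral>x. F x (Z0 x) \<partial>\<mu>)" by (rule integral_completion[OF that(2)])
    finally show ?thesis .
  qed
  have lm: "(\<lambda>x. l (h x)) \<in> borel_measurable M" if "linear l" "h \<in> borel_measurable M" for l :: "'a \<Rightarrow> real" and h and M :: "'g measure"
  proof -
    have "continuous_on UNIV l" by (rule linear_continuous_on) (use that(1) in \<open>simp add: linear_conv_bounded_linear\<close>)
    then have "l \<in> borel_measurable borel" by (rule borel_measurable_continuous_onI)
    from measurable_compose[OF that(2) this] show ?thesis .
  qed
  show thesis
  proof (rule that)
    show "Z0 \<in> borel_measurable borel" using Z0m by (simp add: borel_measurable_mu)
    show "AE x in \<mu>. x \<in> U \<longrightarrow> Z0 x = Z x" using ae by eventually_elim auto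
  next
    fix K assume K: "compact K" "K \<subseteq> U"
    have Ks: "K \<in> sets \<mu>" using K by (simp add: compact_sets)
    have "integrable \<mu> (\<lambda>x. indicator K x *\<^sub>R coframe G i (Z0 x))" if i: "i \<in> I" for i
    proof -
      have m: "(\<lambda>x. indicator K x *\<^sub>R coframe G i (Z0 x)) \<in> borel_measurable \<mu>"
        by (intro borel_measurable_scaleR borel_measurable_indicator Ks lm[OF coframe_linear Z0m])
      have "integrable ?c (\<lambda>x. indicator K x *\<^sub>R coframe G i (Z x))"
        using L1 K i by (auto simp: L1_loc_field_def set_integrable_def I_def)
      moreover have "AE x in ?c. indicator K x *\<^sub>R coframe G i (Z x) = indicator K x *\<^sub>R coframe G i (Z0 x)"
        using aec by eventually_elim (use K(2) in \<open>auto simp: indicator_def\<close>)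
      ultimately have "integrable ?c (\<lambda>x. indicator K x *\<^sub>R coframe G i (Z0 x))"
        by (rule integrable_cong_AE_imp[OF _ measurable_completion[OF m]])
      then show ?thesis using integrable_completion[OF m] by simp
    qed
    then have "integrable \<mu> (\<lambda>x. \<Sum>i\<in>I. (indicator K x *\<^sub>R coframe G i (Z0 x)) *\<^sub>R X i)"
      by (intro Bochner_Integration.integrable_sum integrable_scaleR_left) auto
    moreover have "(\<Sum>i\<in>I. (indicator K x *\<^sub>R coframe G i (Z0 x)) *\<^sub>R X i) = indicator K x *\<^sub>R Z0 x" for x
    proof -
      have "indicator K x *\<^sub>R Z0 x = indicator K x *\<^sub>R (\<Sum>i\<in>I. coframe G i (Z0 x) *\<^sub>R X i)"
        using coframe_expansion[of "Z0 x"] by simp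
      then show ?thesis by (simp add: scaleR_sum_right)
    qed
    ultimately show "integrable \<mu> (\<lambda>x. indicator K x *\<^sub>R Z0 x)" by simp
  next
    fix b :: "'g \<Rightarrow> real" and K i j
    assume b: "smooth_fun_on G UNIV b" and K: "compact K" "K \<subseteq> U" "\<And>x. x \<notin> K \<Longrightarrow> b x = 0"
      and i: "i \<in> {1..layer_dim G 1}" and j: "j \<in> I" "fst j \<noteq> 1"
    let ?X = "X (1, i)"
    have bc: "continuous_on UNIV b" by (rule Ck_fun_on_continuous[OF smooth_fun_onD[OF b] open_UNIV])
    have bm: "b \<in> borel_measurable \<mu>" using borel_measurable_continuous_onI[OF bc] by (simp add: borel_measurable_mu)
    have "continuous_on UNIV (left_deriv G ?X b)"
      by (rule Ck_fun_on_continuous[OF smooth_fun_onD[OF smooth_left_deriv[OF b open_UNIV]] open_UNIV])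
    then have dm: "left_deriv G ?X b \<in> borel_measurable \<mu>"
      using borel_measurable_continuous_onI by (simp add: borel_measurable_mu)
    have l1: "linear (\<lambda>A. coframe G j (lie_bracket G A ?X))"
      using linear_compose[OF lie_bracket_linear_left coframe_linear] by (simp add: o_def)
    have l0: "coframe G j (lie_bracket G 0 ?X) = 0" "coframe G j 0 = 0"
      using linear_0[OF l1] linear_0[OF coframe_linear] by simp_all
    have e1: "set_lebesgue_integral ?c U (\<lambda>x. coframe G j (lie_bracket G (Z x) ?X) * b x)
        = (\<integral>x. coframe G j (lie_bracket G (Z0 x) ?X) * b x \<partial>\<mu>)"
    proof -
      have "set_lebesgue_integral ?c U (\<lambda>x. coframe G j (lie_bracket G (Z x) ?X) * b x)
         = (\<integral>x. coframe G j (lie_bracket G (?Zt x) ?X) * b x \<partial>?c)"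
        unfolding set_lebesgue_integral_def
        using K(2,3) by (intro Bochner_Integration.integral_cong) (auto simp: indicator_def)
      also have "\<dots> = (\<integral>x. coframe G j (lie_bracket G (Z0 x) ?X) * b x \<partial>\<mu>)"
        by (rule transfer[of "\<lambda>x A. coframe G j (lie_bracket G A ?X) * b x"])
          (intro borel_measurable_times lm[OF l1] Zt Z0m bm measurable_completion[OF bm])+
      finally show ?thesis .
    qed
    have e2: "set_lebesgue_integral ?c U (\<lambda>x. coframe G j (Z x) * left_deriv G ?X b x)
        = (\<integral>x. coframe G j (Z0 x) * left_deriv G ?X b x \<partial>\<mu>)"
    proof -
      have "set_lebesgue_integral ?c U (\<lambda>x. coframe G j (Z x) * left_deriv G ?X b x)
         = (\<integral>x. coframe G j (?Zt x) * left_deriv G ?X b x \<partial>?c)"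
        unfolding set_lebesgue_integral_def
        by (intro Bochner_Integration.integral_cong) (auto simp: indicator_def l0)
      also have "\<dots> = (\<integral>x. coframe G j (Z0 x) * left_deriv G ?X b x \<partial>\<mu>)"
        by (rule transfer[of "\<lambda>x A. coframe G j A * left_deriv G ?X b x"])
          (intro borel_measurable_times lm[OF coframe_linear] Zt Z0m dm measurable_completion[OF dm])+
      finally show ?thesis .
    qed
    show "(\<integral>x. coframe G j (lie_bracket G (Z0 x) ?X) * b x \<partial>\<mu>) +
       (\<integral>x. coframe G j (Z0 x) * left_deriv G ?X b x \<partial>\<mu>) = 0"
      using weak_equation[OF Z b K i j] unfolding e1 e2 .
  qed
qed

end

section \<open>Mollification\<close>

context lie_grp
begin

text \<open>Differentiate \<open>u \<cdot> iv u = ge\<close> at the identity, where the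
  multiplication has derivative \<open>(v, v') \<mapsto> v + v'\<close>.\<close>

lemma has_derivative_iv: "((\<lambda>u. kap (iv (xi u))) has_derivative (\<lambda>v. - v)) (at og)"
proof -
  let ?\<iota> = "\<lambda>u. kap (iv (xi u))"
  have g: "Ck_map (Suc 0) D0 (\<lambda>u. iv (xi u))" by (intro Ck_map_iv Ck_map_xi open_D0)
  let ?T = "D0 \<inter> (\<lambda>u. iv (xi u)) -` W0"
  have T: "open ?T" by (rule continuous_open_preimage[OF Ck_map_continuous[OF g] open_D0 chart_open[OF id_chart]])
  have og: "og \<in> ?T" using og_D0 ge_W0 by (simp add: grp.inverse_neutral)
  have i0: "?\<iota> og = og" by (simp add: grp.inverse_neutral)
  define D where "D = frechet_derivative ?\<iota> (at og)"
  have D: "(?\<iota> has_derivative D) (at og)" unfolding D_def by (rule Ck_on_has_derivative[OF Ck_map_chart[OF g id_chart] og])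
  have "((\<lambda>u. (u, ?\<iota> u)) has_derivative (\<lambda>v. (v, D v))) (at og)"
    by (intro has_derivative_Pair has_derivative_ident D)
  from diff_chain_at[OF this, of mm "DM (og, og)"] has_DM[OF MM_og(1)[OF og_D0]]
  have "((\<lambda>u. mm (u, ?\<iota> u)) has_derivative (\<lambda>v. DM (og, og) (v, D v))) (at og)" by (simp add: o_def i0)
  moreover have "((\<lambda>u. mm (u, ?\<iota> u)) has_derivative (\<lambda>v. 0)) (at og)"
    by (rule has_derivative_transform_within_open[OF has_derivative_const[of og] T og]) (simp add: mm_def xi_kap)
  ultimately have "(\<lambda>v. DM (og, og) (v, D v)) = (\<lambda>v. 0)" by (rule has_derivative_unique)
  then have z: "DM (og, og) (v, D v) = 0" for v by (rule fun_cong)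
  have lin: "linear (DM (og, og))" using has_DM[OF MM_og(1)[OF og_D0]] has_derivative_linear by blast
  have "D v = - v" for v
    using z[of v] linear_add[OF lin, of "(v, 0)" "(0, D v)"] by (simp add: DM_og eq_neg_iff_add_eq_0 add.commute)
  then have "D = (\<lambda>v. - v)" by (rule ext)
  with D show ?thesis by simp
qed

lemma left_deriv_zero_open:
  fixes f :: "'g \<Rightarrow> 'b::real_normed_vector"
  assumes V: "open V" "x \<in> V" and f: "\<And>y. y \<in> V \<Longrightarrow> f y = 0"
  shows "left_deriv G A f x = 0"
proof -
  have S: "open {u \<in> D0. x \<cdot> xi u \<in> V}" "og \<in> {u \<in> D0. x \<cdot> xi u \<in> V}"
    using translate_domain[of V x ge] V by simp_all
  have "((\<lambda>u. f (x \<cdot> xi u)) has_derivative (\<lambda>_. 0)) (at og)"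
    by (rule has_derivative_transform_within_open[OF has_derivative_const[of 0] S]) (simp add: f)
  then show ?thesis by (rule left_deriv_eqI)
qed

end

context lie_haar
begin

lemma integrable_continuous_compact:
  fixes f :: "'g \<Rightarrow> real"
  assumes V: "open V" and f: "continuous_on V f" and K: "compact K" "K \<subseteq> V" "\<And>x. x \<notin> K \<Longrightarrow> f x = 0"
  shows "integrable \<mu> f"
proof -
  have "bounded (f ` K)" by (rule compact_imp_bounded[OF compact_continuous_image[OF continuous_on_subset[OF f K(2)] K(1)]])
  then obtain M where M: "\<And>x. x \<in> K \<Longrightarrow> \<bar>f x\<bar> \<le> M" unfolding bounded_iff by auto
  have e: "indicator V x *\<^sub>R f x = f x" for x using K(2,3) by (auto simp: indicator_def)
  have m: "f \<in> borel_measurable \<mu>"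
    using borel_measurable_continuous_on_indicator[OF _ f] V unfolding e borel_measurable_mu by simp
  show ?thesis
  proof (rule Bochner_Integration.integrable_bound[OF _ m])
    show "integrable \<mu> (\<lambda>x. M * indicator K x)" by (intro integrable_mult_right integrable_indicator_compact K)
    show "AE x in \<mu>. norm (f x) \<le> norm (M * indicator K x)"
    proof (rule AE_I2)
      fix x
      show "norm (f x) \<le> norm (M * indicator K x)"
        using M[of x] K(3)[of x] by (cases "x \<in> K") auto
    qed
  qed
qed

end

text \<open>Kernels are supported in \<open>Nb\<close>, mollifications are studied on
  \<open>B\<close>, and \<open>C\<close> contains every point \<open>n\<^sup>-\<^sup>1 x\<close> at
  which the field is then sampled.\<close>

locale mollify = carnot G \<mu>
  for G :: "('g::{t2_space,second_countable_topology}, 'a::euclidean_space, 'm) carnot_data_scheme" and \<mu> +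
  fixes Z0 :: "'g \<Rightarrow> 'a" and B Nb C :: "'g set"
  assumes open_B: "open B" and open_Nb: "open Nb" "ge \<in> Nb" and compact_C: "compact C"
    and near: "\<And>x n. x \<in> B \<Longrightarrow> n \<in> Nb \<Longrightarrow> iv n \<cdot> x \<in> C"
    and Z0_integrable: "integrable \<mu> (\<lambda>x. indicator C x *\<^sub>R Z0 x)"
    and Z0_equation: "\<And>b i j. smooth_fun_on G UNIV b \<Longrightarrow> (\<And>x. x \<notin> C \<Longrightarrow> b x = 0) \<Longrightarrow>
       i \<in> {1..layer_dim G 1} \<Longrightarrow> j \<in> I \<Longrightarrow> fst j \<noteq> 1 \<Longrightarrow>
       (\<integral>x. coframe G j (lie_bracket G (Z0 x) (X (1, i))) * b x \<partial>\<mu>) +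
       (\<integral>x. coframe G j (Z0 x) * left_deriv G (X (1, i)) b x \<partial>\<mu>) = 0"
begin

text \<open>The truncation makes the field integrable on the whole group and leaves mollifications
  on \<open>B\<close> unchanged, since these see points of \<open>C\<close> only.\<close>

definition "w y = indicator C y *\<^sub>R Z0 y"

lemma w_integrable: "integrable \<mu> w"
  using Z0_integrable by (simp add: w_def[abs_def])

text \<open>Neither sign nor total mass is prescribed, so the kernels form a vector space and
  combinations of mollifications are mollifications.\<close>

definition "smoother \<phi> \<longleftrightarrow> smooth_fun_on G UNIV \<phi> \<and> (\<exists>K. compact K \<and> K \<subseteq> Nb \<and> (\<forall>x. x \<notin> K \<longrightarrow> \<phi> x = (0::real)))"

definition "conv \<phi> x = (\<integral>y. \<phi> (x \<cdot> iv y) *\<^sub>R w y \<partial>\<mu>)"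

lemma smoother_zero: "smoother \<phi> \<Longrightarrow> x \<in> B \<Longrightarrow> y \<notin> C \<Longrightarrow> \<phi> (x \<cdot> iv y) = 0"
proof (rule ccontr)
  assume "smoother \<phi>" and x: "x \<in> B" and y: "y \<notin> C" and "\<phi> (x \<cdot> iv y) \<noteq> 0"
  then have "x \<cdot> iv y \<in> Nb" by (auto simp: smoother_def)
  from near[OF x this] show False using y by (simp add: grp.inverse_distrib_swap grp.assoc)
qed

lemma smoother_psm:
  assumes \<phi>: "smoother \<phi>" and S: "open S" and F: "\<And>k. Ck_map k S F"
  shows "param_smooth S (\<lambda>u y. \<phi> (F u \<cdot> iv y))"
proof (rule param_smooth_smooth_fun[OF _ S])
  show "smooth_fun_on G UNIV \<phi>" using \<phi> by (simp add: smoother_def)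
  fix W \<kappa> k assume W: "(W, \<kappa>) \<in> charts G"
  have o: "open (S \<times> \<kappa> ` W)" by (intro open_Times S chart_open_image[OF W])
  show "Ck_map k (S \<times> \<kappa> ` W) (\<lambda>z. F (fst z) \<cdot> iv (inv_into W \<kappa> (snd z)))"
    by (intro Ck_map_mul Ck_map_iv o Ck_map_compose[OF o S F Ck_on_fst[OF o]]
      Ck_map_compose[OF o chart_open_image[OF W] Ck_map_inv_chart[OF W] Ck_on_snd[OF o]]) auto
qed

lemma smoother_integrable:
  assumes \<phi>: "smoother \<phi>" and x: "x \<in> B"
  shows "integrable \<mu> (\<lambda>y. \<phi> (x \<cdot> iv y) *\<^sub>R w y)"
  by (rule param_integral_integrable[of "UNIV :: 'a set" "\<lambda>u y. \<phi> (x \<cdot> iv y)" C w 0])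
    (use smoother_psm[OF \<phi> open_UNIV Ck_map_const, of x] smoother_zero[OF \<phi> x] compact_C w_integrable in auto)

lemma conv_Ck: "smoother \<phi> \<Longrightarrow> Ck_fun_on G k B (conv \<phi>)"
proof (rule Ck_fun_onI)
  fix W \<kappa> assume \<phi>: "smoother \<phi>" and W: "(W, \<kappa>) \<in> charts G"
  have S: "open (\<kappa> ` (W \<inter> B))" by (rule chart_image_open[OF W open_B])
  have F: "Ck_map k (\<kappa> ` (W \<inter> B)) (inv_into W \<kappa>)" for k
    by (rule Ck_map_subset[OF Ck_map_inv_chart[OF W]]) auto
  show "Ck_on k (\<kappa> ` (W \<inter> B)) (\<lambda>u. conv \<phi> (inv_into W \<kappa> u))"
    unfolding conv_def
  proof (rule param_integral_smooth[OF smoother_psm[OF \<phi> S F] S compact_C _ w_integrable])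
    fix u y assume "u \<in> \<kappa> ` (W \<inter> B)" "y \<notin> C"
    then show "\<phi> (inv_into W \<kappa> u \<cdot> iv y) = 0" using W by (intro smoother_zero[OF \<phi>]) auto
  qed
qed

lemma smooth_reflect:
  assumes "smooth_fun_on G UNIV \<phi>"
  shows "smooth_fun_on G UNIV (\<lambda>y. \<phi> (x \<cdot> iv y))"
proof (rule smooth_fun_onI, rule Ck_fun_onI)
  fix k W \<kappa> assume W: "(W, \<kappa>) \<in> charts G"
  note P = chart_open_image[OF W]
  have "Ck_on k (\<kappa> ` W) (\<lambda>u. \<phi> (x \<cdot> iv (inv_into W \<kappa> u)))"
    by (rule Ck_fun_on_gmap[OF smooth_fun_onD[OF assms] open_UNIV P])
      (auto intro!: Ck_map_mul Ck_map_iv Ck_map_inv_chart W P Ck_map_const)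
  then show "Ck_on k (\<kappa> ` (W \<inter> UNIV)) (\<lambda>u. \<phi> (x \<cdot> iv (inv_into W \<kappa> u)))" by simp
qed

lemma conv_left_deriv:
  assumes \<phi>: "smoother \<phi>" and x: "x \<in> B"
  shows "integrable \<mu> (\<lambda>y. left_deriv G A (\<lambda>y. \<phi> (x \<cdot> iv y)) y *\<^sub>R w y)"
    and "left_deriv G A (conv \<phi>) x = - (\<integral>y. left_deriv G A (\<lambda>y. \<phi> (x \<cdot> iv y)) y *\<^sub>R w y \<partial>\<mu>)"
proof -
  let ?b = "\<lambda>y. \<phi> (x \<cdot> iv y)"
  let ?S = "{u \<in> D0. x \<cdot> xi u \<in> B}"
  have S: "open ?S" "og \<in> ?S" using translate_domain[of B x ge] open_B x by simp_all
  have F: "Ck_map k ?S (\<lambda>u. x \<cdot> xi u)" for k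
    by (intro Ck_map_mul Ck_map_const S Ck_map_subset[OF Ck_map_xi]) auto
  have b: "smooth_fun_on G UNIV ?b" using \<phi> by (intro smooth_reflect) (simp add: smoother_def)
  \<comment> \<open>With \<open>x \<cdot> xi u \<cdot> iv y = x \<cdot> iv (y \<cdot> iv (xi
    u))\<close>, moving \<open>x\<close> by \<open>xi u\<close> is moving \<open>y\<close> by its
    inverse; inversion has derivative \<open>- v\<close>, whence the sign.\<close>
  have fr: "frechet_derivative (\<lambda>u. \<phi> (x \<cdot> xi u \<cdot> iv y)) (at og) v = - left_deriv G v ?b y" for v y
  proof -
    let ?T = "D0 \<inter> (\<lambda>u. iv (xi u)) -` W0"
    have T: "open ?T" "og \<in> ?T"
      using continuous_open_preimage[OF continuous_on_iv[OF continuous_on_xi] open_D0 chart_open[OF id_chart]]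
        og_D0 ge_W0 by (simp_all add: grp.inverse_neutral)
    have "((\<lambda>u. ?b (y \<cdot> xi u)) has_derivative (\<lambda>A. left_deriv G A ?b y)) (at (kap (iv (xi og))))"
      using has_left_deriv_smooth[OF b, of y] by (simp add: grp.inverse_neutral)
    from diff_chain_at[OF has_derivative_iv this]
    have "((\<lambda>u. ?b (y \<cdot> xi (kap (iv (xi u))))) has_derivative (\<lambda>v. left_deriv G (- v) ?b y)) (at og)"
      by (simp add: o_def)
    then have "((\<lambda>u. \<phi> (x \<cdot> xi u \<cdot> iv y)) has_derivative (\<lambda>v. left_deriv G (- v) ?b y)) (at og)"
      by (rule has_derivative_transform_within_open[OF _ T])
        (simp add: xi_kap grp.inverse_distrib_swap grp.assoc)
    from fun_cong[OF frechet_derivative_at[OF this], of v] linear_neg[OF left_deriv_linear[OF b], of v y]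
    show ?thesis by simp
  qed
  have P: "param_smooth ?S (\<lambda>u y. \<phi> (x \<cdot> xi u \<cdot> iv y))" by (rule smoother_psm[OF \<phi> S(1) F])
  have 0: "\<phi> (x \<cdot> xi u \<cdot> iv y) = 0" if "u \<in> ?S" "y \<notin> C" for u y using that by (intro smoother_zero[OF \<phi>]) auto
  have D0: "frechet_derivative (\<lambda>u. \<phi> (x \<cdot> xi u \<cdot> iv y)) (at u) v = 0" if "u \<in> ?S" "y \<notin> C" for u y v
    using frechet_zero_outside[OF S(1) that(1), of "\<lambda>u. \<phi> (x \<cdot> xi u \<cdot> iv y)"] 0 that(2) by simp
  have "integrable \<mu> (\<lambda>y. frechet_derivative (\<lambda>u. \<phi> (x \<cdot> xi u \<cdot> iv y)) (at og) A *\<^sub>R w y)"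
    by (rule param_integral_integrable[OF param_smooth_deriv[OF P S(1)] S(1) compact_C D0 w_integrable S(2)])
  then have "integrable \<mu> (\<lambda>y. - (left_deriv G A ?b y *\<^sub>R w y))" unfolding fr scaleR_minus_left .
  then show "integrable \<mu> (\<lambda>y. left_deriv G A ?b y *\<^sub>R w y)" by simp
  have "((\<lambda>u. conv \<phi> (x \<cdot> xi u)) has_derivative
      (\<lambda>v. \<integral>y. frechet_derivative (\<lambda>u. \<phi> (x \<cdot> xi u \<cdot> iv y)) (at og) v *\<^sub>R w y \<partial>\<mu>)) (at og)"
    unfolding conv_def by (rule param_integral_has_derivative[OF P S(1) compact_C 0 w_integrable S(2)])
  from left_deriv_eqI[OF this, of A]
  show "left_deriv G A (conv \<phi>) x = - (\<integral>y. left_deriv G A ?b y *\<^sub>R w y \<partial>\<mu>)"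
    by (simp add: fr)
qed

lemma conv_contact:
  assumes \<phi>: "smoother \<phi>"
  shows "contact_field G B (conv \<phi>)"
  unfolding contact_iff[OF open_B]
proof (intro conjI conv_Ck[OF \<phi>] ballI)
  fix x A assume x: "x \<in> B" and A: "A \<in> layer G 1"
  let ?b = "\<lambda>y. \<phi> (x \<cdot> iv y)"
  have b: "smooth_fun_on G UNIV ?b" using \<phi> by (intro smooth_reflect) (simp add: smoother_def)
  \<comment> \<open>The test function and its derivatives vanish off \<open>C\<close>, so
    \<open>w\<close> may be exchanged for \<open>Z0\<close> in the integrals.\<close>
  have b0: "?b y = 0" if "y \<notin> C" for y by (rule smoother_zero[OF \<phi> x that])
  have db0: "left_deriv G A ?b y = 0" if "y \<notin> C" for A y
    by (rule left_deriv_zero_open[of "- C"]) (use that b0 compact_imp_closed[OF compact_C] in auto)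
  let ?D = "\<lambda>A. left_deriv G A (conv \<phi>) x - lie_bracket G (conv \<phi> x) A"
  have lin: "linear ?D"
    using has_left_deriv[OF conv_Ck[OF \<phi>, of "Suc 0"] open_B x] has_derivative_linear
    by (intro linear_compose_sub lie_bracket_linear_right) blast
  have hor: "?D (X (1, i)) \<in> layer G 1" if i: "i \<in> {1..layer_dim G 1}" for i
    unfolding horizontal_iff
  proof (intro ballI impI)
    fix j assume j: "j \<in> I" "fst j \<noteq> 1"
    let ?X = "X (1, i)"
    have l1: "linear (\<lambda>A. coframe G j (lie_bracket G A ?X))"
      using linear_compose[OF lie_bracket_linear_left coframe_linear] by (simp add: o_def)
    have "coframe G j (lie_bracket G (conv \<phi> x) ?X) = (\<integral>y. coframe G j (lie_bracket G (?b y *\<^sub>R w y) ?X) \<partial>\<mu>)"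
      unfolding conv_def
      by (rule integral_bounded_linear[OF _ smoother_integrable[OF \<phi> x], symmetric])
        (use l1 in \<open>simp add: linear_conv_bounded_linear\<close>)
    also have "\<dots> = (\<integral>y. coframe G j (lie_bracket G (Z0 y) ?X) * ?b y \<partial>\<mu>)"
    proof (rule Bochner_Integration.integral_cong[OF refl])
      fix y
      have "coframe G j (lie_bracket G (?b y *\<^sub>R w y) ?X) = ?b y * coframe G j (lie_bracket G (w y) ?X)"
        using linear_scale[OF l1] by simp
      then show "coframe G j (lie_bracket G (?b y *\<^sub>R w y) ?X) = coframe G j (lie_bracket G (Z0 y) ?X) * ?b y"
        using b0[of y] by (cases "y \<in> C") (simp_all add: w_def)
    qed
    finally have 1: "coframe G j (lie_bracket G (conv \<phi> x) ?X) = (\<integral>y. coframe G j (lie_bracket G (Z0 y) ?X) * ?b y \<partial>\<mu>)" .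
    have "coframe G j (\<integral>y. left_deriv G ?X ?b y *\<^sub>R w y \<partial>\<mu>) = (\<integral>y. coframe G j (left_deriv G ?X ?b y *\<^sub>R w y) \<partial>\<mu>)"
      by (rule integral_bounded_linear[OF coframe_bounded_linear conv_left_deriv(1)[OF \<phi> x], symmetric])
    also have "\<dots> = (\<integral>y. coframe G j (Z0 y) * left_deriv G ?X ?b y \<partial>\<mu>)"
    proof (rule Bochner_Integration.integral_cong[OF refl])
      fix y
      have "coframe G j (left_deriv G ?X ?b y *\<^sub>R w y) = left_deriv G ?X ?b y * coframe G j (w y)"
        using linear_scale[OF coframe_linear] by simp
      then show "coframe G j (left_deriv G ?X ?b y *\<^sub>R w y) = coframe G j (Z0 y) * left_deriv G ?X ?b y"
        using db0[of y ?X] by (cases "y \<in> C") (simp_all add: w_def)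
    qed
    finally have 2: "coframe G j (left_deriv G ?X (conv \<phi>) x) = - (\<integral>y. coframe G j (Z0 y) * left_deriv G ?X ?b y \<partial>\<mu>)"
      unfolding conv_left_deriv(2)[OF \<phi> x] by (simp add: linear_neg[OF coframe_linear])
    show "coframe G j (?D ?X) = 0"
      unfolding linear_diff[OF coframe_linear] 1 2 using Z0_equation[OF b b0 i j] by linarith
  qed
  \<comment> \<open>The weak equation covers the basis vectors of the first layer; a horizontal
    \<open>A\<close> is a combination of these.\<close>
  have "?D A = (\<Sum>i\<in>I. coframe G i A *\<^sub>R ?D (X i))"
  proof -
    have "?D A = ?D (\<Sum>i\<in>I. coframe G i A *\<^sub>R X i)" using coframe_expansion[of A] by simp
    also have "\<dots> = (\<Sum>i\<in>I. coframe G i A *\<^sub>R ?D (X i))"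
      unfolding linear_sum[OF lin] by (rule sum.cong[OF refl]) (rule linear_scale[OF lin])
    finally show ?thesis .
  qed
  also have "\<dots> \<in> layer G 1"
  proof (rule subspace_sum[OF subspace_horizontal])
    fix i assume i: "i \<in> I"
    show "coframe G i A *\<^sub>R ?D (X i) \<in> layer G 1"
    proof (cases "fst i = 1")
      case True
      then have e: "(1, snd i) = i" by (metis prod.collapse)
      have "snd i \<in> {1..layer_dim G 1}" using i True by (auto simp: I_eq)
      from hor[OF this, unfolded e] show ?thesis by (rule subspace_scale[OF subspace_horizontal])
    next
      case False
      then have "coframe G i A = 0" using A i unfolding horizontal_iff by blast
      then show ?thesis using subspace_0[OF subspace_horizontal] by simp
    qed
  qed
  finally show "?D A \<in> layer G 1" .
qed

lemma B_subset_C: "B \<subseteq> C"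
proof
  fix x assume "x \<in> B"
  from near[OF this open_Nb(2)] show "x \<in> C" by (simp add: grp.inverse_neutral)
qed

lemma approximate_identity:
  obtains \<phi> A where "\<And>m. smoother (\<phi> m)" "\<And>m x. \<phi> m x \<ge> 0" "\<And>m. (\<integral>x. \<phi> m x \<partial>\<mu>) = 1"
    "\<And>m x. \<phi> m x \<noteq> 0 \<Longrightarrow> x \<in> A m" "\<And>S. open S \<Longrightarrow> ge \<in> S \<Longrightarrow> eventually (\<lambda>m. A m \<subseteq> S) sequentially"
proof -
  obtain A where A: "\<And>m. open (A m)" "\<And>m. ge \<in> A m" "\<And>S. open S \<Longrightarrow> ge \<in> S \<Longrightarrow> eventually (\<lambda>m. A m \<subseteq> S) sequentially"
    using countable_basis_at_decseq[of ge] by blast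
  have "\<exists>f. smoother f \<and> (\<forall>x. f x \<ge> 0) \<and> (\<integral>x. f x \<partial>\<mu>) = 1 \<and> (\<forall>x. f x \<noteq> 0 \<longrightarrow> x \<in> A m)" for m
  proof -
    have o: "open (Nb \<inter> A m)" "ge \<in> Nb \<inter> A m" using open_Nb A by auto
    obtain f :: "'g \<Rightarrow> real" and K where f: "smooth_fun_on G UNIV f" "\<And>x. f x \<ge> 0" "f ge > 0" "compact K" "K \<subseteq> Nb \<inter> A m"
      "\<And>x. x \<notin> K \<Longrightarrow> f x = 0" using smooth_bump[OF o] by metis
    have c: "continuous_on UNIV f" by (rule Ck_fun_on_continuous[OF smooth_fun_onD[OF f(1)] open_UNIV])
    have fi: "integrable \<mu> f" by (rule integrable_continuous_compact[OF open_UNIV c f(4) subset_UNIV f(6)])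
    define s where "s = (\<integral>x. f x \<partial>\<mu>)"
    \<comment> \<open>A nonnegative continuous function with zero integral vanishes identically, but
      \<open>f\<close> is positive at the identity.\<close>
    have "s \<noteq> 0"
    proof
      assume "s = 0"
      then have "AE x in \<mu>. f x = 0" using fi f(2) by (subst (asm) s_def, subst (asm) integral_nonneg_eq_0_iff_AE) auto
      then have "AE x in \<mu>. x \<in> UNIV \<longrightarrow> f x = 0" by simp
      from continuous_AE_eq[OF open_UNIV c continuous_on_const this UNIV_I, of ge] show False using f(3) by simp
    qed
    moreover have "s \<ge> 0" unfolding s_def by (rule Bochner_Integration.integral_nonneg) (rule f(2))
    ultimately have s: "s > 0" by simp
    have "smooth_fun_on G UNIV (\<lambda>x. (1 / s) * f x)"
      by (intro smooth_fun_onI Ck_fun_on_mult open_UNIV Ck_fun_on_const smooth_fun_onD[OF f(1)])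
    then have "smoother (\<lambda>x. (1 / s) * f x)" unfolding smoother_def using f(4,5,6) by (intro conjI exI[of _ K]) auto
    moreover have "(\<integral>x. (1 / s) * f x \<partial>\<mu>) = 1" using s by (simp add: s_def[symmetric])
    ultimately show ?thesis using f(2,5,6) s by (intro exI[of _ "\<lambda>x. (1 / s) * f x"]) auto
  qed
  then obtain \<phi> where "\<And>m. smoother (\<phi> m) \<and> (\<forall>x. \<phi> m x \<ge> 0) \<and> (\<integral>x. \<phi> m x \<partial>\<mu>) = 1 \<and> (\<forall>x. \<phi> m x \<noteq> 0 \<longrightarrow> x \<in> A m)" by metis
  then show thesis using that[of \<phi> A] A(3) by blast
qed

end

context mollify
begin

text \<open>Fubini's theorem moves the mollifier onto the test function. The averages
  \<open>J m\<close> of \<open>\<psi>\<close> are uniformly bounded and converge pointwise to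
  \<open>\<psi>\<close>, so dominated convergence applies against the integrable
  \<open>w\<close>.\<close>

lemma conv_weak_limit:
  fixes \<psi> :: "'g \<Rightarrow> real"
  assumes \<phi>: "\<And>m. smoother (\<phi> m)" "\<And>m x. \<phi> m x \<ge> 0" "\<And>m. (\<integral>x. \<phi> m x \<partial>\<mu>) = 1"
    and A: "\<And>m x. \<phi> m x \<noteq> 0 \<Longrightarrow> x \<in> A m" "\<And>S. open S \<Longrightarrow> ge \<in> S \<Longrightarrow> eventually (\<lambda>m. A m \<subseteq> S) sequentially"
    and \<psi>: "continuous_on UNIV \<psi>" and K: "compact K" "K \<subseteq> B" "\<And>x. x \<notin> K \<Longrightarrow> \<psi> x = 0"
  shows "(\<lambda>m. \<integral>x. \<psi> x * (conv (\<phi> m) x \<bullet> b) \<partial>\<mu>) \<longlonglongrightarrow> (\<integral>x. \<psi> x * (w x \<bullet> b) \<partial>\<mu>)"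
proof -
  interpret sf: sigma_finite_measure \<mu> by (rule sigma_finite_mu)
  interpret pair_sigma_finite \<mu> \<mu> ..
  let ?v = "\<lambda>y. w y \<bullet> b"
  have \<psi>i: "integrable \<mu> \<psi>" by (rule integrable_continuous_compact[OF open_UNIV \<psi> K(1) subset_UNIV K(3)])
  have vi: "integrable \<mu> ?v" by (rule integrable_inner_left[OF w_integrable])
  have "bounded (\<psi> ` K)" by (rule compact_imp_bounded[OF compact_continuous_image[OF continuous_on_subset[OF \<psi> subset_UNIV] K(1)]])
  then obtain M where M: "\<And>x. x \<in> K \<Longrightarrow> \<bar>\<psi> x\<bar> \<le> M" unfolding bounded_iff by auto
  have M': "\<bar>\<psi> x\<bar> \<le> \<bar>M\<bar>" for x using M[of x] K(3)[of x] by (cases "x \<in> K") auto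
  have sm: "smooth_fun_on G UNIV (\<phi> m)" for m using \<phi>(1)[of m] by (simp add: smoother_def)
  have c\<phi>: "continuous_on UNIV (\<phi> m)" for m by (rule Ck_fun_on_continuous[OF smooth_fun_onD[OF sm] open_UNIV])
  have ctr: "continuous_on UNIV (\<lambda>x. \<phi> m (x \<cdot> h))" for m h
    by (rule continuous_on_compose2[OF c\<phi>]) (auto intro!: continuous_intros)
  have supp: "\<exists>K. compact K \<and> (\<forall>x. x \<notin> K \<longrightarrow> \<phi> m x = 0)" for m using \<phi>(1)[of m] by (auto simp: smoother_def)
  \<comment> \<open>Right invariance gives each translated kernel mass 1; the bound and the limit of
    \<open>J\<close> both rest on it.\<close>
  have tri: "integrable \<mu> (\<lambda>x. \<phi> m (x \<cdot> h))" and mass: "(\<integral>x. \<phi> m (x \<cdot> h) \<partial>\<mu>) = 1" for m h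
  proof -
    obtain L where L: "compact L" "\<And>x. x \<notin> L \<Longrightarrow> \<phi> m x = 0" using supp by blast
    have "compact ((\<lambda>x. x \<cdot> iv h) ` L)" by (intro compact_continuous_image continuous_intros L)
    moreover have "\<phi> m (x \<cdot> h) = 0" if "x \<notin> (\<lambda>x. x \<cdot> iv h) ` L" for x
    proof (rule L(2), rule notI)
      assume "x \<cdot> h \<in> L"
      then have "x \<in> (\<lambda>x. x \<cdot> iv h) ` L" by (intro image_eqI[of _ _ "x \<cdot> h"]) auto
      with that show False by simp
    qed
    ultimately show "integrable \<mu> (\<lambda>x. \<phi> m (x \<cdot> h))"
      by (intro integrable_continuous_compact[OF open_UNIV ctr]) auto
    show "(\<integral>x. \<phi> m (x \<cdot> h) \<partial>\<mu>) = 1"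
      using right_translate_integral[OF sm L trace_ad connected_UNIV_G] \<phi>(3) by simp
  qed
  have p\<psi>i: "integrable \<mu> (\<lambda>x. \<psi> x * \<phi> m (x \<cdot> h))" for m h
    by (rule integrable_continuous_compact[OF open_UNIV _ K(1) subset_UNIV]) (auto intro!: continuous_intros \<psi> ctr simp: K(3))
  define J where "J = (\<lambda>m y. \<integral>x. \<psi> x * \<phi> m (x \<cdot> iv y) \<partial>\<mu>)"
  have Jb: "\<bar>J m y\<bar> \<le> \<bar>M\<bar>" for m y
  proof -
    have "\<bar>J m y\<bar> \<le> (\<integral>x. \<bar>\<psi> x * \<phi> m (x \<cdot> iv y)\<bar> \<partial>\<mu>)" unfolding J_def by (rule integral_abs_bound)
    also have "\<dots> \<le> (\<integral>x. \<bar>M\<bar> * \<phi> m (x \<cdot> iv y) \<partial>\<mu>)"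
    proof (rule integral_mono)
      show "integrable \<mu> (\<lambda>x. \<bar>\<psi> x * \<phi> m (x \<cdot> iv y)\<bar>)" using p\<psi>i by (rule integrable_abs)
      show "integrable \<mu> (\<lambda>x. \<bar>M\<bar> * \<phi> m (x \<cdot> iv y))" using tri by (rule integrable_mult_right)
      show "\<bar>\<psi> x * \<phi> m (x \<cdot> iv y)\<bar> \<le> \<bar>M\<bar> * \<phi> m (x \<cdot> iv y)" for x
        using mult_right_mono[OF M' \<phi>(2)] \<phi>(2) by (simp add: abs_mult)
    qed
    also have "\<dots> = \<bar>M\<bar>" by (simp add: mass)
    finally show ?thesis .
  qed
  have Jlim: "(\<lambda>m. J m y) \<longlonglongrightarrow> \<psi> y" for y
  proof (rule LIMSEQ_I)
    fix e :: real assume e: "e > 0"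
    let ?S = "{n. \<bar>\<psi> (n \<cdot> y) - \<psi> y\<bar> < e / 2}"
    have "continuous_on UNIV (\<lambda>n. \<bar>\<psi> (n \<cdot> y) - \<psi> y\<bar>)"
      by (intro continuous_intros continuous_on_compose2[OF \<psi>]) auto
    from continuous_open_preimage[OF this open_UNIV open_lessThan[of "e / 2"]]
    have "open ?S" by (simp add: vimage_def)
    moreover have "ge \<in> ?S" using e by simp
    ultimately obtain m0 where m0: "\<And>m. m \<ge> m0 \<Longrightarrow> A m \<subseteq> ?S" using A(2) unfolding eventually_sequentially by blast
    have "norm (J m y - \<psi> y) < e" if m: "m \<ge> m0" for m
    proof -
      have i1: "integrable \<mu> (\<lambda>x. (\<psi> x - \<psi> y) * \<phi> m (x \<cdot> iv y))"
        using Bochner_Integration.integrable_diff[OF p\<psi>i integrable_mult_right[OF tri, of "\<psi> y"]] by (simp add: left_diff_distrib)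
      have "J m y - \<psi> y = J m y - \<psi> y * (\<integral>x. \<phi> m (x \<cdot> iv y) \<partial>\<mu>)" by (simp add: mass)
      also have "\<dots> = (\<integral>x. \<psi> x * \<phi> m (x \<cdot> iv y) - \<psi> y * \<phi> m (x \<cdot> iv y) \<partial>\<mu>)"
        unfolding J_def using p\<psi>i tri by (subst Bochner_Integration.integral_diff) auto
      also have "\<dots> = (\<integral>x. (\<psi> x - \<psi> y) * \<phi> m (x \<cdot> iv y) \<partial>\<mu>)" by (simp add: left_diff_distrib)
      finally have "\<bar>J m y - \<psi> y\<bar> \<le> (\<integral>x. \<bar>(\<psi> x - \<psi> y) * \<phi> m (x \<cdot> iv y)\<bar> \<partial>\<mu>)" by (simp only: integral_abs_bound)
      also have "\<dots> \<le> (\<integral>x. e / 2 * \<phi> m (x \<cdot> iv y) \<partial>\<mu>)"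
      proof (rule integral_mono)
        show "integrable \<mu> (\<lambda>x. \<bar>(\<psi> x - \<psi> y) * \<phi> m (x \<cdot> iv y)\<bar>)" using i1 by (rule integrable_abs)
        show "integrable \<mu> (\<lambda>x. e / 2 * \<phi> m (x \<cdot> iv y))" using tri by (rule integrable_mult_right)
        fix x
        show "\<bar>(\<psi> x - \<psi> y) * \<phi> m (x \<cdot> iv y)\<bar> \<le> e / 2 * \<phi> m (x \<cdot> iv y)"
        proof (cases "\<phi> m (x \<cdot> iv y) = 0")
          case False
          then have "\<bar>\<psi> x - \<psi> y\<bar> < e / 2" using A(1)[OF False] m0[OF m] by auto
          from mult_right_mono[OF less_imp_le[OF this] \<phi>(2)[of m "x \<cdot> iv y"]] show ?thesis
            using \<phi>(2)[of m "x \<cdot> iv y"] by (simp add: abs_mult)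
        qed simp
      qed
      also have "\<dots> = e / 2" by (simp add: mass)
      finally show ?thesis using e by simp
    qed
    then show "\<exists>m0. \<forall>m\<ge>m0. norm (J m y - \<psi> y) < e" by blast
  qed
  define f where "f = (\<lambda>m x y. \<psi> x * \<phi> m (x \<cdot> iv y) * ?v y)"
  \<comment> \<open>The kernel is bounded, so the integrand is dominated by a product of an
    integrable function of \<open>x\<close> and one of \<open>y\<close>.\<close>
  have fint: "integrable (\<mu> \<Otimes>\<^sub>M \<mu>) (case_prod (f m))" for m
  proof -
    obtain L where L: "compact L" "\<And>x. x \<notin> L \<Longrightarrow> \<phi> m x = 0" using supp by blast
    have "bounded (\<phi> m ` L)" by (rule compact_imp_bounded[OF compact_continuous_image[OF continuous_on_subset[OF c\<phi> subset_UNIV] L(1)]])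
    then obtain R0 where R0: "\<And>x. x \<in> L \<Longrightarrow> \<bar>\<phi> m x\<bar> \<le> R0" unfolding bounded_iff by auto
    have R: "\<bar>\<phi> m x\<bar> \<le> \<bar>R0\<bar>" for x using R0[of x] L(2)[of x] by (cases "x \<in> L") auto
    have s2: "sets (\<mu> \<Otimes>\<^sub>M \<mu>) = sets (borel :: ('g \<times> 'g) measure)"
      by (rule trans[OF sets_pair_measure_cong[OF sets_mu sets_mu] arg_cong[OF borel_prod, where f = sets]])
    have vm: "?v \<in> borel_measurable \<mu>" by (rule borel_measurable_integrable[OF vi])
    have \<psi>m: "\<psi> \<in> borel_measurable \<mu>" by (rule borel_measurable_integrable[OF \<psi>i])
    have "continuous_on UNIV (\<lambda>z. \<phi> m (fst z \<cdot> iv (snd z)))"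
      by (rule continuous_on_compose2[OF c\<phi>]) (auto intro!: continuous_intros)
    then have \<phi>m: "(\<lambda>z. \<phi> m (fst z \<cdot> iv (snd z))) \<in> borel_measurable (\<mu> \<Otimes>\<^sub>M \<mu>)"
      unfolding measurable_cong_sets[OF s2 refl] by (rule borel_measurable_continuous_onI)
    have vsnd: "(\<lambda>z. ?v (snd z)) \<in> borel_measurable (\<mu> \<Otimes>\<^sub>M \<mu>)"
      using measurable_compose[OF measurable_snd vm] .
    have \<psi>fst: "(\<lambda>z. \<psi> (fst z)) \<in> borel_measurable (\<mu> \<Otimes>\<^sub>M \<mu>)"
      using measurable_compose[OF measurable_fst \<psi>m] .
    have fm: "case_prod (f m) \<in> borel_measurable (\<mu> \<Otimes>\<^sub>M \<mu>)"
      using borel_measurable_times[OF borel_measurable_times[OF \<psi>fst \<phi>m] vsnd] by (simp add: f_def case_prod_unfold)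
    have dom: "integrable (\<mu> \<Otimes>\<^sub>M \<mu>) (\<lambda>z. \<bar>R0\<bar> * \<psi> (fst z) * ?v (snd z))"
    proof (rule Fubini_integrable)
      show "(\<lambda>z. \<bar>R0\<bar> * \<psi> (fst z) * ?v (snd z)) \<in> borel_measurable (\<mu> \<Otimes>\<^sub>M \<mu>)"
        by (intro borel_measurable_times borel_measurable_const \<psi>fst vsnd)
      have "(\<integral>y. norm (\<bar>R0\<bar> * \<psi> (fst (x, y)) * ?v (snd (x, y))) \<partial>\<mu>) = \<bar>R0\<bar> * \<bar>\<psi> x\<bar> * (\<integral>y. \<bar>?v y\<bar> \<partial>\<mu>)" for x
        by (simp add: abs_mult)
      then show "integrable \<mu> (\<lambda>x. \<integral>y. norm (\<bar>R0\<bar> * \<psi> (fst (x, y)) * ?v (snd (x, y))) \<partial>\<mu>)"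
        using \<psi>i by simp
      show "AE x in \<mu>. integrable \<mu> (\<lambda>y. \<bar>R0\<bar> * \<psi> (fst (x, y)) * ?v (snd (x, y)))"
        using vi by (intro AE_I2) simp
    qed
    show ?thesis
    proof (rule Bochner_Integration.integrable_bound[OF dom fm], rule AE_I2)
      fix z :: "'g \<times> 'g"
      have "\<bar>\<phi> m (fst z \<cdot> iv (snd z))\<bar> * (\<bar>\<psi> (fst z)\<bar> * \<bar>?v (snd z)\<bar>) \<le> \<bar>R0\<bar> * (\<bar>\<psi> (fst z)\<bar> * \<bar>?v (snd z)\<bar>)"
        by (intro mult_right_mono R) simp
      then show "norm (case_prod (f m) z) \<le> norm (\<bar>R0\<bar> * \<psi> (fst z) * ?v (snd z))"
        by (simp add: f_def case_prod_unfold abs_mult mult_ac)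
    qed
  qed
  have lhs: "(\<integral>x. \<psi> x * (conv (\<phi> m) x \<bullet> b) \<partial>\<mu>) = (\<integral>y. J m y * ?v y \<partial>\<mu>)" for m
  proof -
    have "\<psi> x * (conv (\<phi> m) x \<bullet> b) = (\<integral>y. f m x y \<partial>\<mu>)" for x
    proof (cases "x \<in> K")
      case True
      then have xB: "x \<in> B" using K(2) by blast
      have "conv (\<phi> m) x \<bullet> b = (\<integral>y. (\<phi> m (x \<cdot> iv y) *\<^sub>R w y) \<bullet> b \<partial>\<mu>)" unfolding conv_def
        using smoother_integrable[OF \<phi>(1) xB] by (intro integral_inner_left[symmetric]) blast
      then show ?thesis by (simp add: f_def mult.assoc)
    qed (simp add: f_def K(3))
    then have "(\<integral>x. \<psi> x * (conv (\<phi> m) x \<bullet> b) \<partial>\<mu>) = (\<integral>x. (\<integral>y. f m x y \<partial>\<mu>) \<partial>\<mu>)" by (simp only:)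
    also have "\<dots> = (\<integral>y. (\<integral>x. f m x y \<partial>\<mu>) \<partial>\<mu>)" by (rule Fubini_integral[OF fint, symmetric])
    also have "\<dots> = (\<integral>y. J m y * ?v y \<partial>\<mu>)" by (simp add: f_def J_def)
    finally show ?thesis .
  qed
  have Jm: "integrable \<mu> (\<lambda>y. J m y * ?v y)" for m
    using integrable_snd[OF fint[of m]] by (simp add: f_def J_def)
  have "(\<lambda>m. \<integral>y. J m y * ?v y \<partial>\<mu>) \<longlonglongrightarrow> (\<integral>y. \<psi> y * ?v y \<partial>\<mu>)"
  proof (rule integral_dominated_convergence[where w="\<lambda>y. \<bar>M\<bar> * \<bar>?v y\<bar>"])
    show "(\<lambda>y. \<psi> y * ?v y) \<in> borel_measurable \<mu>"
      by (intro borel_measurable_times borel_measurable_integrable[OF \<psi>i] borel_measurable_integrable[OF vi])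
    show "(\<lambda>y. J m y * ?v y) \<in> borel_measurable \<mu>" for m by (rule borel_measurable_integrable[OF Jm])
    show "integrable \<mu> (\<lambda>y. \<bar>M\<bar> * \<bar>?v y\<bar>)" by (intro integrable_mult_right integrable_abs vi)
    show "AE y in \<mu>. (\<lambda>m. J m y * ?v y) \<longlonglongrightarrow> \<psi> y * ?v y" by (intro AE_I2 tendsto_mult Jlim tendsto_const)
    show "AE y in \<mu>. norm (J m y * ?v y) \<le> \<bar>M\<bar> * \<bar>?v y\<bar>" for m
      by (intro AE_I2) (simp add: abs_mult Jb mult_right_mono)
  qed
  then show ?thesis unfolding lhs .
qed

lemma conv_sum:
  fixes r :: nat
  assumes "\<And>j. j < r \<Longrightarrow> smoother (\<phi> j)"
  shows "smoother (\<lambda>x. \<Sum>j<r. c j * \<phi> j x)"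
    and "x \<in> B \<Longrightarrow> conv (\<lambda>x. \<Sum>j<r. c j * \<phi> j x) x = (\<Sum>j<r. c j *\<^sub>R conv (\<phi> j) x)"
proof -
  have "\<forall>j\<in>{..<r}. \<exists>K. compact K \<and> K \<subseteq> Nb \<and> (\<forall>x. x \<notin> K \<longrightarrow> \<phi> j x = 0)"
    using assms unfolding smoother_def by blast
  from bchoice[OF this]
  obtain K where K: "\<And>j. j < r \<Longrightarrow> compact (K j) \<and> K j \<subseteq> Nb \<and> (\<forall>x. x \<notin> K j \<longrightarrow> \<phi> j x = 0)" by blast
  show "smoother (\<lambda>x. \<Sum>j<r. c j * \<phi> j x)" unfolding smoother_def
  proof (intro conjI exI[of _ "\<Union>j<r. K j"] allI impI)
    show "smooth_fun_on G UNIV (\<lambda>x. \<Sum>j<r. c j * \<phi> j x)"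
    proof (rule smooth_fun_onI)
      have "Ck_fun_on G k UNIV (\<phi> j)" if "j \<in> {..<r}" for k j
        using assms that by (intro smooth_fun_onD) (simp add: smoother_def)
      then show "Ck_fun_on G k UNIV (\<lambda>x. \<Sum>j<r. c j * \<phi> j x)" for k
        by (intro Ck_fun_on_sum Ck_fun_on_mult Ck_fun_on_const open_UNIV finite_lessThan)
    qed
    show "compact (\<Union>j<r. K j)" using K by (intro compact_UN) auto
    show "(\<Union>j<r. K j) \<subseteq> Nb" using K by blast
    fix x assume "x \<notin> (\<Union>j<r. K j)"
    then show "(\<Sum>j<r. c j * \<phi> j x) = 0" using K by (intro sum.neutral) auto
  qed
  assume x: "x \<in> B"
  have "conv (\<lambda>x. \<Sum>j<r. c j * \<phi> j x) x = (\<integral>y. (\<Sum>j<r. c j *\<^sub>R (\<phi> j (x \<cdot> iv y) *\<^sub>R w y)) \<partial>\<mu>)"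
    unfolding conv_def by (simp add: scaleR_sum_left)
  also have "\<dots> = (\<Sum>j<r. \<integral>y. c j *\<^sub>R (\<phi> j (x \<cdot> iv y) *\<^sub>R w y) \<partial>\<mu>)"
    using smoother_integrable[OF assms x]
    by (intro Bochner_Integration.integral_sum integrable_scaleR_right) auto
  finally show "conv (\<lambda>x. \<Sum>j<r. c j * \<phi> j x) x = (\<Sum>j<r. c j *\<^sub>R conv (\<phi> j) x)"
    by (simp only: conv_def integral_scaleR_right)
qed

lemma test_integrable:
  assumes "open V" "continuous_on V (h :: 'g \<Rightarrow> 'a)" "continuous_on UNIV \<psi>" "compact K" "K \<subseteq> V" "\<And>x. x \<notin> K \<Longrightarrow> \<psi> x = 0"
  shows "integrable \<mu> (\<lambda>x. \<psi> x * (h x \<bullet> b))"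
  by (rule integrable_continuous_compact[OF assms(1) _ assms(4,5)])
    (use assms in \<open>auto intro!: continuous_intros intro: continuous_on_subset\<close>)

text \<open>All mollifications lie, on one neighbourhood \<open>V\<close> of \<open>p\<close>, in a finite-dimensional space spanned by
  mollifications; such a space is closed under weak limits, hence contains the field itself.\<close>

lemma local_regularity:
  assumes rigid: "Cinf_rigid G" and p: "p \<in> B"
  obtains V h where "open V" "p \<in> V" "V \<subseteq> B" "\<And>k. Ck_fun_on G k V h" "contact_field G V h"
    "AE x in \<mu>. x \<in> V \<longrightarrow> h x = Z0 x"
proof -
  obtain V N Y where V: "open V" "p \<in> V" "V \<subseteq> B"
    and span: "\<And>Z. contact_field G B Z \<Longrightarrow>
       fun_span (V \<times> Basis) N (\<lambda>j (x, b). Y j x \<bullet> b) (\<lambda>(x, b). Z x \<bullet> b)"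
    using contact_fields_uniform_germ[OF rigid open_B p] by metis
  let ?f = "\<lambda>Z (x, b). Z x \<bullet> (b :: 'a)"
  define H where "H = {?f (conv \<phi>) | \<phi>. smoother \<phi>}"
  have "fun_span (V \<times> Basis) N (\<lambda>j (x, b). Y j x \<bullet> b) h" if "h \<in> H" for h
    using that span conv_contact unfolding H_def by blast
  \<comment> \<open>Exchanges the germs \<open>Y\<close> for mollifications, which are smooth and
    integrable against test functions.\<close>
  from fun_span_generators[of H, OF this]
  obtain r g where g: "\<forall>j<r. g j \<in> H" "\<forall>h\<in>H. fun_span (V \<times> Basis) r g h" by blast
  have "\<forall>j. \<exists>\<phi>. j < r \<longrightarrow> smoother \<phi> \<and> g j = ?f (conv \<phi>)" using g(1) unfolding H_def by blast
  then obtain \<Phi> where \<Phi>: "\<And>j. j < r \<Longrightarrow> smoother (\<Phi> j)" "\<And>j. j < r \<Longrightarrow> g j = ?f (conv (\<Phi> j))" by metis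
  have gen: "\<exists>c. \<forall>x\<in>V. \<forall>b\<in>Basis. conv \<phi> x \<bullet> b = (\<Sum>j<r. c j * (conv (\<Phi> j) x \<bullet> b))" if "smoother \<phi>" for \<phi>
  proof -
    have "fun_span (V \<times> Basis) r g (?f (conv \<phi>))" using g(2) that unfolding H_def by blast
    then obtain c where c: "\<And>i. i \<in> V \<times> Basis \<Longrightarrow> ?f (conv \<phi>) i = (\<Sum>j<r. c j * g j i)" unfolding fun_span_def by blast
    have "conv \<phi> x \<bullet> b = (\<Sum>j<r. c j * (conv (\<Phi> j) x \<bullet> b))" if "x \<in> V" "b \<in> Basis" for x b
      using c[of "(x, b)"] that by (simp add: \<Phi>(2))
    then show ?thesis by blast
  qed
  have cc: "continuous_on V (conv \<phi>)" if "smoother \<phi>" for \<phi>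
    using Ck_fun_on_continuous[OF conv_Ck[OF that] open_B] V(3) continuous_on_subset by blast
  \<comment> \<open>Indices of the weak topology: a pair stands for integrating one component of a
    field against a test function supported in \<open>V\<close>.\<close>
  define S where "S = {(\<psi>, b). continuous_on UNIV \<psi> \<and> (\<exists>K. compact K \<and> K \<subseteq> V \<and> (\<forall>x. x \<notin> K \<longrightarrow> \<psi> x = (0::real))) \<and> b \<in> (Basis :: 'a set)}"
  let ?T = "\<lambda>Z (\<psi>, b). \<integral>x. \<psi> x * (Z x \<bullet> b) \<partial>\<mu>"
  have Tspan: "fun_span S r (\<lambda>j. ?T (conv (\<Phi> j))) (?T (conv \<phi>))" if \<phi>: "smoother \<phi>" for \<phi>
  proof -
    obtain c where c: "\<And>x b. x \<in> V \<Longrightarrow> b \<in> Basis \<Longrightarrow> conv \<phi> x \<bullet> b = (\<Sum>j<r. c j * (conv (\<Phi> j) x \<bullet> b))"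
      using gen[OF \<phi>] by blast
    have "?T (conv \<phi>) i = (\<Sum>j<r. c j * ?T (conv (\<Phi> j)) i)" if i: "i \<in> S" for i
    proof -
      obtain \<psi> b K where i: "i = (\<psi>, b)" "continuous_on UNIV \<psi>" "compact K" "K \<subseteq> V" "\<And>x. x \<notin> K \<Longrightarrow> \<psi> x = 0" "b \<in> Basis"
        using i unfolding S_def by blast
      have "\<psi> x * (conv \<phi> x \<bullet> b) = (\<Sum>j<r. c j * (\<psi> x * (conv (\<Phi> j) x \<bullet> b)))" for x
      proof (cases "x \<in> V")
        case True
        then show ?thesis using c[OF True i(6)] by (simp add: sum_distrib_left mult_ac)
      next
        case False
        then have "\<psi> x = 0" using i(4,5) by blast
        then show ?thesis by simp
      qed
      then have "?T (conv \<phi>) i = (\<integral>x. (\<Sum>j<r. c j * (\<psi> x * (conv (\<Phi> j) x \<bullet> b))) \<partial>\<mu>)" by (simp only: i(1) prod.case)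
      also have "\<dots> = (\<Sum>j<r. \<integral>x. c j * (\<psi> x * (conv (\<Phi> j) x \<bullet> b)) \<partial>\<mu>)"
        by (intro Bochner_Integration.integral_sum integrable_mult_right test_integrable[OF V(1) cc i(2-5)] \<Phi>(1)) auto
      finally show ?thesis by (simp add: i(1))
    qed
    then show ?thesis unfolding fun_span_def by blast
  qed
  obtain \<phi> A where \<phi>: "\<And>m. smoother (\<phi> m)" "\<And>m x. \<phi> m x \<ge> 0" "\<And>m. (\<integral>x. \<phi> m x \<partial>\<mu>) = 1"
    "\<And>m x. \<phi> m x \<noteq> 0 \<Longrightarrow> x \<in> A m" "\<And>S. open S \<Longrightarrow> ge \<in> S \<Longrightarrow> eventually (\<lambda>m. A m \<subseteq> S) sequentially"
    using approximate_identity by metis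
  have "fun_span S r (\<lambda>j. ?T (conv (\<Phi> j))) (?T w)"
  proof (rule fun_span_limit)
    show "fun_span S r (\<lambda>j. ?T (conv (\<Phi> j))) (?T (conv (\<phi> m)))" for m by (rule Tspan[OF \<phi>(1)])
    fix i assume "i \<in> S"
    then obtain \<psi> b K where i: "i = (\<psi>, b)" "continuous_on UNIV \<psi>" "compact K" "K \<subseteq> V" "\<And>x. x \<notin> K \<Longrightarrow> \<psi> x = 0"
      unfolding S_def by blast
    have "K \<subseteq> B" using i(4) V(3) by blast
    from conv_weak_limit[OF \<phi> i(2,3) this i(5), where b = b]
    show "(\<lambda>m. ?T (conv (\<phi> m)) i) \<longlonglongrightarrow> ?T w i" by (simp add: i(1))
  qed
  then obtain c where c: "\<And>i. i \<in> S \<Longrightarrow> ?T w i = (\<Sum>j<r. c j * ?T (conv (\<Phi> j)) i)" unfolding fun_span_def by blast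
  \<comment> \<open>The combination of generators that represents the limit functional is itself one
    mollification, with the combined kernel.\<close>
  define h where "h = conv (\<lambda>x. \<Sum>j<r. c j * \<Phi> j x)"
  have sm: "smoother (\<lambda>x. \<Sum>j<r. c j * \<Phi> j x)" by (rule conv_sum(1)[OF \<Phi>(1)])
  have hV: "continuous_on V h" unfolding h_def by (rule cc[OF sm])
  have "\<exists>V'. open V' \<and> p \<in> V' \<and> V' \<subseteq> V \<and> (AE x in \<mu>. x \<in> V' \<longrightarrow> (h x - w x) \<bullet> b = 0)" if b: "b \<in> Basis" for b
  proof (rule du_bois_reymond[OF V(1,2)])
    fix K assume K: "compact K" "K \<subseteq> V"
    have Ks: "K \<in> sets \<mu>" by (rule compact_sets[OF K(1)])
    have "bounded ((\<lambda>x. h x \<bullet> b) ` K)"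
      by (intro compact_imp_bounded compact_continuous_image K(1) continuous_intros continuous_on_subset[OF hV K(2)])
    then obtain M where M: "\<And>x. x \<in> K \<Longrightarrow> \<bar>h x \<bullet> b\<bar> \<le> M" unfolding bounded_iff by auto
    have "integrable \<mu> (\<lambda>x. indicator K x * (h x \<bullet> b))"
    proof (rule Bochner_Integration.integrable_bound)
      show "integrable \<mu> (\<lambda>x. M * indicator K x)" by (intro integrable_mult_right integrable_indicator_compact K)
      show "(\<lambda>x. indicator K x * (h x \<bullet> b)) \<in> borel_measurable \<mu>"
        using borel_measurable_continuous_on_indicator[of K "\<lambda>x. h x \<bullet> b"] Ks continuous_on_subset[OF hV K(2)]
        by (simp add: borel_measurable_mu sets_mu continuous_on_inner)
      show "AE x in \<mu>. norm (indicator K x * (h x \<bullet> b)) \<le> norm (M * indicator K x)"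
      proof (rule AE_I2)
        fix x
        show "norm (indicator K x * (h x \<bullet> b)) \<le> norm (M * indicator K x)"
          using M[of x] by (cases "x \<in> K") auto
      qed
    qed
    moreover have "integrable \<mu> (\<lambda>x. indicator K x * (w x \<bullet> b))"
      using integrable_mult_indicator[OF Ks integrable_inner_left[OF w_integrable, of b]] by simp
    ultimately have "integrable \<mu> (\<lambda>x. indicator K x * (h x \<bullet> b) - indicator K x * (w x \<bullet> b))"
      by (rule Bochner_Integration.integrable_diff)
    then show "integrable \<mu> (\<lambda>x. indicator K x * ((h x - w x) \<bullet> b))" by (simp add: inner_diff_left right_diff_distrib)
  next
    fix \<psi> :: "'g \<Rightarrow> real" and K
    assume \<psi>: "continuous_on UNIV \<psi>" and K: "compact K" "K \<subseteq> V" "\<And>x. x \<notin> K \<Longrightarrow> \<psi> x = 0"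
    have iS: "(\<psi>, b) \<in> S" unfolding S_def using \<psi> K b by auto
    have ti: "integrable \<mu> (\<lambda>x. \<psi> x * (conv (\<Phi> j) x \<bullet> b))" if "j < r" for j
      by (rule test_integrable[OF V(1) cc[OF \<Phi>(1)[OF that]] \<psi> K])
    have "\<psi> x * (h x \<bullet> b) = (\<Sum>j<r. c j * (\<psi> x * (conv (\<Phi> j) x \<bullet> b)))" for x
    proof (cases "x \<in> V")
      case True
      then have "h x = (\<Sum>j<r. c j *\<^sub>R conv (\<Phi> j) x)"
        unfolding h_def using V(3) by (intro conv_sum(2)[OF \<Phi>(1)]) auto
      then show ?thesis by (simp add: inner_sum_left sum_distrib_left mult_ac)
    next
      case False
      then have "\<psi> x = 0" using K by blast
      then show ?thesis by simp
    qed
    then have "(\<integral>x. \<psi> x * (h x \<bullet> b) \<partial>\<mu>) = (\<integral>x. (\<Sum>j<r. c j * (\<psi> x * (conv (\<Phi> j) x \<bullet> b))) \<partial>\<mu>)" by (simp only:)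
    also have "\<dots> = (\<Sum>j<r. \<integral>x. c j * (\<psi> x * (conv (\<Phi> j) x \<bullet> b)) \<partial>\<mu>)"
      by (intro Bochner_Integration.integral_sum integrable_mult_right ti) auto
    also have "\<dots> = (\<integral>x. \<psi> x * (w x \<bullet> b) \<partial>\<mu>)" using c[OF iS] by simp
    finally have e: "(\<integral>x. \<psi> x * (h x \<bullet> b) \<partial>\<mu>) = (\<integral>x. \<psi> x * (w x \<bullet> b) \<partial>\<mu>)" .
    have "bounded (\<psi> ` K)" by (rule compact_imp_bounded[OF compact_continuous_image[OF continuous_on_subset[OF \<psi> subset_UNIV] K(1)]])
    then obtain M where M: "\<And>x. x \<in> K \<Longrightarrow> \<bar>\<psi> x\<bar> \<le> M" unfolding bounded_iff by auto
    have M': "\<bar>\<psi> x\<bar> \<le> \<bar>M\<bar>" for x using M[of x] K(3)[of x] by (cases "x \<in> K") auto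
    have wi: "integrable \<mu> (\<lambda>x. \<psi> x * (w x \<bullet> b))"
    proof (rule Bochner_Integration.integrable_bound)
      show "integrable \<mu> (\<lambda>x. \<bar>M\<bar> * (w x \<bullet> b))" by (intro integrable_mult_right integrable_inner_left w_integrable)
      show "(\<lambda>x. \<psi> x * (w x \<bullet> b)) \<in> borel_measurable \<mu>"
        using borel_measurable_continuous_onI[OF \<psi>]
        by (intro borel_measurable_times borel_measurable_integrable[OF integrable_inner_left[OF w_integrable]])
          (simp add: borel_measurable_mu)
      show "AE x in \<mu>. norm (\<psi> x * (w x \<bullet> b)) \<le> norm (\<bar>M\<bar> * (w x \<bullet> b))"
        using M' by (intro AE_I2) (simp add: abs_mult mult_right_mono)
    qed
    have "integrable \<mu> (\<lambda>x. \<psi> x * (h x \<bullet> b))" by (rule test_integrable[OF V(1) hV \<psi> K])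
    with wi e show "(\<integral>x. \<psi> x * ((h x - w x) \<bullet> b) \<partial>\<mu>) = 0"
      by (simp add: inner_diff_left right_diff_distrib Bochner_Integration.integral_diff)
  qed
  then have "\<forall>b\<in>Basis. \<exists>V'. open V' \<and> p \<in> V' \<and> V' \<subseteq> V \<and> (AE x in \<mu>. x \<in> V' \<longrightarrow> (h x - w x) \<bullet> b = 0)"
    by (intro ballI)
  from bchoice[OF this] obtain V' where V': "\<And>b. b \<in> Basis \<Longrightarrow> open (V' b)" "\<And>b. b \<in> Basis \<Longrightarrow> p \<in> V' b"
    "\<And>b. b \<in> Basis \<Longrightarrow> V' b \<subseteq> V" "\<And>b. b \<in> Basis \<Longrightarrow> AE x in \<mu>. x \<in> V' b \<longrightarrow> (h x - w x) \<bullet> b = 0" by blast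
  \<comment> \<open>Each of the finitely many components has its own neighbourhood of
    equality.\<close>
  let ?V = "V \<inter> (\<Inter>b\<in>Basis. V' b)"
  have oV: "open ?V" using V(1) V'(1) by (intro open_Int open_INT) auto
  have "AE x in \<mu>. \<forall>b\<in>Basis. x \<in> V' b \<longrightarrow> (h x - w x) \<bullet> b = 0"
    unfolding AE_ball_countable[OF countable_finite[OF finite_Basis]] using V'(4) by (intro ballI)
  then have ae: "AE x in \<mu>. x \<in> ?V \<longrightarrow> h x = Z0 x"
  proof (rule AE_mp, intro AE_I2 impI)
    fix x assume x: "\<forall>b\<in>Basis. x \<in> V' b \<longrightarrow> (h x - w x) \<bullet> b = 0" "x \<in> ?V"
    have "(h x - w x) \<bullet> b = 0" if "b \<in> Basis" for b
    proof -
      have "x \<in> V' b" using x(2) that by blast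
      then show ?thesis using x(1) that by blast
    qed
    then have "h x - w x = 0" by (rule euclidean_all_zero_iff[THEN iffD1, OF ballI])
    moreover have "x \<in> C" using x(2) V(3) B_subset_C by blast
    ultimately show "h x = Z0 x" by (simp add: w_def)
  qed
  have VB: "?V \<subseteq> B" using V(3) by blast
  show thesis
  proof (rule that[OF oV _ VB _ _ ae])
    show "p \<in> ?V" using V(2) V'(2) by simp
    show "Ck_fun_on G k ?V h" for k unfolding h_def by (rule Ck_fun_on_subset[OF conv_Ck[OF sm] VB])
    show "contact_field G ?V h" unfolding h_def by (rule contact_subset[OF conv_contact[OF sm] VB])
  qed
qed

end

context carnot
begin

section \<open>From local to global regularity\<close>

lemma contact_cong:
  assumes W: "open W" and eq: "\<And>x. x \<in> W \<Longrightarrow> Z x = Z' x" and Z: "contact_field G W Z"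
  shows "contact_field G W Z'"
  unfolding contact_iff[OF W]
proof (intro conjI ballI)
  have C: "Ck_fun_on G 1 W Z" using Z by (simp add: contact_field_def)
  show C': "Ck_fun_on G 1 W Z'" by (rule Ck_fun_on_cong[OF W eq C])
  fix x A assume x: "x \<in> W" and A: "A \<in> layer G 1"
  have S: "open {u \<in> D0. x \<cdot> xi u \<in> W}" "og \<in> {u \<in> D0. x \<cdot> xi u \<in> W}"
    using translate_domain[of W x ge] W x by simp_all
  have "((\<lambda>u. Z (x \<cdot> xi u)) has_derivative (\<lambda>A. left_deriv G A Z x)) (at og)"
    using has_left_deriv[OF _ W x, of 0] C by simp
  then have "((\<lambda>u. Z' (x \<cdot> xi u)) has_derivative (\<lambda>A. left_deriv G A Z x)) (at og)"
    by (rule has_derivative_transform_within_open[OF _ S]) (simp add: eq)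
  then have "left_deriv G A Z' x = left_deriv G A Z x" by (rule left_deriv_eqI)
  then show "left_deriv G A Z' x - lie_bracket G (Z' x) A \<in> layer G 1"
    unfolding eq[OF x, symmetric] using Z x A unfolding contact_iff[OF W] by (simp only:)
qed

lemma weak_contact_local:
  assumes rigid: "Cinf_rigid G" and U: "open U" and Z: "weak_contact_field G \<mu> U Z" and p: "p \<in> U"
  shows "\<exists>V h. open V \<and> p \<in> V \<and> V \<subseteq> U \<and> (\<forall>k. Ck_fun_on G k V h) \<and> contact_field G V h \<and>
    (AE x in \<mu>. x \<in> V \<longrightarrow> h x = Z x)"
proof -
  obtain Z0 where Z0: "AE x in \<mu>. x \<in> U \<longrightarrow> Z0 x = Z x"
    "\<And>K. compact K \<Longrightarrow> K \<subseteq> U \<Longrightarrow> integrable \<mu> (\<lambda>x. indicator K x *\<^sub>R Z0 x)"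
    "\<And>b K i j. smooth_fun_on G UNIV b \<Longrightarrow> compact K \<Longrightarrow> K \<subseteq> U \<Longrightarrow> (\<And>x. x \<notin> K \<Longrightarrow> b x = 0) \<Longrightarrow>
       i \<in> {1..layer_dim G 1} \<Longrightarrow> j \<in> I \<Longrightarrow> fst j \<noteq> 1 \<Longrightarrow>
       (\<integral>x. coframe G j (lie_bracket G (Z0 x) (X (1, i))) * b x \<partial>\<mu>) +
       (\<integral>x. coframe G j (Z0 x) * left_deriv G (X (1, i)) b x \<partial>\<mu>) = 0"
    by (rule borel_version[OF U Z]) blast
  obtain C V where C: "compact C" "C \<subseteq> U" "open V" "p \<in> V" "V \<subseteq> C"
    by (rule compact_neighbourhood[OF U p]) blast
  \<comment> \<open>By continuity of \<open>(n, x) \<mapsto> n\<^sup>-\<^sup>1 x\<close>, all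
    \<open>n\<close> near the identity and \<open>x\<close> near \<open>p\<close> are sent into
    \<open>V\<close>, hence into \<open>C\<close>.\<close>
  have "continuous_on UNIV (\<lambda>z. iv (fst z) \<cdot> snd z)" by (intro continuous_intros)
  from continuous_open_preimage[OF this open_UNIV C(3)]
  have "open {z. iv (fst z) \<cdot> snd z \<in> V}" by (simp add: vimage_def)
  moreover have "(ge, p) \<in> {z. iv (fst z) \<cdot> snd z \<in> V}" using C(4) by (simp add: grp.inverse_neutral)
  ultimately obtain Nb B where NB: "open Nb" "open B" "ge \<in> Nb" "p \<in> B" "Nb \<times> B \<subseteq> {z. iv (fst z) \<cdot> snd z \<in> V}"
    by (rule open_prod_elim) auto
  interpret mollify G \<mu> Z0 B Nb C
  proof
    show "iv n \<cdot> x \<in> C" if "x \<in> B" "n \<in> Nb" for x n using subsetD[OF NB(5), of "(n, x)"] that C(5) by auto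
    show "integrable \<mu> (\<lambda>x. indicator C x *\<^sub>R Z0 x)" by (rule Z0(2)[OF C(1,2)])
  qed (use NB C Z0(3)[OF _ C(1,2)] in auto)
  obtain V' h where V': "open V'" "p \<in> V'" "V' \<subseteq> B" "\<And>k. Ck_fun_on G k V' h" "contact_field G V' h"
    "AE x in \<mu>. x \<in> V' \<longrightarrow> h x = Z0 x" by (rule local_regularity[OF rigid NB(4)]) blast
  have VU: "V' \<subseteq> U" using V'(3) B_subset_C C(2) by blast
  have "AE x in \<mu>. x \<in> V' \<longrightarrow> h x = Z x" using V'(6) Z0(1) by eventually_elim (use VU in auto)
  then show ?thesis using V' VU by blast
qed

text \<open>Local versions are continuous and agree almost everywhere on overlaps, hence everywhere
  there, so they glue.\<close>

lemma weak_contact_regularity: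
  assumes rigid: "Cinf_rigid G" and U: "open U" and Z: "weak_contact_field G \<mu> U Z"
  obtains Z' where "smooth_fun_on G U Z'" "AE x in \<mu>. x \<in> U \<longrightarrow> Z' x = Z x" "contact_field G U Z'"
proof -
  define P where "P = (\<lambda>p (V, h). open V \<and> p \<in> V \<and> V \<subseteq> U \<and> (\<forall>k. Ck_fun_on G k V h) \<and> contact_field G V h \<and>
    (AE x in \<mu>. x \<in> V \<longrightarrow> h x = Z x))"
  have "\<forall>p\<in>U. \<exists>Vh. P p Vh" unfolding P_def split_paired_Ex prod.case
    using weak_contact_local[OF rigid U Z] by (intro ballI)
  from bchoice[OF this] obtain Vh where "\<forall>p\<in>U. P p (Vh p)" by (rule exE)
  define V h where "V = (\<lambda>p. fst (Vh p))" and "h = (\<lambda>p. snd (Vh p))"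
  have Vh: "open (V p) \<and> p \<in> V p \<and> V p \<subseteq> U \<and> (\<forall>k. Ck_fun_on G k (V p) (h p)) \<and>
    contact_field G (V p) (h p) \<and> (AE x in \<mu>. x \<in> V p \<longrightarrow> h p x = Z x)" if "p \<in> U" for p
    using bspec[OF \<open>\<forall>p\<in>U. P p (Vh p)\<close> that] unfolding P_def V_def h_def case_prod_beta .
  \<comment> \<open>Each point takes its value from the version chosen at that point;
    \<open>eq\<close> shows that every other version defined there agrees.\<close>
  define Z' where "Z' = (\<lambda>x. h x x)"
  have eq: "h p x = Z' x" if p: "p \<in> U" and x: "x \<in> V p" for p x
  proof -
    have xU: "x \<in> U" using Vh[OF p] x by blast
    note a = Vh[OF p] and b = Vh[OF xU]
    have "continuous_on (V p) (h p)" "continuous_on (V x) (h x)"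
      using a b Ck_fun_on_continuous by blast+
    then have "continuous_on (V p \<inter> V x) (h p)" "continuous_on (V p \<inter> V x) (h x)" by (auto intro: continuous_on_subset)
    moreover have "AE y in \<mu>. y \<in> V p \<inter> V x \<longrightarrow> h p y = h x y"
    proof -
      have "AE y in \<mu>. y \<in> V p \<longrightarrow> h p y = Z y" "AE y in \<mu>. y \<in> V x \<longrightarrow> h x y = Z y" using a b by blast+
      then show ?thesis by eventually_elim auto
    qed
    ultimately have "h p x = h x x" using a b x by (intro continuous_AE_eq[of "V p \<inter> V x" "h p" "h x"]) auto
    then show ?thesis by (simp add: Z'_def)
  qed
  show thesis
  proof (rule that)
    show "smooth_fun_on G U Z'"
    proof (rule smooth_fun_onI, rule Ck_fun_on_local)
      fix k p assume p: "p \<in> U"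
      have "Ck_fun_on G k (V p) Z'"
        by (rule Ck_fun_on_cong[of _ "h p"]) (use Vh[OF p] eq[OF p] in auto)
      then show "\<exists>V. open V \<and> p \<in> V \<and> Ck_fun_on G k V Z'" using Vh[OF p] by blast
    qed
    show "AE x in \<mu>. x \<in> U \<longrightarrow> Z' x = Z x"
    proof (rule AE_local)
      fix p assume p: "p \<in> U"
      have "AE x in \<mu>. x \<in> V p \<longrightarrow> h p x = Z x" using Vh[OF p] by blast
      then have "AE x in \<mu>. x \<in> V p \<longrightarrow> Z' x = Z x" by eventually_elim (use eq[OF p] in auto)
      then show "\<exists>V. open V \<and> p \<in> V \<and> (AE x in \<mu>. x \<in> V \<longrightarrow> Z' x = Z x)" using Vh[OF p] by blast
    qed
    have loc: "contact_field G (V p) Z'" if p: "p \<in> U" for p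
      by (rule contact_cong[of _ "h p"]) (use Vh[OF p] eq[OF p] in auto)
    show "contact_field G U Z'" unfolding contact_iff[OF U]
    proof (intro conjI ballI)
      show "Ck_fun_on G 1 U Z'"
      proof (rule Ck_fun_on_local)
        fix p assume p: "p \<in> U"
        have "Ck_fun_on G 1 (V p) Z'" using loc[OF p] by (simp only: contact_field_def)
        then show "\<exists>V. open V \<and> p \<in> V \<and> Ck_fun_on G 1 V Z'" using Vh[OF p] by blast
      qed
      fix x A assume x: "x \<in> U" and A: "A \<in> layer G 1"
      have o: "open (V x)" and xV: "x \<in> V x" using Vh[OF x] by blast+
      show "left_deriv G A Z' x - lie_bracket G (Z' x) A \<in> layer G 1"
        using loc[OF x] xV A unfolding contact_iff[OF o] by blast
    qed
  qed
qed

end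

theorem theorem4p1:
  fixes G :: "('g::{t2_space,second_countable_topology}, 'a::euclidean_space) carnot_data"
    and \<mu> :: "'g measure"
    and U :: "'g set"
    and Z :: "'g \<Rightarrow> 'a"
  assumes "carnot_group G"
    and "haar_measure G \<mu>"
    and "Cinf_rigid G"
    and "open U"
    and "weak_contact_field G \<mu> U Z"
  shows "(\<exists>Z'. smooth_fun_on G U Z' \<and> (AE x in \<mu>. x \<in> U \<longrightarrow> Z' x = Z x) \<and> contact_field G U Z') \<and>
         (continuous_on U Z \<longrightarrow> smooth_fun_on G U Z)"
proof -
  interpret carnot G \<mu>
    by unfold_locales (use assms in \<open>auto simp: carnot_group_def\<close>)
  obtain Z' where Z': "smooth_fun_on G U Z'" "AE x in \<mu>. x \<in> U \<longrightarrow> Z' x = Z x" "contact_field G U Z'"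
    using weak_contact_regularity[OF assms(3-5)] by blast
  moreover have "smooth_fun_on G U Z" if Z: "continuous_on U Z"
  proof -
    have "Z' x = Z x" if "x \<in> U" for x
      by (rule continuous_AE_eq[OF assms(4) Ck_fun_on_continuous[OF smooth_fun_onD[OF Z'(1)] assms(4)] Z Z'(2) that])
    then show ?thesis using Ck_fun_on_cong[OF assms(4)] smooth_fun_onD[OF Z'(1)] by (blast intro: smooth_fun_onI)
  qed
  ultimately show ?thesis by blast
qed

end
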